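(* Assume (A1)–(A2) of the context. Let $$f(\mathbf w;\Lambda,\boldsymbol\mu)=\int_{\mathbb R^n}\ell(\mathbf w;\mathbf z)\exp\Big(-\tfrac12\langle\mathbf z-\boldsymbol\mu,\Lambda^{-1}(\mathbf z-\boldsymbol\mu)\rangle\Big)\frac{d\mathbf z}{\sqrt{\det(2\pi\Lambda)}}.$$ Let $\gamma\in(0,1)$, $r=(1-\gamma)\|(\Lambda^* )^{-1}\|_2^{-1/2}$, $p\ge1$ and $1/p+1/q=1$. Then the Riemannian Hessian of $f$ with respect to $(\boldsymbol\mu,\Lambda)$, for any fixed $\mathbf w\in\mathbb R^d$, satisfies the uniform estimate $$\sup_{\substack{\boldsymbol\nu\in\mathbb R^n,\ S\in\mathbb S^n\\ \|S\|_F<1}}\frac{\big|\mathrm{Hess}_{(\boldsymbol\mu,\Lambda)}f\big((\boldsymbol\nu,S\Lambda+\Lambda S),(\boldsymbol\nu,S\Lambda+\Lambda S)\big)\big|}{\|\boldsymbol\nu\|^2+\mathrm{tr}(S\Lambda S)}\le C_{\Lambda,q,n}\Big(C''_{p,\Lambda^*,n}\big(\mathbb E_{\mathbf z\sim\mathbb P(\boldsymbol\mu^*,\Lambda^* )}[|\ell(\mathbf w;\mathbf z)|^{pq}]\big)^{1/q}\Big)^{1/p}<\infty$$ on the product $\bar{\mathcal B}_r(\boldsymbol\mu^* )\times\bar{\mathcal B}_r(\Lambda^* )$ of closed balls of radius $r$ centered at $(\boldsymbol\mu^*,\Lambda^* )$, for some universal constants $C''_{p,\Lambda^*,n}$, $C_{\Lambda,q,n}$,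 where $$C_{\Lambda,q,n}\sim_q\left(\frac{\Gamma(\frac{n+4q}{2})}{\Gamma(\frac n2)}\right)^{1/q}\|(\Lambda^* )^{1/2}\|_F^4\left(\frac{\sqrt n\,\|(\Lambda^* )^{-1}\|_F}{1-r\|(\Lambda^* )^{-1/2}\|_F}\right)^6,$$ $$C''_{p,\Lambda^*,n}\lesssim_p n\max\{1,r^2\}\,\|(\Lambda^* )^{-1/2}\|_F^4\,\|(\Lambda^* )^{1/2}\|_F^4\left(\frac{\Gamma(\frac{n+4p}{2})}{\Gamma(\frac n2)}\right)^{1/p}$$ for $\|\Lambda^*\|_F\ge1$, $\|(\Lambda^* )^{-1/2}\|_F\ge1$.
   Context: $\mathbb P(\boldsymbol\mu,\Lambda)$ is the Gaussian measure on $\mathbb R^n$ with mean $\boldsymbol\mu$ and covariance $\Lambda\in\mathtt{SPD}_n$ (symmetric positive definite $n\times n$ matrices); $\mathbb P(\boldsymbol\mu^*,\Lambda^* )$ is a fixed reference Gaussian measure. $\mathbb S^n$ is the space of symmetric matrices, $\|\cdot\|_F$ the Frobenius and $\|\cdot\|_2$ the operator norm. Bures–Wasserstein (BW) metric on $\mathtt{SPD}_n$: $T_\Lambda\mathtt{SPD}_n\cong\mathbb S^n$; $L_\Lambda(U)$ is the unique symmetric solution $X$ of $\Lambda X+X\Lambda=U$; $g_\Lambda(V,W)=\mathrm{tr}(L_\Lambda(V)\Lambda L_\Lambda(W))$; $d_{BW}(\Lambda_1,\Lambda_2)^2=\mathrm{tr}\big(\Lambda_1+\Lambda_2-2(\Lambda_1^{1/2}\Lambda_2\Lambda_1^{1/2})^{1/2}\big)$.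 The space of $(\boldsymbol\mu,\Lambda)$ is $\mathbb R^n\times\mathtt{SPD}_n$ with the product metric $l_2\oplus BW$; a tangent vector $(\boldsymbol\nu,S\Lambda+\Lambda S)$ has squared norm $\|\boldsymbol\nu\|^2+\mathrm{tr}(S\Lambda S)$. $\bar{\mathcal B}_r(\boldsymbol\mu^* )$ is the closed Euclidean ball and $\bar{\mathcal B}_r(\Lambda^* )=\{\Lambda:d_{BW}(\Lambda,\Lambda^* )\le r\}$. (A1) $\ell:\mathbb R^d\times\mathbb R^n\to\mathbb R$ is jointly $\mathcal C^2$, non-negative, and $\ell(\cdot;\mathbf z)$ is coercive for all $\mathbf z$, i.e. $\lim_{\|\mathbf w\|\to\infty}\ell(\mathbf w;\mathbf z)=+\infty$. (A2) For some $P\ge2$, for any $\mathbf w\in\mathbb R^d$ and all $p\le P<\infty$, the $p$-th moments $(\mathbb E[|\ell(\mathbf w;\mathbf z)|^p])^{1/p}$, $(\mathbb E[\|\nabla_{\mathbf w}\ell(\mathbf w;\mathbf z)\|^p])^{1/p}$, $(\mathbb E[\|\nabla^2_{\mathbf w}\ell(\mathbf w;\mathbf z)\|_F^p])^{1/p}$ under $\mathbf z\sim\mathbb P(\boldsymbol\mu^*,\Lambda^* )$ are finite. $\sim_q$ and $\lesssim_p$ denote comparability, respectively upper bound, up to multiplicative constants depending only on $q$, respectively $p$. $\Gamma$ is the Gamma function. The supremum is over nonzero $(\boldsymbol\nu,S)$.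
   Formalization: The case p=1, q=∞ is left out; pq ≤ P is assumed for the P of (A2); if q=2 or r‖(Λ* )^{-1/2}‖_F > 1 the upper comparability constant for C may also depend on γ; if r‖(Λ* )^{-1/2}‖_F = 1 no size of C is claimed. *)

theory Defs
  imports
    "HOL-Analysis.Embed_Measure"
    "HOL-Analysis.Gamma_Function"
    "Jordan_Normal_Form.Determinant"
    "Jordan_Normal_Form.Gauss_Jordan_Elimination"
begin

text \<open>
  Constants have to be uniform in the dimension, so the dimension must be a term and not a type:
  vectors and matrices are those of the carriers \<open>carrier_vec n\<close> and \<open>carrier_mat n n\<close>.
\<close>

unbundle no vec_syntax
no_notation Inner_Product.real_inner_class.inner (infix "\<bullet>" 70)

hide_const (open) Finite_Cartesian_Product.vec Finite_Cartesian_Product.mat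
  Finite_Cartesian_Product.row

definition vnorm :: "real vec \<Rightarrow> real" where
  "vnorm v = sqrt (v \<bullet> v)"

definition tr :: "real mat \<Rightarrow> real" where
  "tr A = (\<Sum>i<dim_row A. A $$ (i, i))"

definition fnorm :: "real mat \<Rightarrow> real" where
  "fnorm A = sqrt (\<Sum>i<dim_row A. \<Sum>j<dim_col A. (A $$ (i, j))\<^sup>2)"

definition opnorm :: "real mat \<Rightarrow> real" where
  "opnorm A = (SUP v \<in> {v \<in> carrier_vec (dim_col A). vnorm v \<le> 1}. vnorm (A *\<^sub>v v))"

definition minv :: "real mat \<Rightarrow> real mat" where
  "minv A = the (mat_inverse A)"

definition sym_mats :: "nat \<Rightarrow> real mat set" where
  "sym_mats n = {A \<in> carrier_mat n n. transpose_mat A = A}"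

definition psd :: "nat \<Rightarrow> real mat set" where
  "psd n = {A \<in> sym_mats n. \<forall>v \<in> carrier_vec n. 0 \<le> v \<bullet> (A *\<^sub>v v)}"

definition spd :: "nat \<Rightarrow> real mat set" where
  "spd n = {A \<in> sym_mats n. \<forall>v \<in> carrier_vec n. v \<noteq> 0\<^sub>v n \<longrightarrow> 0 < v \<bullet> (A *\<^sub>v v)}"

definition msqrt :: "real mat \<Rightarrow> real mat" where
  "msqrt A = (THE R. R \<in> psd (dim_row A) \<and> R * R = A)"

definition lborel_vec :: "nat \<Rightarrow> real vec measure" where
  "lborel_vec n = embed_measure (Pi\<^sub>M {..<n} (\<lambda>_. lborel)) (vec n)"

definition gaussian_density :: "real vec \<Rightarrow> real mat \<Rightarrow> real vec \<Rightarrow> real" where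
  "gaussian_density \<mu> \<Lambda> z =
     exp (- (1/2) * ((z - \<mu>) \<bullet> (minv \<Lambda> *\<^sub>v (z - \<mu>)))) / sqrt (det ((2 * pi) \<cdot>\<^sub>m \<Lambda>))"

definition gaussian :: "nat \<Rightarrow> real vec \<Rightarrow> real mat \<Rightarrow> real vec measure" where
  "gaussian n \<mu> \<Lambda> = density (lborel_vec n) (\<lambda>z. ennreal (gaussian_density \<mu> \<Lambda> z))"

definition smoothed ::
    "nat \<Rightarrow> (real vec \<Rightarrow> real vec \<Rightarrow> real) \<Rightarrow> real vec \<Rightarrow> real vec \<times> real mat \<Rightarrow> real" where
  "smoothed n l w = (\<lambda>(\<mu>, \<Lambda>). \<integral>z. l w z * gaussian_density \<mu> \<Lambda> z \<partial>lborel_vec n)"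

definition partial :: "nat \<Rightarrow> (real vec \<Rightarrow> real) \<Rightarrow> real vec \<Rightarrow> real" where
  "partial i F v = deriv (\<lambda>t. F (v + t \<cdot>\<^sub>v unit_vec (dim_vec v) i)) 0"

definition has_partial :: "nat \<Rightarrow> nat \<Rightarrow> (real vec \<Rightarrow> real) \<Rightarrow> bool" where
  "has_partial N i F \<longleftrightarrow>
     (\<forall>v \<in> carrier_vec N. (\<lambda>t. F (v + t \<cdot>\<^sub>v unit_vec N i)) differentiable (at 0))"

text \<open>
  The type of vectors carries no topology.  As \<open>vec N\<close> only reads the first \<open>N\<close> coordinates,
  continuity for the product topology below is continuity on \<open>N\<close>-dimensional space.
\<close>

definition cont_vec :: "nat \<Rightarrow> (real vec \<Rightarrow> real) \<Rightarrow> bool" where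
  "cont_vec N F \<longleftrightarrow> continuous_on UNIV (\<lambda>x :: nat \<Rightarrow> real. F (vec N x))"

definition C2_vec :: "nat \<Rightarrow> (real vec \<Rightarrow> real) \<Rightarrow> bool" where
  "C2_vec N F \<longleftrightarrow> cont_vec N F \<and>
     (\<forall>i<N. has_partial N i F \<and> cont_vec N (partial i F) \<and>
       (\<forall>j<N. has_partial N j (partial i F) \<and> cont_vec N (partial j (partial i F))))"

definition grad :: "(real vec \<Rightarrow> real) \<Rightarrow> real vec \<Rightarrow> real vec" where
  "grad F v = vec (dim_vec v) (\<lambda>i. partial i F v)"

definition hess :: "(real vec \<Rightarrow> real) \<Rightarrow> real vec \<Rightarrow> real mat" where
  "hess F v = mat (dim_vec v) (dim_vec v) (\<lambda>(i, j). partial i (partial j F) v)"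

definition assumption_A1 :: "nat \<Rightarrow> nat \<Rightarrow> (real vec \<Rightarrow> real vec \<Rightarrow> real) \<Rightarrow> bool" where
  "assumption_A1 d n l \<longleftrightarrow>
     C2_vec (d + n) (\<lambda>v. l (vec_first v d) (vec_last v n)) \<and>
     (\<forall>w \<in> carrier_vec d. \<forall>z \<in> carrier_vec n. 0 \<le> l w z) \<and>
     (\<forall>z \<in> carrier_vec n.
        filterlim (\<lambda>w. l w z) at_top (inf (filtercomap vnorm at_top) (principal (carrier_vec d))))"

definition assumption_A2 ::
    "nat \<Rightarrow> nat \<Rightarrow> real \<Rightarrow> real vec \<Rightarrow> real mat \<Rightarrow> (real vec \<Rightarrow> real vec \<Rightarrow> real) \<Rightarrow> bool" where
  "assumption_A2 d n P \<mu>' \<Lambda>' l \<longleftrightarrow> 2 \<le> P \<and>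
     (\<forall>w \<in> carrier_vec d. \<forall>s. 1 \<le> s \<and> s \<le> P \<longrightarrow>
        integrable (gaussian n \<mu>' \<Lambda>') (\<lambda>z. \<bar>l w z\<bar> powr s) \<and>
        integrable (gaussian n \<mu>' \<Lambda>') (\<lambda>z. vnorm (grad (\<lambda>u. l u z) w) powr s) \<and>
        integrable (gaussian n \<mu>' \<Lambda>') (\<lambda>z. fnorm (hess (\<lambda>u. l u z) w) powr s))"

definition lyap :: "real mat \<Rightarrow> real mat \<Rightarrow> real mat" where
  "lyap \<Lambda> U = (THE X. X \<in> sym_mats (dim_row \<Lambda>) \<and> \<Lambda> * X + X * \<Lambda> = U)"

definition bw_metric :: "real mat \<Rightarrow> real mat \<Rightarrow> real mat \<Rightarrow> real" where
  "bw_metric \<Lambda> V W = tr (lyap \<Lambda> V * \<Lambda> * lyap \<Lambda> W)"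

definition bw_dist :: "real mat \<Rightarrow> real mat \<Rightarrow> real" where
  "bw_dist A B = sqrt (tr (A + B - 2 \<cdot>\<^sub>m msqrt (msqrt A * B * msqrt A)))"

type_synonym point = "real vec \<times> real mat"

definition tangents :: "nat \<Rightarrow> point set" where
  "tangents n = carrier_vec n \<times> sym_mats n"

definition shift :: "point \<Rightarrow> real \<Rightarrow> point \<Rightarrow> point" where
  "shift x t V = (fst x + t \<cdot>\<^sub>v fst V, snd x + t \<cdot>\<^sub>m snd V)"

definition metric :: "point \<Rightarrow> point \<Rightarrow> point \<Rightarrow> real" where
  "metric x V W = fst V \<bullet> fst W + bw_metric (snd x) (snd V) (snd W)"

definition dir_deriv :: "(point \<Rightarrow> real) \<Rightarrow> point \<Rightarrow> point \<Rightarrow> real" where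
  "dir_deriv F x V = deriv (\<lambda>t. F (shift x t V)) 0"

text \<open>
  The manifold is an open subset of the vector space \<open>tangents n\<close>, which is a global chart.  For
  constant (hence commuting) vector fields \<open>V\<close>, \<open>W\<close>, the Koszul formula determines the
  Levi--Civita derivative of \<open>W\<close> along \<open>V\<close>, that is, the Christoffel term.
\<close>

definition christoffel :: "nat \<Rightarrow> point \<Rightarrow> point \<Rightarrow> point \<Rightarrow> point" where
  "christoffel n x V W = (THE G. G \<in> tangents n \<and> (\<forall>Z \<in> tangents n.
     2 * metric x G Z =
       dir_deriv (\<lambda>y. metric y W Z) x V + dir_deriv (\<lambda>y. metric y V Z) x W
       - dir_deriv (\<lambda>y. metric y V W) x Z))"

definition riem_hess :: "nat \<Rightarrow> (point \<Rightarrow> real) \<Rightarrow> point \<Rightarrow> point \<Rightarrow> point \<Rightarrow> real" where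
  "riem_hess n F x V W =
     dir_deriv (\<lambda>y. dir_deriv F y W) x V - dir_deriv F x (christoffel n x V W)"

text \<open>
  \<open>deriv\<close> is total, so the existence of the derivatives that enter \<open>riem_hess\<close> is a separate
  statement.
\<close>

definition has_riem_hess :: "nat \<Rightarrow> (point \<Rightarrow> real) \<Rightarrow> point \<Rightarrow> bool" where
  "has_riem_hess n F x \<longleftrightarrow> (\<forall>V \<in> tangents n. \<forall>W \<in> tangents n.
     (\<forall>\<^sub>F s in nhds 0. (\<lambda>t. F (shift (shift x s V) t W)) differentiable (at 0)) \<and>
     (\<lambda>s. dir_deriv F (shift x s V) W) differentiable (at 0))"

definition radius :: "real \<Rightarrow> real mat \<Rightarrow> real" where
  "radius \<gamma> \<Lambda>' = (1 - \<gamma>) * opnorm (minv \<Lambda>') powr (- 1/2)"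

definition ball_product :: "nat \<Rightarrow> real vec \<Rightarrow> real mat \<Rightarrow> real \<Rightarrow> point set" where
  "ball_product n \<mu>' \<Lambda>' r =
     {\<mu> \<in> carrier_vec n. vnorm (\<mu> - \<mu>') \<le> r} \<times> {\<Lambda> \<in> spd n. bw_dist \<Lambda> \<Lambda>' \<le> r}"

definition hess_sup :: "nat \<Rightarrow> (point \<Rightarrow> real) \<Rightarrow> point \<Rightarrow> ereal" where
  "hess_sup n F x = (case x of (\<mu>, \<Lambda>) \<Rightarrow>
     SUP (\<nu>, S) \<in> {(\<nu>, S). \<nu> \<in> carrier_vec n \<and> S \<in> sym_mats n \<and> fnorm S < 1 \<and>
                    (\<nu>, S) \<noteq> (0\<^sub>v n, 0\<^sub>m n n)}.
       ereal (\<bar>riem_hess n F (\<mu>, \<Lambda>) (\<nu>, S * \<Lambda> + \<Lambda> * S) (\<nu>, S * \<Lambda> + \<Lambda> * S)\<bar>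
              / ((vnorm \<nu>)\<^sup>2 + tr (S * \<Lambda> * S))))"

definition scale_C :: "real \<Rightarrow> nat \<Rightarrow> real mat \<Rightarrow> real \<Rightarrow> real" where
  "scale_C q n \<Lambda>' r =
     (Gamma ((real n + 4 * q) / 2) / Gamma (real n / 2)) powr (1 / q)
     * fnorm (msqrt \<Lambda>') ^ 4
     * (sqrt (real n) * fnorm (minv \<Lambda>') / (1 - r * fnorm (minv (msqrt \<Lambda>')))) ^ 6"

definition scale_C'' :: "real \<Rightarrow> nat \<Rightarrow> real mat \<Rightarrow> real \<Rightarrow> real" where
  "scale_C'' p n \<Lambda>' r =
     real n * max 1 (r\<^sup>2) * fnorm (minv (msqrt \<Lambda>')) ^ 4 * fnorm (msqrt \<Lambda>') ^ 4
     * (Gamma ((real n + 4 * p) / 2) / Gamma (real n / 2)) powr (1 / p)"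

end

theory Submission
  imports Defs "HOL-Probability.Distributions" "Jordan_Normal_Form.Spectral_Radius"
begin

unbundle no vec_syntax
no_notation Inner_Product.real_inner_class.inner (infix "\<bullet>" 70)
hide_const (open) Finite_Cartesian_Product.vec Finite_Cartesian_Product.mat
  Finite_Cartesian_Product.row Determinants.det

text \<open>
  In suitable linear coordinates \<open>P\<close> one has \<open>\<Lambda>' = P P\<^sup>T\<close> and \<open>\<Lambda> = P diag(g) P\<^sup>T\<close>. An optimal transport map
  between the two Gaussians shows that on the Bures--Wasserstein ball of radius \<open>r\<close> the
  \<open>g\<^sub>i\<close> lie in \<open>[\<gamma>\<^sup>2, (2 - \<gamma>)\<^sup>2]\<close> and, decisively for uniformity in the dimension,
  \<open>\<Sum>\<^sub>i (g\<^sub>i - 1)\<^sup>2 \<le> 9\<close>.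

  The derivatives of \<open>f\<close> are moved onto the Gaussian density, where they produce scores. Since the
  Christoffel term of \<open>V = S \<Lambda> + \<Lambda> S\<close> is \<open>- 2 S \<Lambda> S\<close>, the Hessian is the average of \<open>\<ell>\<close> against
  a quartic polynomial in \<open>\<Lambda>\<^sup>-\<^sup>1\<^sup>/\<^sup>2 (z - \<mu>)\<close>, bounded by a multiple of \<open>(n + q)\<^sup>2\<close> with
  \<open>q = \<langle>z - \<mu>, \<Lambda>\<^sup>-\<^sup>1 (z - \<mu>)\<rangle>\<close>. A factor \<open>exp (d q / (2 n))\<close> absorbs the polynomial, and Hoelder's
  inequality with exponent \<open>\<kappa> = p q = p + q \<ge> 4\<close> against the reference Gaussian leaves an explicit Gaussian
  integral. It converges because \<open>(2 - \<gamma>)\<^sup>2 < \<kappa>\<close>; for \<open>\<kappa> = 4\<close>, that is \<open>q = 2\<close>, the margin degenerates as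
  \<open>\<gamma> \<rightarrow> 0\<close>. All powers of \<open>\<gamma>\<close> are absorbed by the sixth power in \<open>C\<close>, since
  \<open>1 - r \<parallel>\<Lambda>'\<^sup>-\<^sup>1\<^sup>/\<^sup>2\<parallel>\<^sub>F \<le> \<gamma>\<close>, and one may take \<open>C'' = 1\<close>.
\<close>

section \<open>Vectors and matrices of a fixed dimension\<close>

text \<open>With \<open>s = \<kappa> / (\<kappa> - 1)\<close>, the ratio of the Gaussian densities
  for \<open>\<Lambda>\<close> and \<open>\<Lambda>'\<close> has an integrable \<open>s\<close>-th
  power under the reference measure exactly when every \<open>g\<^sub>i\<close> lies below
  \<open>s / (s - 1) = \<kappa>\<close>. This is where
  \<open>(2 - \<gamma>)\<^sup>2 < \<kappa>\<close> comes from. The obstacle is the dimension: some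
  constants are fixed before \<open>n\<close>, whereas the Hoelder norm of the weight is a product
  of \<open>n\<close> one-dimensional factors. Its logarithm must therefore have no first-order part
  in \<open>g\<^sub>i - 1\<close>. The damping is divided by \<open>n\<close> for the same reason:
  each coordinate pays of order \<open>d / n\<close>, which adds up to order \<open>d\<close>, and
  this is still enough because the polynomial, divided by \<open>n\<^sup>2\<close>, depends on
  \<open>q / n\<close> only. The radius is measured by an operator norm but the scale by Frobenius
  norms, so \<open>1 - r
  \<parallel>\<Lambda>'\<^sup>-\<^sup>1\<^sup>/\<^sup>2\<parallel>\<^sub>F\<close> may vanish or be
  negative. Powers of \<open>\<gamma>\<close> can be absorbed only while it is positive, hence the
  separate constant that depends on \<open>\<gamma>\<close>.\<close>

lemma vnorm_nonneg [simp]: "0 \<le> vnorm v"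
  by (simp add: vnorm_def scalar_prod_def sum_nonneg)

lemma vnorm_sq: "(vnorm v)\<^sup>2 = v \<bullet> v"
  by (simp add: vnorm_def scalar_prod_def sum_nonneg)

lemma fnorm_nonneg [simp]: "0 \<le> fnorm A"
  by (simp add: fnorm_def sum_nonneg)

lemma fnorm_sq: "(fnorm A)\<^sup>2 = (\<Sum>i<dim_row A. \<Sum>j<dim_col A. (A $$ (i, j))\<^sup>2)"
  by (simp add: fnorm_def sum_nonneg)

lemma vnorm_L2: "vnorm v = L2_set (\<lambda>i. v $ i) {..<dim_vec v}"
  by (simp add: vnorm_def L2_set_def scalar_prod_def power2_eq_square lessThan_atLeast0)

lemma fnorm_L2: "fnorm A = L2_set (\<lambda>(i, j). A $$ (i, j)) ({..<dim_row A} \<times> {..<dim_col A})"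
  by (simp add: fnorm_def L2_set_def sum.cartesian_product case_prod_unfold)

lemma fnorm_transpose [simp]: "fnorm (transpose_mat A) = fnorm A"
  unfolding fnorm_def by (subst sum.swap) simp

text \<open>Vectors and matrices of all sizes share one type, so every algebraic law carries side
  conditions on carriers. Fixing \<open>n\<close> once makes these conditions simplification rules
  (\<open>closed\<close>, \<open>dims\<close>), and identities can then be proved by
  rewriting.\<close>

locale fixed_dim = fixes n :: nat
begin

abbreviation cv :: "real vec set" where "cv \<equiv> carrier_vec n"
abbreviation cm :: "real mat set" where "cm \<equiv> carrier_mat n n"

lemma closed [simp]:
  "A \<in> cm \<Longrightarrow> B \<in> cm \<Longrightarrow> A * B \<in> cm"
  "A \<in> cm \<Longrightarrow> B \<in> cm \<Longrightarrow> A + B \<in> cm"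
  "A \<in> cm \<Longrightarrow> B \<in> cm \<Longrightarrow> A - B \<in> cm"
  "A \<in> cm \<Longrightarrow> c \<cdot>\<^sub>m A \<in> cm"
  "A \<in> cm \<Longrightarrow> transpose_mat A \<in> cm"
  "A \<in> cm \<Longrightarrow> x \<in> cv \<Longrightarrow> A *\<^sub>v x \<in> cv"
  "x \<in> cv \<Longrightarrow> y \<in> cv \<Longrightarrow> x + y \<in> cv"
  "x \<in> cv \<Longrightarrow> y \<in> cv \<Longrightarrow> x - y \<in> cv"
  "x \<in> cv \<Longrightarrow> c \<cdot>\<^sub>v x \<in> cv"
  by auto

lemma dims [simp]:
  "A \<in> cm \<Longrightarrow> dim_row A = n" "A \<in> cm \<Longrightarrow> dim_col A = n" "x \<in> cv \<Longrightarrow> dim_vec x = n"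
  by auto

lemma scalar_prod_sum: "y \<in> cv \<Longrightarrow> x \<bullet> y = (\<Sum>i<n. x $ i * y $ i)"
  by (simp add: scalar_prod_def lessThan_atLeast0)

lemma mat_vec_index: "A \<in> cm \<Longrightarrow> x \<in> cv \<Longrightarrow> i < n \<Longrightarrow> (A *\<^sub>v x) $ i = (\<Sum>j<n. A $$ (i, j) * x $ j)"
  by (simp add: scalar_prod_def lessThan_atLeast0)

lemma mat_mult_index:
  "A \<in> cm \<Longrightarrow> B \<in> cm \<Longrightarrow> i < n \<Longrightarrow> j < n \<Longrightarrow> (A * B) $$ (i, j) = (\<Sum>k<n. A $$ (i, k) * B $$ (k, j))"
  by (simp add: scalar_prod_def lessThan_atLeast0)

lemma dot_simps:
  "x \<in> cv \<Longrightarrow> y \<in> cv \<Longrightarrow> z \<in> cv \<Longrightarrow> (x + y) \<bullet> z = x \<bullet> z + y \<bullet> z"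
  "x \<in> cv \<Longrightarrow> y \<in> cv \<Longrightarrow> z \<in> cv \<Longrightarrow> z \<bullet> (x + y) = z \<bullet> x + z \<bullet> y"
  "x \<in> cv \<Longrightarrow> y \<in> cv \<Longrightarrow> z \<in> cv \<Longrightarrow> (x - y) \<bullet> z = x \<bullet> z - y \<bullet> z"
  "x \<in> cv \<Longrightarrow> y \<in> cv \<Longrightarrow> z \<in> cv \<Longrightarrow> z \<bullet> (x - y) = z \<bullet> x - z \<bullet> y"
  "x \<in> cv \<Longrightarrow> z \<in> cv \<Longrightarrow> (c \<cdot>\<^sub>v x) \<bullet> z = c * (x \<bullet> z)"
  "x \<in> cv \<Longrightarrow> z \<in> cv \<Longrightarrow> z \<bullet> (c \<cdot>\<^sub>v x) = c * (z \<bullet> x)"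
  by (auto simp: scalar_prod_sum algebra_simps sum.distrib sum_subtractf sum_distrib_left)

lemma dot_comm: "x \<in> cv \<Longrightarrow> y \<in> cv \<Longrightarrow> x \<bullet> y = y \<bullet> x"
  by (rule comm_scalar_prod)

lemma mat_vec_simps:
  "A \<in> cm \<Longrightarrow> B \<in> cm \<Longrightarrow> x \<in> cv \<Longrightarrow> (A + B) *\<^sub>v x = A *\<^sub>v x + B *\<^sub>v x"
  "A \<in> cm \<Longrightarrow> x \<in> cv \<Longrightarrow> y \<in> cv \<Longrightarrow> A *\<^sub>v (x + y) = A *\<^sub>v x + A *\<^sub>v y"
  "A \<in> cm \<Longrightarrow> B \<in> cm \<Longrightarrow> x \<in> cv \<Longrightarrow> (A - B) *\<^sub>v x = A *\<^sub>v x - B *\<^sub>v x"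
  "A \<in> cm \<Longrightarrow> x \<in> cv \<Longrightarrow> y \<in> cv \<Longrightarrow> A *\<^sub>v (x - y) = A *\<^sub>v x - A *\<^sub>v y"
  "A \<in> cm \<Longrightarrow> x \<in> cv \<Longrightarrow> (c \<cdot>\<^sub>m A) *\<^sub>v x = c \<cdot>\<^sub>v (A *\<^sub>v x)"
  "A \<in> cm \<Longrightarrow> x \<in> cv \<Longrightarrow> A *\<^sub>v (c \<cdot>\<^sub>v x) = c \<cdot>\<^sub>v (A *\<^sub>v x)"
  "A \<in> cm \<Longrightarrow> B \<in> cm \<Longrightarrow> x \<in> cv \<Longrightarrow> (A * B) *\<^sub>v x = A *\<^sub>v (B *\<^sub>v x)"
  by (rule add_mult_distrib_mat_vec[of _ n n] mult_add_distrib_mat_vec[of _ n n]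
      minus_mult_distrib_mat_vec[of _ n n] mult_minus_distrib_mat_vec[of _ n n] mult_mat_vec[of _ n n]
      assoc_mult_mat_vec[of _ n n _ n]; assumption | rule eq_vecI; simp)+

lemma mat_simps:
  "A \<in> cm \<Longrightarrow> B \<in> cm \<Longrightarrow> C \<in> cm \<Longrightarrow> (A * B) * C = A * (B * C)"
  "A \<in> cm \<Longrightarrow> B \<in> cm \<Longrightarrow> C \<in> cm \<Longrightarrow> (A + B) * C = A * C + B * C"
  "A \<in> cm \<Longrightarrow> B \<in> cm \<Longrightarrow> C \<in> cm \<Longrightarrow> A * (B + C) = A * B + A * C"
  "A \<in> cm \<Longrightarrow> B \<in> cm \<Longrightarrow> C \<in> cm \<Longrightarrow> (A - B) * C = A * C - B * C"
  "A \<in> cm \<Longrightarrow> B \<in> cm \<Longrightarrow> C \<in> cm \<Longrightarrow> A * (B - C) = A * B - A * C"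
  "A \<in> cm \<Longrightarrow> B \<in> cm \<Longrightarrow> (c \<cdot>\<^sub>m A) * B = c \<cdot>\<^sub>m (A * B)"
  "A \<in> cm \<Longrightarrow> B \<in> cm \<Longrightarrow> A * (c \<cdot>\<^sub>m B) = c \<cdot>\<^sub>m (A * B)"
  "A \<in> cm \<Longrightarrow> 1\<^sub>m n * A = A" "A \<in> cm \<Longrightarrow> A * 1\<^sub>m n = A"
  by (rule assoc_mult_mat[of _ n n _ n _ n] add_mult_distrib_mat[of _ n n] mult_add_distrib_mat[of _ n n]
     minus_mult_distrib_mat[of _ n n] mult_minus_distrib_mat[of _ n n]
     left_mult_one_mat[of _ n n] right_mult_one_mat[of _ n n]; assumption | rule eq_matI; simp)+

lemma transpose_simps:
  "A \<in> cm \<Longrightarrow> B \<in> cm \<Longrightarrow> transpose_mat (A * B) = transpose_mat B * transpose_mat A"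
  "A \<in> cm \<Longrightarrow> B \<in> cm \<Longrightarrow> transpose_mat (A + B) = transpose_mat A + transpose_mat B"
  "A \<in> cm \<Longrightarrow> B \<in> cm \<Longrightarrow> transpose_mat (A - B) = transpose_mat A - transpose_mat B"
  "A \<in> cm \<Longrightarrow> transpose_mat (c \<cdot>\<^sub>m A) = c \<cdot>\<^sub>m transpose_mat A"
  by (rule transpose_mult[of _ n n] transpose_add[of _ n n] transpose_minus[of _ n n]; assumption
     | rule eq_matI; simp)+

lemma dot_transpose: "A \<in> cm \<Longrightarrow> x \<in> cv \<Longrightarrow> y \<in> cv \<Longrightarrow> x \<bullet> (A *\<^sub>v y) = (transpose_mat A *\<^sub>v x) \<bullet> y"
  using transpose_vec_mult_scalar[of A n n y x] by simp

lemma symD: "A \<in> sym_mats n \<Longrightarrow> A \<in> cm" "A \<in> sym_mats n \<Longrightarrow> transpose_mat A = A"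
  by (auto simp: sym_mats_def)

lemma dot_sym: "A \<in> sym_mats n \<Longrightarrow> x \<in> cv \<Longrightarrow> y \<in> cv \<Longrightarrow> x \<bullet> (A *\<^sub>v y) = (A *\<^sub>v x) \<bullet> y"
  using dot_transpose symD by metis

lemma sym_closed:
  "A \<in> sym_mats n \<Longrightarrow> B \<in> sym_mats n \<Longrightarrow> A + B \<in> sym_mats n"
  "A \<in> sym_mats n \<Longrightarrow> B \<in> sym_mats n \<Longrightarrow> A - B \<in> sym_mats n"
  "A \<in> sym_mats n \<Longrightarrow> c \<cdot>\<^sub>m A \<in> sym_mats n"
  "A \<in> sym_mats n \<Longrightarrow> B \<in> cm \<Longrightarrow> B * A * transpose_mat B \<in> sym_mats n"
  "A \<in> sym_mats n \<Longrightarrow> B \<in> sym_mats n \<Longrightarrow> B * A * B \<in> sym_mats n"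
  "A \<in> sym_mats n \<Longrightarrow> B \<in> sym_mats n \<Longrightarrow> B * A + A * B \<in> sym_mats n"
  "1\<^sub>m n \<in> sym_mats n" "0\<^sub>m n n \<in> sym_mats n" "mat_diag n d \<in> sym_mats n"
  by (auto simp: sym_mats_def transpose_simps mat_simps comm_add_mat[of _ n n])
    (auto simp: mat_diag_def)

text \<open>On \<open>unit_vec n j\<close>, equality of the actions is equality of the
  \<open>j\<close>-th columns.\<close>

lemma mat_eq_by_action:
  assumes "A \<in> cm" "B \<in> cm" "\<And>x. x \<in> cv \<Longrightarrow> A *\<^sub>v x = B *\<^sub>v x"
  shows "A = B"
proof (rule eq_matI)
  fix i j assume "i < dim_row B" "j < dim_col B"
  then have ij: "i < n" "j < n" using assms by auto
  have "A *\<^sub>v unit_vec n j = B *\<^sub>v unit_vec n j" using assms by auto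
  then have "(A *\<^sub>v unit_vec n j) $ i = (B *\<^sub>v unit_vec n j) $ i" by simp
  then show "A $$ (i, j) = B $$ (i, j)" using ij assms(1,2) by simp
qed (use assms in auto)

section \<open>Euclidean norm, Frobenius norm and the trace pairing\<close>

lemma vnorm_eq_0: "x \<in> cv \<Longrightarrow> vnorm x = 0 \<longleftrightarrow> x = 0\<^sub>v n"
  by (auto simp: vnorm_L2 L2_set_eq_0_iff intro!: eq_vecI)

lemma dot_self_eq_0: "x \<in> cv \<Longrightarrow> x \<bullet> x = 0 \<longleftrightarrow> x = 0\<^sub>v n"
  using vnorm_eq_0 by (simp add: vnorm_sq[symmetric])

lemma Cauchy_Schwarz: "x \<in> cv \<Longrightarrow> y \<in> cv \<Longrightarrow> \<bar>x \<bullet> y\<bar> \<le> vnorm x * vnorm y"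
  unfolding vnorm_L2 scalar_prod_sum
  by (rule order_trans[OF sum_abs]) (simp add: abs_mult L2_set_mult_ineq)

lemma vnorm_triangle: "x \<in> cv \<Longrightarrow> y \<in> cv \<Longrightarrow> vnorm (x + y) \<le> vnorm x + vnorm y"
proof -
  assume a: "x \<in> cv" "y \<in> cv"
  then have "vnorm (x + y) = L2_set (\<lambda>i. x $ i + y $ i) {..<n}"
    unfolding vnorm_L2 by (intro L2_set_cong) auto
  then show ?thesis using a L2_set_triangle_ineq[of "\<lambda>i. x $ i" "\<lambda>i. y $ i" "{..<n}"]
    by (simp add: vnorm_L2)
qed

lemma vnorm_smult: "x \<in> cv \<Longrightarrow> vnorm (c \<cdot>\<^sub>v x) = \<bar>c\<bar> * vnorm x"
proof -
  assume x: "x \<in> cv"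
  then have "(c \<cdot>\<^sub>v x) \<bullet> (c \<cdot>\<^sub>v x) = c\<^sup>2 * (x \<bullet> x)" by (simp add: dot_simps power2_eq_square)
  then show ?thesis by (simp add: vnorm_def real_sqrt_mult)
qed

lemma fnorm_sq': "A \<in> cm \<Longrightarrow> (fnorm A)\<^sup>2 = (\<Sum>i<n. \<Sum>j<n. (A $$ (i, j))\<^sup>2)"
  by (simp add: fnorm_sq)

lemma fnorm_sq_col: "A \<in> cm \<Longrightarrow> (fnorm A)\<^sup>2 = (\<Sum>j<n. (vnorm (A *\<^sub>v unit_vec n j))\<^sup>2)"
proof -
  assume A: "A \<in> cm"
  have "(vnorm (A *\<^sub>v unit_vec n j))\<^sup>2 = (\<Sum>i<n. (A $$ (i, j))\<^sup>2)" if "j < n" for j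
    unfolding vnorm_sq scalar_prod_sum[OF closed(6)[OF A unit_vec_carrier]]
    using A that by (intro sum.cong) (simp_all add: power2_eq_square)
  then show ?thesis unfolding fnorm_sq'[OF A] by (subst sum.swap) simp
qed

lemma fnorm_triangle: "A \<in> cm \<Longrightarrow> B \<in> cm \<Longrightarrow> fnorm (A + B) \<le> fnorm A + fnorm B"
proof -
  assume a: "A \<in> cm" "B \<in> cm"
  have "fnorm (A + B) = L2_set (\<lambda>ij. (case ij of (i, j) \<Rightarrow> A $$ (i, j)) + (case ij of (i, j) \<Rightarrow> B $$ (i, j)))
      ({..<n} \<times> {..<n})"
    using a unfolding fnorm_L2 by (intro L2_set_cong) auto
  then show ?thesis
    using a L2_set_triangle_ineq[of "\<lambda>(i, j). A $$ (i, j)" "\<lambda>(i, j). B $$ (i, j)" "{..<n} \<times> {..<n}"]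
    by (simp add: fnorm_L2)
qed

lemma fnorm_smult: "A \<in> cm \<Longrightarrow> fnorm (c \<cdot>\<^sub>m A) = \<bar>c\<bar> * fnorm A"
proof -
  assume A: "A \<in> cm"
  then have "(fnorm (c \<cdot>\<^sub>m A))\<^sup>2 = (\<bar>c\<bar> * fnorm A)\<^sup>2"
    by (simp add: fnorm_sq' power_mult_distrib sum_distrib_left)
  then show ?thesis by (simp add: power2_eq_iff_nonneg)
qed

lemma tr_sum: "A \<in> cm \<Longrightarrow> tr A = (\<Sum>i<n. A $$ (i, i))"
  by (simp add: tr_def)

lemma tr_mult: "A \<in> cm \<Longrightarrow> B \<in> cm \<Longrightarrow> tr (A * B) = (\<Sum>i<n. \<Sum>j<n. A $$ (i, j) * B $$ (j, i))"
  by (simp add: tr_sum mat_mult_index del: index_mult_mat)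

lemma tr_comm: "A \<in> cm \<Longrightarrow> B \<in> cm \<Longrightarrow> tr (A * B) = tr (B * A)"
  unfolding tr_mult by (subst sum.swap) (simp add: mult.commute)

lemma tr_simps:
  "A \<in> cm \<Longrightarrow> B \<in> cm \<Longrightarrow> tr (A + B) = tr A + tr B"
  "A \<in> cm \<Longrightarrow> B \<in> cm \<Longrightarrow> tr (A - B) = tr A - tr B"
  "A \<in> cm \<Longrightarrow> tr (c \<cdot>\<^sub>m A) = c * tr A"
  "A \<in> cm \<Longrightarrow> tr (transpose_mat A) = tr A"
  by (simp_all add: tr_def sum.distrib sum_subtractf sum_distrib_left)

lemma fnorm_sq_tr: "A \<in> cm \<Longrightarrow> (fnorm A)\<^sup>2 = tr (transpose_mat A * A)"
  unfolding fnorm_sq' by (subst tr_mult) (simp, assumption, simp add: power2_eq_square, rule sum.swap)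

text \<open>Cauchy--Schwarz for the Frobenius inner product of \<open>A\<close> with the transpose
  of \<open>B\<close>; indexing the entries by pairs makes both Frobenius norms instances of
  \<open>L2_set\<close>.\<close>

lemma tr_mult_le: "A \<in> cm \<Longrightarrow> B \<in> cm \<Longrightarrow> \<bar>tr (A * B)\<bar> \<le> fnorm A * fnorm B"
proof -
  assume a: "A \<in> cm" "B \<in> cm"
  let ?I = "{..<n} \<times> {..<n}"
  have "\<bar>tr (A * B)\<bar> = \<bar>\<Sum>ij\<in>?I. (case ij of (i, j) \<Rightarrow> A $$ (i, j)) * (case ij of (i, j) \<Rightarrow> transpose_mat B $$ (i, j))\<bar>"
    using a by (simp add: tr_mult sum.cartesian_product case_prod_unfold)
      (intro arg_cong[where f = abs] sum.cong, auto)
  also have "\<dots> \<le> (\<Sum>ij\<in>?I. \<bar>case ij of (i, j) \<Rightarrow> A $$ (i, j)\<bar> * \<bar>case ij of (i, j) \<Rightarrow> transpose_mat B $$ (i, j)\<bar>)"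
    by (rule order_trans[OF sum_abs]) (simp add: abs_mult)
  also have "\<dots> \<le> fnorm A * fnorm (transpose_mat B)"
    using a unfolding fnorm_L2 by (simp add: L2_set_mult_ineq)
  finally show ?thesis by simp
qed

lemma fnorm_one: "fnorm (1\<^sub>m n) = sqrt n"
proof -
  have "(\<Sum>i<n. \<Sum>j<n. ((1\<^sub>m n :: real mat) $$ (i, j))\<^sup>2) = (\<Sum>i<n. \<Sum>j<n. if i = j then 1 else 0)"
    by (intro sum.cong) auto
  then show ?thesis by (simp add: fnorm_def)
qed

lemma tr_le: "A \<in> cm \<Longrightarrow> \<bar>tr A\<bar> \<le> sqrt n * fnorm A"
  using tr_mult_le[of "1\<^sub>m n" A] by (simp add: fnorm_one)

lemma vnorm_mat_vec_le: "A \<in> cm \<Longrightarrow> x \<in> cv \<Longrightarrow> vnorm (A *\<^sub>v x) \<le> fnorm A * vnorm x"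
proof -
  assume a: "A \<in> cm" "x \<in> cv"
  have "(\<Sum>j<n. A $$ (i, j) * x $ j)\<^sup>2 \<le> (\<Sum>j<n. (A $$ (i, j))\<^sup>2) * (\<Sum>j<n. (x $ j)\<^sup>2)" for i
    by (rule Cauchy_Schwarz_ineq_sum)
  then have "(vnorm (A *\<^sub>v x))\<^sup>2 \<le> (\<Sum>i<n. (\<Sum>j<n. (A $$ (i, j))\<^sup>2) * (\<Sum>j<n. (x $ j)\<^sup>2))"
    using a unfolding vnorm_sq
    by (auto simp: scalar_prod_sum mat_vec_index power2_eq_square[symmetric] simp del: index_mult_mat_vec intro!: sum_mono)
  also have "\<dots> = (fnorm A * vnorm x)\<^sup>2"
    unfolding power_mult_distrib fnorm_sq'[OF a(1)] vnorm_sq scalar_prod_sum[OF a(2)]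
    by (simp only: sum_distrib_right power2_eq_square)
  finally show ?thesis by (meson fnorm_nonneg mult_nonneg_nonneg power2_le_imp_le vnorm_nonneg)
qed

text \<open>Each column of \<open>A * B\<close> is \<open>A\<close> applied to a column of
  \<open>B\<close>, and the squared Frobenius norm adds up squared column norms. An operator bound
  on the left factor therefore costs nothing that depends on \<open>n\<close>, unlike its Frobenius
  norm.\<close>

lemma fnorm_mult_bound:
  assumes "A \<in> cm" "B \<in> cm" "0 \<le> c" "\<And>x. x \<in> cv \<Longrightarrow> vnorm (A *\<^sub>v x) \<le> c * vnorm x"
  shows "fnorm (A * B) \<le> c * fnorm B"
proof -
  have "(fnorm (A * B))\<^sup>2 = (\<Sum>j<n. (vnorm (A *\<^sub>v (B *\<^sub>v unit_vec n j)))\<^sup>2)"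
    using assms by (subst fnorm_sq_col) (auto simp: mat_vec_simps)
  also have "\<dots> \<le> (\<Sum>j<n. (c * vnorm (B *\<^sub>v unit_vec n j))\<^sup>2)"
    using assms by (intro sum_mono power_mono) auto
  also have "\<dots> = (c * fnorm B)\<^sup>2"
    using assms by (simp add: power_mult_distrib fnorm_sq_col sum_distrib_left)
  finally show ?thesis using assms by (meson fnorm_nonneg mult_nonneg_nonneg power2_le_imp_le)
qed

lemma fnorm_mult_le: "A \<in> cm \<Longrightarrow> B \<in> cm \<Longrightarrow> fnorm (A * B) \<le> fnorm A * fnorm B"
  by (rule fnorm_mult_bound) (auto simp: vnorm_mat_vec_le)

lemma fnorm_mult_bound_right:
  assumes "A \<in> cm" "B \<in> cm" "0 \<le> c" "\<And>x. x \<in> cv \<Longrightarrow> vnorm (transpose_mat A *\<^sub>v x) \<le> c * vnorm x"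
  shows "fnorm (B * A) \<le> c * fnorm B"
  using fnorm_mult_bound[of "transpose_mat A" "transpose_mat B" c] assms
  by (simp add: transpose_simps[symmetric])

end

section \<open>The spectral theorem\<close>

text \<open>The complexified matrix has an eigenvalue \<open>k\<close> with an eigenvector of real
  part \<open>a\<close> and imaginary part \<open>b\<close>. Symmetry of \<open>A\<close>, tested on
  \<open>a\<close> and \<open>b\<close>, gives
  \<open>Im k * (a \<bullet> a + b \<bullet> b) = 0\<close>; so \<open>k\<close> is real, and
  whichever of \<open>a\<close>, \<open>b\<close> is nonzero is a real eigenvector.\<close>

lemma real_symmetric_eigenvector:
  fixes A :: "real mat"
  assumes A: "A \<in> sym_mats n" and n: "0 < n"
  obtains l v where "v \<in> carrier_vec n" "v \<noteq> 0\<^sub>v n" "A *\<^sub>v v = l \<cdot>\<^sub>v v"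
proof -
  interpret fixed_dim n .
  have Ac: "A \<in> cm" using A by (auto simp: sym_mats_def)
  let ?C = "map_mat complex_of_real A"
  have "?C \<in> carrier_mat n n" using Ac by simp
  from spectrum_non_empty[OF this n] obtain k where "eigenvalue ?C k"
    unfolding spectrum_def by auto
  then obtain v where v: "v \<in> carrier_vec n" "v \<noteq> 0\<^sub>v n" "?C *\<^sub>v v = k \<cdot>\<^sub>v v"
    unfolding eigenvalue_def eigenvector_def using Ac by auto
  define a b where "a = vec n (\<lambda>i. Re (v $ i))" and "b = vec n (\<lambda>i. Im (v $ i))"
  have [simp]: "a \<in> cv" "b \<in> cv" by (auto simp: a_def b_def)
  have ev: "(\<Sum>j<n. complex_of_real (A $$ (i, j)) * v $ j) = k * v $ i" if "i < n" for i
  proof -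
    have "(?C *\<^sub>v v) $ i = (k \<cdot>\<^sub>v v) $ i" using v(3) by simp
    then show ?thesis using that v(1) Ac by (simp add: scalar_prod_def lessThan_atLeast0)
  qed
  have Aa: "A *\<^sub>v a = Re k \<cdot>\<^sub>v a - Im k \<cdot>\<^sub>v b"
  proof (rule eq_vecI)
    fix i assume "i < dim_vec (Re k \<cdot>\<^sub>v a - Im k \<cdot>\<^sub>v b)"
    then have i: "i < n" by simp
    have "(A *\<^sub>v a) $ i = Re (\<Sum>j<n. complex_of_real (A $$ (i, j)) * v $ j)"
      using i Ac by (simp add: mat_vec_index a_def del: index_mult_mat_vec)
    then show "(A *\<^sub>v a) $ i = (Re k \<cdot>\<^sub>v a - Im k \<cdot>\<^sub>v b) $ i"
      unfolding ev[OF i] using i by (simp add: a_def b_def)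
  qed (use Ac in auto)
  have Ab: "A *\<^sub>v b = Im k \<cdot>\<^sub>v a + Re k \<cdot>\<^sub>v b"
  proof (rule eq_vecI)
    fix i assume "i < dim_vec (Im k \<cdot>\<^sub>v a + Re k \<cdot>\<^sub>v b)"
    then have i: "i < n" by simp
    have "(A *\<^sub>v b) $ i = Im (\<Sum>j<n. complex_of_real (A $$ (i, j)) * v $ j)"
      using i Ac by (simp add: mat_vec_index b_def del: index_mult_mat_vec)
    then show "(A *\<^sub>v b) $ i = (Im k \<cdot>\<^sub>v a + Re k \<cdot>\<^sub>v b) $ i"
      unfolding ev[OF i] using i by (simp add: a_def b_def)
  qed (use Ac in auto)
  have ab: "a \<noteq> 0\<^sub>v n \<or> b \<noteq> 0\<^sub>v n"
  proof (rule ccontr)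
    assume "\<not> ?thesis"
    then have z: "a $ i = 0" "b $ i = 0" if "i < n" for i using that by auto
    have "v = 0\<^sub>v n"
      using v(1) z by (intro eq_vecI) (auto simp: a_def b_def complex_eq_iff)
    with v(2) show False by simp
  qed
  have "a \<bullet> (A *\<^sub>v b) = b \<bullet> (A *\<^sub>v a)"
    using dot_sym[OF A, of a b] dot_comm[of "A *\<^sub>v a" b] Ac by auto
  then have "Im k * (a \<bullet> a + b \<bullet> b) = 0"
    unfolding Aa Ab by (simp add: dot_simps dot_comm[of b a] algebra_simps)
  moreover have "a \<bullet> a + b \<bullet> b > 0"
    using ab dot_self_eq_0[of a] dot_self_eq_0[of b] vnorm_sq[of a] vnorm_sq[of b]
      zero_le_power2[of "vnorm a"] zero_le_power2[of "vnorm b"]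
    by (auto simp: add_nonneg_pos add_pos_nonneg less_le)
  ultimately have k: "Im k = 0" by auto
  have "A *\<^sub>v a = Re k \<cdot>\<^sub>v a" "A *\<^sub>v b = Re k \<cdot>\<^sub>v b" unfolding Aa Ab k by (auto intro!: eq_vecI)
  then show ?thesis using ab that[of a "Re k"] that[of b "Re k"] by auto
qed

text \<open>The reflection in the hyperplane orthogonal to \<open>u = v - ?e\<close> exchanges two
  vectors of equal length; for \<open>v = ?e\<close> the identity serves. It moves a unit
  eigenvector to the first coordinate axis.\<close>

lemma Householder:
  fixes v :: "real vec"
  assumes v: "v \<in> carrier_vec (Suc m)" "v \<bullet> v = 1"
  obtains H where "H \<in> sym_mats (Suc m)" "H * H = 1\<^sub>m (Suc m)" "H *\<^sub>v unit_vec (Suc m) 0 = v"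
proof (cases "v = unit_vec (Suc m) 0")
  case True
  interpret fixed_dim "Suc m" .
  show ?thesis using that[of "1\<^sub>m (Suc m)"] True by (auto simp: sym_closed)
next
  case False
  interpret fixed_dim "Suc m" .
  let ?e = "unit_vec (Suc m) 0 :: real vec"
  define u where "u = v - ?e"
  have u: "u \<in> cv" using v by (simp add: u_def)
  have ee: "?e \<bullet> ?e = 1" "?e \<bullet> v = v $ 0" "v \<bullet> ?e = v $ 0" using v by auto
  have uu: "u \<bullet> u = 2 - 2 * v $ 0" and ue: "u \<bullet> ?e = v $ 0 - 1"
    unfolding u_def using v ee by (auto simp: dot_simps)
  have "u \<noteq> 0\<^sub>v (Suc m)"
  proof
    assume "u = 0\<^sub>v (Suc m)"
    then have "u $ i = 0" if "i < Suc m" for i using that by simp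
    then have "v = ?e" using v(1) unfolding u_def by (intro eq_vecI) force+
    with False show False by simp
  qed
  then have uu0: "u \<bullet> u \<noteq> 0" using u dot_self_eq_0 by auto
  define c where "c = 2 / (u \<bullet> u)"
  define H where "H = mat (Suc m) (Suc m) (\<lambda>(i, j). (if i = j then 1 else 0) - c * u $ i * u $ j)"
  have Hc: "H \<in> cm" by (simp add: H_def)
  have Hx: "H *\<^sub>v x = x - (c * (u \<bullet> x)) \<cdot>\<^sub>v u" if x: "x \<in> cv" for x
  proof (rule eq_vecI)
    fix i assume "i < dim_vec (x - (c * (u \<bullet> x)) \<cdot>\<^sub>v u)"
    then have i: "i < Suc m" using u by simp
    have "(H *\<^sub>v x) $ i = (\<Sum>j<Suc m. (if i = j then x $ j else 0) - c * u $ i * (u $ j * x $ j))"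
      using i x Hc by (subst mat_vec_index) (auto simp: H_def algebra_simps intro!: sum.cong)
    also have "\<dots> = x $ i - c * u $ i * (u \<bullet> x)"
      using i x by (simp only: sum_subtractf scalar_prod_sum[OF x] sum_distrib_left[symmetric]) simp
    finally show "(H *\<^sub>v x) $ i = (x - (c * (u \<bullet> x)) \<cdot>\<^sub>v u) $ i" using i u x by simp
  qed (use u Hc in auto)
  have 1: "H \<in> sym_mats (Suc m)" unfolding sym_mats_def H_def by auto
  have 2: "H * H = 1\<^sub>m (Suc m)"
  proof (rule mat_eq_by_action)
    fix x assume x: "x \<in> cv"
    have xu: "x - (c * (u \<bullet> x)) \<cdot>\<^sub>v u \<in> cv" using x u by simp
    have "u \<bullet> (x - (c * (u \<bullet> x)) \<cdot>\<^sub>v u) = - (u \<bullet> x)"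
      using x u uu0 by (simp add: dot_simps c_def)
    then have "(H * H) *\<^sub>v x = (x - (c * (u \<bullet> x)) \<cdot>\<^sub>v u) - (c * - (u \<bullet> x)) \<cdot>\<^sub>v u"
      using x xu Hc by (simp add: mat_vec_simps Hx)
    also have "\<dots> = x" using x u by (intro eq_vecI) auto
    finally show "(H * H) *\<^sub>v x = 1\<^sub>m (Suc m) *\<^sub>v x" using x by simp
  qed (use Hc in auto)
  \<comment> \<open>For unit vectors \<open>u \<bullet> u = - 2 * (u \<bullet> ?e)\<close>, so the
    reflection adds exactly \<open>u\<close> to \<open>?e\<close>.\<close>
  have "c * (u \<bullet> ?e) = -1" using uu0 unfolding c_def ue uu by (simp add: field_simps)
  then have "H *\<^sub>v ?e = ?e - (-1) \<cdot>\<^sub>v u" by (subst Hx) auto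
  also have "\<dots> = v" unfolding u_def using v by (intro eq_vecI) auto
  finally show ?thesis using that 1 2 by blast
qed

lemma block_diag_mult:
  fixes X Y X' Y' :: "real mat"
  assumes "X \<in> carrier_mat k k" "Y \<in> carrier_mat k k" "X' \<in> carrier_mat m m" "Y' \<in> carrier_mat m m"
  shows "four_block_mat X (0\<^sub>m k m) (0\<^sub>m m k) X' * four_block_mat Y (0\<^sub>m k m) (0\<^sub>m m k) Y'
    = four_block_mat (X * Y) (0\<^sub>m k m) (0\<^sub>m m k) (X' * Y')"
  using assms by (subst mult_four_block_mat[of X k k _ m _ m X' Y k _ m]) simp_all

text \<open>Induction on the dimension by deflation: after conjugation with a Householder reflection
  the first axis is an eigenvector, symmetry clears the first row together with the first column,
  and the remaining block \<open>B'\<close> is symmetric of size one less.\<close>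

theorem spectral_theorem:
  fixes A :: "real mat"
  assumes "A \<in> sym_mats n"
  obtains Q d where "Q \<in> carrier_mat n n" "Q * transpose_mat Q = 1\<^sub>m n" "transpose_mat Q * Q = 1\<^sub>m n"
    "A = Q * mat_diag n d * transpose_mat Q"
proof -
  have "\<exists>Q d. Q \<in> carrier_mat n n \<and> Q * transpose_mat Q = 1\<^sub>m n \<and> A = Q * mat_diag n d * transpose_mat Q"
    using assms
  proof (induction n arbitrary: A)
    case 0
    then show ?case by (intro exI[of _ "1\<^sub>m 0"] exI[of _ "\<lambda>_. 0"]) (auto simp: sym_mats_def intro!: eq_matI)
  next
    case (Suc m)
    interpret fixed_dim "Suc m" .
    let ?e = "unit_vec (Suc m) 0 :: real vec"
    have Ac: "A \<in> cm" using Suc.prems by (auto simp: sym_mats_def)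
    obtain l w where w: "w \<in> cv" "w \<noteq> 0\<^sub>v (Suc m)" "A *\<^sub>v w = l \<cdot>\<^sub>v w"
      using real_symmetric_eigenvector[OF Suc.prems zero_less_Suc] by blast
    define v where "v = (1 / vnorm w) \<cdot>\<^sub>v w"
    have w0: "vnorm w \<noteq> 0" using w vnorm_eq_0 by auto
    have v: "v \<in> cv" "A *\<^sub>v v = l \<cdot>\<^sub>v v" "v \<bullet> v = 1"
      using w w0 Ac vnorm_sq[of w] unfolding v_def
      by (auto simp: mat_vec_simps dot_simps power2_eq_square field_simps intro!: eq_vecI)
    obtain H where H: "H \<in> sym_mats (Suc m)" "H * H = 1\<^sub>m (Suc m)" "H *\<^sub>v ?e = v"
      using Householder[OF v(1,3)] by blast
    have Hc: "H \<in> cm" using H by (simp add: symD)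
    define B where "B = H * A * H"
    have Bs: "B \<in> sym_mats (Suc m)" unfolding B_def using Suc.prems H by (auto intro: sym_closed)
    have Bc: "B \<in> cm" using Bs symD by blast
    have "H *\<^sub>v v = ?e"
      using mat_vec_simps(7)[OF Hc Hc unit_vec_carrier[of _ 0]] H(2,3) by simp
    then have "B *\<^sub>v ?e = l \<cdot>\<^sub>v ?e"
      unfolding B_def using Hc Ac H(3) v by (simp add: mat_vec_simps)
    then have col0: "B $$ (i, 0) = (if i = 0 then l else 0)" if "i < Suc m" for i
    proof -
      have "(B *\<^sub>v ?e) $ i = (l \<cdot>\<^sub>v ?e) $ i" using \<open>B *\<^sub>v ?e = l \<cdot>\<^sub>v ?e\<close> by simp
      then show ?thesis using that Bc by (auto split: if_splits)
    qed
    have Bsym: "B $$ (i, j) = B $$ (j, i)" if "i < Suc m" "j < Suc m" for i j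
      using symD(2)[OF Bs] index_transpose_mat(1)[of j B i] Bc that by auto
    define B' where "B' = mat m m (\<lambda>(i, j). B $$ (Suc i, Suc j))"
    have B's: "B' \<in> sym_mats m" unfolding B'_def sym_mats_def by (auto simp: Bsym)
    from Suc.IH[OF B's] obtain Q' d' where
      Q': "Q' \<in> carrier_mat m m" "Q' * transpose_mat Q' = 1\<^sub>m m" "B' = Q' * mat_diag m d' * transpose_mat Q'"
      by blast
    define Q1 where "Q1 = four_block_mat (1\<^sub>m 1) (0\<^sub>m 1 m) (0\<^sub>m m 1) Q'"
    define d where "d = case_nat l d'"
    have Q1c: "Q1 \<in> cm" unfolding Q1_def using Q' four_block_carrier_mat[of "1\<^sub>m 1" 1 1 Q' m m] by simp
    have Q1T: "transpose_mat Q1 = four_block_mat (1\<^sub>m 1) (0\<^sub>m 1 m) (0\<^sub>m m 1) (transpose_mat Q')"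
      unfolding Q1_def using Q' by (subst transpose_four_block_mat[of _ 1 1 _ m _ m]) auto
    have D: "mat_diag (Suc m) d = four_block_mat (mat_diag 1 (\<lambda>_. l)) (0\<^sub>m 1 m) (0\<^sub>m m 1) (mat_diag m d')"
      by (rule eq_matI) (auto simp: mat_diag_def d_def split: nat.split)
    have Bb: "B = four_block_mat (mat_diag 1 (\<lambda>_. l)) (0\<^sub>m 1 m) (0\<^sub>m m 1) B'"
    proof (rule eq_matI)
      fix i j assume "i < dim_row (four_block_mat (mat_diag 1 (\<lambda>_. l)) (0\<^sub>m 1 m) (0\<^sub>m m 1) B')"
        "j < dim_col (four_block_mat (mat_diag 1 (\<lambda>_. l)) (0\<^sub>m 1 m) (0\<^sub>m m 1) B')"
      then have ij: "i < Suc m" "j < Suc m" by (auto simp: mat_diag_def B'_def)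
      then show "B $$ (i, j) = four_block_mat (mat_diag 1 (\<lambda>_. l)) (0\<^sub>m 1 m) (0\<^sub>m m 1) B' $$ (i, j)"
        using col0[of i] col0[of j] Bsym[of i j] by (auto simp: mat_diag_def B'_def)
    qed (use Bc in \<open>auto simp: mat_diag_def B'_def\<close>)
    have "Q1 * transpose_mat Q1 = four_block_mat (1\<^sub>m 1) (0\<^sub>m 1 m) (0\<^sub>m m 1) (1\<^sub>m m)"
      unfolding Q1T unfolding Q1_def using Q'(1,2) by (subst block_diag_mult) simp_all
    also have "\<dots> = 1\<^sub>m (Suc m)" unfolding four_block_one_mat by (simp only: plus_1_eq_Suc)
    finally have Q1i: "Q1 * transpose_mat Q1 = 1\<^sub>m (Suc m)" .
    have "Q1 * mat_diag (Suc m) d = four_block_mat (mat_diag 1 (\<lambda>_. l)) (0\<^sub>m 1 m) (0\<^sub>m m 1) (Q' * mat_diag m d')"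
      unfolding D unfolding Q1_def using Q'(1)
      by (subst block_diag_mult) (simp_all add: left_mult_one_mat[OF mat_diag_dim])
    then have "Q1 * mat_diag (Suc m) d * transpose_mat Q1 = B"
      unfolding Q1T Bb Q'(3) using Q'(1) by (simp only:, subst block_diag_mult)
        (simp_all add: right_mult_one_mat[OF mat_diag_dim, where ?'a = real])
    then have QB: "Q1 * (mat_diag (Suc m) d * transpose_mat Q1) = H * (A * H)"
      using Q1c Hc Ac unfolding B_def by (simp add: mat_simps)
    have HH: "H * (H * X) = X" if "X \<in> cm" for X
      using mat_simps(1)[OF Hc Hc that] H(2) that by (simp add: mat_simps)
    have QQ: "Q1 * (transpose_mat Q1 * X) = X" if "X \<in> cm" for X
      using mat_simps(1)[of Q1 "transpose_mat Q1" X] Q1c Q1i that by (simp add: mat_simps)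
    show ?case
    proof (intro exI[of _ "H * Q1"] exI[of _ d] conjI)
      show "H * Q1 \<in> cm" using Hc Q1c by simp
      show "H * Q1 * transpose_mat (H * Q1) = 1\<^sub>m (Suc m)"
        using Hc Q1c symD(2)[OF H(1)] by (simp add: transpose_simps mat_simps QQ H(2))
      have "H * Q1 * mat_diag (Suc m) d * transpose_mat (H * Q1) = H * (Q1 * (mat_diag (Suc m) d * transpose_mat Q1)) * H"
        using Hc Q1c symD(2)[OF H(1)] by (simp add: transpose_simps mat_simps)
      also have "\<dots> = A" unfolding QB using Hc Ac by (simp add: mat_simps HH H(2))
      finally show "A = H * Q1 * mat_diag (Suc m) d * transpose_mat (H * Q1)" by simp
    qed
  qed
  \<comment> \<open>A one-sided inverse of a square matrix is two-sided, so the induction carries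
    only one of the two orthogonality relations.\<close>
  then show ?thesis using that mat_mult_left_right_inverse[of _ n] by (metis transpose_carrier_mat)
qed

section \<open>Positive definite matrices\<close>

context fixed_dim
begin

lemma spdD:
  assumes "A \<in> spd n"
  shows "A \<in> sym_mats n" "A \<in> cm" "transpose_mat A = A"
    "\<And>v. v \<in> cv \<Longrightarrow> v \<noteq> 0\<^sub>v n \<Longrightarrow> 0 < v \<bullet> (A *\<^sub>v v)" "\<And>v. v \<in> cv \<Longrightarrow> 0 \<le> v \<bullet> (A *\<^sub>v v)"
proof -
  show 1: "A \<in> sym_mats n" "A \<in> cm" "transpose_mat A = A"
    using assms by (auto simp: spd_def sym_mats_def)
  show "\<And>v. v \<in> cv \<Longrightarrow> v \<noteq> 0\<^sub>v n \<Longrightarrow> 0 < v \<bullet> (A *\<^sub>v v)" using assms by (auto simp: spd_def)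
  then show "0 \<le> v \<bullet> (A *\<^sub>v v)" if "v \<in> cv" for v
    using that 1 by (cases "v = 0\<^sub>v n") (force simp: less_imp_le)+
qed

lemma spd_psd: "A \<in> spd n \<Longrightarrow> A \<in> psd n"
  using spdD by (auto simp: psd_def)

lemma mat_vec_zero: "A \<in> cm \<Longrightarrow> A *\<^sub>v 0\<^sub>v n = 0\<^sub>v n"
  by (rule eq_vecI) auto

text \<open>The matrix \<open>C\<close> certifies that \<open>transpose_mat B\<close> is injective,
  so that a nonzero vector stays nonzero before the form of \<open>A\<close> is evaluated.\<close>

lemma spd_cong_transform:
  assumes A: "A \<in> spd n" and B: "B \<in> cm" "C \<in> cm" "C * transpose_mat B = 1\<^sub>m n"
  shows "B * A * transpose_mat B \<in> spd n"
  unfolding spd_def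
proof (intro CollectI conjI ballI impI)
  show "B * A * transpose_mat B \<in> sym_mats n" using sym_closed(4)[OF spdD(1)[OF A] B(1)] .
next
  fix v assume v: "v \<in> cv" "v \<noteq> 0\<^sub>v n"
  have Tv: "transpose_mat B *\<^sub>v v \<in> cv" using B v by simp
  have "C *\<^sub>v (transpose_mat B *\<^sub>v v) = v"
    using B v by (simp add: mat_vec_simps(7)[symmetric])
  then have "transpose_mat B *\<^sub>v v \<noteq> 0\<^sub>v n" using v(2) mat_vec_zero[OF B(2)] by auto
  then have "0 < (transpose_mat B *\<^sub>v v) \<bullet> (A *\<^sub>v (transpose_mat B *\<^sub>v v))"
    using spdD(4)[OF A Tv] by blast
  also have "\<dots> = v \<bullet> (B * A * transpose_mat B *\<^sub>v v)"
    using B v spdD(2)[OF A] by (simp add: mat_vec_simps dot_transpose)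
  finally show "0 < v \<bullet> (B * A * transpose_mat B *\<^sub>v v)" .
qed

lemma mat_diag_vec: "w \<in> cv \<Longrightarrow> mat_diag n d *\<^sub>v w = vec n (\<lambda>i. d i * w $ i)"
proof (rule eq_vecI)
  fix i assume w: "w \<in> cv" and "i < dim_vec (vec n (\<lambda>i. d i * w $ i))"
  then have i: "i < n" by simp
  have "(mat_diag n d *\<^sub>v w) $ i = (\<Sum>j<n. if i = j then d j * w $ j else 0)"
    unfolding mat_vec_index[OF mat_diag_dim w i] using i by (intro sum.cong) (auto simp: mat_diag_def)
  then show "(mat_diag n d *\<^sub>v w) $ i = vec n (\<lambda>i. d i * w $ i) $ i" using i by simp
qed (simp add: mat_diag_def)

lemma mat_diag_quadratic: "w \<in> cv \<Longrightarrow> w \<bullet> (mat_diag n d *\<^sub>v w) = (\<Sum>i<n. d i * (w $ i)\<^sup>2)"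
  by (simp add: mat_diag_vec scalar_prod_sum power2_eq_square algebra_simps)

lemma mat_diag_spd:
  assumes "\<And>i. i < n \<Longrightarrow> 0 < d i"
  shows "mat_diag n d \<in> spd n"
  unfolding spd_def
proof (intro CollectI conjI ballI impI)
  fix v assume v: "v \<in> cv" "v \<noteq> 0\<^sub>v n"
  then obtain i where i: "i < n" "v $ i \<noteq> 0"
    by (metis carrier_vecD eq_vecI index_zero_vec)
  have "0 < (\<Sum>i<n. d i * (v $ i)\<^sup>2)"
    using i assms by (intro sum_pos2[of _ i]) (auto simp: less_imp_le)
  then show "0 < v \<bullet> (mat_diag n d *\<^sub>v v)" using v by (simp add: mat_diag_quadratic)
qed (rule sym_closed)

lemma det_mat_diag: "det (mat_diag n d :: real mat) = (\<Prod>i<n. d i)"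
proof -
  have "det (mat_diag n d) = prod_list (diag_mat (mat_diag n d))"
    by (rule det_upper_triangular[of _ n]) (auto simp: mat_diag_def)
  also have "\<dots> = (\<Prod>i<n. d i)"
    by (auto simp: prod_list_diag_prod mat_diag_def lessThan_atLeast0 intro!: prod.cong)
  finally show ?thesis .
qed

lemma inverse_cancel:
  assumes "P \<in> cm" "P' \<in> cm" "P * P' = 1\<^sub>m n"
  shows "X \<in> cm \<Longrightarrow> P * (P' * X) = X" "X \<in> cm \<Longrightarrow> P' * (P * X) = X"
    "x \<in> cv \<Longrightarrow> P *\<^sub>v (P' *\<^sub>v x) = x" "x \<in> cv \<Longrightarrow> P' *\<^sub>v (P *\<^sub>v x) = x"
proof -
  have 2: "P' * P = 1\<^sub>m n" using assms mat_mult_left_right_inverse[of P n P'] by simp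
  show "X \<in> cm \<Longrightarrow> P * (P' * X) = X" "X \<in> cm \<Longrightarrow> P' * (P * X) = X"
    using assms 2 by (simp_all add: mat_simps(1)[symmetric])
  show "x \<in> cv \<Longrightarrow> P *\<^sub>v (P' *\<^sub>v x) = x" "x \<in> cv \<Longrightarrow> P' *\<^sub>v (P *\<^sub>v x) = x"
    using assms 2 by (simp_all add: mat_vec_simps(7)[symmetric])
qed

section \<open>Functional calculus: inverse, determinant and square root\<close>

lemma spectral_calculus:
  assumes Q: "Q \<in> cm" "transpose_mat Q * Q = 1\<^sub>m n"
  shows "(Q * mat_diag n d * transpose_mat Q) * (Q * mat_diag n e * transpose_mat Q)
    = Q * mat_diag n (\<lambda>i. d i * e i) * transpose_mat Q"
proof -
  have "mat_diag n d * (mat_diag n e * transpose_mat Q) = mat_diag n (\<lambda>i. d i * e i) * transpose_mat Q"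
    using Q by (simp add: mat_simps(1)[symmetric])
  then show ?thesis using Q by (simp add: mat_simps inverse_cancel(1)[of "transpose_mat Q" Q])
qed

lemma spectral_one: "Q \<in> cm \<Longrightarrow> Q * transpose_mat Q = 1\<^sub>m n \<Longrightarrow> Q * mat_diag n (\<lambda>i. 1) * transpose_mat Q = 1\<^sub>m n"
  by (simp add: mat_simps)

lemma spectral_spd:
  assumes "Q \<in> cm" "Q * transpose_mat Q = 1\<^sub>m n" "\<And>i. i < n \<Longrightarrow> 0 < d i"
  shows "Q * mat_diag n d * transpose_mat Q \<in> spd n"
  using assms by (intro spd_cong_transform[of _ Q Q] mat_diag_spd) auto

lemma spd_spectral:
  assumes A: "A \<in> spd n"
  obtains Q d where "Q \<in> cm" "Q * transpose_mat Q = 1\<^sub>m n" "transpose_mat Q * Q = 1\<^sub>m n"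
    "\<And>i. i < n \<Longrightarrow> 0 < d i" "A = Q * mat_diag n d * transpose_mat Q"
proof -
  obtain Q d where Q: "Q \<in> cm" "Q * transpose_mat Q = 1\<^sub>m n" "transpose_mat Q * Q = 1\<^sub>m n"
    "A = Q * mat_diag n d * transpose_mat Q"
    using spectral_theorem[OF spdD(1)[OF A]] by blast
  have "0 < d i" if i: "i < n" for i
  proof -
    \<comment> \<open>The form of \<open>A\<close> at the eigenvector \<open>Q *\<^sub>v e\<close>
      is the eigenvalue \<open>d i\<close>.\<close>
    define e :: "real vec" where "e = unit_vec n i"
    have e: "e \<in> cv" "e \<noteq> 0\<^sub>v n" "\<And>j. j < n \<Longrightarrow> e $ j = (if j = i then 1 else 0)"
      unfolding e_def using unit_vec_nonzero[OF i] i by auto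
    have v: "transpose_mat Q *\<^sub>v (Q *\<^sub>v e) = e" using Q(1,2) e(1) by (simp add: inverse_cancel(4)[of Q])
    then have "Q *\<^sub>v e \<noteq> 0\<^sub>v n" using e(2) mat_vec_zero[of "transpose_mat Q"] Q(1) by auto
    then have "0 < (Q *\<^sub>v e) \<bullet> (A *\<^sub>v (Q *\<^sub>v e))" using spdD(4)[OF A] Q(1) e(1) by simp
    also have "\<dots> = e \<bullet> (mat_diag n d *\<^sub>v e)"
      unfolding Q(4) using Q(1) e(1) v by (simp add: mat_vec_simps dot_transpose)
    also have "\<dots> = (\<Sum>j<n. if j = i then d j else 0)"
      unfolding mat_diag_quadratic[OF e(1)] by (rule sum.cong) (auto simp: e(3))
    finally show ?thesis using i by simp
  qed
  with Q show ?thesis using that by blast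
qed

text \<open>\<open>minv\<close> unwraps an option, so \<open>mat_inverse\<close> must first be shown
  to succeed; this is why membership in the units of the matrix ring appears. Uniqueness of inverses
  does the rest.\<close>

lemma minv_eqI:
  assumes "A \<in> cm" "B \<in> cm" "A * B = 1\<^sub>m n"
  shows "minv A = B"
proof -
  have BA: "B * A = 1\<^sub>m n" using mat_mult_left_right_inverse assms by blast
  have "A \<in> Units (ring_mat TYPE(real) n ())"
    using assms BA by (auto simp: Units_def ring_mat_simps)
  then obtain C where C: "mat_inverse A = Some C"
    using mat_inverse(1)[OF assms(1)] by fastforce
  then have C': "A * C = 1\<^sub>m n" "C \<in> cm" using mat_inverse(2)[OF assms(1) C] by auto
  have "C = B * (A * C)" by (rule inverse_cancel(2)[OF assms C'(2), symmetric])
  also have "\<dots> = B" unfolding C'(1) using assms(2) by (simp add: mat_simps)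
  finally show ?thesis using C by (simp add: minv_def)
qed

lemma spd_minv:
  assumes A: "A \<in> spd n"
  shows "minv A \<in> spd n" "A * minv A = 1\<^sub>m n" "minv A * A = 1\<^sub>m n" "minv A \<in> cm"
proof -
  obtain Q d where Q: "Q \<in> cm" "Q * transpose_mat Q = 1\<^sub>m n" "transpose_mat Q * Q = 1\<^sub>m n"
    "\<And>i. i < n \<Longrightarrow> 0 < d i" "A = Q * mat_diag n d * transpose_mat Q"
    by (rule spd_spectral[OF A]) blast
  let ?B = "Q * mat_diag n (\<lambda>i. inverse (d i)) * transpose_mat Q"
  have B: "?B \<in> spd n" using Q by (intro spectral_spd) auto
  have "mat_diag n (\<lambda>i. d i * inverse (d i)) = mat_diag n (\<lambda>i. 1)"
    using Q(4) by (intro eq_matI) (auto simp: mat_diag_def less_imp_neq[symmetric])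
  then have "A * ?B = 1\<^sub>m n" unfolding Q(5) spectral_calculus[OF Q(1,3)] using Q spectral_one by simp
  moreover from this have "minv A = ?B" using A B spdD by (intro minv_eqI) auto
  ultimately show 1: "minv A \<in> spd n" "A * minv A = 1\<^sub>m n" using B by auto
  show 2: "minv A \<in> cm" using spdD(2)[OF 1(1)] .
  show "minv A * A = 1\<^sub>m n" by (rule mat_mult_left_right_inverse[OF spdD(2)[OF A] 2 1(2)])
qed

lemma det_spectral:
  assumes "Q \<in> cm" "Q * transpose_mat Q = 1\<^sub>m n"
  shows "det (Q * mat_diag n d * transpose_mat Q) = (\<Prod>i<n. d i)"
proof -
  have "det Q * det Q = 1"
    using det_mult[of Q n "transpose_mat Q"] assms by (simp add: Determinant.det_transpose[of Q n])
  then show ?thesis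
    using assms by (simp add: det_mult[of _ n] Determinant.det_transpose[of Q n] det_mat_diag algebra_simps)
qed

lemma spd_det_pos: "A \<in> spd n \<Longrightarrow> 0 < det A"
  using det_spectral by (metis spd_spectral prod_pos lessThan_iff)

text \<open>The diagonal entries of a congruence are the values of the form at the columns of
  \<open>X\<close>. Signs of traces thereby follow from signs of quadratic forms.\<close>

lemma tr_cong_sum:
  assumes "X \<in> cm" "A \<in> cm"
  shows "tr (transpose_mat X * A * X) = (\<Sum>j<n. (X *\<^sub>v unit_vec n j) \<bullet> (A *\<^sub>v (X *\<^sub>v unit_vec n j)))"
proof -
  have "(transpose_mat X * A * X) $$ (j, j) = (X *\<^sub>v unit_vec n j) \<bullet> (A *\<^sub>v (X *\<^sub>v unit_vec n j))" if "j < n" for j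
  proof -
    have "(transpose_mat X * A * X) $$ (j, j) = unit_vec n j \<bullet> ((transpose_mat X * A * X) *\<^sub>v unit_vec n j)"
      using that assms by (simp del: index_mult_mat)
    also have "\<dots> = (X *\<^sub>v unit_vec n j) \<bullet> (A *\<^sub>v (X *\<^sub>v unit_vec n j))"
      using assms by (simp only: mat_vec_simps closed unit_vec_carrier dot_transpose transpose_transpose)
    finally show ?thesis .
  qed
  then show ?thesis using assms by (simp add: tr_sum)
qed

lemma psd_tr_nonneg:
  assumes "X \<in> sym_mats n" "A \<in> psd n"
  shows "0 \<le> tr (X * A * X)"
  using tr_cong_sum[of X A] assms symD[OF assms(1)] by (auto simp: psd_def sym_mats_def intro!: sum_nonneg)

lemma spd_tr_zero:
  assumes X: "X \<in> sym_mats n" and A: "A \<in> spd n" and 0: "tr (X * A * X) = 0"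
  shows "X = 0\<^sub>m n n"
proof (rule mat_eq_by_action)
  note [simp] = symD[OF X] spdD(2)[OF A]
  have "(\<Sum>j<n. (X *\<^sub>v unit_vec n j) \<bullet> (A *\<^sub>v (X *\<^sub>v unit_vec n j))) = 0"
    using tr_cong_sum[of X A] 0 by simp
  then have "\<forall>j<n. (X *\<^sub>v unit_vec n j) \<bullet> (A *\<^sub>v (X *\<^sub>v unit_vec n j)) = 0"
    by (subst (asm) sum_nonneg_eq_0_iff) (auto simp: spdD(5)[OF A])
  then have z: "X *\<^sub>v unit_vec n j = 0\<^sub>v n" if "j < n" for j
    using spdD(4)[OF A, of "X *\<^sub>v unit_vec n j"] that by fastforce
  have z': "X $$ (i, j) = 0" if "i < n" "j < n" for i j
  proof -
    have "(X *\<^sub>v unit_vec n j) $ i = 0" using z that by simp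
    then show ?thesis using that by simp
  qed
  show "X *\<^sub>v x = 0\<^sub>m n n *\<^sub>v x" if "x \<in> cv" for x
    using that by (intro eq_vecI) (auto simp: mat_vec_index z' simp del: index_mult_mat_vec)
qed (use X in \<open>auto simp: symD\<close>)

text \<open>For \<open>X = R0 - R\<close> one has \<open>R0 * X + X * R = 0\<^sub>m n n\<close>.
  Tracing against \<open>X\<close> writes zero as a sum of two nonnegative terms, and the one with
  the definite \<open>R0\<close> forces \<open>X\<close> to vanish; the two roots are not assumed to
  commute. This identifies the \<open>THE\<close> in \<open>msqrt\<close>.\<close>

lemma psd_sqrt_unique:
  assumes R0: "R0 \<in> spd n" and R: "R \<in> psd n" and eq: "R0 * R0 = R * R"
  shows "R = R0"
proof -
  have Rs: "R \<in> sym_mats n" using R by (simp add: psd_def)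
  note [simp] = spdD(2)[OF R0] symD(1)[OF Rs]
  define X where "X = R0 - R"
  have X: "X \<in> sym_mats n" unfolding X_def using sym_closed(2) R0 Rs spdD by auto
  have [simp]: "X \<in> cm" using symD X by auto
  have "R0 * X + X * R = 0\<^sub>m n n"
  proof -
    have "R0 * X + X * R = (R0 * R0 - R0 * R) + (R0 * R - R * R)" unfolding X_def by (simp add: mat_simps)
    also have "\<dots> = R0 * R0 - R * R"
      by (rule eq_matI) (auto simp del: index_mult_mat)
    finally show ?thesis unfolding eq by simp
  qed
  then have "tr (X * (R0 * X + X * R)) = 0" by (simp add: tr_def)
  then have "tr (X * R0 * X) + tr (X * (X * R)) = 0" by (simp add: mat_simps tr_simps)
  moreover have "tr (X * (X * R)) = tr (X * R * X)" by (rule tr_comm) auto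
  ultimately have "tr (X * R0 * X) = 0"
    using psd_tr_nonneg[OF X R] psd_tr_nonneg[OF X spd_psd[OF R0]] by linarith
  then have X0: "X = 0\<^sub>m n n" using spd_tr_zero X R0 by blast
  show ?thesis
  proof (rule eq_matI)
    fix i j assume "i < dim_row R0" "j < dim_col R0"
    then have ij: "i < n" "j < n" by auto
    have "X $$ (i, j) = 0" using X0 ij by simp
    then show "R $$ (i, j) = R0 $$ (i, j)" using ij by (simp add: X_def)
  qed auto
qed

lemma spd_msqrt:
  assumes A: "A \<in> spd n"
  shows "msqrt A \<in> spd n" "msqrt A * msqrt A = A"
proof -
  obtain Q d where Q: "Q \<in> cm" "Q * transpose_mat Q = 1\<^sub>m n" "transpose_mat Q * Q = 1\<^sub>m n"
    "\<And>i. i < n \<Longrightarrow> 0 < d i" "A = Q * mat_diag n d * transpose_mat Q"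
    by (rule spd_spectral[OF A]) blast
  let ?R = "Q * mat_diag n (\<lambda>i. sqrt (d i)) * transpose_mat Q"
  have R: "?R \<in> spd n" using Q by (intro spectral_spd) auto
  have "mat_diag n (\<lambda>i. sqrt (d i) * sqrt (d i)) = mat_diag n d"
    using Q(4) by (intro eq_matI) (auto simp: mat_diag_def less_imp_le)
  then have RR: "?R * ?R = A" unfolding Q(5) spectral_calculus[OF Q(1,3)] by simp
  have "msqrt A = ?R"
    unfolding msqrt_def using psd_sqrt_unique[OF R] R spd_psd RR spdD(2)[OF A]
    by (intro the_equality) auto
  then show "msqrt A \<in> spd n" "msqrt A * msqrt A = A" using R RR by auto
qed

lemma spd_square:
  assumes R: "R \<in> spd n"
  shows "R * R \<in> spd n" "minv (R * R) = minv R * minv R"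
proof -
  note [simp] = spdD(2)[OF R] spd_minv[OF R]
  have "R * 1\<^sub>m n * transpose_mat R \<in> spd n"
    using mat_diag_spd[of "\<lambda>_. 1"] by (intro spd_cong_transform[of _ R "minv R"]) (simp_all add: spdD(3)[OF R])
  then show "R * R \<in> spd n" by (simp add: spdD(3)[OF R])
  show "minv (R * R) = minv R * minv R"
    by (intro minv_eqI) (simp_all add: mat_simps inverse_cancel[of R "minv R"])
qed

lemma root_quadratic: "R \<in> spd n \<Longrightarrow> v \<in> cv \<Longrightarrow> v \<bullet> (R * R *\<^sub>v v) = (vnorm (R *\<^sub>v v))\<^sup>2"
  by (simp add: vnorm_sq mat_vec_simps spdD(2) spdD(3) dot_transpose)

text \<open>A vector is recovered from its image under \<open>msqrt A\<close> at the cost of the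
  Frobenius norm of the inverse root. The added \<open>1\<close> keeps the constant well defined
  also when that norm is \<open>0\<close>, as in dimension zero.\<close>

lemma spd_coercive:
  assumes A: "A \<in> spd n"
  obtains c where "0 < c" "\<And>v. v \<in> cv \<Longrightarrow> c * (v \<bullet> v) \<le> v \<bullet> (A *\<^sub>v v)"
proof -
  let ?R = "msqrt A" and ?f = "fnorm (minv (msqrt A))"
  note R = spd_msqrt[OF A]
  note [simp] = spdD(2)[OF R(1)] spd_minv[OF R(1)]
  have "v \<bullet> v \<le> (1 + ?f\<^sup>2) * (v \<bullet> (A *\<^sub>v v))" if v: "v \<in> cv" for v
  proof -
    have "vnorm v = vnorm (minv ?R *\<^sub>v (?R *\<^sub>v v))" using v by (simp add: inverse_cancel)
    also have "\<dots> \<le> ?f * vnorm (?R *\<^sub>v v)" using v by (intro vnorm_mat_vec_le) auto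
    finally have "(vnorm v)\<^sup>2 \<le> (?f * vnorm (?R *\<^sub>v v))\<^sup>2" by (rule power_mono) simp
    also have "\<dots> = ?f\<^sup>2 * (v \<bullet> (A *\<^sub>v v))"
      using root_quadratic[OF R(1) v] R(2) by (simp add: power_mult_distrib)
    also have "\<dots> \<le> (1 + ?f\<^sup>2) * (v \<bullet> (A *\<^sub>v v))"
      using spdD(5)[OF A v] by (intro mult_right_mono) auto
    finally show ?thesis by (simp add: vnorm_sq)
  qed
  moreover have "0 < 1 + ?f\<^sup>2" by (simp add: add_pos_nonneg)
  ultimately show ?thesis using that[of "1 / (1 + ?f\<^sup>2)"] by (simp add: field_simps)
qed

text \<open>The difference \<open>Z\<close> of two solutions satisfies
  \<open>L * Z + Z * L = 0\<^sub>m n n\<close>, and tracing against \<open>Z\<close> gives twice the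
  definite expression \<open>tr (Z * L * Z)\<close>. Uniqueness is what gives the \<open>THE\<close>
  in \<open>lyap\<close> its value.\<close>

lemma lyap_eqI:
  assumes L: "L \<in> spd n" and X: "X \<in> sym_mats n" and U: "L * X + X * L = U"
  shows "lyap L U = X"
  unfolding lyap_def
proof (rule the_equality)
  show "X \<in> sym_mats (dim_row L) \<and> L * X + X * L = U" using assms spdD(2)[OF L] by simp
  fix Y assume "Y \<in> sym_mats (dim_row L) \<and> L * Y + Y * L = U"
  then have Y: "Y \<in> sym_mats n" "L * Y + Y * L = U" using spdD(2)[OF L] by auto
  note [simp] = spdD(2)[OF L] symD(1)[OF X] symD(1)[OF Y(1)]
  define Z where "Z = Y - X"
  have Z: "Z \<in> sym_mats n" unfolding Z_def using sym_closed(2) X Y by auto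
  have [simp]: "Z \<in> cm" using symD Z by auto
  have "L * Z + Z * L = (L * Y + Y * L) - (L * X + X * L)"
    unfolding Z_def by (simp add: mat_simps) (rule eq_matI, auto simp del: index_mult_mat)
  also have "\<dots> = 0\<^sub>m n n" unfolding U Y(2) using U[symmetric] by simp
  finally have "tr (Z * (L * Z + Z * L)) = 0" by (simp add: tr_def)
  then have "tr (Z * L * Z) + tr (Z * (Z * L)) = 0" by (simp add: mat_simps tr_simps)
  moreover have "tr (Z * (Z * L)) = tr (Z * L * Z)" by (rule tr_comm) auto
  ultimately have "tr (Z * L * Z) = 0" by linarith
  then have Z0: "Z = 0\<^sub>m n n" using spd_tr_zero Z L by blast
  show "Y = X"
  proof (rule eq_matI)
    fix i j assume "i < dim_row X" "j < dim_col X"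
    then have ij: "i < n" "j < n" by auto
    have "Z $$ (i, j) = 0" using Z0 ij by simp
    then show "Y $$ (i, j) = X $$ (i, j)" using ij by (simp add: Z_def)
  qed auto
qed

text \<open>In an eigenbasis of \<open>L\<close> the equation decouples entrywise and is solved by
  dividing by \<open>d i + d j\<close>, which is positive.\<close>

lemma lyap_solves:
  assumes L: "L \<in> spd n" and U: "U \<in> sym_mats n"
  shows "lyap L U \<in> sym_mats n" "L * lyap L U + lyap L U * L = U"
proof -
  obtain Q d where Q: "Q \<in> cm" "Q * transpose_mat Q = 1\<^sub>m n" "transpose_mat Q * Q = 1\<^sub>m n"
    "\<And>i. i < n \<Longrightarrow> 0 < d i" "L = Q * mat_diag n d * transpose_mat Q"
    by (rule spd_spectral[OF L]) blast
  note [simp] = Q(1) symD(1)[OF U]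
  define M where "M = transpose_mat Q * U * Q"
  have M: "M \<in> sym_mats n" unfolding M_def using sym_closed(4)[OF U, of "transpose_mat Q"] by simp
  have [simp]: "M \<in> cm" using symD M by auto
  have Msym: "M $$ (i, j) = M $$ (j, i)" if "i < n" "j < n" for i j
    using symD(2)[OF M] index_transpose_mat(1)[of j M i] that by auto
  define Y where "Y = mat n n (\<lambda>(i, j). M $$ (i, j) / (d i + d j))"
  have Y: "Y \<in> sym_mats n" unfolding Y_def sym_mats_def using Msym by (auto simp: add.commute)
  have [simp]: "Y \<in> cm" using symD Y by auto
  have DY: "mat_diag n d * Y + Y * mat_diag n d = M"
  proof (rule eq_matI)
    fix i j assume "i < dim_row M" "j < dim_col M"
    then have ij: "i < n" "j < n" by auto
    then have "d i + d j \<noteq> 0" using Q(4) by (metis add_pos_pos less_irrefl)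
    then have "d i * (M $$ (i, j) / (d i + d j)) + M $$ (i, j) / (d i + d j) * d j = M $$ (i, j)"
      by (metis mult.commute distrib_left nonzero_eq_divide_eq)
    then show "(mat_diag n d * Y + Y * mat_diag n d) $$ (i, j) = M $$ (i, j)"
      using ij by (simp add: mat_diag_mult_left[of _ n n] mat_diag_mult_right[of _ n n] Y_def)
  qed (simp_all add: mat_diag_def)
  define X where "X = Q * Y * transpose_mat Q"
  have X: "X \<in> sym_mats n" unfolding X_def using sym_closed(4)[OF Y] by simp
  have "L * X + X * L = Q * (mat_diag n d * Y + Y * mat_diag n d) * transpose_mat Q"
    unfolding X_def Q(5) using Q(2,3)
    by (simp add: mat_simps inverse_cancel(1)[of "transpose_mat Q" Q])
  also have "\<dots> = U" unfolding DY M_def using Q(2)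
    by (simp add: mat_simps inverse_cancel(1)[of Q "transpose_mat Q"])
  finally have "L * X + X * L = U" .
  moreover from this have "lyap L U = X" by (rule lyap_eqI[OF L X])
  ultimately show "lyap L U \<in> sym_mats n" "L * lyap L U + lyap L U * L = U" using X by auto
qed

end

section \<open>Gaussian integrals\<close>

text \<open>Integrals are transported by \<open>embed_measure\<close> along injective maps only.
  \<open>vec n\<close> forgets the values at indices from \<open>n\<close> on, but on the product
  space these are all \<open>undefined\<close>.\<close>

lemma inj_on_vec: "inj_on (vec n) (space (Pi\<^sub>M {..<n} (\<lambda>_. lborel :: real measure)))"
proof (rule inj_onI)
  fix x y :: "nat \<Rightarrow> real"
  assume "x \<in> space (Pi\<^sub>M {..<n} (\<lambda>_. lborel))" "y \<in> space (Pi\<^sub>M {..<n} (\<lambda>_. lborel))"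
    and eq: "vec n x = vec n y"
  then have "x \<in> extensional {..<n}" "y \<in> extensional {..<n}" by (auto simp: space_PiM PiE_def)
  moreover have "x i = y i" if "i \<in> {..<n}" for i using arg_cong[OF eq, of "\<lambda>v. v $ i"] that by simp
  ultimately show "x = y" by (rule extensionalityI)
qed

lemma space_lborel_vec: "z \<in> space (lborel_vec n) \<Longrightarrow> z \<in> carrier_vec n"
  by (auto simp: lborel_vec_def space_embed_measure)

lemma nn_integral_lborel_vec:
  "g \<in> borel_measurable (lborel_vec n) \<Longrightarrow>
    (\<integral>\<^sup>+z. g z \<partial>lborel_vec n) = (\<integral>\<^sup>+x. g (vec n x) \<partial>Pi\<^sub>M {..<n} (\<lambda>_. lborel))"
  unfolding lborel_vec_def by (rule nn_integral_embed_measure'[OF inj_on_vec])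

lemma measurable_lborel_vec_index:
  assumes "i < n"
  shows "(\<lambda>z. z $ i) \<in> borel_measurable (lborel_vec n)"
proof -
  have "(\<lambda>x. x i) \<in> measurable (Pi\<^sub>M {..<n} (\<lambda>_. lborel :: real measure)) lborel"
    using assms by (intro measurable_component_singleton) auto
  then show ?thesis
    unfolding lborel_vec_def using assms by (intro measurable_embed_measure1) simp
qed

context fixed_dim
begin

text \<open>Measurability of a vector-valued map is expressed by its real coordinates. The sum
  formula for the scalar product holds on the carrier, hence the congruence over the space of
  \<open>M\<close>.\<close>

lemma measurable_dot:
  assumes "\<And>z. z \<in> space M \<Longrightarrow> g z \<in> cv"
    and "\<And>i. i < n \<Longrightarrow> (\<lambda>z. f z $ i) \<in> borel_measurable M" "\<And>i. i < n \<Longrightarrow> (\<lambda>z. g z $ i) \<in> borel_measurable M"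
  shows "(\<lambda>z. f z \<bullet> g z) \<in> borel_measurable M"
proof -
  have "(\<lambda>z. \<Sum>i<n. f z $ i * g z $ i) \<in> borel_measurable M"
    using assms by (intro borel_measurable_sum borel_measurable_times) auto
  then show ?thesis by (rule measurable_cong[THEN iffD1, rotated]) (simp add: scalar_prod_sum assms)
qed

lemma measurable_mat_vec:
  assumes "A \<in> cm" "\<And>z. z \<in> space M \<Longrightarrow> f z \<in> cv" "\<And>i. i < n \<Longrightarrow> (\<lambda>z. f z $ i) \<in> borel_measurable M"
    and i: "i < n"
  shows "(\<lambda>z. (A *\<^sub>v f z) $ i) \<in> borel_measurable M"
proof -
  have "(\<lambda>z. \<Sum>j<n. A $$ (i, j) * f z $ j) \<in> borel_measurable M"
    using assms by (intro borel_measurable_sum borel_measurable_times) auto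
  then show ?thesis
    by (rule measurable_cong[THEN iffD1, rotated]) (use assms mat_vec_index in metis)
qed

lemma measurable_shifted:
  assumes "m \<in> cv" "i < n"
  shows "(\<lambda>z. (z - m) $ i) \<in> borel_measurable (lborel_vec n)"
proof -
  have "(\<lambda>z. z $ i - m $ i) \<in> borel_measurable (lborel_vec n)"
    using measurable_lborel_vec_index[OF assms(2)] by simp
  then show ?thesis
    by (rule measurable_cong[THEN iffD1, rotated]) (use assms space_lborel_vec in auto)
qed

lemma measurable_quadratic:
  assumes "A \<in> cm" "m \<in> cv"
  shows "(\<lambda>z. (z - m) \<bullet> (A *\<^sub>v (z - m))) \<in> borel_measurable (lborel_vec n)"
  using assms space_lborel_vec
  by (intro measurable_dot measurable_mat_vec measurable_shifted) (auto simp del: index_mult_mat_vec)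

lemma quadratic_sum:
  "A \<in> cm \<Longrightarrow> x \<in> cv \<Longrightarrow> x \<bullet> (A *\<^sub>v x) = (\<Sum>i<n. \<Sum>j<n. A $$ (i, j) * x $ i * x $ j)"
  by (simp add: scalar_prod_sum mat_vec_index sum_distrib_left algebra_simps del: index_mult_mat_vec)

end

text \<open>Completing the square in the last variable leaves the form of the Schur complement of
  the last diagonal entry, one dimension lower. This drives the induction for Gaussian
  integrals.\<close>

lemma complete_square_last:
  fixes A :: "nat \<Rightarrow> nat \<Rightarrow> real" and v :: "nat \<Rightarrow> real"
  assumes sym: "\<And>i. i < n \<Longrightarrow> A i n = A n i" and c: "A n n \<noteq> 0"
  shows "(\<Sum>i<Suc n. \<Sum>j<Suc n. A i j * v i * v j)
    = A n n * (v n + (\<Sum>i<n. A n i * v i) / A n n)\<^sup>2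
      + (\<Sum>i<n. \<Sum>j<n. (A i j - A i n * A n j / A n n) * v i * v j)"
proof -
  define b where "b = (\<Sum>i<n. A n i * v i)"
  have "(\<Sum>i<n. A i n * v i * v n) = b * v n"
    unfolding b_def sum_distrib_right by (rule sum.cong) (auto simp: sym)
  moreover have "(\<Sum>j<n. A n j * v n * v j) = b * v n"
    unfolding b_def sum_distrib_right by (rule sum.cong) auto
  ultimately have L: "(\<Sum>i<Suc n. \<Sum>j<Suc n. A i j * v i * v j)
    = (\<Sum>i<n. \<Sum>j<n. A i j * v i * v j) + 2 * b * v n + A n n * v n * v n"
    by (simp add: sum.distrib)
  have "(\<Sum>i<n. \<Sum>j<n. A i n * A n j / A n n * v i * v j) = (\<Sum>i<n. \<Sum>j<n. (A n i * v i) * (A n j * v j)) / A n n"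
    unfolding sum_divide_distrib by (intro sum.cong refl) (simp add: sym)
  also have "\<dots> = b * b / A n n" unfolding b_def sum_product by simp
  finally have "(\<Sum>i<n. \<Sum>j<n. (A i j - A i n * A n j / A n n) * v i * v j)
    = (\<Sum>i<n. \<Sum>j<n. A i j * v i * v j) - b * b / A n n"
    by (simp add: left_diff_distrib sum_subtractf)
  note R = this
  define p where "p = (\<Sum>i<n. \<Sum>j<n. A i j * v i * v j)"
  show ?thesis unfolding L R b_def[symmetric] p_def[symmetric] using c
    by (simp add: power2_eq_square field_simps)
qed

lemma nn_integral_gaussian_line:
  fixes c m :: real
  assumes "0 < c"
  shows "(\<integral>\<^sup>+y. ennreal (exp (- (c * (y - m)\<^sup>2) / 2)) \<partial>lborel) = ennreal (sqrt (2 * pi / c))"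
proof -
  define \<sigma> where "\<sigma> = 1 / sqrt c"
  have \<sigma>: "0 < \<sigma>" "\<sigma>\<^sup>2 = 1 / c" using assms by (auto simp: \<sigma>_def power_divide)
  have "exp (- (c * (y - m)\<^sup>2) / 2) = sqrt (2 * pi / c) * normal_density m \<sigma> y" for y
    unfolding normal_density_def \<sigma>(2) using assms by (simp add: field_simps)
  then have "(\<integral>\<^sup>+y. ennreal (exp (- (c * (y - m)\<^sup>2) / 2)) \<partial>lborel)
    = (\<integral>\<^sup>+y. ennreal (sqrt (2 * pi / c) * normal_density m \<sigma> y) \<partial>lborel)" by simp
  also have "\<dots> = ennreal (\<integral>y. sqrt (2 * pi / c) * normal_density m \<sigma> y \<partial>lborel)"
    using assms \<sigma> by (intro nn_integral_eq_integral) auto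
  finally show ?thesis using \<sigma> by simp
qed

text \<open>The form of \<open>S\<close> at \<open>v\<close> is that of \<open>A\<close> at
  \<open>v\<close> extended by the last coordinate that annihilates the completed square; this gives
  positivity. The determinant formula is one block elimination.\<close>

lemma Schur_complement:
  assumes A: "A \<in> spd (Suc n)"
  defines "S \<equiv> mat n n (\<lambda>(i, j). A $$ (i, j) - A $$ (i, n) * A $$ (n, j) / A $$ (n, n))"
  shows "0 < A $$ (n, n)" "S \<in> spd n" "det A = A $$ (n, n) * det S"
proof -
  interpret N: fixed_dim "Suc n" .
  interpret fixed_dim n .
  have Ac: "A \<in> carrier_mat (Suc n) (Suc n)" using N.spdD(2)[OF A] .
  have Sc: "S \<in> cm" by (simp add: S_def)
  have sym: "A $$ (i, j) = A $$ (j, i)" if "i < Suc n" "j < Suc n" for i j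
    using arg_cong[OF N.spdD(3)[OF A], of "\<lambda>B. B $$ (i, j)"] that Ac by auto
  have "unit_vec (Suc n) n \<noteq> (0\<^sub>v (Suc n) :: real vec)" by simp
  then have "0 < unit_vec (Suc n) n \<bullet> (A *\<^sub>v unit_vec (Suc n) n)"
    by (rule N.spdD(4)[OF A unit_vec_carrier])
  also have "\<dots> = A $$ (n, n)" using Ac by simp
  finally show c: "0 < A $$ (n, n)" .
  show "S \<in> spd n"
    unfolding spd_def
  proof (intro CollectI conjI ballI impI)
    show "S \<in> sym_mats n"
    proof -
      have "S $$ (j, i) = S $$ (i, j)" if "i < n" "j < n" for i j
      proof -
        have "A $$ (j, i) = A $$ (i, j)" "A $$ (j, n) = A $$ (n, j)" "A $$ (n, i) = A $$ (i, n)"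
          by (rule sym; use that in simp)+
        moreover have "S $$ (j, i) = A $$ (j, i) - A $$ (j, n) * A $$ (n, i) / A $$ (n, n)"
          "S $$ (i, j) = A $$ (i, j) - A $$ (i, n) * A $$ (n, j) / A $$ (n, n)"
          using that by (simp_all add: S_def)
        ultimately show ?thesis by (simp only: mult.commute)
      qed
      then have "transpose_mat S = S" using Sc by (intro eq_matI) auto
      then show ?thesis unfolding sym_mats_def using Sc by blast
    qed
    fix v assume v: "v \<in> cv" "v \<noteq> 0\<^sub>v n"
    define u where "u = vec (Suc n) (\<lambda>i. if i < n then v $ i else - (\<Sum>i<n. A $$ (n, i) * v $ i) / A $$ (n, n))"
    have u: "u \<in> carrier_vec (Suc n)" by (simp add: u_def)
    obtain i where "i < n" "v $ i \<noteq> 0" using v by (metis carrier_vecD eq_vecI index_zero_vec)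
    then have "u $ i \<noteq> 0" "i < Suc n" by (auto simp: u_def)
    then have u0: "u \<noteq> 0\<^sub>v (Suc n)" by auto
    have un: "u $ i = v $ i" if "i < n" for i using that by (simp add: u_def)
    have ul: "u $ n + (\<Sum>i<n. A $$ (n, i) * u $ i) / A $$ (n, n) = 0"
      by (simp add: un) (simp add: u_def)
    have "0 < u \<bullet> (A *\<^sub>v u)" by (rule N.spdD(4)[OF A u u0])
    also have "\<dots> = (\<Sum>i<n. \<Sum>j<n. (A $$ (i, j) - A $$ (i, n) * A $$ (n, j) / A $$ (n, n)) * u $ i * u $ j)"
      unfolding N.quadratic_sum[OF Ac u]
      by (subst complete_square_last[of n "\<lambda>i j. A $$ (i, j)"]) (use sym c ul in \<open>auto simp: \<close>)
    also have "\<dots> = v \<bullet> (S *\<^sub>v v)"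
      unfolding quadratic_sum[OF Sc v(1)] by (intro sum.cong refl) (simp add: un S_def)
    finally show "0 < v \<bullet> (S *\<^sub>v v)" .
  qed
  \<comment> \<open>\<open>E\<close> clears the last column above the pivot, so that
    \<open>E * A\<close> is block lower triangular, and it has determinant \<open>1\<close>.\<close>
  define E where "E = four_block_mat (1\<^sub>m n) (mat n 1 (\<lambda>(i, _). - A $$ (i, n) / A $$ (n, n))) (0\<^sub>m 1 n) (1\<^sub>m 1)"
  let ?B = "mat n n (\<lambda>(i, j). A $$ (i, j))" and ?b = "mat n 1 (\<lambda>(i, j). A $$ (i, n))"
    and ?r = "mat 1 n (\<lambda>(i, j). A $$ (n, j))" and ?d = "mat 1 1 (\<lambda>(i, j). A $$ (n, n))"
  have Ab: "A = four_block_mat ?B ?b ?r ?d"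
    using Ac by (intro eq_matI) (auto simp: less_Suc_eq)
  have detE: "det E = 1"
    unfolding E_def by (subst det_four_block_mat_lower_left_zero[of _ n _ 1]) auto
  have Ec: "E \<in> carrier_mat (Suc n) (Suc n)"
    unfolding E_def using four_block_carrier_mat[of "1\<^sub>m n" n n "1\<^sub>m 1" 1 1] by simp
  have "E * A = four_block_mat S (0\<^sub>m n 1) ?r ?d"
    unfolding E_def by (subst Ab, subst mult_four_block_mat[of _ n n _ 1 _ 1 _ _ n _ 1])
      (use c in \<open>auto intro!: cong_four_block_mat eq_matI simp: S_def scalar_prod_def\<close>)
  then have "det (E * A) = det S * det ?d"
    using Sc by (simp only:) (subst det_four_block_mat_upper_right_zero[of _ n _ 1], auto)
  also have "det ?d = A $$ (n, n)" by (subst det_single) auto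
  finally show "det A = A $$ (n, n) * det S" using det_mult[OF Ec Ac] detE by simp
qed

text \<open>Fubini in the last coordinate: with the others fixed, the inner integral is a
  one-dimensional Gaussian whose centre \<open>m $ n - \<beta> x\<close> depends on them but whose
  value does not. What remains is the Gaussian of the Schur complement.\<close>

lemma gaussian_integral_PiM:
  assumes "A \<in> spd n" "m \<in> carrier_vec n"
  shows "(\<integral>\<^sup>+x. ennreal (exp (- ((vec n x - m) \<bullet> (A *\<^sub>v (vec n x - m))) / 2)) \<partial>Pi\<^sub>M {..<n} (\<lambda>_. lborel))
    = ennreal (sqrt ((2 * pi) ^ n / det A))"
  using assms
proof (induction n arbitrary: A m)
  case 0
  then have "A \<in> carrier_mat 0 0" by (auto simp: spd_def sym_mats_def)
  then have "det A = 1" by simp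
  then show ?case using 0 by (simp add: space_PiM scalar_prod_def)
next
  case (Suc n)
  interpret N: fixed_dim "Suc n" .
  interpret fixed_dim n .
  interpret product_sigma_finite "\<lambda>_ :: nat. lborel :: real measure" ..
  let ?c = "A $$ (n, n)"
  define S where "S = mat n n (\<lambda>(i, j). A $$ (i, j) - A $$ (i, n) * A $$ (n, j) / ?c)"
  note Schur = Schur_complement[OF Suc.prems(1), folded S_def]
  have Ac: "A \<in> carrier_mat (Suc n) (Suc n)" using N.spdD(2)[OF Suc.prems(1)] .
  have Sc: "S \<in> cm" by (simp add: S_def)
  have sym: "A $$ (i, j) = A $$ (j, i)" if "i < Suc n" "j < Suc n" for i j
    using arg_cong[OF N.spdD(3)[OF Suc.prems(1)], of "\<lambda>B. B $$ (i, j)"] that Ac by auto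
  define m' where "m' = vec n (\<lambda>i. m $ i)"
  have m': "m' \<in> cv" by (simp add: m'_def)
  define q where "q x = (vec n x - m') \<bullet> (S *\<^sub>v (vec n x - m'))" for x
  define \<beta> where "\<beta> x = (\<Sum>i<n. A $$ (n, i) * (x i - m $ i)) / ?c" for x :: "nat \<Rightarrow> real"
  have split: "(vec (Suc n) (x(n := y)) - m) \<bullet> (A *\<^sub>v (vec (Suc n) (x(n := y)) - m))
      = ?c * (y - (m $ n - \<beta> x))\<^sup>2 + q x" for x y
  proof -
    let ?v = "vec (Suc n) (x(n := y)) - m" and ?w = "vec n x - m'"
    have v: "?v \<in> carrier_vec (Suc n)" "?w \<in> cv" using Suc.prems m' by auto
    have vi: "?v $ i = x i - m $ i" "?w $ i = x i - m $ i" if "i < n" for i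
      using that Suc.prems by (auto simp: m'_def)
    have vn: "?v $ n = y - m $ n" using Suc.prems by simp
    have "?v \<bullet> (A *\<^sub>v ?v) = ?c * (?v $ n + (\<Sum>i<n. A $$ (n, i) * ?v $ i) / ?c)\<^sup>2
      + (\<Sum>i<n. \<Sum>j<n. (A $$ (i, j) - A $$ (i, n) * A $$ (n, j) / ?c) * ?v $ i * ?v $ j)"
      unfolding N.quadratic_sum[OF Ac v(1)]
      by (rule complete_square_last[of n "\<lambda>i j. A $$ (i, j)"]) (use sym Schur(1) in auto)
    also have "(\<Sum>i<n. \<Sum>j<n. (A $$ (i, j) - A $$ (i, n) * A $$ (n, j) / ?c) * ?v $ i * ?v $ j) = q x"
      unfolding q_def quadratic_sum[OF Sc v(2)] by (intro sum.cong refl) (simp add: vi S_def del: index_minus_vec)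
    also have "(\<Sum>i<n. A $$ (n, i) * ?v $ i) / ?c = \<beta> x"
      unfolding \<beta>_def by (intro arg_cong2[where f = "(/)"] sum.cong refl) (simp add: vi del: index_minus_vec)
    finally have "?v \<bullet> (A *\<^sub>v ?v) = ?c * (?v $ n + \<beta> x)\<^sup>2 + q x" .
    moreover have "?v $ n + \<beta> x = y - (m $ n - \<beta> x)" unfolding vn by simp
    ultimately show ?thesis by (simp only:)
  qed
  have meas: "(\<lambda>x. ennreal (exp (- ((vec k x - a) \<bullet> (B *\<^sub>v (vec k x - a))) / 2)))
      \<in> borel_measurable (Pi\<^sub>M {..<k} (\<lambda>_. lborel))" if "B \<in> carrier_mat k k" "a \<in> carrier_vec k" for k B a
  proof -
    have "vec k \<in> measurable (Pi\<^sub>M {..<k} (\<lambda>_. lborel)) (lborel_vec k)"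
      unfolding lborel_vec_def by (rule measurable_embed_measure2'[OF inj_on_vec])
    from measurable_compose[OF this fixed_dim.measurable_quadratic[OF that]]
    show ?thesis by simp
  qed
  have "(\<integral>\<^sup>+x. ennreal (exp (- ((vec (Suc n) x - m) \<bullet> (A *\<^sub>v (vec (Suc n) x - m))) / 2)) \<partial>Pi\<^sub>M {..<Suc n} (\<lambda>_. lborel))
    = (\<integral>\<^sup>+x. (\<integral>\<^sup>+y. ennreal (exp (- (?c * (y - (m $ n - \<beta> x))\<^sup>2 + q x) / 2)) \<partial>lborel) \<partial>Pi\<^sub>M {..<n} (\<lambda>_. lborel))"
    unfolding lessThan_Suc split[symmetric]
    using meas[OF Ac Suc.prems(2)] by (intro product_nn_integral_insert) (auto simp: lessThan_Suc)
  also have "\<dots> = (\<integral>\<^sup>+x. ennreal (exp (- q x / 2)) * ennreal (sqrt (2 * pi / ?c)) \<partial>Pi\<^sub>M {..<n} (\<lambda>_. lborel))"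
  proof (rule nn_integral_cong)
    fix x
    have "(\<integral>\<^sup>+y. ennreal (exp (- (?c * (y - (m $ n - \<beta> x))\<^sup>2 + q x) / 2)) \<partial>lborel)
      = (\<integral>\<^sup>+y. ennreal (exp (- q x / 2)) * ennreal (exp (- (?c * (y - (m $ n - \<beta> x))\<^sup>2) / 2)) \<partial>lborel)"
      by (intro nn_integral_cong) (simp add: ennreal_mult[symmetric] exp_add[symmetric] field_simps)
    also have "\<dots> = ennreal (exp (- q x / 2)) * ennreal (sqrt (2 * pi / ?c))"
      by (subst nn_integral_cmult) (simp, simp only: nn_integral_gaussian_line[OF Schur(1)])
    finally show "(\<integral>\<^sup>+y. ennreal (exp (- (?c * (y - (m $ n - \<beta> x))\<^sup>2 + q x) / 2)) \<partial>lborel)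
      = ennreal (exp (- q x / 2)) * ennreal (sqrt (2 * pi / ?c))" .
  qed
  also have "\<dots> = (\<integral>\<^sup>+x. ennreal (exp (- q x / 2)) \<partial>Pi\<^sub>M {..<n} (\<lambda>_. lborel)) * ennreal (sqrt (2 * pi / ?c))"
    unfolding q_def by (rule nn_integral_multc[OF meas[OF Sc m']])
  also have "(\<integral>\<^sup>+x. ennreal (exp (- q x / 2)) \<partial>Pi\<^sub>M {..<n} (\<lambda>_. lborel)) = ennreal (sqrt ((2 * pi) ^ n / det S))"
    unfolding q_def by (rule Suc.IH[OF Schur(2) m'])
  also have "ennreal (sqrt ((2 * pi) ^ n / det S)) * ennreal (sqrt (2 * pi / ?c)) = ennreal (sqrt ((2 * pi) ^ Suc n / det A))"
    using spd_det_pos[OF Schur(2)] Schur(1)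
    by (simp add: Schur(3) ennreal_mult[symmetric] real_sqrt_mult[symmetric] algebra_simps)
  finally show ?case .
qed

theorem gaussian_integral:
  assumes "A \<in> spd n" "m \<in> carrier_vec n"
  shows "(\<integral>\<^sup>+z. ennreal (exp (- ((z - m) \<bullet> (A *\<^sub>v (z - m))) / 2)) \<partial>lborel_vec n)
    = ennreal (sqrt ((2 * pi) ^ n / det A))"
proof -
  interpret fixed_dim n .
  have "(\<lambda>z. ennreal (exp (- ((z - m) \<bullet> (A *\<^sub>v (z - m))) / 2))) \<in> borel_measurable (lborel_vec n)"
    using measurable_quadratic[OF spdD(2)[OF assms(1)] assms(2)] by simp
  from nn_integral_lborel_vec[OF this] show ?thesis
    unfolding gaussian_integral_PiM[OF assms] .
qed

section \<open>Hoelder's inequality and changes of Gaussian weights\<close>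

text \<open>Young's inequality yields integrability of the product and, applied to normalised
  functions, the estimate. Normalisation fails only if one of the power integrals vanishes, and then
  the product is zero almost everywhere.\<close>

lemma Hoelder_integral:
  fixes f g :: "'a \<Rightarrow> real"
  assumes ps: "1 < p" "1 < s" "1 / p + 1 / s = 1"
    and meas: "f \<in> borel_measurable M" "g \<in> borel_measurable M"
    and nonneg: "\<And>x. x \<in> space M \<Longrightarrow> 0 \<le> f x" "\<And>x. x \<in> space M \<Longrightarrow> 0 \<le> g x"
    and int: "integrable M (\<lambda>x. f x powr p)" "integrable M (\<lambda>x. g x powr s)"
  shows "integrable M (\<lambda>x. f x * g x)"
    "(\<integral>x. f x * g x \<partial>M) \<le> (\<integral>x. f x powr p \<partial>M) powr (1 / p) * (\<integral>x. g x powr s \<partial>M) powr (1 / s)"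
proof -
  let ?A = "\<integral>x. f x powr p \<partial>M" and ?B = "\<integral>x. g x powr s \<partial>M"
  show int_fg: "integrable M (\<lambda>x. f x * g x)"
  proof (rule Bochner_Integration.integrable_bound)
    show "integrable M (\<lambda>x. f x powr p / p + g x powr s / s)" using int by simp
    show "AE x in M. norm (f x * g x) \<le> norm (f x powr p / p + g x powr s / s)"
    proof (rule AE_I2)
      fix x assume "x \<in> space M"
      then have "f x * g x \<le> f x powr p / p + g x powr s / s" "0 \<le> f x * g x"
        using Youngs_inequality[OF ps] nonneg by auto
      then show "norm (f x * g x) \<le> norm (f x powr p / p + g x powr s / s)" by simp
    qed
  qed (use meas in simp)
  have zero: "(\<integral>x. f x * g x \<partial>M) = 0" if "AE x in M. f x * g x = 0"
    using that by (subst integral_cong_AE[where g = "\<lambda>_. 0"]) (use meas in auto)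
  have A: "0 \<le> ?A" "0 \<le> ?B" by simp_all
  consider "?A = 0" | "?B = 0" | "0 < ?A" "0 < ?B" using A by linarith
  then show "(\<integral>x. f x * g x \<partial>M) \<le> ?A powr (1 / p) * ?B powr (1 / s)"
  proof cases
    case 1
    then have "AE x in M. f x powr p = 0" using int by (subst (asm) integral_nonneg_eq_0_iff_AE) auto
    then have "AE x in M. f x * g x = 0" by eventually_elim auto
    then show ?thesis using zero by simp
  next
    case 2
    then have "AE x in M. g x powr s = 0" using int by (subst (asm) integral_nonneg_eq_0_iff_AE) auto
    then have "AE x in M. f x * g x = 0" by eventually_elim auto
    then show ?thesis using zero by simp
  next
    case 3
    let ?a = "?A powr (1 / p)" and ?b = "?B powr (1 / s)"
    have ab: "0 < ?a" "0 < ?b" "?a powr p = ?A" "?b powr s = ?B" using 3 ps by (auto simp: powr_powr)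
    have "(\<integral>x. f x * g x / (?a * ?b) \<partial>M) \<le> (\<integral>x. f x powr p / (?A * p) + g x powr s / (?B * s) \<partial>M)"
    proof (rule integral_mono)
      fix x assume x: "x \<in> space M"
      have "(f x / ?a) * (g x / ?b) \<le> (f x / ?a) powr p / p + (g x / ?b) powr s / s"
        by (rule Youngs_inequality[OF ps]) (use nonneg[OF x] ab in simp_all)
      then show "f x * g x / (?a * ?b) \<le> f x powr p / (?A * p) + g x powr s / (?B * s)"
        using nonneg[OF x] ab by (simp add: powr_divide)
    qed (use int int_fg in simp_all)
    also have "\<dots> = 1 / p + 1 / s"
      using int 3 by (subst Bochner_Integration.integral_add) auto
    finally have "(\<integral>x. f x * g x \<partial>M) / (?a * ?b) \<le> 1" using ps by simp
    then show ?thesis using ab by (simp add: divide_le_eq)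
  qed
qed

text \<open>One coordinate of the exponent when the \<open>s\<close>-th power of the weight is
  divided by the \<open>(s - 1)\<close>-st power of the reference density: in whitened coordinates
  the reference variance is \<open>1\<close>, the other one \<open>g\<close>. For positive
  \<open>g\<close>, the coefficient \<open>a\<close> is positive exactly when
  \<open>(s - 1) * g < t\<close>.\<close>

lemma complete_square_scalar:
  fixes t s g x \<eta> :: real
  assumes "g \<noteq> 0" "t - (s - 1) * g \<noteq> 0"
  defines "a \<equiv> t / g - (s - 1)" and "m \<equiv> t * \<eta> / (t - (s - 1) * g)"
    and "k \<equiv> t * (s - 1) * \<eta>\<^sup>2 / (t - (s - 1) * g)"
  shows "t * ((x - \<eta>)\<^sup>2 / g) - (s - 1) * x\<^sup>2 = a * (x - m)\<^sup>2 - k"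
proof -
  define u where "u = t - (s - 1) * g"
  have u: "u \<noteq> 0" "t = u + (s - 1) * g" using assms by (auto simp: u_def)
  have a: "a = u / g" using assms(1) unfolding a_def u(2) by (simp add: field_simps)
  show ?thesis
    unfolding m_def k_def u_def[symmetric] a using u(1) assms(1) unfolding u(2)
    by (simp add: field_simps power2_eq_square)
qed

text \<open>The linear terms cancel, so the bound involves \<open>(g - 1)\<^sup>2\<close> only and its sum over the
  eigenvalues stays bounded in high dimension.\<close>

lemma log_weight_bound:
  fixes g \<delta> \<kappa> \<theta> L :: real
  assumes "1 < \<kappa>" "0 < \<theta>" "0 < g" "\<theta> \<le> (1 - \<delta>) * \<kappa> - g" "- ln g \<le> (1 - g) + L * (1 - g)\<^sup>2"
  defines "s \<equiv> \<kappa> / (\<kappa> - 1)"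
  shows "- (s * ln g + ln (s * (1 - \<delta>) / g - (s - 1)))
    \<le> s * \<delta> + ((s - 1) * L + 2 * (s - 1) / \<theta>) * (g - 1)\<^sup>2 + 2 * s\<^sup>2 * \<delta>\<^sup>2 / ((s - 1) * \<theta>)"
proof -
  define r where "r = s - 1"
  have r: "r = 1 / (\<kappa> - 1)" "0 < r" using assms by (auto simp: r_def s_def field_simps)
  have s: "s = r * \<kappa>" "s = 1 + r" using assms(1) by (auto simp: r(1) s_def field_simps)
  define u where "u = r * ((1 - \<delta>) * \<kappa> - g)"
  have u: "r * \<theta> \<le> u" "0 < u" using assms r mult_left_mono[OF assms(4), of r]
    by (auto simp: u_def intro!: mult_pos_pos)
  have "u = (1 - \<delta>) * (r * \<kappa>) - r * g" unfolding u_def by (simp add: algebra_simps)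
  then have u': "u = (1 - \<delta>) * s - r * g" using s(1) by simp
  have 1: "s * (1 - \<delta>) / g - (s - 1) = u / g"
    using assms(3) unfolding u' r_def by (simp add: field_simps)
  have ln: "s * ln g + ln (u / g) = r * ln g + ln u"
    using u assms(3) by (simp add: ln_div s(2) algebra_simps)
  \<comment> \<open>The term \<open>r * (g - 1)\<close> is what cancels the linear part
    \<open>r * (1 - g)\<close> of the bound on \<open>- r * ln g\<close>.\<close>
  have e: "1 - u = r * (g - 1) + s * \<delta>"
    using s unfolding u_def by (simp add: algebra_simps)
  have "ln (1 / u) \<le> 1 / u - 1" using u by (intro ln_le_minus_one) simp
  then have "- ln u \<le> 1 / u - 1" using u by (simp add: ln_div)
  also have "\<dots> = (1 - u) + (1 - u)\<^sup>2 / u" using u by (simp add: field_simps power2_eq_square)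
  also have "\<dots> \<le> (1 - u) + (1 - u)\<^sup>2 / (r * \<theta>)"
    using u r assms(2) by (intro add_left_mono divide_left_mono) auto
  also have "(1 - u)\<^sup>2 \<le> 2 * r\<^sup>2 * (g - 1)\<^sup>2 + 2 * s\<^sup>2 * \<delta>\<^sup>2"
  proof -
    have "(x + y)\<^sup>2 \<le> 2 * x\<^sup>2 + 2 * y\<^sup>2" for x y :: real
      using sum_squares_bound[of x y] by (simp add: power2_sum)
    from this[of "r * (g - 1)" "s * \<delta>"] show ?thesis unfolding e by (simp add: power_mult_distrib)
  qed
  finally have 2: "- ln u \<le> (1 - u) + (2 * r\<^sup>2 * (g - 1)\<^sup>2 + 2 * s\<^sup>2 * \<delta>\<^sup>2) / (r * \<theta>)"
    using r assms(2) by (simp add: divide_right_mono)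
  have 3: "r * - ln g \<le> r * ((1 - g) + L * (1 - g)\<^sup>2)"
    using assms(5) r by (intro mult_left_mono) auto
  have "- (s * ln g + ln (u / g)) \<le> r * ((1 - g) + L * (1 - g)\<^sup>2) + (1 - u)
      + (2 * r\<^sup>2 * (g - 1)\<^sup>2 + 2 * s\<^sup>2 * \<delta>\<^sup>2) / (r * \<theta>)"
    unfolding ln using 2 3 by linarith
  also have "\<dots> = s * \<delta> + (r * L + 2 * r / \<theta>) * (g - 1)\<^sup>2 + 2 * s\<^sup>2 * \<delta>\<^sup>2 / (r * \<theta>)"
  proof -
    have "r \<noteq> 0" "\<theta> \<noteq> 0" using r(2) assms(2) by auto
    then show ?thesis unfolding e by (simp add: field_simps power2_eq_square)
  qed
  finally show ?thesis unfolding r_def[symmetric] 1[folded r_def] .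
qed

text \<open>Above \<open>1 / 16\<close>, the inequality \<open>- ln g \<le> 1 / g - 1\<close> has
  the remainder \<open>(1 - g)\<^sup>2 / g\<close>. Below, \<open>(1 - g)\<^sup>2\<close> is at
  least \<open>(15 / 16)\<^sup>2\<close>, and \<open>3 * (15 / 16)\<^sup>2 \<ge> 2\<close> covers
  \<open>- ln g \<le> - 2 * ln \<gamma>\<close>. Because of the split the coefficient grows only
  like \<open>- ln \<gamma>\<close>, so that exponentiation later gives a power of
  \<open>1 / \<gamma>\<close>.\<close>

lemma neg_ln_bound:
  fixes g \<gamma> :: real
  assumes "0 < \<gamma>" "\<gamma> < 1" "\<gamma>\<^sup>2 \<le> g"
  shows "- ln g \<le> (1 - g) + (16 - 3 * ln \<gamma>) * (1 - g)\<^sup>2"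
proof -
  have g: "0 < g" using assms by (meson less_le_trans zero_less_power)
  have l: "ln \<gamma> < 0" using assms by simp
  show ?thesis
  proof (cases "1 / 16 \<le> g")
    case True
    have "ln (1 / g) \<le> 1 / g - 1" using g by (intro ln_le_minus_one) simp
    then have "- ln g \<le> (1 - g) + (1 - g)\<^sup>2 / g" using g by (simp add: ln_div field_simps power2_eq_square)
    also have "\<dots> \<le> (1 - g) + (1 - g)\<^sup>2 / (1 / 16)"
      using True by (intro add_left_mono divide_left_mono) auto
    also have "\<dots> \<le> (1 - g) + (16 - 3 * ln \<gamma>) * (1 - g)\<^sup>2"
    proof -
      have "16 * (1 - g)\<^sup>2 \<le> (16 - 3 * ln \<gamma>) * (1 - g)\<^sup>2" using l by (intro mult_right_mono) auto
      then show ?thesis by simp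
    qed
    finally show ?thesis .
  next
    case False
    have "ln (\<gamma>\<^sup>2) \<le> ln g" using assms g by simp
    then have "- ln g \<le> - 2 * ln \<gamma>" using assms by (simp add: ln_realpow)
    also have "\<dots> \<le> (- 3 * ln \<gamma>) * (15 / 16)\<^sup>2" using l by (simp add: power2_eq_square field_simps)
    also have "\<dots> \<le> (16 - 3 * ln \<gamma>) * (1 - g)\<^sup>2"
      using False l by (intro mult_mono power_mono) auto
    also have "\<dots> \<le> (1 - g) + (16 - 3 * ln \<gamma>) * (1 - g)\<^sup>2" using False by simp
    finally show ?thesis .
  qed
qed

context fixed_dim
begin

text \<open>Both Gaussian weights become products in the coordinates given by \<open>P'\<close>.\<close>

lemma weighted_gaussian_integral:
  assumes P: "P \<in> cm" "P' \<in> cm" "P * P' = 1\<^sub>m n"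
    and K: "K = transpose_mat P' * mat_diag n (\<lambda>i. 1 / g i) * P'" "K' = transpose_mat P' * P'"
    and \<mu>: "\<mu> \<in> cv" "\<mu>' \<in> cv"
    and g: "\<And>i. i < n \<Longrightarrow> 0 < g i" "\<And>i. i < n \<Longrightarrow> 0 < t - (s - 1) * g i"
  defines "\<eta> \<equiv> P' *\<^sub>v (\<mu> - \<mu>')"
  shows "(\<integral>\<^sup>+z. ennreal (exp (- (t * ((z - \<mu>) \<bullet> (K *\<^sub>v (z - \<mu>))) - (s - 1) * ((z - \<mu>') \<bullet> (K' *\<^sub>v (z - \<mu>')))) / 2)) \<partial>lborel_vec n)
    = ennreal (exp ((\<Sum>i<n. t * (s - 1) * (\<eta> $ i)\<^sup>2 / (t - (s - 1) * g i)) / 2)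
        * sqrt ((2 * pi) ^ n * (det P)\<^sup>2 / (\<Prod>i<n. t / g i - (s - 1))))"
proof -
  define a where "a i = t / g i - (s - 1)" for i
  define m where "m = vec n (\<lambda>i. t * \<eta> $ i / (t - (s - 1) * g i))"
  define k where "k = (\<Sum>i<n. t * (s - 1) * (\<eta> $ i)\<^sup>2 / (t - (s - 1) * g i))"
  define A where "A = transpose_mat P' * mat_diag n a * P'"
  \<comment> \<open>The product of the two weights is again Gaussian: \<open>m\<close> is its centre
    in the coordinates of \<open>P'\<close>, relative to \<open>\<mu>'\<close>, and
    \<open>z0\<close> the same point in the original coordinates.\<close>
  define z0 where "z0 = \<mu>' + P *\<^sub>v m"
  have a: "0 < a i" if "i < n" for i
    using g(1,2)[OF that] by (simp add: a_def field_simps)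
  have m: "m \<in> cv" and \<eta>: "\<eta> \<in> cv" and z0: "z0 \<in> cv" using P \<mu> by (auto simp: m_def \<eta>_def z0_def)
  have A: "A \<in> spd n"
    unfolding A_def using spd_cong_transform[OF mat_diag_spd[of a], of "transpose_mat P'" P] a P
    by simp
  have dP: "det P * det P' = 1" using det_mult[OF P(1,2)] P(3) by simp
  then have "det P \<noteq> 0" by auto
  with dP have detP: "det P' = 1 / det P" "det P \<noteq> 0" by (auto simp: eq_divide_eq mult.commute)
  have detA: "det A = (\<Prod>i<n. a i) / (det P)\<^sup>2"
    unfolding A_def using P detP
    by (simp add: det_mult[of _ n] Determinant.det_transpose[of P' n] det_mat_diag power2_eq_square)
  have quad: "y \<bullet> (transpose_mat P' * mat_diag n d * P' *\<^sub>v y) = (\<Sum>i<n. d i * ((P' *\<^sub>v y) $ i)\<^sup>2)" if "y \<in> cv" for y d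
  proof -
    have "y \<bullet> (transpose_mat P' * mat_diag n d * P' *\<^sub>v y) = y \<bullet> (transpose_mat P' *\<^sub>v (mat_diag n d *\<^sub>v (P' *\<^sub>v y)))"
      using that P by (simp add: mat_vec_simps)
    also have "\<dots> = (P' *\<^sub>v y) \<bullet> (mat_diag n d *\<^sub>v (P' *\<^sub>v y))"
      using that P dot_transpose[of "transpose_mat P'" y "mat_diag n d *\<^sub>v (P' *\<^sub>v y)"] by simp
    also have "\<dots> = (\<Sum>i<n. d i * ((P' *\<^sub>v y) $ i)\<^sup>2)"
      using that P by (intro mat_diag_quadratic) simp
    finally show ?thesis .
  qed
  have quad': "y \<bullet> (transpose_mat P' * P' *\<^sub>v y) = (\<Sum>i<n. ((P' *\<^sub>v y) $ i)\<^sup>2)" if "y \<in> cv" for y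
    using quad[OF that, of "\<lambda>_. 1"] P by (simp add: mat_simps)
  have "exp (- (t * ((z - \<mu>) \<bullet> (K *\<^sub>v (z - \<mu>))) - (s - 1) * ((z - \<mu>') \<bullet> (K' *\<^sub>v (z - \<mu>')))) / 2)
      = exp (k / 2) * exp (- ((z - z0) \<bullet> (A *\<^sub>v (z - z0))) / 2)" if z: "z \<in> cv" for z
  proof -
    let ?x = "P' *\<^sub>v (z - \<mu>')"
    have x: "?x \<in> cv" using z P \<mu> by simp
    have 1: "P' *\<^sub>v (z - \<mu>) = ?x - \<eta>"
      unfolding \<eta>_def using z P \<mu> by (simp add: mat_vec_simps) (rule eq_vecI, auto simp del: index_mult_mat_vec)
    have 2: "P' *\<^sub>v (z - z0) = ?x - m"
    proof -
      have "P' *\<^sub>v z0 = P' *\<^sub>v \<mu>' + m"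
        unfolding z0_def using P \<mu> m inverse_cancel(4)[OF P m] by (simp add: mat_vec_simps)
      then show ?thesis using z P \<mu> m z0
        by (simp add: mat_vec_simps) (rule eq_vecI, auto simp del: index_mult_mat_vec)
    qed
    have "(z - \<mu>') \<bullet> (K' *\<^sub>v (z - \<mu>')) = (\<Sum>i<n. (?x $ i)\<^sup>2)"
      unfolding K using z \<mu> by (intro quad') simp
    moreover have "(z - \<mu>) \<bullet> (K *\<^sub>v (z - \<mu>)) = (\<Sum>i<n. (?x $ i - \<eta> $ i)\<^sup>2 / g i)"
      unfolding K using z \<mu> x \<eta> by (subst quad) (simp_all add: 1 del: index_mult_mat_vec)
    moreover have "(z - z0) \<bullet> (A *\<^sub>v (z - z0)) = (\<Sum>i<n. a i * (?x $ i - m $ i)\<^sup>2)"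
      unfolding A_def using z z0 x m by (subst quad) (simp_all add: 2 del: index_mult_mat_vec)
    moreover have "(\<Sum>i<n. t * ((?x $ i - \<eta> $ i)\<^sup>2 / g i) - (s - 1) * (?x $ i)\<^sup>2) = (\<Sum>i<n. a i * (?x $ i - m $ i)\<^sup>2) - k"
    proof -
      have "t * ((?x $ i - \<eta> $ i)\<^sup>2 / g i) - (s - 1) * (?x $ i)\<^sup>2
          = a i * (?x $ i - m $ i)\<^sup>2 - t * (s - 1) * (\<eta> $ i)\<^sup>2 / (t - (s - 1) * g i)" if i: "i < n" for i
        using complete_square_scalar[of "g i" t s "?x $ i" "\<eta> $ i"] g(1,2)[OF i] i
        by (simp add: a_def m_def del: index_mult_mat_vec)
      then show ?thesis unfolding k_def sum_subtractf[symmetric] by (intro sum.cong) auto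
    qed
    ultimately have "t * ((z - \<mu>) \<bullet> (K *\<^sub>v (z - \<mu>))) - (s - 1) * ((z - \<mu>') \<bullet> (K' *\<^sub>v (z - \<mu>')))
        = (z - z0) \<bullet> (A *\<^sub>v (z - z0)) - k"
      by (simp add: sum_subtractf sum_distrib_left)
    then show ?thesis by (simp add: exp_add[symmetric] field_simps)
  qed
  then have "(\<integral>\<^sup>+z. ennreal (exp (- (t * ((z - \<mu>) \<bullet> (K *\<^sub>v (z - \<mu>))) - (s - 1) * ((z - \<mu>') \<bullet> (K' *\<^sub>v (z - \<mu>')))) / 2)) \<partial>lborel_vec n)
      = (\<integral>\<^sup>+z. ennreal (exp (k / 2)) * ennreal (exp (- ((z - z0) \<bullet> (A *\<^sub>v (z - z0))) / 2)) \<partial>lborel_vec n)"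
    by (intro nn_integral_cong) (simp add: space_lborel_vec ennreal_mult[symmetric])
  also have "\<dots> = ennreal (exp (k / 2)) * ennreal (sqrt ((2 * pi) ^ n / det A))"
    using measurable_quadratic[OF spdD(2)[OF A] z0] gaussian_integral[OF A z0]
    by (subst nn_integral_cmult) simp_all
  also have "\<dots> = ennreal (exp (k / 2) * sqrt ((2 * pi) ^ n * (det P)\<^sup>2 / (\<Prod>i<n. a i)))"
    using detA detP(2) prod_pos[of "{..<n}" a] a by (subst ennreal_mult) (auto simp: spd_det_pos[OF A] less_imp_le)
  finally show ?thesis unfolding k_def a_def .
qed

end

section \<open>The Bures--Wasserstein ball\<close>

text \<open>The logarithm of the constant lost in Hoelder's inequality, term by term: the damping;
  the bound \<open>9\<close> on the squared eigenvalue deviations times the coefficient of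
  \<open>neg_ln_bound\<close>, and once more times \<open>2 / \<theta>\<close>; the second-order
  effect of the damping; the shift of the mean. The divisor \<open>\<kappa>\<close> is
  \<open>s / (s - 1)\<close>, and the overall \<open>1 / 2\<close> is that of the Gaussian exponent
  and of the root of the determinant.\<close>

definition bound_exponent :: "real \<Rightarrow> real \<Rightarrow> real \<Rightarrow> real \<Rightarrow> real" where
  "bound_exponent \<kappa> \<theta> d \<gamma> = (d + 9 * (16 - 3 * ln \<gamma>) / \<kappa> + 18 / (\<kappa> * \<theta>) + 2 * \<kappa> * d\<^sup>2 / \<theta> + 1 / \<theta>) / 2"

context fixed_dim
begin

section \<open>Operator norm\<close>

lemma vnorm_mat_vec_opnorm:
  assumes "A \<in> cm" "x \<in> cv"
  shows "vnorm (A *\<^sub>v x) \<le> opnorm A * vnorm x"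
proof (cases "x = 0\<^sub>v n")
  case True
  then show ?thesis using mat_vec_zero[OF assms(1)] vnorm_eq_0[of "0\<^sub>v n"] by simp
next
  case False
  then have x: "0 < vnorm x" using vnorm_eq_0[OF assms(2)] by (simp add: less_le)
  let ?V = "{v \<in> carrier_vec (dim_col A). vnorm v \<le> 1}"
  have bdd: "bdd_above ((\<lambda>v. vnorm (A *\<^sub>v v)) ` ?V)"
  proof (rule bdd_aboveI2)
    fix v assume v: "v \<in> ?V"
    then have "vnorm (A *\<^sub>v v) \<le> fnorm A * vnorm v" using assms vnorm_mat_vec_le by auto
    also have "\<dots> \<le> fnorm A * 1" using v by (intro mult_left_mono) auto
    finally show "vnorm (A *\<^sub>v v) \<le> fnorm A" by simp
  qed
  have "vnorm (A *\<^sub>v ((1 / vnorm x) \<cdot>\<^sub>v x)) \<le> opnorm A"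
    unfolding opnorm_def using assms x by (intro cSUP_upper bdd) (auto simp: vnorm_smult)
  then have "1 / vnorm x * vnorm (A *\<^sub>v x) \<le> opnorm A"
    using assms x by (simp add: mat_vec_simps vnorm_smult)
  then show ?thesis using x by (simp add: field_simps)
qed

lemma opnorm_le:
  assumes "A \<in> cm" "0 \<le> c" "\<And>x. x \<in> cv \<Longrightarrow> vnorm (A *\<^sub>v x) \<le> c * vnorm x"
  shows "opnorm A \<le> c"
  unfolding opnorm_def
proof (rule cSUP_least)
  have "0\<^sub>v n \<in> {v \<in> carrier_vec (dim_col A). vnorm v \<le> 1}"
    using assms(1) vnorm_eq_0[of "0\<^sub>v n"] by simp
  then show "{v \<in> carrier_vec (dim_col A). vnorm v \<le> 1} \<noteq> {}" by blast
  fix v assume v: "v \<in> {v \<in> carrier_vec (dim_col A). vnorm v \<le> 1}"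
  then have "vnorm (A *\<^sub>v v) \<le> c * vnorm v" using assms by auto
  also have "\<dots> \<le> c * 1" using v assms(2) by (intro mult_left_mono) auto
  finally show "vnorm (A *\<^sub>v v) \<le> c" by simp
qed

lemma quadratic_le_opnorm: "A \<in> cm \<Longrightarrow> x \<in> cv \<Longrightarrow> x \<bullet> (A *\<^sub>v x) \<le> opnorm A * (vnorm x)\<^sup>2"
proof -
  assume a: "A \<in> cm" "x \<in> cv"
  have "x \<bullet> (A *\<^sub>v x) \<le> vnorm x * vnorm (A *\<^sub>v x)" using Cauchy_Schwarz[of x "A *\<^sub>v x"] a by simp
  also have "\<dots> \<le> vnorm x * (opnorm A * vnorm x)" using vnorm_mat_vec_opnorm a by (intro mult_left_mono) auto
  finally show ?thesis by (simp add: power2_eq_square algebra_simps)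
qed

lemma unit_vec_facts: "i < n \<Longrightarrow> unit_vec n i \<in> cv" "i < n \<Longrightarrow> vnorm (unit_vec n i) = 1"
  by (simp_all add: vnorm_def)

lemma spd_opnorm_pos:
  assumes A: "A \<in> spd n" and n: "0 < n"
  shows "0 < opnorm A"
proof -
  let ?e = "unit_vec n 0 :: real vec"
  have "?e \<noteq> 0\<^sub>v n" using unit_vec_nonzero n by blast
  then have "0 < ?e \<bullet> (A *\<^sub>v ?e)" by (rule spdD(4)[OF A unit_vec_carrier])
  also have "\<dots> \<le> opnorm A * (vnorm ?e)\<^sup>2" by (rule quadratic_le_opnorm[OF spdD(2)[OF A] unit_vec_carrier])
  finally show ?thesis using unit_vec_facts(2)[OF n] by simp
qed

text \<open>\<open>T = R * I * R\<close> is the linear optimal transport map from the centred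
  Gaussian with covariance \<open>L'\<close> to the one with covariance \<open>L\<close>. Its cost,
  the mean squared displacement \<open>tr ((T - 1\<^sub>m n) * L' * (T - 1\<^sub>m n))\<close>, is
  the squared Bures--Wasserstein distance.\<close>

lemma transport_map:
  assumes L: "L \<in> spd n" and L': "L' \<in> spd n" and d: "bw_dist L L' \<le> r"
  obtains T where "T \<in> sym_mats n" "T * L' * T = L" "tr ((T - 1\<^sub>m n) * L' * (T - 1\<^sub>m n)) \<le> r\<^sup>2"
proof -
  define R where "R = msqrt L"
  note R = spd_msqrt[OF L, folded R_def]
  define W where "W = R * L' * R"
  have W: "W \<in> spd n"
    using spd_cong_transform[OF L', of R "minv R"] R(1) spd_minv[OF R(1)] by (simp add: spdD(2,3) W_def)
  define N where "N = msqrt W"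
  note N = spd_msqrt[OF W, folded N_def]
  define I where "I = minv N"
  note I = spd_minv[OF N(1), folded I_def]
  note [simp] = spdD(2)[OF R(1)] spdD(2)[OF L'] spdD(2)[OF N(1)] spdD(2)[OF I(1)] spdD(2)[OF L]
  note cancel = inverse_cancel[OF spdD(2)[OF N(1)] spdD(2)[OF I(1)] I(2)]
  define T where "T = R * I * R"
  have T: "T \<in> sym_mats n" unfolding T_def using sym_closed(5)[OF spdD(1)[OF I(1)] spdD(1)[OF R(1)]] .
  have [simp]: "T \<in> cm" using symD(1)[OF T] .
  have WN: "R * (L' * (R * X)) = N * (N * X)" if "X \<in> cm" for X
  proof -
    have "W * X = N * N * X" using N(2) by simp
    then show ?thesis unfolding W_def using that by (simp add: mat_simps)
  qed
  have TLT: "T * L' * T = L"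
    unfolding T_def by (simp add: mat_simps WN cancel R(2))
  have trT: "tr (T * L') = tr N"
  proof -
    have "tr (T * L') = tr (R * (I * (R * L')))" unfolding T_def by (simp add: mat_simps)
    also have "\<dots> = tr ((I * (R * L')) * R)" by (rule tr_comm) simp_all
    also have "(I * (R * L')) * R = I * W" unfolding W_def by (simp add: mat_simps)
    also have "\<dots> = N" unfolding N(2)[symmetric] by (simp add: cancel)
    finally show ?thesis .
  qed
  have exp: "(T - 1\<^sub>m n) * L' * (T - 1\<^sub>m n) = (T * L' * T - L' * T) - (T * L' - L')"
    by (simp add: mat_simps)
  have "tr ((T - 1\<^sub>m n) * L' * (T - 1\<^sub>m n)) = tr L + tr L' - 2 * tr N"
    unfolding exp using tr_comm[of L' T] trT by (simp add: tr_simps TLT)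
  also have "\<dots> = tr (L + L' - 2 \<cdot>\<^sub>m N)" by (simp add: tr_simps)
  also have "\<dots> \<le> r\<^sup>2"
    using d unfolding bw_dist_def R_def[symmetric] W_def[symmetric] N_def[symmetric] by (rule sqrt_le_D)
  finally show ?thesis using that T TLT by blast
qed

text \<open>Whitening with \<open>S = msqrt L'\<close> turns the displacement
  \<open>X = T - 1\<^sub>m n\<close> into \<open>F = I * X * S\<close>. The radius is
  \<open>1 - \<gamma>\<close> times the smallest eigenvalue of \<open>S\<close>, so the Frobenius
  norm of \<open>F\<close> is at most \<open>1 - \<gamma>\<close>. The whitened covariance
  \<open>G = I * L * I\<close> is the product of 1 + F with its transpose: its eigenvalues are
  squares of lengths between \<open>\<gamma>\<close> and \<open>2 - \<gamma>\<close>, and G - 1 = F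
  + F^T + F F^T has Frobenius norm at most 3 in every dimension, whence the bound 9.\<close>

lemma BW_ball_coordinates:
  assumes n: "0 < n" and L: "L \<in> spd n" and L': "L' \<in> spd n" and \<gamma>: "0 < \<gamma>" "\<gamma> < 1"
    and d: "bw_dist L L' \<le> radius \<gamma> L'"
  obtains P P' g where "P \<in> cm" "P' \<in> cm" "P * P' = 1\<^sub>m n"
    "L = P * mat_diag n g * transpose_mat P" "L' = P * transpose_mat P"
    "\<And>i. i < n \<Longrightarrow> \<gamma>\<^sup>2 \<le> g i" "\<And>i. i < n \<Longrightarrow> g i \<le> (2 - \<gamma>)\<^sup>2" "(\<Sum>i<n. (g i - 1)\<^sup>2) \<le> 9"
    "\<And>h. h \<in> cv \<Longrightarrow> (vnorm (P' *\<^sub>v h))\<^sup>2 \<le> opnorm (minv L') * (vnorm h)\<^sup>2"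
proof -
  define b where "b = opnorm (minv L')"
  have b: "0 < b" unfolding b_def using spd_opnorm_pos[OF spd_minv(1)[OF L'] n] .
  define r where "r = radius \<gamma> L'"
  have r: "r = (1 - \<gamma>) / sqrt b"
    unfolding r_def radius_def b_def[symmetric] using b by (simp add: powr_minus powr_half_sqrt field_simps)
  obtain T where T: "T \<in> sym_mats n" "T * L' * T = L" "tr ((T - 1\<^sub>m n) * L' * (T - 1\<^sub>m n)) \<le> r\<^sup>2"
    using transport_map[OF L L' d] unfolding r_def by blast
  define S where "S = msqrt L'"
  note S = spd_msqrt[OF L', folded S_def]
  define I where "I = minv S"
  note I = spd_minv[OF S(1), folded I_def]
  note [simp] = spdD(2)[OF S(1)] spdD(2)[OF I(1)] spdD(2)[OF L'] symD(1)[OF T(1)] spdD(2)[OF L]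
  note St [simp] = spdD(3)[OF S(1)] spdD(3)[OF I(1)] symD(2)[OF T(1)]
  note cancel = inverse_cancel[OF spdD(2)[OF S(1)] spdD(2)[OF I(1)] I(2)]
  have Ib: "(vnorm (I *\<^sub>v h))\<^sup>2 \<le> b * (vnorm h)\<^sup>2" if "h \<in> cv" for h
  proof -
    have "(vnorm (I *\<^sub>v h))\<^sup>2 = h \<bullet> (minv L' *\<^sub>v h)"
      using root_quadratic[OF I(1) that] spd_square(2)[OF S(1)] S(2) by (simp add: I_def)
    then show ?thesis unfolding b_def using quadratic_le_opnorm[OF spd_minv(4)[OF L'] that] by simp
  qed
  have Ib': "vnorm (I *\<^sub>v h) \<le> sqrt b * vnorm h" if "h \<in> cv" for h
    using real_le_rsqrt[OF Ib[OF that]] b by (simp add: real_sqrt_mult)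
  define X where "X = T - 1\<^sub>m n"
  have X: "X \<in> sym_mats n" unfolding X_def using sym_closed(2,7) T(1) by blast
  have [simp]: "X \<in> cm" "transpose_mat X = X" using symD[OF X] by auto
  define F where "F = I * X * S"
  have Fc [simp]: "F \<in> cm" unfolding F_def by simp
  \<comment> \<open>The transport cost is the squared Frobenius norm of \<open>S * X\<close>;
    transposition gives that of \<open>X * S\<close>, to which \<open>I\<close> can be applied from
    the left with its operator bound.\<close>
  have "(fnorm (X * S))\<^sup>2 = (fnorm (S * X))\<^sup>2"
    using fnorm_transpose[of "X * S"] by (simp add: transpose_simps)
  also have "\<dots> = tr (X * L' * X)"
    using S(2) by (simp add: fnorm_sq_tr transpose_simps mat_simps[symmetric] del: mat_simps(2-9))
      (simp add: mat_simps)
  finally have "(fnorm (X * S))\<^sup>2 \<le> r\<^sup>2" using T(3) unfolding X_def by simp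
  moreover have "0 \<le> r" unfolding r using b \<gamma> by simp
  ultimately have XS: "fnorm (X * S) \<le> r" by (rule power2_le_imp_le)
  have "fnorm F \<le> sqrt b * fnorm (X * S)"
    unfolding F_def using fnorm_mult_bound[of I "X * S" "sqrt b"] Ib' b by (simp add: mat_simps)
  also have "\<dots> \<le> sqrt b * r" using XS b by (intro mult_left_mono) auto
  also have "\<dots> = 1 - \<gamma>" unfolding r using b by simp
  finally have F: "fnorm F \<le> 1 - \<gamma>" .
  define G where "G = I * L * I"
  have G: "G \<in> spd n"
    using spd_cong_transform[OF L, of I S] I(2) by (simp add: G_def)
  have [simp]: "G \<in> cm" using spdD(2)[OF G] .
  have M: "I * (T * S) = 1\<^sub>m n + F"
  proof -
    have "I * (T * S) = I * ((1\<^sub>m n + X) * S)"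
    proof -
      have "1\<^sub>m n + X = T" unfolding X_def by (rule eq_matI) auto
      then show ?thesis by simp
    qed
    then show ?thesis unfolding F_def using I(3) by (simp add: mat_simps)
  qed
  have GM: "G = (1\<^sub>m n + F) * transpose_mat (1\<^sub>m n + F)"
  proof -
    have "(1\<^sub>m n + F) * transpose_mat (1\<^sub>m n + F) = I * (T * S) * (S * (T * I))"
      unfolding M[symmetric] by (simp add: transpose_simps mat_simps)
    also have "\<dots> = I * (T * (S * S) * T) * I" by (simp add: mat_simps)
    also have "\<dots> = G" unfolding S(2) T(2) G_def ..
    finally show ?thesis ..
  qed
  obtain Q g where Q: "Q \<in> cm" "Q * transpose_mat Q = 1\<^sub>m n" "transpose_mat Q * Q = 1\<^sub>m n"
    "G = Q * mat_diag n g * transpose_mat Q"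
    using spectral_theorem[OF spdD(1)[OF G]] by blast
  note [simp] = Q(1)
  note Qc = inverse_cancel[OF Q(1) closed(5)[OF Q(1)] Q(2)]
  have iso: "vnorm (Q *\<^sub>v x) = vnorm x" "vnorm (transpose_mat Q *\<^sub>v x) = vnorm x" if "x \<in> cv" for x
    using that by (simp_all add: vnorm_def dot_transpose Qc)
  have eig: "\<gamma>\<^sup>2 \<le> g i \<and> g i \<le> (2 - \<gamma>)\<^sup>2" if i: "i < n" for i
  proof -
    define e :: "real vec" where "e = unit_vec n i"
    have e: "e \<in> cv" "vnorm e = 1" "\<And>j. j < n \<Longrightarrow> e $ j = (if j = i then 1 else 0)"
      using i unit_vec_facts by (auto simp: e_def)
    define w where "w = Q *\<^sub>v e"
    have w: "w \<in> cv" "vnorm w = 1" using e iso by (simp_all add: w_def)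
    have "w \<bullet> (G *\<^sub>v w) = e \<bullet> (mat_diag n g *\<^sub>v e)"
      unfolding Q(4) w_def using e(1) by (simp add: mat_vec_simps dot_transpose Qc)
    also have "\<dots> = (\<Sum>j<n. if j = i then g j else 0)"
      unfolding mat_diag_quadratic[OF e(1)] by (rule sum.cong) (auto simp: e(3))
    finally have "g i = w \<bullet> (G *\<^sub>v w)" using i by simp
    also have "\<dots> = (vnorm (transpose_mat (1\<^sub>m n + F) *\<^sub>v w))\<^sup>2"
      unfolding GM vnorm_sq using w by (simp add: mat_vec_simps(7) dot_transpose)
    also have "transpose_mat (1\<^sub>m n + F) *\<^sub>v w = w + transpose_mat F *\<^sub>v w"
      using w by (simp add: transpose_simps mat_vec_simps)
    finally have gi: "g i = (vnorm (w + transpose_mat F *\<^sub>v w))\<^sup>2" .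
    let ?u = "transpose_mat F *\<^sub>v w"
    have u: "?u \<in> cv" "vnorm ?u \<le> 1 - \<gamma>"
      using vnorm_mat_vec_le[of "transpose_mat F" w] w F by auto
    have "vnorm (w + ?u) \<le> 2 - \<gamma>" using vnorm_triangle[OF w(1) u(1)] w u by simp
    moreover have "\<gamma> \<le> vnorm (w + ?u)"
    proof -
      have "w = (w + ?u) + (-1) \<cdot>\<^sub>v ?u" using w u by (intro eq_vecI) auto
      then have "vnorm w \<le> vnorm (w + ?u) + vnorm ((-1) \<cdot>\<^sub>v ?u)"
        using vnorm_triangle[of "w + ?u" "(-1) \<cdot>\<^sub>v ?u"] w(1) u(1) by (metis closed(7) closed(9))
      then show ?thesis using w(2) u vnorm_smult[OF u(1), of "-1"] by simp
    qed
    ultimately show ?thesis unfolding gi using \<gamma> by (auto intro!: power_mono)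
  qed
  have sum9: "(\<Sum>i<n. (g i - 1)\<^sup>2) \<le> 9"
  proof -
    have "mat_diag n (\<lambda>i. g i - 1) = transpose_mat Q * (G - 1\<^sub>m n) * Q"
    proof -
      have "transpose_mat Q * (G - 1\<^sub>m n) * Q = mat_diag n g - 1\<^sub>m n"
        unfolding Q(4) using Q(3) by (simp add: mat_simps Qc)
      also have "\<dots> = mat_diag n (\<lambda>i. g i - 1)" by (rule eq_matI) (auto simp: mat_diag_def)
      finally show ?thesis ..
    qed
    then have "fnorm (mat_diag n (\<lambda>i. g i - 1)) = fnorm (transpose_mat Q * ((G - 1\<^sub>m n) * Q))"
      by (simp add: mat_simps(1))
    also have "\<dots> \<le> 1 * fnorm ((G - 1\<^sub>m n) * Q)" by (rule fnorm_mult_bound) (simp_all add: iso)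
    also have "fnorm ((G - 1\<^sub>m n) * Q) \<le> 1 * fnorm (G - 1\<^sub>m n)"
      by (rule fnorm_mult_bound_right) (simp_all add: iso)
    also have "G - 1\<^sub>m n = F + (transpose_mat F + F * transpose_mat F)"
    proof -
      have "G = 1\<^sub>m n + F + (transpose_mat F + F * transpose_mat F)"
        unfolding GM by (simp add: transpose_simps mat_simps)
      then show ?thesis by (simp only:) (rule eq_matI, auto simp del: index_mult_mat)
    qed
    also have "fnorm \<dots> \<le> fnorm F + (fnorm F + fnorm F * fnorm F)"
      using fnorm_triangle[of F "transpose_mat F + F * transpose_mat F"]
        fnorm_triangle[of "transpose_mat F" "F * transpose_mat F"] fnorm_mult_le[of F "transpose_mat F"] by simp
    also have "\<dots> \<le> 1 + (1 + 1 * 1)" using F \<gamma> by (intro add_mono mult_mono) auto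
    finally have "fnorm (mat_diag n (\<lambda>i. g i - 1)) \<le> 3" by simp
    then have "(fnorm (mat_diag n (\<lambda>i. g i - 1)))\<^sup>2 \<le> 3\<^sup>2" by (rule power_mono) simp
    moreover have "(fnorm (mat_diag n (\<lambda>i. g i - 1)))\<^sup>2 = (\<Sum>i<n. (g i - 1)\<^sup>2)"
    proof -
      have "(\<Sum>j<n. (mat_diag n (\<lambda>i. g i - 1) $$ (i, j))\<^sup>2) = (g i - 1)\<^sup>2" if "i < n" for i
      proof -
        have "(\<Sum>j<n. (mat_diag n (\<lambda>i. g i - 1) $$ (i, j))\<^sup>2) = (\<Sum>j<n. if j = i then (g i - 1)\<^sup>2 else 0)"
          using that by (intro sum.cong) (auto simp: mat_diag_def)
        then show ?thesis using that by simp
      qed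
      then show ?thesis by (simp add: fnorm_sq')
    qed
    ultimately show ?thesis by simp
  qed
  show ?thesis
  \<comment> \<open>The inverse of \<open>S * Q\<close> whitens \<open>L'\<close> and diagonalises
    \<open>L\<close> simultaneously.\<close>
  proof (rule that[of "S * Q" "transpose_mat Q * I" g])
    show "S * Q * (transpose_mat Q * I) = 1\<^sub>m n" using I(2) by (simp add: mat_simps Qc)
    have "S * Q * mat_diag n g * transpose_mat (S * Q) = S * G * S"
      unfolding Q(4) by (simp add: transpose_simps mat_simps)
    also have "\<dots> = L" unfolding G_def using I(3) by (simp add: mat_simps cancel)
    finally show "L = S * Q * mat_diag n g * transpose_mat (S * Q)" ..
    show "L' = S * Q * transpose_mat (S * Q)" using S(2) by (simp add: transpose_simps mat_simps Qc)
    show "(vnorm (transpose_mat Q * I *\<^sub>v h))\<^sup>2 \<le> opnorm (minv L') * (vnorm h)\<^sup>2" if "h \<in> cv" for h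
      using Ib[OF that] that unfolding b_def by (simp add: mat_vec_simps iso)
  qed (use eig sum9 in auto)
qed

section \<open>The weighted Hoelder bound\<close>

lemma minv_coordinates:
  assumes P: "P \<in> cm" "P' \<in> cm" "P * P' = 1\<^sub>m n" and g: "\<And>i. i < n \<Longrightarrow> g i \<noteq> 0"
  shows "minv (P * mat_diag n g * transpose_mat P) = transpose_mat P' * mat_diag n (\<lambda>i. 1 / g i) * P'"
    "minv (P * transpose_mat P) = transpose_mat P' * P'"
proof -
  have P'P: "P' * P = 1\<^sub>m n" using P mat_mult_left_right_inverse by blast
  have "transpose_mat P * transpose_mat P' = 1\<^sub>m n"
    using P'P transpose_simps(1)[OF P(2,1)] by simp
  note c = inverse_cancel[OF closed(5)[OF P(1)] closed(5)[OF P(2)] this]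
  have "mat_diag n g * (mat_diag n (\<lambda>i. 1 / g i) * P') = P'"
  proof -
    have "mat_diag n (\<lambda>i. g i * (1 / g i)) = 1\<^sub>m n"
      using g by (intro eq_matI) (auto simp: mat_diag_def)
    then show ?thesis using P by (simp add: mat_simps(1)[symmetric])
  qed
  then show "minv (P * mat_diag n g * transpose_mat P) = transpose_mat P' * mat_diag n (\<lambda>i. 1 / g i) * P'"
    using P by (intro minv_eqI) (simp_all add: mat_simps c)
  show "minv (P * transpose_mat P) = transpose_mat P' * P'"
    using P by (intro minv_eqI) (simp_all add: mat_simps c)
qed

text \<open>The integrand is split as \<open>F1 * F2\<close> by inserting the reference density to
  the powers \<open>1 / \<kappa>\<close> and \<open>- 1 / \<kappa>\<close>. Then \<open>F1\<close>
  carries the given moment, and the \<open>s\<close>-th power of \<open>F2\<close> is an explicit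
  Gaussian because \<open>s / \<kappa> = s - 1\<close>.\<close>

lemma weighted_Hoelder_bound:
  assumes n: "0 < n" and P: "P \<in> cm" "P' \<in> cm" "P * P' = 1\<^sub>m n"
    and L: "L = P * mat_diag n g * transpose_mat P" "L' = P * transpose_mat P"
    and \<gamma>: "0 < \<gamma>" "\<gamma> < 1" and \<kappa>: "1 < \<kappa>" "0 < \<theta>" and d: "0 < d" "d < 1"
    and g: "\<And>i. i < n \<Longrightarrow> \<gamma>\<^sup>2 \<le> g i" "\<And>i. i < n \<Longrightarrow> g i \<le> (1 - d) * \<kappa> - \<theta>" "(\<Sum>i<n. (g i - 1)\<^sup>2) \<le> 9"
    and \<mu>: "\<mu> \<in> cv" "\<mu>' \<in> cv" "vnorm (P' *\<^sub>v (\<mu> - \<mu>')) \<le> 1"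
    and f: "f \<in> borel_measurable (lborel_vec n)" "\<And>z. z \<in> cv \<Longrightarrow> 0 \<le> f z"
      "integrable (lborel_vec n) (\<lambda>z. f z powr \<kappa> * gaussian_density \<mu>' L' z)"
  defines "w \<equiv> \<lambda>z. exp (- (1 - d / n) * ((z - \<mu>) \<bullet> (minv L *\<^sub>v (z - \<mu>))) / 2) / sqrt (det ((2 * pi) \<cdot>\<^sub>m L))"
  shows "integrable (lborel_vec n) (\<lambda>z. f z * w z)"
    "(\<integral>z. f z * w z \<partial>lborel_vec n)
      \<le> (\<integral>z. f z powr \<kappa> * gaussian_density \<mu>' L' z \<partial>lborel_vec n) powr (1 / \<kappa>) * exp (bound_exponent \<kappa> \<theta> d \<gamma>)"
proof -
  define \<delta> where "\<delta> = d / n"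
  have \<delta>: "0 < \<delta>" "\<delta> < 1" "\<delta> \<le> d" "n * \<delta> = d" using d n unfolding \<delta>_def by (auto simp: field_simps)
  have g0: "0 < g i" if "i < n" for i using g(1)[OF that] \<gamma> by (meson less_le_trans zero_less_power)
  define s where "s = \<kappa> / (\<kappa> - 1)"
  have s: "1 < s" "1 / \<kappa> + 1 / s = 1" "s = (s - 1) * \<kappa>" "s / \<kappa> = s - 1" "(s - 1) / s = 1 / \<kappa>"
    using \<kappa> by (auto simp: s_def field_simps)
  define t where "t = s * (1 - \<delta>)"
  have \<theta>g: "\<theta> \<le> (1 - \<delta>) * \<kappa> - g i" if "i < n" for i
  proof -
    have "(1 - d) * \<kappa> \<le> (1 - \<delta>) * \<kappa>" using \<delta>(3) \<kappa>(1) by (intro mult_right_mono) auto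
    then show ?thesis using g(2)[OF that] by linarith
  qed
  have gt: "(s - 1) * \<theta> \<le> t - (s - 1) * g i" if "i < n" for i
  proof -
    have "(s - 1) * \<theta> \<le> (s - 1) * ((1 - \<delta>) * \<kappa> - g i)"
      using s \<theta>g[OF that] by (intro mult_left_mono) auto
    also have "\<dots> = (1 - \<delta>) * ((s - 1) * \<kappa>) - (s - 1) * g i" by (simp add: algebra_simps)
    finally show ?thesis unfolding s(3)[symmetric] t_def by (simp add: algebra_simps)
  qed
  have gt0: "0 < t - (s - 1) * g i" if "i < n" for i
    using gt[OF that] s \<kappa> mult_pos_pos[of "s - 1" \<theta>] by linarith
  define a where "a i = t / g i - (s - 1)" for i
  have a: "0 < a i" if "i < n" for i using gt0[OF that] g0[OF that] by (simp add: a_def field_simps)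
  define e where "e = (2 * pi) ^ n * (det P)\<^sup>2"
  have "det P * det P' = 1" using det_mult[OF P(1,2)] P(3) by simp
  then have "det P \<noteq> 0" by auto
  then have e: "0 < e" by (simp add: e_def)
  have Lc: "L \<in> cm" "L' \<in> cm" using P L by auto
  have detL': "det ((2 * pi) \<cdot>\<^sub>m L') = e"
    using P Lc unfolding L e_def by (simp add: det_mult[of _ n] Determinant.det_transpose[of P n] power2_eq_square)
  have detL: "det ((2 * pi) \<cdot>\<^sub>m L) = e * (\<Prod>i<n. g i)"
    using P Lc unfolding L e_def
    by (simp add: det_mult[of _ n] Determinant.det_transpose[of P n] det_mat_diag power2_eq_square)
  define q where "q z = (z - \<mu>) \<bullet> (minv L *\<^sub>v (z - \<mu>))" for z
  define q' where "q' z = (z - \<mu>') \<bullet> (minv L' *\<^sub>v (z - \<mu>'))" for z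
  note K = minv_coordinates[OF P, of g, folded L]
  have Kc: "minv L \<in> cm" "minv L' \<in> cm" using K g0 P by (auto simp: less_imp_neq[symmetric])
  have qm: "q \<in> borel_measurable (lborel_vec n)" "q' \<in> borel_measurable (lborel_vec n)"
    using measurable_quadratic[OF Kc(1) \<mu>(1)] measurable_quadratic[OF Kc(2) \<mu>(2)]
    unfolding q_def[symmetric] q'_def[symmetric] by simp_all
  define G where "G = (\<Prod>i<n. g i)"
  have G: "0 < G" unfolding G_def using g0 by (intro prod_pos) auto
  define F1 where "F1 z = f z * (exp (- q' z / 2) / sqrt e) powr (1 / \<kappa>)" for z
  define F2 where "F2 z = exp (- (1 - \<delta>) * q z / 2) / sqrt (e * G) * (exp (- q' z / 2) / sqrt e) powr (- 1 / \<kappa>)" for z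
  define C where "C = (e * G) powr (- s / 2) * e powr ((s - 1) / 2)"
  have w: "f z * w z = F1 z * F2 z" for z
    unfolding F1_def F2_def w_def \<delta>_def[symmetric] q_def[symmetric] detL G_def[symmetric] using e
    by (simp add: powr_minus field_simps)
  have F1: "F1 z powr \<kappa> = f z powr \<kappa> * gaussian_density \<mu>' L' z" if "z \<in> cv" for z
    unfolding F1_def gaussian_density_def detL' q'_def using f(2)[OF that] e \<kappa>
    by (simp add: powr_mult powr_powr)
  have F2: "F2 z powr s = C * exp (- (t * q z - (s - 1) * q' z) / 2)" for z
  proof -
    have "sqrt e = exp (ln e / 2)" "sqrt (e * G) = exp (ln (e * G) / 2)"
      using e G by (simp_all add: powr_half_sqrt[symmetric] powr_def)
    then have "F2 z = exp ((- (1 - \<delta>) * q z / 2 - ln (e * G) / 2) + (- 1 / \<kappa>) * (- q' z / 2 - ln e / 2))"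
      unfolding F2_def by (simp only: exp_diff[symmetric] powr_def exp_add ln_exp exp_not_eq_zero if_False)
    then have "F2 z powr s = exp (s * ((- (1 - \<delta>) * q z / 2 - ln (e * G) / 2) + (- 1 / \<kappa>) * (- q' z / 2 - ln e / 2)))"
      by (simp only: powr_def ln_exp exp_not_eq_zero if_False)
    also have "\<dots> = exp (s * (- (1 - \<delta>) * q z / 2 - ln (e * G) / 2) + (s / \<kappa>) * (q' z / 2 + ln e / 2))"
      by (simp add: algebra_simps add_divide_distrib)
    also have "\<dots> = C * exp (- (t * q z - (s - 1) * q' z) / 2)"
      unfolding C_def powr_def s(4) t_def using e G
      by (simp add: mult_exp_exp algebra_simps add_divide_distrib diff_divide_distrib)
    finally show ?thesis .
  qed
  define k where "k = (\<Sum>i<n. t * (s - 1) * ((P' *\<^sub>v (\<mu> - \<mu>')) $ i)\<^sup>2 / (t - (s - 1) * g i))"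
  define A where "A = (\<Prod>i<n. a i)"
  have A: "0 < A" unfolding A_def using a by (intro prod_pos) auto
  have "(\<integral>\<^sup>+z. ennreal (exp (- (t * q z - (s - 1) * q' z) / 2)) \<partial>lborel_vec n) = ennreal (exp (k / 2) * sqrt (e / A))"
    unfolding q_def q'_def k_def A_def a_def e_def
    by (rule weighted_gaussian_integral[OF P]) (use K g0 gt0 \<mu> in \<open>auto simp: less_imp_neq[symmetric]\<close>)
  then have "(\<integral>\<^sup>+z. ennreal (F2 z powr s) \<partial>lborel_vec n) = ennreal (C * (exp (k / 2) * sqrt (e / A)))"
    unfolding F2 using qm e A by (subst ennreal_mult) (auto simp: C_def nn_integral_cmult ennreal_mult less_imp_le)
  moreover have F2m: "F2 \<in> borel_measurable (lborel_vec n)" unfolding F2_def using qm by measurable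
  ultimately have hbi: "has_bochner_integral (lborel_vec n) (\<lambda>z. F2 z powr s) (C * (exp (k / 2) * sqrt (e / A)))"
    using e A by (intro has_bochner_integral_nn_integral) (auto simp: C_def)
  have intF2: "integrable (lborel_vec n) (\<lambda>z. F2 z powr s)"
    "(\<integral>z. F2 z powr s \<partial>lborel_vec n) = C * (exp (k / 2) * sqrt (e / A))"
    using hbi by (auto simp: has_bochner_integral_iff)
  have F1m: "F1 \<in> borel_measurable (lborel_vec n)" unfolding F1_def using qm f(1) by measurable
  have intF1: "integrable (lborel_vec n) (\<lambda>z. F1 z powr \<kappa>)"
    using f(3) by (rule Bochner_Integration.integrable_cong[THEN iffD1, rotated 2]) (auto simp: F1 space_lborel_vec)
  have eqF1: "(\<integral>z. F1 z powr \<kappa> \<partial>lborel_vec n) = (\<integral>z. f z powr \<kappa> * gaussian_density \<mu>' L' z \<partial>lborel_vec n)"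
    by (rule Bochner_Integration.integral_cong) (auto simp: F1 space_lborel_vec)
  have nonneg: "0 \<le> F1 z" "0 \<le> F2 z" if "z \<in> space (lborel_vec n)" for z
    using f(2)[OF space_lborel_vec[OF that]] e G by (auto simp: F1_def F2_def)
  note H = Hoelder_integral[OF \<kappa>(1) s(1,2) F1m F2m nonneg intF1 intF2(1)]
  show "integrable (lborel_vec n) (\<lambda>z. f z * w z)" unfolding w using H(1) .
  \<comment> \<open>The normalisation \<open>e\<close> cancels: it occurs with the powers
    \<open>- s / 2\<close>, \<open>(s - 1) / 2\<close> and \<open>1 / 2\<close>.\<close>
  have "C * (exp (k / 2) * sqrt (e / A)) = exp ((k - (\<Sum>i<n. s * ln (g i) + ln (a i))) / 2)"
  proof -
    have lnG: "ln G = (\<Sum>i<n. ln (g i))" "ln A = (\<Sum>i<n. ln (a i))"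
      unfolding G_def A_def by (rule ln_prod; use g0 a in force)+
    have "sqrt (e / A) = exp ((ln e - ln A) / 2)"
      using e A by (simp add: powr_half_sqrt[symmetric] powr_def ln_div)
    moreover have "C = exp (- s / 2 * (ln e + ln G) + (s - 1) / 2 * ln e)"
      unfolding C_def powr_def using e G by (simp add: ln_mult mult_exp_exp)
    ultimately have "C * (exp (k / 2) * sqrt (e / A)) = exp ((k - (s * ln G + ln A)) / 2)"
      by (simp add: mult_exp_exp algebra_simps add_divide_distrib diff_divide_distrib)
    then show ?thesis unfolding lnG by (simp add: sum.distrib sum_distrib_left)
  qed
  \<comment> \<open>\<open>bound_exponent\<close> is normalised so that the outer power
    \<open>1 / s\<close> in Hoelder's inequality removes the factor \<open>s\<close>.\<close>
  also have "\<dots> \<le> exp (s * bound_exponent \<kappa> \<theta> d \<gamma>)"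
  proof -
    define Lc where "Lc = 16 - 3 * ln \<gamma>"
    define c where "c = (s - 1) * Lc + 2 * (s - 1) / \<theta>"
    have "ln \<gamma> < 0" using \<gamma> by simp
    then have "0 \<le> Lc" by (simp add: Lc_def)
    then have c0: "0 \<le> c" unfolding c_def using s(1) \<kappa>(2) by simp
    have "- (s * ln (g i) + ln (a i)) \<le> s * \<delta> + c * (g i - 1)\<^sup>2 + 2 * s\<^sup>2 * \<delta>\<^sup>2 / ((s - 1) * \<theta>)" if i: "i < n" for i
      unfolding c_def a_def t_def s_def Lc_def
    proof (rule log_weight_bound[OF \<kappa> g0[OF i]])
      show "- ln (g i) \<le> 1 - g i + (16 - 3 * ln \<gamma>) * (1 - g i)\<^sup>2" by (rule neg_ln_bound[OF \<gamma> g(1)[OF i]])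
      show "\<theta> \<le> (1 - \<delta>) * \<kappa> - g i" by (rule \<theta>g[OF i])
    qed
    then have "(\<Sum>i<n. - (s * ln (g i) + ln (a i)))
        \<le> (\<Sum>i<n. s * \<delta> + c * (g i - 1)\<^sup>2 + 2 * s\<^sup>2 * \<delta>\<^sup>2 / ((s - 1) * \<theta>))"
      by (intro sum_mono) auto
    \<comment> \<open>Summation gives \<open>n * \<delta> = d\<close> for the linear cost of the
      damping; the quadratic cost even keeps a spare factor \<open>\<delta> \<le> d\<close>.\<close>
    also have "\<dots> = s * (n * \<delta>) + c * (\<Sum>i<n. (g i - 1)\<^sup>2) + 2 * s\<^sup>2 * ((n * \<delta>) * \<delta>) / ((s - 1) * \<theta>)"
      by (simp only: sum.distrib sum_distrib_left[symmetric] sum_constant card_lessThan) (simp add: power2_eq_square)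
    also have "\<dots> \<le> s * d + c * 9 + 2 * s\<^sup>2 * (d * d) / ((s - 1) * \<theta>)"
      unfolding \<delta>(4) using g(3) c0 s(1) \<kappa> d \<delta>(3)
      by (intro add_mono mult_left_mono divide_right_mono) auto
    finally have 1: "- (\<Sum>i<n. s * ln (g i) + ln (a i)) \<le> s * d + c * 9 + 2 * s\<^sup>2 * (d * d) / ((s - 1) * \<theta>)"
      unfolding sum_negf .
    have 2: "k \<le> s / \<theta>"
    proof -
      let ?\<eta> = "P' *\<^sub>v (\<mu> - \<mu>')"
      have \<eta>: "?\<eta> \<in> cv" using P \<mu> by simp
      have "t * (s - 1) * (?\<eta> $ i)\<^sup>2 / (t - (s - 1) * g i) \<le> s / \<theta> * (?\<eta> $ i)\<^sup>2" if i: "i < n" for i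
      proof -
        have "t * (s - 1) * (?\<eta> $ i)\<^sup>2 / (t - (s - 1) * g i) \<le> s * (s - 1) * (?\<eta> $ i)\<^sup>2 / ((s - 1) * \<theta>)"
          using gt[OF i] gt0[OF i] s(1) \<kappa> \<delta> unfolding t_def
          by (intro frac_le mult_right_mono mult_nonneg_nonneg) (auto simp: mult_left_le)
        also have "\<dots> = ((s - 1) * (s * (?\<eta> $ i)\<^sup>2)) / ((s - 1) * \<theta>)" by (simp only: ac_simps)
        also have "\<dots> = s * (?\<eta> $ i)\<^sup>2 / \<theta>" using s(1) by (intro mult_divide_mult_cancel_left) simp
        finally show ?thesis by simp
      qed
      then have "k \<le> (\<Sum>i<n. s / \<theta> * (?\<eta> $ i)\<^sup>2)" unfolding k_def by (intro sum_mono) auto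
      also have "\<dots> = s / \<theta> * (vnorm ?\<eta>)\<^sup>2"
        unfolding vnorm_sq scalar_prod_sum[OF \<eta>] by (simp add: sum_distrib_left power2_eq_square)
      also have "\<dots> \<le> s / \<theta> * 1"
        using \<mu>(3) s(1) \<kappa> by (intro mult_left_mono) (auto simp: power_le_one)
      finally show ?thesis by simp
    qed
    have sd: "s\<^sup>2 / (s - 1) = s * \<kappa>" using s(1,3) by (metis power2_eq_square nonzero_mult_div_cancel_left less_irrefl
          diff_gt_0_iff_gt mult.assoc mult.left_commute)
    have "s * bound_exponent \<kappa> \<theta> d \<gamma> = (s * d + 9 * Lc * (s / \<kappa>) + 18 / \<theta> * (s / \<kappa>) + 2 * (s * \<kappa>) * d\<^sup>2 / \<theta> + s / \<theta>) / 2"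
      unfolding bound_exponent_def Lc_def using \<kappa> by (simp add: field_simps)
    also have "\<dots> = (s * d + c * 9 + 2 * s\<^sup>2 * (d * d) / ((s - 1) * \<theta>) + s / \<theta>) / 2"
      unfolding s(4) sd[symmetric] c_def by (simp add: field_simps power2_eq_square)
    finally show ?thesis using 1 2 by simp
  qed
  finally have "(C * (exp (k / 2) * sqrt (e / A))) powr (1 / s) \<le> exp (s * bound_exponent \<kappa> \<theta> d \<gamma>) powr (1 / s)"
    using e A s(1) by (intro powr_mono2) (auto simp: C_def)
  also have "\<dots> = exp (bound_exponent \<kappa> \<theta> d \<gamma>)" using s(1) by (simp add: powr_def)
  finally have "(\<integral>z. F2 z powr s \<partial>lborel_vec n) powr (1 / s) \<le> exp (bound_exponent \<kappa> \<theta> d \<gamma>)" unfolding intF2(2) .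
  then show "(\<integral>z. f z * w z \<partial>lborel_vec n)
      \<le> (\<integral>z. f z powr \<kappa> * gaussian_density \<mu>' L' z \<partial>lborel_vec n) powr (1 / \<kappa>) * exp (bound_exponent \<kappa> \<theta> d \<gamma>)"
    unfolding w using H(2) eqF1 by (smt (verit) mult_left_mono powr_ge_zero)
qed

end

section \<open>Differentiation of Gaussian densities\<close>

text \<open>A remainder of order \<open>s\<^sup>2\<close> certifies differentiability of maps given
  implicitly, such as \<open>minv\<close> and \<open>lyap\<close>, for which an exact second-order
  expansion is available.\<close>

lemma DERIV_quadratic_remainder:
  fixes f :: "real \<Rightarrow> real"
  assumes "\<forall>\<^sub>F s in at 0. \<bar>f s - f 0 - s * D\<bar> \<le> C * s\<^sup>2"
  shows "(f has_real_derivative D) (at 0)"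
proof -
  have "((\<lambda>h. (f h - f 0) / h - D) \<longlongrightarrow> 0) (at 0)"
  proof (rule Lim_null_comparison)
    show "\<forall>\<^sub>F h in at 0. norm ((f h - f 0) / h - D) \<le> C * \<bar>h\<bar>"
      using assms eventually_neq_at_within[of "0 :: real" "0 :: real" UNIV]
    proof eventually_elim
      case (elim h)
      have h: "h \<noteq> 0" using elim(2) .
      then have "D = h * D / h" by simp
      then have "(f h - f 0) / h - D = (f h - f 0 - h * D) / h" by (metis diff_divide_distrib)
      then have "norm ((f h - f 0) / h - D) = \<bar>f h - f 0 - h * D\<bar> / \<bar>h\<bar>" by (simp only: real_norm_def abs_divide)
      also have "\<dots> \<le> C * h\<^sup>2 / \<bar>h\<bar>" using elim(1) by (rule divide_right_mono) simp
      also have "\<dots> = C * \<bar>h\<bar>" using h abs_mult_self_eq[of h] by (simp add: power2_eq_square field_simps)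
      finally show ?case .
    qed
    show "((\<lambda>h. C * \<bar>h\<bar>) \<longlongrightarrow> 0) (at 0)" by (auto intro!: tendsto_eq_intros)
  qed
  then show ?thesis by (simp add: DERIV_def LIM_zero_iff)
qed

text \<open>The mean value theorem bounds the difference quotients by \<open>h\<close>, so dominated
  convergence applies along every sequence tending to zero. Measurability of \<open>f' 0\<close> is
  that of a pointwise limit of quotients.\<close>

lemma has_derivative_integral_dominated:
  fixes f f' :: "real \<Rightarrow> 'a \<Rightarrow> real"
  assumes \<rho>: "0 < \<rho>"
    and D: "\<And>s z. \<bar>s\<bar> < \<rho> \<Longrightarrow> z \<in> space M \<Longrightarrow> ((\<lambda>s. f s z) has_real_derivative f' s z) (at s)"
    and b: "\<And>s z. \<bar>s\<bar> < \<rho> \<Longrightarrow> z \<in> space M \<Longrightarrow> \<bar>f' s z\<bar> \<le> h z" and h: "integrable M h"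
    and f: "\<And>s. \<bar>s\<bar> < \<rho> \<Longrightarrow> integrable M (f s)"
  shows "integrable M (f' 0)" "((\<lambda>s. \<integral>z. f s z \<partial>M) has_real_derivative (\<integral>z. f' 0 z \<partial>M)) (at 0)"
proof -
  have quot: "\<bar>(f s z - f 0 z) / s\<bar> \<le> h z" if "\<bar>s\<bar> < \<rho>" "s \<noteq> 0" "z \<in> space M" for s z
  proof -
    have "\<exists>c. \<bar>c\<bar> < \<rho> \<and> f s z - f 0 z = s * f' c z"
    proof (cases "0 < s")
      case True
      then have "\<exists>c>0. c < s \<and> f s z - f 0 z = (s - 0) * f' c z" using that by (intro MVT2 D) auto
      then obtain c where "0 < c" "c < s" "f s z - f 0 z = (s - 0) * f' c z" by blast
      then show ?thesis using that by (intro exI[of _ c]) auto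
    next
      case False
      then have "\<exists>c>s. c < 0 \<and> f 0 z - f s z = (0 - s) * f' c z" using that by (intro MVT2 D) auto
      then obtain c where "s < c" "c < 0" "f 0 z - f s z = (0 - s) * f' c z" by blast
      then show ?thesis using that by (intro exI[of _ c]) auto
    qed
    then obtain c where "\<bar>c\<bar> < \<rho>" "f s z - f 0 z = s * f' c z" by blast
    then show ?thesis using b[of c z] that by simp
  qed
  have main: "integrable M (f' 0) \<and> (\<lambda>i. ((\<integral>z. f (S i) z \<partial>M) - (\<integral>z. f 0 z \<partial>M)) / S i) \<longlonglongrightarrow> (\<integral>z. f' 0 z \<partial>M)"
    if S: "\<And>i. S i \<noteq> 0" "S \<longlonglongrightarrow> 0" for S :: "nat \<Rightarrow> real"
  proof -
    \<comment> \<open>The quotient is set to \<open>0\<close> outside the interval, where no bound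
      is available; the sequence eventually stays inside.\<close>
    define g where "g i z = (if \<bar>S i\<bar> < \<rho> then (f (S i) z - f 0 z) / S i else 0)" for i z
    have ev: "\<forall>\<^sub>F i in sequentially. \<bar>S i\<bar> < \<rho>"
      using tendstoD[OF S(2) \<rho>] by (simp add: dist_real_def)
    have gm: "g i \<in> borel_measurable M" for i
      unfolding g_def using f[of "S i"] f[of 0] \<rho> by (cases "\<bar>S i\<bar> < \<rho>") auto
    have lim: "(\<lambda>i. g i z) \<longlonglongrightarrow> f' 0 z" if z: "z \<in> space M" for z
    proof -
      have "(\<lambda>h. (f (0 + h) z - f 0 z) / h) \<midarrow>0\<rightarrow> f' 0 z" using D[of 0 z] z \<rho> by (simp add: DERIV_def)
      then have "(\<lambda>i. (f (0 + S i) z - f 0 z) / S i) \<longlonglongrightarrow> f' 0 z"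
        using S by (simp add: LIMSEQ_SEQ_conv[symmetric])
      then show ?thesis
        by (rule Lim_transform_eventually) (use ev in eventually_elim, simp add: g_def)
    qed
    have f'm: "f' 0 \<in> borel_measurable M" by (rule borel_measurable_LIMSEQ_real[OF lim gm])
    have bd: "AE z in M. norm (g i z) \<le> \<bar>h z\<bar>" for i
      using quot S(1)[of i] by (intro AE_I2) (auto simp: g_def intro: order_trans[OF _ abs_ge_self])
    have AElim: "AE z in M. (\<lambda>i. g i z) \<longlonglongrightarrow> f' 0 z" using lim by (intro AE_I2)
    have habs: "integrable M (\<lambda>z. \<bar>h z\<bar>)" using h by simp
    have 1: "integrable M (f' 0)" by (rule integrable_dominated_convergence[OF f'm gm habs AElim bd])
    have 2: "(\<lambda>i. \<integral>z. g i z \<partial>M) \<longlonglongrightarrow> (\<integral>z. f' 0 z \<partial>M)"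
      by (rule integral_dominated_convergence[OF f'm gm habs AElim bd])
    have "\<forall>\<^sub>F i in sequentially. (\<integral>z. g i z \<partial>M) = ((\<integral>z. f (S i) z \<partial>M) - (\<integral>z. f 0 z \<partial>M)) / S i"
      using ev
    proof eventually_elim
      case (elim i)
      then show ?case unfolding g_def using f[OF elim] f[of 0] \<rho> by simp
    qed
    with 2 have "(\<lambda>i. ((\<integral>z. f (S i) z \<partial>M) - (\<integral>z. f 0 z \<partial>M)) / S i) \<longlonglongrightarrow> (\<integral>z. f' 0 z \<partial>M)"
      by (rule Lim_transform_eventually)
    with 1 show ?thesis by blast
  qed
  have "(\<lambda>i. 1 / real (Suc i)) \<longlonglongrightarrow> 0" by (rule LIMSEQ_Suc[OF lim_1_over_n])
  then show "integrable M (f' 0)" using main[of "\<lambda>i. 1 / real (Suc i)"] by simp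
  show "((\<lambda>s. \<integral>z. f s z \<partial>M) has_real_derivative (\<integral>z. f' 0 z \<partial>M)) (at 0)"
    unfolding DERIV_def using main by (subst LIMSEQ_SEQ_conv[symmetric]) simp
qed

text \<open>The derivative of the logarithm of the Gaussian density at \<open>z\<close> when mean
  and covariance move in the direction \<open>(\<nu>, W)\<close>.\<close>

definition score :: "real vec \<Rightarrow> real mat \<Rightarrow> real vec \<Rightarrow> real mat \<Rightarrow> real vec \<Rightarrow> real" where
  "score \<mu> L \<nu> W z = (let u = minv L *\<^sub>v (z - \<mu>) in \<nu> \<bullet> u + u \<bullet> (W *\<^sub>v u) / 2 - tr (minv L * W) / 2)"

text \<open>The derivative of the score for \<open>(\<nu>', W)\<close> when its base point moves
  along \<open>(\<nu>, V)\<close>.\<close>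

definition dscore :: "real vec \<Rightarrow> real mat \<Rightarrow> real vec \<Rightarrow> real mat \<Rightarrow> real vec \<Rightarrow> real mat \<Rightarrow> real vec \<Rightarrow> real" where
  "dscore \<mu> L \<nu> V \<nu>' W z = (let u = minv L *\<^sub>v (z - \<mu>) in
     tr (minv L * V * minv L * W) / 2 - (\<nu>' + W *\<^sub>v u) \<bullet> (minv L *\<^sub>v (V *\<^sub>v u + \<nu>)))"

context fixed_dim
begin

section \<open>Derivatives of inverse, trace and determinant along a segment\<close>

lemma sym_quadratic_le: "V \<in> cm \<Longrightarrow> v \<in> cv \<Longrightarrow> \<bar>v \<bullet> (V *\<^sub>v v)\<bar> \<le> fnorm V * (v \<bullet> v)"
proof -
  assume a: "V \<in> cm" "v \<in> cv"
  have "\<bar>v \<bullet> (V *\<^sub>v v)\<bar> \<le> vnorm v * vnorm (V *\<^sub>v v)" using Cauchy_Schwarz a by simp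
  also have "\<dots> \<le> vnorm v * (fnorm V * vnorm v)" using vnorm_mat_vec_le a by (intro mult_left_mono) auto
  finally show ?thesis unfolding vnorm_sq[symmetric] by (simp add: power2_eq_square algebra_simps)
qed

text \<open>Half of the coercivity constant of \<open>L\<close> absorbs the perturbation and half
  survives. The surviving constant is the same on the whole segment, which later bounds the inverses
  uniformly.\<close>

lemma spd_perturbation:
  assumes L: "L \<in> spd n" and V: "V \<in> sym_mats n"
  obtains \<rho> c where "0 < \<rho>" "0 < c" "\<And>s. \<bar>s\<bar> < \<rho> \<Longrightarrow> L + s \<cdot>\<^sub>m V \<in> spd n"
    "\<And>s v. \<bar>s\<bar> < \<rho> \<Longrightarrow> v \<in> cv \<Longrightarrow> c * (v \<bullet> v) \<le> v \<bullet> ((L + s \<cdot>\<^sub>m V) *\<^sub>v v)"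
proof -
  note [simp] = spdD(2)[OF L] symD(1)[OF V]
  obtain c where c: "0 < c" "\<And>v. v \<in> cv \<Longrightarrow> c * (v \<bullet> v) \<le> v \<bullet> (L *\<^sub>v v)" using spd_coercive[OF L] by blast
  define \<rho> where "\<rho> = c / (2 * (1 + fnorm V))"
  have F: "0 < 1 + fnorm V" by (simp add: add_pos_nonneg)
  have \<rho>: "0 < \<rho>" using c F by (simp add: \<rho>_def)
  have lower: "c / 2 * (v \<bullet> v) \<le> v \<bullet> ((L + s \<cdot>\<^sub>m V) *\<^sub>v v)" if s: "\<bar>s\<bar> < \<rho>" and v: "v \<in> cv" for s v
  proof -
    have vv: "0 \<le> v \<bullet> v" by (simp add: vnorm_sq[symmetric])
    have "\<bar>s\<bar> * fnorm V \<le> \<rho> * (1 + fnorm V)" using s by (intro mult_mono) auto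
    also have "\<dots> = c / 2" using F by (simp add: \<rho>_def field_simps)
    finally have sV: "\<bar>s\<bar> * fnorm V \<le> c / 2" .
    have "\<bar>s * (v \<bullet> (V *\<^sub>v v))\<bar> \<le> \<bar>s\<bar> * (fnorm V * (v \<bullet> v))"
      unfolding abs_mult using sym_quadratic_le v by (intro mult_left_mono) auto
    also have "\<dots> \<le> c / 2 * (v \<bullet> v)" using mult_right_mono[OF sV vv] by (simp add: mult.assoc)
    finally have "- (c / 2 * (v \<bullet> v)) \<le> s * (v \<bullet> (V *\<^sub>v v))" by linarith
    then show ?thesis using c(2)[OF v] v by (simp add: mat_vec_simps dot_simps)
  qed
  have "L + s \<cdot>\<^sub>m V \<in> spd n" if s: "\<bar>s\<bar> < \<rho>" for s
    unfolding spd_def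
  proof (intro CollectI conjI ballI impI)
    show "L + s \<cdot>\<^sub>m V \<in> sym_mats n" by (intro sym_closed spdD(1)[OF L] V)
    fix v assume v: "v \<in> cv" "v \<noteq> 0\<^sub>v n"
    then have "0 < v \<bullet> v" using dot_self_eq_0[OF v(1)] vnorm_sq[of v] by (metis less_le zero_le_power2)
    then have "0 < c / 2 * (v \<bullet> v)" using c by simp
    then show "0 < v \<bullet> ((L + s \<cdot>\<^sub>m V) *\<^sub>v v)" using lower[OF s v(1)] by linarith
  qed
  then show ?thesis using that[of \<rho> "c / 2"] \<rho> c lower by auto
qed

lemma minv_bound:
  assumes M: "M \<in> spd n" and c: "0 < c" "\<And>v. v \<in> cv \<Longrightarrow> c * (v \<bullet> v) \<le> v \<bullet> (M *\<^sub>v v)" and x: "x \<in> cv"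
  shows "vnorm (minv M *\<^sub>v x) \<le> vnorm x / c"
proof -
  note [simp] = spdD(2)[OF M] spd_minv(4)[OF M]
  let ?v = "minv M *\<^sub>v x"
  have v: "?v \<in> cv" using x by simp
  have "c * (vnorm ?v)\<^sup>2 \<le> ?v \<bullet> (M *\<^sub>v ?v)" unfolding vnorm_sq by (rule c(2)[OF v])
  also have "M *\<^sub>v ?v = x" using x spd_minv(2)[OF M] by (simp add: inverse_cancel)
  also have "?v \<bullet> x \<le> vnorm ?v * vnorm x" using Cauchy_Schwarz[OF v x] by simp
  finally have "vnorm ?v * (c * vnorm ?v) \<le> vnorm ?v * vnorm x" by (simp add: power2_eq_square algebra_simps)
  then show ?thesis using c(1) by (cases "vnorm ?v = 0") (auto simp: field_simps less_le)
qed

text \<open>The resolvent identity.\<close>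

lemma minv_difference:
  assumes L: "L \<in> spd n" "L + s \<cdot>\<^sub>m V \<in> spd n" and V: "V \<in> cm" and x: "x \<in> cv"
  shows "minv (L + s \<cdot>\<^sub>m V) *\<^sub>v x - minv L *\<^sub>v x = (- s) \<cdot>\<^sub>v (minv (L + s \<cdot>\<^sub>m V) *\<^sub>v (V *\<^sub>v (minv L *\<^sub>v x)))"
proof -
  note [simp] = spdD(2)[OF L(1)] spd_minv(4)[OF L(1)] spd_minv(4)[OF L(2)] V x spdD(2)[OF L(2)]
  let ?K = "minv L" and ?Ks = "minv (L + s \<cdot>\<^sub>m V)"
  have "?Ks *\<^sub>v x = ?Ks *\<^sub>v (L *\<^sub>v (?K *\<^sub>v x))" using spd_minv(2)[OF L(1)] by (simp add: inverse_cancel)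
  moreover have "?K *\<^sub>v x = ?Ks *\<^sub>v ((L + s \<cdot>\<^sub>m V) *\<^sub>v (?K *\<^sub>v x))"
    using inverse_cancel(4)[OF spdD(2)[OF L(2)] spd_minv(4)[OF L(2)] spd_minv(2)[OF L(2)], of "?K *\<^sub>v x"] by simp
  moreover have "?Ks *\<^sub>v ((L + s \<cdot>\<^sub>m V) *\<^sub>v (?K *\<^sub>v x))
      = ?Ks *\<^sub>v (L *\<^sub>v (?K *\<^sub>v x)) + s \<cdot>\<^sub>v (?Ks *\<^sub>v (V *\<^sub>v (?K *\<^sub>v x)))"
    by (simp add: mat_vec_simps)
  ultimately have "?Ks *\<^sub>v x - ?K *\<^sub>v x
      = ?Ks *\<^sub>v (L *\<^sub>v (?K *\<^sub>v x)) - (?Ks *\<^sub>v (L *\<^sub>v (?K *\<^sub>v x)) + s \<cdot>\<^sub>v (?Ks *\<^sub>v (V *\<^sub>v (?K *\<^sub>v x))))"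
    by metis
  also have "\<dots> = (- s) \<cdot>\<^sub>v (?Ks *\<^sub>v (V *\<^sub>v (?K *\<^sub>v x)))"
    by (rule eq_vecI) (auto simp del: index_mult_mat_vec)
  finally show ?thesis .
qed

text \<open>Using the resolvent identity twice leaves exactly \<open>s\<^sup>2 * (a \<bullet> (minv
  (L + s \<cdot>\<^sub>m V) *\<^sub>v b2))\<close>, and perturbed inverses are uniformly
  bounded.\<close>

lemma DERIV_minv:
  assumes L: "L \<in> spd n" and V: "V \<in> sym_mats n" and a: "a \<in> cv" and b: "b \<in> cv"
  shows "((\<lambda>s. a \<bullet> (minv (L + s \<cdot>\<^sub>m V) *\<^sub>v b)) has_real_derivative
    - (a \<bullet> (minv L *\<^sub>v (V *\<^sub>v (minv L *\<^sub>v b))))) (at 0)"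
proof -
  obtain \<rho> c where \<rho>: "0 < \<rho>" "0 < c" "\<And>s. \<bar>s\<bar> < \<rho> \<Longrightarrow> L + s \<cdot>\<^sub>m V \<in> spd n"
    "\<And>s v. \<bar>s\<bar> < \<rho> \<Longrightarrow> v \<in> cv \<Longrightarrow> c * (v \<bullet> v) \<le> v \<bullet> ((L + s \<cdot>\<^sub>m V) *\<^sub>v v)"
    using spd_perturbation[OF L V] by blast
  note [simp] = spdD(2)[OF L] symD(1)[OF V] spd_minv(4)[OF L] a b
  define b1 where "b1 = V *\<^sub>v (minv L *\<^sub>v b)"
  define b2 where "b2 = V *\<^sub>v (minv L *\<^sub>v b1)"
  have [simp]: "b1 \<in> cv" "b2 \<in> cv" by (simp_all add: b1_def b2_def)
  have L0: "L + 0 \<cdot>\<^sub>m V = L" by (rule eq_matI) auto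
  define C where "C = vnorm a * (vnorm b2 / c)"
  have "\<bar>a \<bullet> (minv (L + s \<cdot>\<^sub>m V) *\<^sub>v b) - a \<bullet> (minv (L + 0 \<cdot>\<^sub>m V) *\<^sub>v b) - s * - (a \<bullet> (minv L *\<^sub>v b1))\<bar> \<le> C * s\<^sup>2"
    if s: "\<bar>s\<bar> < \<rho>" for s
  proof -
    note Ls = \<rho>(3)[OF s]
    note [simp] = spd_minv(4)[OF Ls]
    have d: "a \<bullet> (minv (L + s \<cdot>\<^sub>m V) *\<^sub>v x) - a \<bullet> (minv L *\<^sub>v x) = - s * (a \<bullet> (minv (L + s \<cdot>\<^sub>m V) *\<^sub>v (V *\<^sub>v (minv L *\<^sub>v x))))"
      if x: "x \<in> cv" for x
      using arg_cong[OF minv_difference[OF L Ls symD(1)[OF V] x], of "\<lambda>y. a \<bullet> y"] x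
      by (simp add: dot_simps)
    have "a \<bullet> (minv (L + s \<cdot>\<^sub>m V) *\<^sub>v b) - a \<bullet> (minv L *\<^sub>v b) + s * (a \<bullet> (minv L *\<^sub>v b1))
        = - s * (a \<bullet> (minv (L + s \<cdot>\<^sub>m V) *\<^sub>v b1) - a \<bullet> (minv L *\<^sub>v b1))"
      using d[OF b] unfolding b1_def[symmetric] by (simp add: algebra_simps)
    also have "\<dots> = s\<^sup>2 * (a \<bullet> (minv (L + s \<cdot>\<^sub>m V) *\<^sub>v b2))"
      using d[of b1] unfolding b2_def[symmetric] by (simp add: power2_eq_square)
    finally have e: "a \<bullet> (minv (L + s \<cdot>\<^sub>m V) *\<^sub>v b) - a \<bullet> (minv L *\<^sub>v b) + s * (a \<bullet> (minv L *\<^sub>v b1))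
        = s\<^sup>2 * (a \<bullet> (minv (L + s \<cdot>\<^sub>m V) *\<^sub>v b2))" .
    have "\<bar>a \<bullet> (minv (L + s \<cdot>\<^sub>m V) *\<^sub>v b2)\<bar> \<le> vnorm a * vnorm (minv (L + s \<cdot>\<^sub>m V) *\<^sub>v b2)"
      by (rule Cauchy_Schwarz) simp_all
    also have "\<dots> \<le> C" unfolding C_def using minv_bound[OF Ls \<rho>(2) \<rho>(4)[OF s], of b2]
      by (intro mult_left_mono) simp_all
    finally have "\<bar>s\<^sup>2 * (a \<bullet> (minv (L + s \<cdot>\<^sub>m V) *\<^sub>v b2))\<bar> \<le> s\<^sup>2 * C"
      unfolding abs_mult by (simp add: mult_left_mono)
    then show ?thesis unfolding L0 using e by (simp add: mult.commute)
  qed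
  then have "\<forall>\<^sub>F s in at 0. \<bar>a \<bullet> (minv (L + s \<cdot>\<^sub>m V) *\<^sub>v b) - a \<bullet> (minv (L + 0 \<cdot>\<^sub>m V) *\<^sub>v b) - s * - (a \<bullet> (minv L *\<^sub>v b1))\<bar> \<le> C * s\<^sup>2"
    unfolding eventually_at using \<rho>(1) by (auto simp: dist_real_def)
  then show ?thesis unfolding b1_def by (rule DERIV_quadratic_remainder)
qed

lemma tr_as_sum: "A \<in> cm \<Longrightarrow> tr A = (\<Sum>j<n. unit_vec n j \<bullet> (A *\<^sub>v unit_vec n j))"
  by (simp add: tr_sum)

lemma DERIV_tr_minv:
  assumes L: "L \<in> spd n" and V: "V \<in> sym_mats n" and W: "W \<in> cm"
  shows "((\<lambda>s. tr (minv (L + s \<cdot>\<^sub>m V) * W)) has_real_derivative - tr (minv L * V * minv L * W)) (at 0)"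
proof -
  note [simp] = spdD(2)[OF L] symD(1)[OF V] spd_minv(4)[OF L] W
  obtain \<rho> c where \<rho>: "0 < \<rho>" "\<And>s. \<bar>s\<bar> < \<rho> \<Longrightarrow> L + s \<cdot>\<^sub>m V \<in> spd n"
    using spd_perturbation[OF L V] by metis
  let ?e = "unit_vec n :: nat \<Rightarrow> real vec"
  have "((\<lambda>s. \<Sum>j<n. ?e j \<bullet> (minv (L + s \<cdot>\<^sub>m V) *\<^sub>v (W *\<^sub>v ?e j))) has_real_derivative
    (\<Sum>j<n. - (?e j \<bullet> (minv L *\<^sub>v (V *\<^sub>v (minv L *\<^sub>v (W *\<^sub>v ?e j))))))) (at 0)"
    by (intro DERIV_sum DERIV_minv L V) simp_all
  moreover have "(\<Sum>j<n. - (?e j \<bullet> (minv L *\<^sub>v (V *\<^sub>v (minv L *\<^sub>v (W *\<^sub>v ?e j)))))) = - tr (minv L * V * minv L * W)"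
    unfolding sum_negf by (subst tr_as_sum) (simp_all only: mat_vec_simps closed unit_vec_carrier W
        spd_minv(4)[OF L] symD(1)[OF V])
  moreover have "\<forall>\<^sub>F s in nhds 0. tr (minv (L + s \<cdot>\<^sub>m V) * W) = (\<Sum>j<n. ?e j \<bullet> (minv (L + s \<cdot>\<^sub>m V) *\<^sub>v (W *\<^sub>v ?e j)))"
    unfolding eventually_nhds_metric
  proof (intro exI[of _ \<rho>] conjI allI impI \<rho>(1))
    fix s :: real assume "dist s 0 < \<rho>"
    then have "minv (L + s \<cdot>\<^sub>m V) \<in> cm" using \<rho>(2)[of s] spd_minv(4) by (simp add: dist_real_def)
    then show "tr (minv (L + s \<cdot>\<^sub>m V) * W) = (\<Sum>j<n. ?e j \<bullet> (minv (L + s \<cdot>\<^sub>m V) *\<^sub>v (W *\<^sub>v ?e j)))"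
      by (subst tr_as_sum) (simp_all only: mat_vec_simps closed unit_vec_carrier W)
  qed
  ultimately show ?thesis by (subst DERIV_cong_ev[OF refl _ refl]) auto
qed

text \<open>Jacobi's formula by diagonalisation: \<open>L + s \<cdot>\<^sub>m V = R * (1\<^sub>m n +
  s \<cdot>\<^sub>m W) * R\<close> with \<open>R = msqrt L\<close>, so the determinant is
  \<open>det L\<close> times the product of the factors \<open>1 + s * d i\<close>, whose derivative
  at zero is the trace of \<open>W\<close>.\<close>

lemma DERIV_det:
  assumes L: "L \<in> spd n" and V: "V \<in> sym_mats n"
  shows "((\<lambda>s. det (L + s \<cdot>\<^sub>m V)) has_real_derivative det L * tr (minv L * V)) (at 0)"
proof -
  define R where "R = msqrt L"
  note R = spd_msqrt[OF L, folded R_def]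
  define I where "I = minv R"
  note I = spd_minv[OF R(1), folded I_def]
  note [simp] = spdD(2)[OF L] symD(1)[OF V] spdD(2)[OF R(1)] spdD(2)[OF I(1)]
  note cancel = inverse_cancel[OF spdD(2)[OF R(1)] spdD(2)[OF I(1)] I(2)]
  define W where "W = I * V * I"
  have W: "W \<in> sym_mats n" unfolding W_def by (rule sym_closed(5)[OF V spdD(1)[OF I(1)]])
  obtain Q d where Q: "Q \<in> cm" "Q * transpose_mat Q = 1\<^sub>m n" "transpose_mat Q * Q = 1\<^sub>m n"
    "W = Q * mat_diag n d * transpose_mat Q"
    using spectral_theorem[OF W] by blast
  have det: "det (L + s \<cdot>\<^sub>m V) = det L * (\<Prod>i<n. 1 + s * d i)" for s
  proof -
    have D: "mat_diag n (\<lambda>i. 1 + s * d i) = 1\<^sub>m n + s \<cdot>\<^sub>m mat_diag n d"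
      by (rule eq_matI) (auto simp: mat_diag_def)
    have "Q * mat_diag n (\<lambda>i. 1 + s * d i) * transpose_mat Q = 1\<^sub>m n + s \<cdot>\<^sub>m W"
      unfolding D Q(4) using Q(1,2) by (simp add: mat_simps)
    then have "det (1\<^sub>m n + s \<cdot>\<^sub>m W) = (\<Prod>i<n. 1 + s * d i)" using det_spectral[OF Q(1,2)] by metis
    moreover have "L + s \<cdot>\<^sub>m V = R * (1\<^sub>m n + s \<cdot>\<^sub>m W) * R"
      unfolding W_def using R(2) I(3) by (simp add: mat_simps cancel)
    moreover have "det L = det R * det R" using det_mult[of R n R] R(2) by simp
    ultimately show ?thesis using symD(1)[OF W] by (simp add: det_mult[of _ n])
  qed
  have "minv L = I * I" using spd_square(2)[OF R(1)] R(2) by (simp add: I_def)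
  then have "tr (minv L * V) = tr (I * (I * V))" by (simp add: mat_simps)
  also have "\<dots> = tr (I * V * I)" by (rule tr_comm) simp_all
  also have "\<dots> = tr (Q * (mat_diag n d * transpose_mat Q))" using Q(1) unfolding W_def[symmetric] Q(4) by (simp add: mat_simps)
  also have "\<dots> = tr (mat_diag n d * transpose_mat Q * Q)" using Q(1) by (intro tr_comm) simp_all
  also have "\<dots> = (\<Sum>i<n. d i)" using Q(1,3) by (simp add: mat_simps tr_sum) (simp add: mat_diag_def)
  finally have tr: "tr (minv L * V) = (\<Sum>i<n. d i)" .
  have "((\<lambda>s. \<Prod>i<n. 1 + s * d i) has_real_derivative (\<Sum>i<n. d i * (\<Prod>j\<in>{..<n} - {i}. 1 + 0 * d j))) (at 0)"
    by (rule has_field_derivative_prod) (auto intro!: derivative_eq_intros)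
  then have "((\<lambda>s. det L * (\<Prod>i<n. 1 + s * d i)) has_real_derivative det L * (\<Sum>i<n. d i)) (at 0)"
    by (intro DERIV_cmult) simp
  then show ?thesis unfolding det tr .
qed

text \<open>Membership in the carrier is required only near \<open>0\<close>, because curves built
  from \<open>minv (L + s \<cdot>\<^sub>m V)\<close> are controlled only while the matrix stays
  positive definite.\<close>

definition has_vderiv :: "(real \<Rightarrow> real vec) \<Rightarrow> real vec \<Rightarrow> bool" where
  "has_vderiv u u' \<longleftrightarrow> u' \<in> cv \<and> (\<forall>\<^sub>F s in nhds 0. u s \<in> cv) \<and>
     (\<forall>i<n. ((\<lambda>s. u s $ i) has_real_derivative u' $ i) (at 0))"

lemma has_vderiv_dot:
  assumes u: "has_vderiv u u'" and w: "has_vderiv w w'"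
  shows "((\<lambda>s. u s \<bullet> w s) has_real_derivative u' \<bullet> w 0 + u 0 \<bullet> w') (at 0)"
proof -
  have w0: "w 0 \<in> cv" using w eventually_nhds_x_imp_x unfolding has_vderiv_def by blast
  have w': "w' \<in> cv" using w unfolding has_vderiv_def by blast
  have "((\<lambda>s. \<Sum>i<n. u s $ i * w s $ i) has_real_derivative (\<Sum>i<n. u' $ i * w 0 $ i + w' $ i * u 0 $ i)) (at 0)"
    using u w unfolding has_vderiv_def by (intro DERIV_sum DERIV_mult) auto
  moreover have "(\<Sum>i<n. u' $ i * w 0 $ i + w' $ i * u 0 $ i) = u' \<bullet> w 0 + u 0 \<bullet> w'"
    unfolding scalar_prod_sum[OF w0] scalar_prod_sum[OF w'] by (simp add: sum.distrib mult.commute)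
  moreover have "\<forall>\<^sub>F s in nhds 0. u s \<bullet> w s = (\<Sum>i<n. u s $ i * w s $ i)"
    using w unfolding has_vderiv_def by (auto elim!: eventually_mono simp: scalar_prod_sum)
  ultimately show ?thesis by (subst DERIV_cong_ev[OF refl _ refl]) auto
qed

lemma has_vderiv_mat_vec:
  assumes A: "A \<in> cm" and u: "has_vderiv u u'"
  shows "has_vderiv (\<lambda>s. A *\<^sub>v u s) (A *\<^sub>v u')"
  unfolding has_vderiv_def
proof (intro conjI allI impI)
  have u': "u' \<in> cv" and ev: "\<forall>\<^sub>F s in nhds 0. u s \<in> cv" using u unfolding has_vderiv_def by blast+
  show "A *\<^sub>v u' \<in> cv" using A u' by simp
  show "\<forall>\<^sub>F s in nhds 0. A *\<^sub>v u s \<in> cv" using ev A by (auto elim!: eventually_mono)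
  fix i assume i: "i < n"
  have "((\<lambda>s. \<Sum>j<n. A $$ (i, j) * u s $ j) has_real_derivative (\<Sum>j<n. A $$ (i, j) * u' $ j)) (at 0)"
    using u unfolding has_vderiv_def by (intro DERIV_sum DERIV_cmult) auto
  moreover have "\<forall>\<^sub>F s in nhds 0. (A *\<^sub>v u s) $ i = (\<Sum>j<n. A $$ (i, j) * u s $ j)"
    using ev by eventually_elim (rule mat_vec_index[OF A _ i])
  ultimately show "((\<lambda>s. (A *\<^sub>v u s) $ i) has_real_derivative (A *\<^sub>v u') $ i) (at 0)"
    unfolding mat_vec_index[OF A u' i] by (subst DERIV_cong_ev[OF refl _ refl]) auto
qed

lemma has_vderiv_const: "a \<in> cv \<Longrightarrow> has_vderiv (\<lambda>s. a) (0\<^sub>v n)"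
  by (auto simp: has_vderiv_def)

lemma has_vderiv_line: "y \<in> cv \<Longrightarrow> \<nu> \<in> cv \<Longrightarrow> has_vderiv (\<lambda>s. y - s \<cdot>\<^sub>v \<nu>) ((-1) \<cdot>\<^sub>v \<nu>)"
  by (auto simp: has_vderiv_def intro!: derivative_eq_intros)

lemma has_vderiv_minv:
  assumes L: "L \<in> spd n" and V: "V \<in> sym_mats n" and y: "y \<in> cv" and \<nu>: "\<nu> \<in> cv"
  shows "has_vderiv (\<lambda>s. minv (L + s \<cdot>\<^sub>m V) *\<^sub>v (y - s \<cdot>\<^sub>v \<nu>)) ((-1) \<cdot>\<^sub>v (minv L *\<^sub>v (V *\<^sub>v (minv L *\<^sub>v y) + \<nu>)))"
  unfolding has_vderiv_def
proof (intro conjI allI impI)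
  note [simp] = spdD(2)[OF L] symD(1)[OF V] spd_minv(4)[OF L] y \<nu>
  have L0: "L + 0 \<cdot>\<^sub>m V = L" by (rule eq_matI) auto
  obtain \<rho> c where \<rho>: "0 < \<rho>" "\<And>s. \<bar>s\<bar> < \<rho> \<Longrightarrow> L + s \<cdot>\<^sub>m V \<in> spd n"
    using spd_perturbation[OF L V] by metis
  have ev: "\<forall>\<^sub>F s in nhds 0. minv (L + s \<cdot>\<^sub>m V) \<in> cm"
    unfolding eventually_nhds_metric using \<rho> spd_minv(4) by (auto simp: dist_real_def intro!: exI[of _ \<rho>])
  show "(-1) \<cdot>\<^sub>v (minv L *\<^sub>v (V *\<^sub>v (minv L *\<^sub>v y) + \<nu>)) \<in> cv" by simp
  show "\<forall>\<^sub>F s in nhds 0. minv (L + s \<cdot>\<^sub>m V) *\<^sub>v (y - s \<cdot>\<^sub>v \<nu>) \<in> cv" using ev by eventually_elim simp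
  fix i assume i: "i < n"
  define e :: "real vec" where "e = unit_vec n i"
  have e: "e \<in> cv" "\<And>x. x \<in> cv \<Longrightarrow> e \<bullet> x = x $ i" using i by (simp_all add: e_def)
  have "((\<lambda>s. e \<bullet> (minv (L + s \<cdot>\<^sub>m V) *\<^sub>v y) - s * (e \<bullet> (minv (L + s \<cdot>\<^sub>m V) *\<^sub>v \<nu>))) has_real_derivative
      - (e \<bullet> (minv L *\<^sub>v (V *\<^sub>v (minv L *\<^sub>v y)))) - (1 * (e \<bullet> (minv (L + 0 \<cdot>\<^sub>m V) *\<^sub>v \<nu>)) + - (e \<bullet> (minv L *\<^sub>v (V *\<^sub>v (minv L *\<^sub>v \<nu>)))) * 0)) (at 0)"
    by (intro DERIV_diff DERIV_mult DERIV_ident DERIV_minv L V e y \<nu>)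
  moreover have "- (e \<bullet> (minv L *\<^sub>v (V *\<^sub>v (minv L *\<^sub>v y)))) - (1 * (e \<bullet> (minv (L + 0 \<cdot>\<^sub>m V) *\<^sub>v \<nu>)) + - (e \<bullet> (minv L *\<^sub>v (V *\<^sub>v (minv L *\<^sub>v \<nu>)))) * 0)
      = ((-1) \<cdot>\<^sub>v (minv L *\<^sub>v (V *\<^sub>v (minv L *\<^sub>v y) + \<nu>))) $ i"
    unfolding L0 using i by (subst e(2)[symmetric]) (simp_all add: mat_vec_simps dot_simps e(1))
  moreover have "\<forall>\<^sub>F s in nhds 0. (minv (L + s \<cdot>\<^sub>m V) *\<^sub>v (y - s \<cdot>\<^sub>v \<nu>)) $ i
      = e \<bullet> (minv (L + s \<cdot>\<^sub>m V) *\<^sub>v y) - s * (e \<bullet> (minv (L + s \<cdot>\<^sub>m V) *\<^sub>v \<nu>))"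
    using ev by eventually_elim (subst e(2)[symmetric], simp_all add: mat_vec_simps dot_simps e(1))
  ultimately show "((\<lambda>s. (minv (L + s \<cdot>\<^sub>m V) *\<^sub>v (y - s \<cdot>\<^sub>v \<nu>)) $ i) has_real_derivative
      ((-1) \<cdot>\<^sub>v (minv L *\<^sub>v (V *\<^sub>v (minv L *\<^sub>v y) + \<nu>))) $ i) (at 0)"
    by (subst DERIV_cong_ev[OF refl _ refl]) auto
qed

section \<open>Derivatives of the Gaussian density and of its score\<close>

lemma shift_diff: "z \<in> cv \<Longrightarrow> \<mu> \<in> cv \<Longrightarrow> \<nu> \<in> cv \<Longrightarrow> z - (\<mu> + s \<cdot>\<^sub>v \<nu>) = (z - \<mu>) - s \<cdot>\<^sub>v (\<nu> :: real vec)"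
  by (rule eq_vecI) auto

lemma mat_line_0: "L \<in> cm \<Longrightarrow> V \<in> cm \<Longrightarrow> L + 0 \<cdot>\<^sub>m V = L"
  by (rule eq_matI) auto

lemma vec_line_0: "y \<in> cv \<Longrightarrow> \<nu> \<in> cv \<Longrightarrow> y - 0 \<cdot>\<^sub>v \<nu> = y" "y \<in> cv \<Longrightarrow> \<nu> \<in> cv \<Longrightarrow> y + 0 \<cdot>\<^sub>v \<nu> = y"
  by (auto intro!: eq_vecI)

lemma DERIV_gaussian_density:
  assumes L: "L \<in> spd n" and V: "V \<in> sym_mats n" and \<mu>: "\<mu> \<in> cv" "\<nu> \<in> cv" and z: "z \<in> cv"
  shows "((\<lambda>s. gaussian_density (\<mu> + s \<cdot>\<^sub>v \<nu>) (L + s \<cdot>\<^sub>m V) z) has_real_derivative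
    gaussian_density \<mu> L z * score \<mu> L \<nu> V z) (at 0)"
proof -
  note [simp] = spdD(2)[OF L] symD(1)[OF V] spd_minv(4)[OF L] \<mu> z
  define y where "y = z - \<mu>"
  define u where "u = minv L *\<^sub>v y"
  have [simp]: "y \<in> cv" "u \<in> cv" by (simp_all add: y_def u_def)
  define q where "q s = (y - s \<cdot>\<^sub>v \<nu>) \<bullet> (minv (L + s \<cdot>\<^sub>m V) *\<^sub>v (y - s \<cdot>\<^sub>v \<nu>))" for s
  have q: "(q has_real_derivative - 2 * (\<nu> \<bullet> u) - u \<bullet> (V *\<^sub>v u)) (at 0)"
  proof -
    have "(q has_real_derivative ((-1) \<cdot>\<^sub>v \<nu>) \<bullet> (minv (L + 0 \<cdot>\<^sub>m V) *\<^sub>v (y - 0 \<cdot>\<^sub>v \<nu>))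
        + (y - 0 \<cdot>\<^sub>v \<nu>) \<bullet> ((-1) \<cdot>\<^sub>v (minv L *\<^sub>v (V *\<^sub>v (minv L *\<^sub>v y) + \<nu>)))) (at 0)"
      unfolding q_def by (intro has_vderiv_dot has_vderiv_line has_vderiv_minv L V) simp_all
    moreover have "y \<bullet> (minv L *\<^sub>v (V *\<^sub>v u + \<nu>)) = u \<bullet> (V *\<^sub>v u) + \<nu> \<bullet> u"
      using dot_sym[OF spdD(1)[OF spd_minv(1)[OF L]], of y "V *\<^sub>v u + \<nu>"] dot_comm[of u \<nu>]
      by (simp add: u_def[symmetric] dot_simps)
    ultimately show ?thesis by (simp add: mat_line_0 vec_line_0 u_def[symmetric] dot_simps)
  qed
  define D where "D s = det ((2 * pi) \<cdot>\<^sub>m (L + s \<cdot>\<^sub>m V))" for s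
  have D: "(D has_real_derivative D 0 * tr (minv L * V)) (at 0)"
  proof -
    have "D = (\<lambda>s. (2 * pi) ^ n * det (L + s \<cdot>\<^sub>m V))" unfolding D_def by auto
    moreover have "((\<lambda>s. (2 * pi) ^ n * det (L + s \<cdot>\<^sub>m V)) has_real_derivative (2 * pi) ^ n * (det L * tr (minv L * V))) (at 0)"
      by (intro DERIV_cmult DERIV_det L V)
    ultimately show ?thesis by (simp add: mat_line_0 algebra_simps)
  qed
  have D0: "0 < D 0" using spd_det_pos[OF L] by (simp add: D_def mat_line_0)
  have "((\<lambda>s. exp (- (1/2) * q s) / sqrt (D s)) has_real_derivative
      exp (- (1/2) * q 0) / sqrt (D 0) * score \<mu> L \<nu> V z) (at 0)"
  proof -
    have 1: "((\<lambda>s. exp (- (1/2) * q s) / sqrt (D s)) has_real_derivative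
      ((exp (- (1/2) * q 0) * (- (1/2) * (- 2 * (\<nu> \<bullet> u) - u \<bullet> (V *\<^sub>v u)))) * sqrt (D 0)
        - exp (- (1/2) * q 0) * (inverse (sqrt (D 0)) / 2 * (D 0 * tr (minv L * V)))) / (sqrt (D 0) * sqrt (D 0))) (at 0)"
      using D0 by (intro DERIV_divide DERIV_chain'[where g = exp] DERIV_exp DERIV_cmult q
          DERIV_chain'[where g = sqrt] DERIV_real_sqrt D) auto
    have 2: "inverse (sqrt (D 0)) / 2 * (D 0 * tr (minv L * V)) = sqrt (D 0) * (tr (minv L * V) / 2)"
      using D0 real_sqrt_mult_self[of "D 0"] by (simp add: field_simps)
    have 3: "score \<mu> L \<nu> V z = - (1/2) * (- 2 * (\<nu> \<bullet> u) - u \<bullet> (V *\<^sub>v u)) - tr (minv L * V) / 2"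
      by (simp add: score_def Let_def y_def[symmetric] u_def[symmetric] field_simps)
    have 4: "(a * b * r - a * (r * c)) / (r * r) = a / r * (b - c)" if "r \<noteq> 0" for a b c r :: real
      using that by (simp add: field_simps)
    have "sqrt (D 0) \<noteq> 0" using D0 by simp
    from 1[unfolded 2 4[OF this]] show ?thesis unfolding 3 .
  qed
  moreover have "gaussian_density (\<mu> + s \<cdot>\<^sub>v \<nu>) (L + s \<cdot>\<^sub>m V) z = exp (- (1/2) * q s) / sqrt (D s)" for s
    unfolding gaussian_density_def q_def D_def y_def by (simp add: shift_diff)
  moreover from this[of 0] have "gaussian_density \<mu> L z = exp (- (1/2) * q 0) / sqrt (D 0)"
    by (simp add: mat_line_0 vec_line_0)
  ultimately show ?thesis by simp
qed

lemma DERIV_score: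
  assumes L: "L \<in> spd n" and V: "V \<in> sym_mats n" and W: "W \<in> sym_mats n"
    and \<mu>: "\<mu> \<in> cv" "\<nu> \<in> cv" "\<nu>' \<in> cv" and z: "z \<in> cv"
  shows "((\<lambda>s. score (\<mu> + s \<cdot>\<^sub>v \<nu>) (L + s \<cdot>\<^sub>m V) \<nu>' W z) has_real_derivative dscore \<mu> L \<nu> V \<nu>' W z) (at 0)"
proof -
  note [simp] = spdD(2)[OF L] symD(1)[OF V] symD(1)[OF W] spd_minv(4)[OF L] \<mu> z
  define y where "y = z - \<mu>"
  define u where "u s = minv (L + s \<cdot>\<^sub>m V) *\<^sub>v (y - s \<cdot>\<^sub>v \<nu>)" for s
  have [simp]: "y \<in> cv" by (simp add: y_def)
  have u0: "u 0 = minv L *\<^sub>v y" by (simp add: u_def mat_line_0 vec_line_0)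
  have [simp]: "u 0 \<in> cv" by (simp add: u0)
  define x where "x = minv L *\<^sub>v (V *\<^sub>v u 0 + \<nu>)"
  have [simp]: "x \<in> cv" by (simp add: x_def)
  have u: "has_vderiv u ((-1) \<cdot>\<^sub>v x)"
  proof -
    have x': "x = minv L *\<^sub>v (V *\<^sub>v (minv L *\<^sub>v y) + \<nu>)" unfolding x_def u0 ..
    have "u = (\<lambda>s. minv (L + s \<cdot>\<^sub>m V) *\<^sub>v (y - s \<cdot>\<^sub>v \<nu>))" by (rule ext) (rule u_def)
    then show ?thesis unfolding x' by (simp only:) (intro has_vderiv_minv L V, simp_all)
  qed
  have "((\<lambda>s. \<nu>' \<bullet> u s + u s \<bullet> (W *\<^sub>v u s) / 2 - tr (minv (L + s \<cdot>\<^sub>m V) * W) / 2) has_real_derivative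
    (0\<^sub>v n \<bullet> u 0 + \<nu>' \<bullet> ((-1) \<cdot>\<^sub>v x)) + (((-1) \<cdot>\<^sub>v x) \<bullet> (W *\<^sub>v u 0) + u 0 \<bullet> (W *\<^sub>v ((-1) \<cdot>\<^sub>v x))) / 2
      - (- tr (minv L * V * minv L * W)) / 2) (at 0)"
    by (intro DERIV_diff DERIV_add DERIV_cdivide has_vderiv_dot has_vderiv_const has_vderiv_mat_vec u DERIV_tr_minv L V) simp_all
  moreover have "(0\<^sub>v n \<bullet> u 0 + \<nu>' \<bullet> ((-1) \<cdot>\<^sub>v x)) + (((-1) \<cdot>\<^sub>v x) \<bullet> (W *\<^sub>v u 0) + u 0 \<bullet> (W *\<^sub>v ((-1) \<cdot>\<^sub>v x))) / 2
      - (- tr (minv L * V * minv L * W)) / 2 = dscore \<mu> L \<nu> V \<nu>' W z"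
    unfolding dscore_def Let_def y_def[symmetric] u0[symmetric] x_def[symmetric]
    using dot_comm[of x "W *\<^sub>v u 0"] dot_sym[OF W, of "u 0" x]
    by (simp add: dot_simps mat_vec_simps)
  moreover have "score (\<mu> + s \<cdot>\<^sub>v \<nu>) (L + s \<cdot>\<^sub>m V) \<nu>' W z
      = \<nu>' \<bullet> u s + u s \<bullet> (W *\<^sub>v u s) / 2 - tr (minv (L + s \<cdot>\<^sub>m V) * W) / 2" for s
    by (simp add: score_def Let_def u_def y_def shift_diff)
  ultimately show ?thesis by simp
qed

end

section \<open>Differentiation of Gaussian averages\<close>

context fixed_dim
begin

text \<open>Duality of quadratic forms: for positive definite \<open>M\<close> and any
  \<open>u\<close>, the value \<open>2 * (u \<bullet> w) - u \<bullet> (M *\<^sub>v u)\<close> is at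
  most the form of \<open>minv M\<close> at \<open>w\<close>. The unperturbed \<open>u\<close> as
  trial vector gives a lower bound that is explicit in \<open>s\<close>.\<close>

lemma quadratic_perturbation:
  assumes L: "L \<in> spd n" and M: "L + s \<cdot>\<^sub>m V \<in> spd n" and V: "V \<in> cm" and y: "y \<in> cv" and \<nu>: "\<nu> \<in> cv"
  defines "u \<equiv> minv L *\<^sub>v y"
  shows "y \<bullet> u - s * (2 * (u \<bullet> \<nu>) + u \<bullet> (V *\<^sub>v u)) \<le> (y - s \<cdot>\<^sub>v \<nu>) \<bullet> (minv (L + s \<cdot>\<^sub>m V) *\<^sub>v (y - s \<cdot>\<^sub>v \<nu>))"
proof -
  note [simp] = spdD(2)[OF L] spd_minv(4)[OF L] spd_minv(4)[OF M] V y \<nu> spdD(2)[OF M]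
  define w where "w = y - s \<cdot>\<^sub>v \<nu>"
  define v where "v = (L + s \<cdot>\<^sub>m V) *\<^sub>v u"
  let ?K = "minv (L + s \<cdot>\<^sub>m V)"
  have [simp]: "u \<in> cv" "w \<in> cv" "v \<in> cv" unfolding u_def w_def v_def by simp_all
  have Kv: "?K *\<^sub>v v = u"
    unfolding v_def using inverse_cancel(4)[OF spdD(2)[OF M] spd_minv(4)[OF M] spd_minv(2)[OF M]] by simp
  have vKw: "v \<bullet> (?K *\<^sub>v w) = u \<bullet> w"
    using dot_sym[OF spdD(1)[OF spd_minv(1)[OF M]], of v w] Kv by simp
  have "0 \<le> (w - v) \<bullet> (?K *\<^sub>v (w - v))" by (rule spdD(5)[OF spd_minv(1)[OF M]]) simp
  also have "\<dots> = w \<bullet> (?K *\<^sub>v w) - 2 * (u \<bullet> w) + u \<bullet> v"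
    using Kv vKw dot_comm[of w u] dot_comm[of v u] by (simp add: mat_vec_simps dot_simps)
  finally have 1: "2 * (u \<bullet> w) - u \<bullet> v \<le> w \<bullet> (?K *\<^sub>v w)" by linarith
  have "L *\<^sub>v u = y" unfolding u_def using spd_minv(2)[OF L] by (simp add: inverse_cancel)
  then have "u \<bullet> v = u \<bullet> y + s * (u \<bullet> (V *\<^sub>v u))" unfolding v_def by (simp add: mat_vec_simps dot_simps)
  moreover have "u \<bullet> w = u \<bullet> y - s * (u \<bullet> \<nu>)" unfolding w_def by (simp add: dot_simps)
  ultimately show ?thesis using 1 dot_comm[of y u] unfolding w_def[symmetric] by (simp add: algebra_simps)
qed

text \<open>What domination asks of nearby parameters, with one radius and one constant: the
  exponent loses at most the fraction \<open>\<epsilon>\<close> up to an additive constant, inverses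
  stay bounded and determinants stay away from zero. \<open>C\<close> may depend on
  \<open>n\<close>, \<open>L\<close> and the direction, since it serves only to justify
  differentiation.\<close>

lemma near_estimates:
  assumes L: "L \<in> spd n" and V: "V \<in> sym_mats n" and \<mu>: "\<mu> \<in> cv" "\<nu> \<in> cv" and \<epsilon>: "0 < \<epsilon>"
  defines "q \<equiv> \<lambda>z. (z - \<mu>) \<bullet> (minv L *\<^sub>v (z - \<mu>))"
  obtains \<rho> C where "0 < \<rho>" "1 \<le> C" "\<And>s. \<bar>s\<bar> < \<rho> \<Longrightarrow> L + s \<cdot>\<^sub>m V \<in> spd n"
    "\<And>s z. \<bar>s\<bar> < \<rho> \<Longrightarrow> z \<in> cv \<Longrightarrow> (1 - \<epsilon>) * q z - C
      \<le> (z - (\<mu> + s \<cdot>\<^sub>v \<nu>)) \<bullet> (minv (L + s \<cdot>\<^sub>m V) *\<^sub>v (z - (\<mu> + s \<cdot>\<^sub>v \<nu>)))"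
    "\<And>s z. \<bar>s\<bar> < \<rho> \<Longrightarrow> z \<in> cv \<Longrightarrow> (vnorm (minv (L + s \<cdot>\<^sub>m V) *\<^sub>v (z - (\<mu> + s \<cdot>\<^sub>v \<nu>))))\<^sup>2 \<le> C * (1 + q z)"
    "\<And>s v. \<bar>s\<bar> < \<rho> \<Longrightarrow> v \<in> cv \<Longrightarrow> vnorm (minv (L + s \<cdot>\<^sub>m V) *\<^sub>v v) \<le> C * vnorm v"
    "\<And>s. \<bar>s\<bar> < \<rho> \<Longrightarrow> 1 \<le> C * sqrt (det ((2 * pi) \<cdot>\<^sub>m (L + s \<cdot>\<^sub>m V)))"
proof -
  note [simp] = spdD(2)[OF L] symD(1)[OF V] spd_minv(4)[OF L] \<mu>
  obtain \<rho>0 c where \<rho>0: "0 < \<rho>0" "0 < c" "\<And>s. \<bar>s\<bar> < \<rho>0 \<Longrightarrow> L + s \<cdot>\<^sub>m V \<in> spd n"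
    "\<And>s v. \<bar>s\<bar> < \<rho>0 \<Longrightarrow> v \<in> cv \<Longrightarrow> c * (v \<bullet> v) \<le> v \<bullet> ((L + s \<cdot>\<^sub>m V) *\<^sub>v v)"
    using spd_perturbation[OF L V] by blast
  obtain c1 where c1: "0 < c1" "\<And>v. v \<in> cv \<Longrightarrow> c1 * (v \<bullet> v) \<le> v \<bullet> (minv L *\<^sub>v v)"
    using spd_coercive[OF spd_minv(1)[OF L]] by blast
  define b where "b = 1 / c"
  have b: "0 < b" using \<rho>0 by (simp add: b_def)
  have Kb: "vnorm (minv (L + s \<cdot>\<^sub>m V) *\<^sub>v v) \<le> b * vnorm v" if "\<bar>s\<bar> < \<rho>0" "v \<in> cv" for s v
    using minv_bound[OF \<rho>0(3)[OF that(1)] \<rho>0(2) \<rho>0(4)[OF that(1)] that(2)] by (simp add: b_def)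
  have q0: "0 \<le> q z" if "z \<in> cv" for z
    unfolding q_def using spdD(5)[OF spd_minv(1)[OF L]] that by simp
  have yq: "(vnorm (z - \<mu>))\<^sup>2 \<le> q z / c1" if "z \<in> cv" for z
    using c1(2)[of "z - \<mu>"] that c1(1) unfolding q_def vnorm_sq by (simp add: field_simps)
  define d where "d = (2 * pi) ^ n * (det L / 2)"
  have d: "0 < d" using spd_det_pos[OF L] by (simp add: d_def)
  have "((\<lambda>s. det (L + s \<cdot>\<^sub>m V)) \<longlongrightarrow> det (L + 0 \<cdot>\<^sub>m V)) (nhds 0)"
    using DERIV_isCont[OF DERIV_det[OF L V]] unfolding isCont_def
    by (rule tendsto_at_iff_tendsto_nhds[of "\<lambda>s. det (L + s \<cdot>\<^sub>m V)" 0, THEN iffD1])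
  then have "((\<lambda>s. det (L + s \<cdot>\<^sub>m V)) \<longlongrightarrow> det L) (nhds 0)"
    using mat_line_0[OF spdD(2)[OF L] symD(1)[OF V]] by simp
  then have "\<forall>\<^sub>F s in nhds 0. det L / 2 < det (L + s \<cdot>\<^sub>m V)"
    by (rule order_tendstoD(1)) (use spd_det_pos[OF L] in simp)
  then obtain \<rho>1 where \<rho>1: "0 < \<rho>1" "\<And>s. \<bar>s\<bar> < \<rho>1 \<Longrightarrow> det L / 2 < det (L + s \<cdot>\<^sub>m V)"
    unfolding eventually_nhds_metric by (auto simp: dist_real_def)
  \<comment> \<open>The cost per unit of \<open>s\<close>, relative to \<open>q z\<close>, of the
    first-order term in \<open>quadratic_perturbation\<close>; the radius
    \<open>\<epsilon> / m\<close> caps it at the fraction \<open>\<epsilon>\<close>.\<close>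
  define m where "m = (1 + fnorm V) * (b\<^sup>2 / c1)"
  have m: "0 < m" unfolding m_def using b c1 by (intro mult_pos_pos) (auto simp: add_pos_nonneg)
  define \<rho> where "\<rho> = min (min \<rho>0 \<rho>1) (min 1 (\<epsilon> / m))"
  have \<rho>: "0 < \<rho>" using \<rho>0 \<rho>1 \<epsilon> m by (simp add: \<rho>_def)
  define C where "C = 1 + (vnorm \<nu>)\<^sup>2 + (2 * b\<^sup>2 / c1 + 2 * b\<^sup>2 * (vnorm \<nu>)\<^sup>2) + b + 1 / sqrt d"
  have pos: "0 \<le> (vnorm \<nu>)\<^sup>2" "0 \<le> 2 * b\<^sup>2 / c1" "0 \<le> 2 * b\<^sup>2 * (vnorm \<nu>)\<^sup>2" "0 \<le> b" "0 \<le> 1 / sqrt d"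
    using b c1 d by auto
  have C: "1 \<le> C" "(vnorm \<nu>)\<^sup>2 \<le> C" "2 * b\<^sup>2 / c1 + 2 * b\<^sup>2 * (vnorm \<nu>)\<^sup>2 \<le> C" "b \<le> C" "1 / sqrt d \<le> C"
    unfolding C_def using pos by linarith+
  show ?thesis
  proof (rule that[OF \<rho> C(1)])
    fix s assume s: "\<bar>s\<bar> < \<rho>"
    then have s': "\<bar>s\<bar> < \<rho>0" "\<bar>s\<bar> < \<rho>1" "\<bar>s\<bar> \<le> 1" "\<bar>s\<bar> * m \<le> \<epsilon>" using m by (auto simp: \<rho>_def field_simps)
    show M: "L + s \<cdot>\<^sub>m V \<in> spd n" by (rule \<rho>0(3)[OF s'(1)])
    show "vnorm (minv (L + s \<cdot>\<^sub>m V) *\<^sub>v v) \<le> C * vnorm v" if "v \<in> cv" for v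
      using Kb[OF s'(1) that] C(4) by (meson mult_right_mono order_trans vnorm_nonneg)
    have "d \<le> det ((2 * pi) \<cdot>\<^sub>m (L + s \<cdot>\<^sub>m V))"
      using \<rho>1(2)[OF s'(2)] by (simp add: d_def)
    then have "sqrt d \<le> sqrt (det ((2 * pi) \<cdot>\<^sub>m (L + s \<cdot>\<^sub>m V)))" by simp
    moreover have "1 \<le> C * sqrt d" using C(5) d by (simp add: field_simps)
    ultimately show "1 \<le> C * sqrt (det ((2 * pi) \<cdot>\<^sub>m (L + s \<cdot>\<^sub>m V)))"
      using C(1) by (meson mult_left_mono order_trans zero_le_one)
    fix z assume z: "z \<in> cv"
    define y where "y = z - \<mu>"
    have y: "y \<in> cv" "z - (\<mu> + s \<cdot>\<^sub>v \<nu>) = y - s \<cdot>\<^sub>v \<nu>" using z by (simp_all add: y_def shift_diff)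
    define u where "u = minv L *\<^sub>v y"
    have u: "u \<in> cv" using y by (simp add: u_def)
    have qz: "q z = y \<bullet> u" by (simp add: q_def y_def u_def)
    have yq': "(vnorm y)\<^sup>2 \<le> q z / c1" using yq[OF z] by (simp add: y_def)
    have uq: "(vnorm u)\<^sup>2 \<le> b\<^sup>2 / c1 * q z"
    proof -
      have "vnorm u \<le> b * vnorm y" using Kb[of 0 y] \<rho>0(1) y(1) by (simp add: u_def mat_line_0)
      then have "(vnorm u)\<^sup>2 \<le> b\<^sup>2 * (vnorm y)\<^sup>2" by (metis power_mono power_mult_distrib vnorm_nonneg)
      also have "\<dots> \<le> b\<^sup>2 * (q z / c1)" using yq' by (intro mult_left_mono) auto
      finally show ?thesis by simp
    qed
    show "(1 - \<epsilon>) * q z - C \<le> (z - (\<mu> + s \<cdot>\<^sub>v \<nu>)) \<bullet> (minv (L + s \<cdot>\<^sub>m V) *\<^sub>v (z - (\<mu> + s \<cdot>\<^sub>v \<nu>)))"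
    proof -
      have "\<bar>2 * (u \<bullet> \<nu>) + u \<bullet> (V *\<^sub>v u)\<bar> \<le> (1 + fnorm V) * (vnorm u)\<^sup>2 + (vnorm \<nu>)\<^sup>2"
      proof -
        have "\<bar>u \<bullet> \<nu>\<bar> \<le> vnorm u * vnorm \<nu>" using u by (intro Cauchy_Schwarz) simp_all
        moreover have "2 * (vnorm u * vnorm \<nu>) \<le> (vnorm u)\<^sup>2 + (vnorm \<nu>)\<^sup>2"
          using sum_squares_bound[of "vnorm u" "vnorm \<nu>"] by simp
        moreover have "\<bar>u \<bullet> (V *\<^sub>v u)\<bar> \<le> fnorm V * (vnorm u)\<^sup>2" using sym_quadratic_le[of V u] u by (simp add: vnorm_sq)
        ultimately show ?thesis by (simp add: algebra_simps abs_le_iff)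
      qed
      also have "\<dots> \<le> m * q z + (vnorm \<nu>)\<^sup>2"
        using mult_left_mono[OF uq, of "1 + fnorm V"] by (simp add: m_def algebra_simps)
      finally have "\<bar>s * (2 * (u \<bullet> \<nu>) + u \<bullet> (V *\<^sub>v u))\<bar> \<le> \<bar>s\<bar> * (m * q z + (vnorm \<nu>)\<^sup>2)"
        unfolding abs_mult by (rule mult_left_mono) simp
      also have "\<dots> = (\<bar>s\<bar> * m) * q z + \<bar>s\<bar> * (vnorm \<nu>)\<^sup>2" by (simp add: algebra_simps)
      also have "\<dots> \<le> \<epsilon> * q z + 1 * (vnorm \<nu>)\<^sup>2"
        using s' q0[OF z] by (intro add_mono mult_right_mono) auto
      finally have "s * (2 * (u \<bullet> \<nu>) + u \<bullet> (V *\<^sub>v u)) \<le> \<epsilon> * q z + C" using C(2) by linarith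
      moreover have "y \<bullet> u - s * (2 * (u \<bullet> \<nu>) + u \<bullet> (V *\<^sub>v u)) \<le> (y - s \<cdot>\<^sub>v \<nu>) \<bullet> (minv (L + s \<cdot>\<^sub>m V) *\<^sub>v (y - s \<cdot>\<^sub>v \<nu>))"
        unfolding u_def using y(1) by (intro quadratic_perturbation[OF L M]) simp_all
      ultimately show ?thesis unfolding y(2) qz by (simp add: algebra_simps)
    qed
    show "(vnorm (minv (L + s \<cdot>\<^sub>m V) *\<^sub>v (z - (\<mu> + s \<cdot>\<^sub>v \<nu>))))\<^sup>2 \<le> C * (1 + q z)"
    proof -
      have ys: "y - s \<cdot>\<^sub>v \<nu> = y + (- s) \<cdot>\<^sub>v \<nu>" using y by (intro eq_vecI) auto
      have "vnorm (y - s \<cdot>\<^sub>v \<nu>) \<le> vnorm y + \<bar>s\<bar> * vnorm \<nu>"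
        unfolding ys using vnorm_triangle[of y "(- s) \<cdot>\<^sub>v \<nu>"] y by (simp add: vnorm_smult)
      also have "\<dots> \<le> vnorm y + 1 * vnorm \<nu>" using s' by (intro add_left_mono mult_right_mono) auto
      finally have "(vnorm (y - s \<cdot>\<^sub>v \<nu>))\<^sup>2 \<le> (vnorm y + vnorm \<nu>)\<^sup>2" by (intro power_mono) auto
      also have "\<dots> \<le> 2 * (vnorm y)\<^sup>2 + 2 * (vnorm \<nu>)\<^sup>2"
        using sum_squares_bound[of "vnorm y" "vnorm \<nu>"] by (simp add: power2_sum)
      finally have 1: "(vnorm (y - s \<cdot>\<^sub>v \<nu>))\<^sup>2 \<le> 2 * (q z / c1) + 2 * (vnorm \<nu>)\<^sup>2" using yq' by linarith
      have "vnorm (minv (L + s \<cdot>\<^sub>m V) *\<^sub>v (y - s \<cdot>\<^sub>v \<nu>)) \<le> b * vnorm (y - s \<cdot>\<^sub>v \<nu>)"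
        using Kb[OF s'(1)] y by simp
      then have "(vnorm (minv (L + s \<cdot>\<^sub>m V) *\<^sub>v (y - s \<cdot>\<^sub>v \<nu>)))\<^sup>2 \<le> b\<^sup>2 * (vnorm (y - s \<cdot>\<^sub>v \<nu>))\<^sup>2"
        by (metis power_mono power_mult_distrib vnorm_nonneg)
      also have "\<dots> \<le> b\<^sup>2 * (2 * (q z / c1) + 2 * (vnorm \<nu>)\<^sup>2)" using 1 by (intro mult_left_mono) auto
      also have "\<dots> = 2 * b\<^sup>2 / c1 * q z + 2 * b\<^sup>2 * (vnorm \<nu>)\<^sup>2" by (simp add: algebra_simps)
      also have "\<dots> \<le> C * q z + C * 1"
        using C(3) pos q0[OF z] by (intro add_mono mult_right_mono) linarith+
      finally show ?thesis unfolding y(2) by (simp add: algebra_simps)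
    qed
  qed
qed

lemma fnorm_operator_bound:
  "A \<in> cm \<Longrightarrow> 0 \<le> C \<Longrightarrow> (\<And>v. v \<in> cv \<Longrightarrow> vnorm (A *\<^sub>v v) \<le> C * vnorm v) \<Longrightarrow> fnorm A \<le> C * sqrt n"
  using fnorm_mult_bound[of A "1\<^sub>m n" C] by (simp add: fnorm_one mat_simps)

lemma le_one_plus_square: "(x :: real) \<le> 1 + x\<^sup>2"
proof -
  have "2 * x \<le> x\<^sup>2 + 1" using sum_squares_bound[of x 1] by simp
  then show ?thesis using zero_le_power2[of x] by linarith
qed

text \<open>Scores are polynomials of degree two in \<open>minv M *\<^sub>v (z - \<mu>)\<close>. The
  crude constant is harmless: the bound enters domination only, not the final estimate.\<close>

lemma score_le:
  assumes M: "M \<in> spd n" and W: "W \<in> cm" and \<nu>: "\<nu> \<in> cv" "\<mu> \<in> cv" "z \<in> cv"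
    and C: "0 \<le> C" "\<And>v. v \<in> cv \<Longrightarrow> vnorm (minv M *\<^sub>v v) \<le> C * vnorm v"
  shows "\<bar>score \<mu> M \<nu> W z\<bar> \<le> (vnorm \<nu> + fnorm W + C * sqrt n * fnorm W) * (1 + (vnorm (minv M *\<^sub>v (z - \<mu>)))\<^sup>2)"
proof -
  note [simp] = spd_minv(4)[OF M] W \<nu>
  define u where "u = minv M *\<^sub>v (z - \<mu>)"
  have u: "u \<in> cv" by (simp add: u_def)
  let ?X = "1 + (vnorm u)\<^sup>2"
  have "\<bar>\<nu> \<bullet> u\<bar> \<le> vnorm \<nu> * vnorm u" using u by (intro Cauchy_Schwarz) simp_all
  also have "\<dots> \<le> vnorm \<nu> * ?X" by (intro mult_left_mono le_one_plus_square) simp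
  finally have 1: "\<bar>\<nu> \<bullet> u\<bar> \<le> vnorm \<nu> * ?X" .
  have "\<bar>u \<bullet> (W *\<^sub>v u)\<bar> \<le> fnorm W * (vnorm u)\<^sup>2" using sym_quadratic_le[of W u] u by (simp add: vnorm_sq)
  also have "\<dots> \<le> fnorm W * ?X" by (intro mult_left_mono) simp_all
  finally have 2: "\<bar>u \<bullet> (W *\<^sub>v u)\<bar> \<le> fnorm W * ?X" .
  have "\<bar>tr (minv M * W)\<bar> \<le> fnorm (minv M) * fnorm W" by (rule tr_mult_le) simp_all
  also have "\<dots> \<le> C * sqrt n * fnorm W" using fnorm_operator_bound[OF _ C] by (intro mult_right_mono) simp_all
  also have "\<dots> \<le> (C * sqrt n * fnorm W) * ?X" using C(1) mult_left_mono[of 1 ?X "C * sqrt n * fnorm W"] by simp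
  finally have 3: "\<bar>tr (minv M * W)\<bar> \<le> (C * sqrt n * fnorm W) * ?X" .
  have "\<bar>score \<mu> M \<nu> W z\<bar> \<le> \<bar>\<nu> \<bullet> u\<bar> + \<bar>u \<bullet> (W *\<^sub>v u)\<bar> + \<bar>tr (minv M * W)\<bar>"
    unfolding score_def Let_def u_def[symmetric] by linarith
  also have "\<dots> \<le> vnorm \<nu> * ?X + fnorm W * ?X + (C * sqrt n * fnorm W) * ?X" using 1 2 3 by linarith
  finally show ?thesis unfolding u_def[symmetric] by (simp add: algebra_simps)
qed

lemma dscore_le:
  assumes M: "M \<in> spd n" and W: "W \<in> cm" "V \<in> cm" and \<nu>: "\<nu> \<in> cv" "\<nu>' \<in> cv" "\<mu> \<in> cv" "z \<in> cv"
    and C: "0 \<le> C" "\<And>v. v \<in> cv \<Longrightarrow> vnorm (minv M *\<^sub>v v) \<le> C * vnorm v"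
  shows "\<bar>dscore \<mu> M \<nu> V \<nu>' W z\<bar>
    \<le> (C * C * sqrt n * fnorm V * fnorm W + 2 * C * (vnorm \<nu>' + fnorm W) * (vnorm \<nu> + fnorm V))
        * (1 + (vnorm (minv M *\<^sub>v (z - \<mu>)))\<^sup>2)"
proof -
  note [simp] = spd_minv(4)[OF M] W \<nu>
  define u where "u = minv M *\<^sub>v (z - \<mu>)"
  have [simp]: "u \<in> cv" by (simp add: u_def)
  let ?X = "1 + (vnorm u)\<^sup>2"
  have K: "fnorm (minv M) \<le> C * sqrt n" using fnorm_operator_bound[OF _ C] by simp
  have "\<bar>tr (minv M * V * minv M * W)\<bar> \<le> fnorm (minv M * V * minv M) * fnorm W" by (rule tr_mult_le) simp_all
  also have "fnorm (minv M * V * minv M) \<le> C * fnorm (V * minv M)"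
    using fnorm_mult_bound[OF _ _ C, of "V * minv M"] by (simp add: mat_simps)
  also have "fnorm (V * minv M) \<le> fnorm V * (C * sqrt n)"
    using fnorm_mult_le[of V "minv M"] K by (meson W(2) fnorm_nonneg mult_left_mono order_trans spd_minv(4)[OF M])
  finally have "\<bar>tr (minv M * V * minv M * W)\<bar> \<le> C * (fnorm V * (C * sqrt n)) * fnorm W"
    using C(1) by (simp add: mult_left_mono mult_right_mono)
  also have "\<dots> = C * C * sqrt n * fnorm V * fnorm W" by simp
  also have "\<dots> \<le> (C * C * sqrt n * fnorm V * fnorm W) * ?X"
    using mult_left_mono[of 1 ?X "C * C * sqrt n * fnorm V * fnorm W"] C(1) by simp
  finally have 1: "\<bar>tr (minv M * V * minv M * W)\<bar> \<le> (C * C * sqrt n * fnorm V * fnorm W) * ?X" .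
  have lin: "vnorm (x + A *\<^sub>v u) \<le> (vnorm x + fnorm A) * (1 + vnorm u)" if "x \<in> cv" "A \<in> cm" for x A
  proof -
    have "vnorm (x + A *\<^sub>v u) \<le> vnorm x + fnorm A * vnorm u"
      using vnorm_triangle[of x "A *\<^sub>v u"] vnorm_mat_vec_le[of A u] that by simp
    also have "\<dots> \<le> (vnorm x + fnorm A) * (1 + vnorm u)" by (simp add: algebra_simps)
    finally show ?thesis .
  qed
  have "\<bar>(\<nu>' + W *\<^sub>v u) \<bullet> (minv M *\<^sub>v (V *\<^sub>v u + \<nu>))\<bar> \<le> vnorm (\<nu>' + W *\<^sub>v u) * vnorm (minv M *\<^sub>v (V *\<^sub>v u + \<nu>))"
    by (rule Cauchy_Schwarz) simp_all
  also have "\<dots> \<le> ((vnorm \<nu>' + fnorm W) * (1 + vnorm u)) * (C * ((vnorm \<nu> + fnorm V) * (1 + vnorm u)))"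
  proof (intro mult_mono)
    have "vnorm (V *\<^sub>v u + \<nu>) \<le> (vnorm \<nu> + fnorm V) * (1 + vnorm u)"
      using lin[of \<nu> V] comm_add_vec[of "V *\<^sub>v u" n \<nu>] by simp
    then show "vnorm (minv M *\<^sub>v (V *\<^sub>v u + \<nu>)) \<le> C * ((vnorm \<nu> + fnorm V) * (1 + vnorm u))"
      using C(2)[of "V *\<^sub>v u + \<nu>"] C(1) by (meson closed(6,7) W(2) \<nu>(1) \<open>u \<in> cv\<close> mult_left_mono order_trans)
  qed (use lin[of \<nu>' W] in simp_all)
  also have "\<dots> = C * (vnorm \<nu>' + fnorm W) * (vnorm \<nu> + fnorm V) * (1 + vnorm u)\<^sup>2"
    by (simp add: power2_eq_square)
  also have "\<dots> \<le> C * (vnorm \<nu>' + fnorm W) * (vnorm \<nu> + fnorm V) * (2 * ?X)"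
    using C(1) sum_squares_bound[of 1 "vnorm u"] by (intro mult_left_mono) (auto simp: power2_sum)
  finally have 2: "\<bar>(\<nu>' + W *\<^sub>v u) \<bullet> (minv M *\<^sub>v (V *\<^sub>v u + \<nu>))\<bar>
      \<le> (2 * C * (vnorm \<nu>' + fnorm W) * (vnorm \<nu> + fnorm V)) * ?X" by (simp add: algebra_simps)
  have "\<bar>dscore \<mu> M \<nu> V \<nu>' W z\<bar> \<le> \<bar>tr (minv M * V * minv M * W)\<bar> + \<bar>(\<nu>' + W *\<^sub>v u) \<bullet> (minv M *\<^sub>v (V *\<^sub>v u + \<nu>))\<bar>"
    unfolding dscore_def Let_def u_def[symmetric] by linarith
  then show ?thesis using 1 2 unfolding u_def[symmetric] by (simp add: distrib_right)
qed

section \<open>Measurability and domination near a parameter\<close>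

lemma measurable_gaussian_density:
  "L \<in> spd n \<Longrightarrow> \<mu> \<in> cv \<Longrightarrow> gaussian_density \<mu> L \<in> borel_measurable (lborel_vec n)"
  unfolding gaussian_density_def using measurable_quadratic[of "minv L" \<mu>] spd_minv(4) by simp

lemma measurable_score:
  assumes "L \<in> spd n" "\<mu> \<in> cv" "\<nu> \<in> cv" "W \<in> cm"
  shows "score \<mu> L \<nu> W \<in> borel_measurable (lborel_vec n)"
proof -
  have u: "minv L *\<^sub>v (z - \<mu>) \<in> cv" if "z \<in> space (lborel_vec n)" for z
    using space_lborel_vec[OF that] spd_minv(4)[OF assms(1)] assms by simp
  have ui: "(\<lambda>z. (minv L *\<^sub>v (z - \<mu>)) $ i) \<in> borel_measurable (lborel_vec n)" if "i < n" for i
    using assms space_lborel_vec that spd_minv(4)[OF assms(1)]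
    by (intro measurable_mat_vec measurable_shifted) auto
  have "(\<lambda>z. \<nu> \<bullet> (minv L *\<^sub>v (z - \<mu>))) \<in> borel_measurable (lborel_vec n)"
    by (rule measurable_dot[OF u _ ui]) simp_all
  moreover have "(\<lambda>z. (minv L *\<^sub>v (z - \<mu>)) \<bullet> (W *\<^sub>v (minv L *\<^sub>v (z - \<mu>)))) \<in> borel_measurable (lborel_vec n)"
    by (rule measurable_dot[OF _ ui measurable_mat_vec[OF assms(4) u ui]]) (use u assms(4) in simp)
  ultimately show ?thesis unfolding score_def Let_def by (intro borel_measurable_diff borel_measurable_add) auto
qed

text \<open>An unnormalised Gaussian with covariance enlarged by the factor
  \<open>1 / (1 - \<delta>)\<close>, whose slower decay leaves room for polynomial factors.\<close>

definition gauss_weight :: "real vec \<Rightarrow> real mat \<Rightarrow> real \<Rightarrow> real vec \<Rightarrow> real" where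
  "gauss_weight \<mu> L \<delta> z = exp (- (1 - \<delta>) * ((z - \<mu>) \<bullet> (minv L *\<^sub>v (z - \<mu>))) / 2)"

text \<open>Integrability against a slightly slower Gaussian, unlike integrability against the
  density itself, survives multiplication by scores and small changes of the parameters. The
  quantifier over \<open>\<delta>\<close> allows \<open>\<delta>\<close> to shrink under such
  changes.\<close>

definition averageable :: "(real vec \<Rightarrow> real) \<Rightarrow> real vec \<Rightarrow> real mat \<Rightarrow> bool" where
  "averageable f \<mu> L \<longleftrightarrow> f \<in> borel_measurable (lborel_vec n) \<and>
     (\<exists>\<delta>. 0 < \<delta> \<and> \<delta> < 1 \<and> integrable (lborel_vec n) (\<lambda>z. f z * gauss_weight \<mu> L \<delta> z))"

lemma measurable_gauss_weight:
  "L \<in> spd n \<Longrightarrow> \<mu> \<in> cv \<Longrightarrow> gauss_weight \<mu> L \<delta> \<in> borel_measurable (lborel_vec n)"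
  unfolding gauss_weight_def using measurable_quadratic[of "minv L" \<mu>] spd_minv(4) by simp

lemma square_le_exp: "0 \<le> x \<Longrightarrow> x\<^sup>2 \<le> 2 * exp (x :: real)"
  using exp_lower_Taylor_quadratic[of x] by (simp add: field_simps)

text \<open>Half of \<open>\<delta>\<close> pays for moving the parameters, the other half for the
  quartic polynomial made of scores. The first estimate holds because
  \<open>(1 - \<delta> / 2)\<^sup>2 \<ge> 1 - \<delta>\<close>.\<close>

lemma density_domination:
  assumes L: "L \<in> spd n" and V: "V \<in> sym_mats n" and W: "W \<in> sym_mats n"
    and \<mu>: "\<mu> \<in> cv" "\<nu> \<in> cv" "\<nu>' \<in> cv" and \<delta>: "0 < \<delta>" "\<delta> < 1"
  obtains \<rho> C where "0 < \<rho>" "0 < C" "\<And>s. \<bar>s\<bar> < \<rho> \<Longrightarrow> L + s \<cdot>\<^sub>m V \<in> spd n"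
    "\<And>s z. \<bar>s\<bar> < \<rho> \<Longrightarrow> z \<in> cv \<Longrightarrow> gauss_weight (\<mu> + s \<cdot>\<^sub>v \<nu>) (L + s \<cdot>\<^sub>m V) (\<delta> / 2) z \<le> C * gauss_weight \<mu> L \<delta> z"
    "\<And>s z. \<bar>s\<bar> < \<rho> \<Longrightarrow> z \<in> cv \<Longrightarrow> \<bar>gaussian_density (\<mu> + s \<cdot>\<^sub>v \<nu>) (L + s \<cdot>\<^sub>m V) z\<bar> \<le> C * gauss_weight \<mu> L \<delta> z"
    "\<And>s z. \<bar>s\<bar> < \<rho> \<Longrightarrow> z \<in> cv \<Longrightarrow> \<bar>gaussian_density (\<mu> + s \<cdot>\<^sub>v \<nu>) (L + s \<cdot>\<^sub>m V) z
      * score (\<mu> + s \<cdot>\<^sub>v \<nu>) (L + s \<cdot>\<^sub>m V) \<nu>' W z\<bar> \<le> C * gauss_weight \<mu> L \<delta> z"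
    "\<And>s z. \<bar>s\<bar> < \<rho> \<Longrightarrow> z \<in> cv \<Longrightarrow> \<bar>gaussian_density (\<mu> + s \<cdot>\<^sub>v \<nu>) (L + s \<cdot>\<^sub>m V) z
      * (score (\<mu> + s \<cdot>\<^sub>v \<nu>) (L + s \<cdot>\<^sub>m V) \<nu> V z * score (\<mu> + s \<cdot>\<^sub>v \<nu>) (L + s \<cdot>\<^sub>m V) \<nu>' W z
        + dscore (\<mu> + s \<cdot>\<^sub>v \<nu>) (L + s \<cdot>\<^sub>m V) \<nu> V \<nu>' W z)\<bar> \<le> C * gauss_weight \<mu> L \<delta> z"
proof -
  note [simp] = spdD(2)[OF L] symD(1)[OF V] symD(1)[OF W] spd_minv(4)[OF L] \<mu>
  define q where "q z = (z - \<mu>) \<bullet> (minv L *\<^sub>v (z - \<mu>))" for z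
  have q0: "0 \<le> q z" if "z \<in> cv" for z
    unfolding q_def using spdD(5)[OF spd_minv(1)[OF L]] that by simp
  have "0 < \<delta> / 2" using \<delta> by simp
  from near_estimates[OF L V \<mu>(1,2) this, folded q_def] obtain \<rho> B where \<rho>: "0 < \<rho>" "1 \<le> B"
    "\<And>s. \<bar>s\<bar> < \<rho> \<Longrightarrow> L + s \<cdot>\<^sub>m V \<in> spd n"
    "\<And>s z. \<bar>s\<bar> < \<rho> \<Longrightarrow> z \<in> cv \<Longrightarrow> (1 - \<delta> / 2) * q z - B
      \<le> (z - (\<mu> + s \<cdot>\<^sub>v \<nu>)) \<bullet> (minv (L + s \<cdot>\<^sub>m V) *\<^sub>v (z - (\<mu> + s \<cdot>\<^sub>v \<nu>)))"
    "\<And>s z. \<bar>s\<bar> < \<rho> \<Longrightarrow> z \<in> cv \<Longrightarrow> (vnorm (minv (L + s \<cdot>\<^sub>m V) *\<^sub>v (z - (\<mu> + s \<cdot>\<^sub>v \<nu>))))\<^sup>2 \<le> B * (1 + q z)"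
    "\<And>s v. \<bar>s\<bar> < \<rho> \<Longrightarrow> v \<in> cv \<Longrightarrow> vnorm (minv (L + s \<cdot>\<^sub>m V) *\<^sub>v v) \<le> B * vnorm v"
    "\<And>s. \<bar>s\<bar> < \<rho> \<Longrightarrow> 1 \<le> B * sqrt (det ((2 * pi) \<cdot>\<^sub>m (L + s \<cdot>\<^sub>m V)))"
    by blast
  define A where "A = 1 + (vnorm \<nu> + fnorm V + B * sqrt n * fnorm V) + (vnorm \<nu>' + fnorm W + B * sqrt n * fnorm W)
    + (B * B * sqrt n * fnorm V * fnorm W + 2 * B * (vnorm \<nu>' + fnorm W) * (vnorm \<nu> + fnorm V))"
  have parts: "0 \<le> vnorm \<nu> + fnorm V + B * sqrt n * fnorm V" "0 \<le> vnorm \<nu>' + fnorm W + B * sqrt n * fnorm W"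
    "0 \<le> B * B * sqrt n * fnorm V * fnorm W + 2 * B * (vnorm \<nu>' + fnorm W) * (vnorm \<nu> + fnorm V)"
    using \<rho>(2) by (auto intro!: add_nonneg_nonneg mult_nonneg_nonneg)
  have A: "1 \<le> A" "vnorm \<nu> + fnorm V + B * sqrt n * fnorm V \<le> A" "vnorm \<nu>' + fnorm W + B * sqrt n * fnorm W \<le> A"
    "B * B * sqrt n * fnorm V * fnorm W + 2 * B * (vnorm \<nu>' + fnorm W) * (vnorm \<nu> + fnorm V) \<le> A"
    using parts unfolding A_def by linarith+
  define H where "H = A * (2 * B)"
  have H: "1 \<le> H" unfolding H_def using A(1) \<rho>(2) mult_mono[of 1 A 1 "2 * B"] by simp
  define E where "E = B * exp (B / 2)"
  define P where "P = 2 * (4 / \<delta>)\<^sup>2 * exp (\<delta> / 4)"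
  define C where "C = exp B + 2 * H\<^sup>2 * (E * P)"
  have EP: "0 < E" "0 < P" unfolding E_def P_def using \<rho>(2) \<delta> by auto
  have poly: "(1 + q z)\<^sup>2 * exp (- (1 - \<delta> / 2) * q z / 2) \<le> P * gauss_weight \<mu> L \<delta> z" if z: "z \<in> cv" for z
  proof -
    have "((\<delta> / 4) * (1 + q z))\<^sup>2 \<le> 2 * exp ((\<delta> / 4) * (1 + q z))"
      using q0[OF z] \<delta> by (intro square_le_exp) auto
    then have "(4 / \<delta>)\<^sup>2 * ((\<delta> / 4) * (1 + q z))\<^sup>2 \<le> (4 / \<delta>)\<^sup>2 * (2 * exp ((\<delta> / 4) * (1 + q z)))"
      by (rule mult_left_mono) simp
    moreover have "(4 / \<delta>)\<^sup>2 * ((\<delta> / 4) * (1 + q z))\<^sup>2 = (1 + q z)\<^sup>2"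
      unfolding power_mult_distrib[symmetric] mult.assoc[symmetric] using \<delta> by simp
    ultimately have "(1 + q z)\<^sup>2 \<le> 2 * (4 / \<delta>)\<^sup>2 * exp ((\<delta> / 4) * (1 + q z))" by simp
    also have "\<dots> = P * exp (\<delta> * q z / 4)" unfolding P_def by (simp add: exp_add[symmetric] algebra_simps)
    finally have "(1 + q z)\<^sup>2 * exp (- (1 - \<delta> / 2) * q z / 2) \<le> P * exp (\<delta> * q z / 4) * exp (- (1 - \<delta> / 2) * q z / 2)"
      by (rule mult_right_mono) simp
    also have "\<dots> = P * exp (\<delta> * q z / 4 + - (1 - \<delta> / 2) * q z / 2)" by (simp only: exp_add mult.assoc)
    also have "\<delta> * q z / 4 + - (1 - \<delta> / 2) * q z / 2 = - (1 - \<delta>) * q z / 2" by (simp add: field_simps)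
    finally show ?thesis unfolding gauss_weight_def q_def[symmetric] .
  qed
  have w0: "0 < gauss_weight \<mu> L \<delta> z" for z by (simp add: gauss_weight_def)
  have gd: "0 \<le> gaussian_density (\<mu> + s \<cdot>\<^sub>v \<nu>) (L + s \<cdot>\<^sub>m V) z"
    "gaussian_density (\<mu> + s \<cdot>\<^sub>v \<nu>) (L + s \<cdot>\<^sub>m V) z \<le> E * exp (- (1 - \<delta> / 2) * q z / 2)"
    if s: "\<bar>s\<bar> < \<rho>" and z: "z \<in> cv" for s z
  proof -
    let ?D = "sqrt (det ((2 * pi) \<cdot>\<^sub>m (L + s \<cdot>\<^sub>m V)))" and ?Q = "(z - (\<mu> + s \<cdot>\<^sub>v \<nu>)) \<bullet> (minv (L + s \<cdot>\<^sub>m V) *\<^sub>v (z - (\<mu> + s \<cdot>\<^sub>v \<nu>)))"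
    have "0 < B * ?D" using \<rho>(7)[OF s] by linarith
    then have D: "0 < ?D" using \<rho>(2) by (simp add: zero_less_mult_iff)
    then show "0 \<le> gaussian_density (\<mu> + s \<cdot>\<^sub>v \<nu>) (L + s \<cdot>\<^sub>m V) z" unfolding gaussian_density_def by simp
    have "gaussian_density (\<mu> + s \<cdot>\<^sub>v \<nu>) (L + s \<cdot>\<^sub>m V) z = exp (- (1/2) * ?Q) * (1 / ?D)"
      unfolding gaussian_density_def by simp
    also have "\<dots> \<le> exp (B / 2 + - (1 - \<delta> / 2) * q z / 2) * B"
      using \<rho>(4)[OF s z] \<rho>(7)[OF s] D \<rho>(2) by (intro mult_mono) (auto simp: field_simps)
    finally show "gaussian_density (\<mu> + s \<cdot>\<^sub>v \<nu>) (L + s \<cdot>\<^sub>m V) z \<le> E * exp (- (1 - \<delta> / 2) * q z / 2)"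
      unfolding E_def exp_add by (simp add: mult_ac)
  qed
  \<comment> \<open>The three estimates with the density are instances: \<open>1\<close>, a score
    and the second-order factor are all bounded by
    \<open>2 * H\<^sup>2 * (1 + q z)\<^sup>2\<close>.\<close>
  have dom: "\<bar>gaussian_density (\<mu> + s \<cdot>\<^sub>v \<nu>) (L + s \<cdot>\<^sub>m V) z * p\<bar> \<le> C * gauss_weight \<mu> L \<delta> z"
    if s: "\<bar>s\<bar> < \<rho>" and z: "z \<in> cv" and p: "\<bar>p\<bar> \<le> 2 * H\<^sup>2 * (1 + q z)\<^sup>2" for s z p
  proof -
    have "\<bar>gaussian_density (\<mu> + s \<cdot>\<^sub>v \<nu>) (L + s \<cdot>\<^sub>m V) z * p\<bar> \<le> (E * exp (- (1 - \<delta> / 2) * q z / 2)) * (2 * H\<^sup>2 * (1 + q z)\<^sup>2)"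
      unfolding abs_mult using gd[OF s z] p EP by (intro mult_mono) auto
    also have "\<dots> = 2 * H\<^sup>2 * E * ((1 + q z)\<^sup>2 * exp (- (1 - \<delta> / 2) * q z / 2))" by simp
    also have "\<dots> \<le> 2 * H\<^sup>2 * E * (P * gauss_weight \<mu> L \<delta> z)" using poly[OF z] EP by (intro mult_left_mono) auto
    also have "\<dots> \<le> C * gauss_weight \<mu> L \<delta> z" unfolding C_def using w0[of z] by (simp add: distrib_right)
    finally show ?thesis .
  qed
  have uX: "1 + (vnorm (minv (L + s \<cdot>\<^sub>m V) *\<^sub>v (z - (\<mu> + s \<cdot>\<^sub>v \<nu>))))\<^sup>2 \<le> 2 * B * (1 + q z)"
    if "\<bar>s\<bar> < \<rho>" "z \<in> cv" for s z
  proof -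
    have "1 * 1 \<le> B * (1 + q z)" using \<rho>(2) q0[OF that(2)] by (intro mult_mono) auto
    then show ?thesis using \<rho>(5)[OF that] by linarith
  qed
  have AH: "a * (1 + (vnorm (minv (L + s \<cdot>\<^sub>m V) *\<^sub>v (z - (\<mu> + s \<cdot>\<^sub>v \<nu>))))\<^sup>2) \<le> H * (1 + q z)"
    if "\<bar>s\<bar> < \<rho>" "z \<in> cv" "a \<le> A" for s z a
  proof -
    have "a * (1 + (vnorm (minv (L + s \<cdot>\<^sub>m V) *\<^sub>v (z - (\<mu> + s \<cdot>\<^sub>v \<nu>))))\<^sup>2) \<le> A * (2 * B * (1 + q z))"
      using uX[OF that(1,2)] that(3) A(1) by (intro mult_mono) auto
    then show ?thesis by (simp add: H_def mult_ac)
  qed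
  have B0: "0 \<le> B" using \<rho>(2) by simp
  have sc: "\<bar>score (\<mu> + s \<cdot>\<^sub>v \<nu>) (L + s \<cdot>\<^sub>m V) \<nu> V z\<bar> \<le> H * (1 + q z)"
    "\<bar>score (\<mu> + s \<cdot>\<^sub>v \<nu>) (L + s \<cdot>\<^sub>m V) \<nu>' W z\<bar> \<le> H * (1 + q z)"
    "\<bar>dscore (\<mu> + s \<cdot>\<^sub>v \<nu>) (L + s \<cdot>\<^sub>m V) \<nu> V \<nu>' W z\<bar> \<le> H * (1 + q z)" if s: "\<bar>s\<bar> < \<rho>" and z: "z \<in> cv" for s z
  proof -
    show "\<bar>score (\<mu> + s \<cdot>\<^sub>v \<nu>) (L + s \<cdot>\<^sub>m V) \<nu> V z\<bar> \<le> H * (1 + q z)"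
      by (rule order_trans[OF score_le[OF \<rho>(3)[OF s] _ _ _ _ B0 \<rho>(6)[OF s]] AH[OF s z A(2)]]) (use z in simp_all)
    show "\<bar>score (\<mu> + s \<cdot>\<^sub>v \<nu>) (L + s \<cdot>\<^sub>m V) \<nu>' W z\<bar> \<le> H * (1 + q z)"
      by (rule order_trans[OF score_le[OF \<rho>(3)[OF s] _ _ _ _ B0 \<rho>(6)[OF s]] AH[OF s z A(3)]]) (use z in simp_all)
    show "\<bar>dscore (\<mu> + s \<cdot>\<^sub>v \<nu>) (L + s \<cdot>\<^sub>m V) \<nu> V \<nu>' W z\<bar> \<le> H * (1 + q z)"
      by (rule order_trans[OF dscore_le[OF \<rho>(3)[OF s] _ _ _ _ _ _ B0 \<rho>(6)[OF s]] AH[OF s z A(4)]]) (use z in simp_all)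
  qed
  have HQ: "H * (1 + q z) \<le> H\<^sup>2 * (1 + q z)\<^sup>2" "1 \<le> H\<^sup>2 * (1 + q z)\<^sup>2" if "z \<in> cv" for z
  proof -
    have "1 * 1 \<le> H * (1 + q z)" using H q0[OF that] by (intro mult_mono) auto
    then have "1 \<le> H * (1 + q z)" by simp
    then show "H * (1 + q z) \<le> H\<^sup>2 * (1 + q z)\<^sup>2" "1 \<le> H\<^sup>2 * (1 + q z)\<^sup>2"
      unfolding power_mult_distrib[symmetric] by (auto simp: self_le_power one_le_power)
  qed
  show ?thesis
  proof (rule that[of \<rho> C])
    show "0 < \<rho>" "0 < C" using \<rho>(1) EP by (auto simp: C_def add_pos_nonneg)
    fix s :: real assume s: "\<bar>s\<bar> < \<rho>"
    show "L + s \<cdot>\<^sub>m V \<in> spd n" by (rule \<rho>(3)[OF s])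
    fix z assume z: "z \<in> cv"
    show "gauss_weight (\<mu> + s \<cdot>\<^sub>v \<nu>) (L + s \<cdot>\<^sub>m V) (\<delta> / 2) z \<le> C * gauss_weight \<mu> L \<delta> z"
    proof -
      let ?Q = "(z - (\<mu> + s \<cdot>\<^sub>v \<nu>)) \<bullet> (minv (L + s \<cdot>\<^sub>m V) *\<^sub>v (z - (\<mu> + s \<cdot>\<^sub>v \<nu>)))"
      have "(1 - \<delta> / 2) * ((1 - \<delta> / 2) * q z - B) \<le> (1 - \<delta> / 2) * ?Q"
        using \<rho>(4)[OF s z] \<delta> by (intro mult_left_mono) auto
      moreover have "(1 - \<delta>) * q z \<le> (1 - \<delta> / 2) * ((1 - \<delta> / 2) * q z)"
      proof -
        have "(1 - \<delta>) * q z \<le> ((1 - \<delta> / 2) * (1 - \<delta> / 2)) * q z"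
          using q0[OF z] by (intro mult_right_mono) (simp_all add: algebra_simps)
        then show ?thesis by (simp add: mult.assoc)
      qed
      moreover have "(1 - \<delta> / 2) * B \<le> 1 * B" using \<delta> B0 by (intro mult_right_mono) auto
      ultimately have "(1 - \<delta>) * q z - B \<le> (1 - \<delta> / 2) * ?Q" unfolding right_diff_distrib by linarith
      moreover have "- (1 - \<delta> / 2) * ?Q / 2 = - ((1 - \<delta> / 2) * ?Q) / 2"
        "- (1 - \<delta>) * q z / 2 = - ((1 - \<delta>) * q z) / 2" by (simp_all only: mult_minus_left)
      ultimately have "- (1 - \<delta> / 2) * ?Q / 2 \<le> B + - (1 - \<delta>) * q z / 2" using B0 by linarith
      then have "gauss_weight (\<mu> + s \<cdot>\<^sub>v \<nu>) (L + s \<cdot>\<^sub>m V) (\<delta> / 2) z \<le> exp (B + - (1 - \<delta>) * q z / 2)"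
        unfolding gauss_weight_def by (simp only: exp_le_cancel_iff)
      also have "\<dots> = exp B * gauss_weight \<mu> L \<delta> z" unfolding gauss_weight_def q_def[symmetric] exp_add ..
      also have "\<dots> \<le> C * gauss_weight \<mu> L \<delta> z" using w0[of z] EP by (intro mult_right_mono) (auto simp: C_def)
      finally show ?thesis .
    qed
    show "\<bar>gaussian_density (\<mu> + s \<cdot>\<^sub>v \<nu>) (L + s \<cdot>\<^sub>m V) z\<bar> \<le> C * gauss_weight \<mu> L \<delta> z"
      using dom[OF s z, of 1] HQ[OF z] by simp
    show "\<bar>gaussian_density (\<mu> + s \<cdot>\<^sub>v \<nu>) (L + s \<cdot>\<^sub>m V) z
      * score (\<mu> + s \<cdot>\<^sub>v \<nu>) (L + s \<cdot>\<^sub>m V) \<nu>' W z\<bar> \<le> C * gauss_weight \<mu> L \<delta> z"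
      by (rule dom[OF s z]) (use sc(2)[OF s z] HQ[OF z] in linarith)
    show "\<bar>gaussian_density (\<mu> + s \<cdot>\<^sub>v \<nu>) (L + s \<cdot>\<^sub>m V) z
      * (score (\<mu> + s \<cdot>\<^sub>v \<nu>) (L + s \<cdot>\<^sub>m V) \<nu> V z * score (\<mu> + s \<cdot>\<^sub>v \<nu>) (L + s \<cdot>\<^sub>m V) \<nu>' W z
        + dscore (\<mu> + s \<cdot>\<^sub>v \<nu>) (L + s \<cdot>\<^sub>m V) \<nu> V \<nu>' W z)\<bar> \<le> C * gauss_weight \<mu> L \<delta> z"
    proof (rule dom[OF s z])
      have "\<bar>score (\<mu> + s \<cdot>\<^sub>v \<nu>) (L + s \<cdot>\<^sub>m V) \<nu> V z * score (\<mu> + s \<cdot>\<^sub>v \<nu>) (L + s \<cdot>\<^sub>m V) \<nu>' W z\<bar>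
          \<le> (H * (1 + q z)) * (H * (1 + q z))"
        unfolding abs_mult using sc(1,2)[OF s z] by (intro mult_mono) (auto intro: order_trans[OF abs_ge_zero])
      then show "\<bar>score (\<mu> + s \<cdot>\<^sub>v \<nu>) (L + s \<cdot>\<^sub>m V) \<nu> V z * score (\<mu> + s \<cdot>\<^sub>v \<nu>) (L + s \<cdot>\<^sub>m V) \<nu>' W z
        + dscore (\<mu> + s \<cdot>\<^sub>v \<nu>) (L + s \<cdot>\<^sub>m V) \<nu> V \<nu>' W z\<bar> \<le> 2 * H\<^sup>2 * (1 + q z)\<^sup>2"
        using sc(3)[OF s z] HQ(1)[OF z] unfolding power2_eq_square[symmetric] power_mult_distrib by linarith
    qed
  qed
qed

section \<open>Differentiation under the integral sign\<close>

lemma line_shift: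
  "\<mu> \<in> cv \<Longrightarrow> \<nu> \<in> cv \<Longrightarrow> \<mu> + (h + s) \<cdot>\<^sub>v \<nu> = (\<mu> + s \<cdot>\<^sub>v \<nu>) + h \<cdot>\<^sub>v (\<nu> :: real vec)"
  "L \<in> cm \<Longrightarrow> V \<in> cm \<Longrightarrow> L + (h + s) \<cdot>\<^sub>m V = (L + s \<cdot>\<^sub>m V) + h \<cdot>\<^sub>m V"
  by (auto intro!: eq_vecI eq_matI simp: algebra_simps)

lemma averageable_integrable:
  assumes L: "L \<in> spd n" and \<mu>: "\<mu> \<in> cv" and f: "averageable f \<mu> L"
  shows "integrable (lborel_vec n) (\<lambda>z. f z * gaussian_density \<mu> L z)"
proof -
  obtain \<delta> where \<delta>: "0 < \<delta>" "\<delta> < 1" "integrable (lborel_vec n) (\<lambda>z. f z * gauss_weight \<mu> L \<delta> z)"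
    and fm: "f \<in> borel_measurable (lborel_vec n)"
    using f unfolding averageable_def by blast
  \<comment> \<open>At \<open>s = 0\<close> the direction is irrelevant, so any admissible one
    extracts the bound at the base point.\<close>
  have Z: "0\<^sub>m n n \<in> sym_mats n" by (rule sym_closed)
  obtain \<rho> C where \<rho>: "0 < \<rho>" "0 < C"
    "\<And>s z. \<bar>s\<bar> < \<rho> \<Longrightarrow> z \<in> cv \<Longrightarrow> \<bar>gaussian_density (\<mu> + s \<cdot>\<^sub>v \<mu>) (L + s \<cdot>\<^sub>m 0\<^sub>m n n) z\<bar> \<le> C * gauss_weight \<mu> L \<delta> z"
    using density_domination[OF L Z Z \<mu> \<mu> \<mu> \<delta>(1,2)] by metis
  have gd: "\<bar>gaussian_density \<mu> L z\<bar> \<le> C * gauss_weight \<mu> L \<delta> z" if "z \<in> cv" for z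
    using \<rho>(3)[of 0 z] \<rho>(1) that \<mu> spdD(2)[OF L] by (simp add: mat_line_0 vec_line_0)
  show ?thesis
  proof (rule Bochner_Integration.integrable_bound)
    show "integrable (lborel_vec n) (\<lambda>z. C * (f z * gauss_weight \<mu> L \<delta> z))" using \<delta>(3) by simp
    show "AE z in lborel_vec n. norm (f z * gaussian_density \<mu> L z) \<le> norm (C * (f z * gauss_weight \<mu> L \<delta> z))"
    proof (rule AE_I2)
      fix z assume "z \<in> space (lborel_vec n)"
      then have "\<bar>f z\<bar> * \<bar>gaussian_density \<mu> L z\<bar> \<le> \<bar>f z\<bar> * (C * gauss_weight \<mu> L \<delta> z)"
        using gd space_lborel_vec by (intro mult_left_mono) auto
      then show "norm (f z * gaussian_density \<mu> L z) \<le> norm (C * (f z * gauss_weight \<mu> L \<delta> z))"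
        using \<rho>(2) by (simp add: abs_mult gauss_weight_def mult_ac)
    qed
  qed (use fm measurable_gaussian_density[OF L \<mu>] in simp)
qed

text \<open>The property persists along lines, with \<open>\<delta>\<close> halved. This makes the
  formula for the first derivative valid near \<open>s = 0\<close>, so that it can be differentiated
  again.\<close>

lemma averageable_near:
  assumes L: "L \<in> spd n" and V: "V \<in> sym_mats n" and \<mu>: "\<mu> \<in> cv" "\<nu> \<in> cv" and f: "averageable f \<mu> L"
  shows "\<forall>\<^sub>F s in nhds 0. L + s \<cdot>\<^sub>m V \<in> spd n \<and> averageable f (\<mu> + s \<cdot>\<^sub>v \<nu>) (L + s \<cdot>\<^sub>m V)"
proof -
  obtain \<delta> where \<delta>: "0 < \<delta>" "\<delta> < 1" "integrable (lborel_vec n) (\<lambda>z. f z * gauss_weight \<mu> L \<delta> z)"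
    and fm: "f \<in> borel_measurable (lborel_vec n)"
    using f unfolding averageable_def by blast
  obtain \<rho> C where \<rho>: "0 < \<rho>" "0 < C" "\<And>s. \<bar>s\<bar> < \<rho> \<Longrightarrow> L + s \<cdot>\<^sub>m V \<in> spd n"
    "\<And>s z. \<bar>s\<bar> < \<rho> \<Longrightarrow> z \<in> cv \<Longrightarrow> gauss_weight (\<mu> + s \<cdot>\<^sub>v \<nu>) (L + s \<cdot>\<^sub>m V) (\<delta> / 2) z \<le> C * gauss_weight \<mu> L \<delta> z"
    using density_domination[OF L V V \<mu> \<mu>(2) \<delta>(1,2)] by metis
  have "averageable f (\<mu> + s \<cdot>\<^sub>v \<nu>) (L + s \<cdot>\<^sub>m V)" if s: "\<bar>s\<bar> < \<rho>" for s
    unfolding averageable_def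
  proof (intro conjI exI[of _ "\<delta> / 2"])
    show "integrable (lborel_vec n) (\<lambda>z. f z * gauss_weight (\<mu> + s \<cdot>\<^sub>v \<nu>) (L + s \<cdot>\<^sub>m V) (\<delta> / 2) z)"
    proof (rule Bochner_Integration.integrable_bound)
      show "integrable (lborel_vec n) (\<lambda>z. C * (f z * gauss_weight \<mu> L \<delta> z))" using \<delta>(3) by simp
      show "AE z in lborel_vec n. norm (f z * gauss_weight (\<mu> + s \<cdot>\<^sub>v \<nu>) (L + s \<cdot>\<^sub>m V) (\<delta> / 2) z)
          \<le> norm (C * (f z * gauss_weight \<mu> L \<delta> z))"
      proof (rule AE_I2)
        fix z assume "z \<in> space (lborel_vec n)"
        then have "\<bar>f z\<bar> * gauss_weight (\<mu> + s \<cdot>\<^sub>v \<nu>) (L + s \<cdot>\<^sub>m V) (\<delta> / 2) z \<le> \<bar>f z\<bar> * (C * gauss_weight \<mu> L \<delta> z)"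
          using \<rho>(4)[OF s] space_lborel_vec by (intro mult_left_mono) auto
        then show "norm (f z * gauss_weight (\<mu> + s \<cdot>\<^sub>v \<nu>) (L + s \<cdot>\<^sub>m V) (\<delta> / 2) z) \<le> norm (C * (f z * gauss_weight \<mu> L \<delta> z))"
          using \<rho>(2) by (simp add: abs_mult gauss_weight_def mult_ac)
      qed
    qed (use fm measurable_gauss_weight[OF \<rho>(3)[OF s]] \<mu> in simp)
  qed (use \<delta> fm in auto)
  then show ?thesis
    unfolding eventually_nhds_metric using \<rho>(1,3) by (intro exI[of _ \<rho>]) (auto simp: dist_real_def)
qed

text \<open>The first derivative of the density produces a score, the second the product of two
  scores plus the derivative of one. Pointwise derivatives at \<open>s \<noteq> 0\<close> follow
  from those at \<open>0\<close> by taking the moved point as the new base point.\<close>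

lemma DERIV_averages:
  assumes L: "L \<in> spd n" and V: "V \<in> sym_mats n" and W: "W \<in> sym_mats n"
    and \<mu>: "\<mu> \<in> cv" "\<nu> \<in> cv" "\<nu>' \<in> cv" and f: "averageable f \<mu> L"
  shows "((\<lambda>s. \<integral>z. f z * gaussian_density (\<mu> + s \<cdot>\<^sub>v \<nu>') (L + s \<cdot>\<^sub>m W) z \<partial>lborel_vec n) has_real_derivative
      (\<integral>z. f z * (gaussian_density \<mu> L z * score \<mu> L \<nu>' W z) \<partial>lborel_vec n)) (at 0)"
    and "((\<lambda>s. \<integral>z. f z * (gaussian_density (\<mu> + s \<cdot>\<^sub>v \<nu>) (L + s \<cdot>\<^sub>m V) z * score (\<mu> + s \<cdot>\<^sub>v \<nu>) (L + s \<cdot>\<^sub>m V) \<nu>' W z)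
          \<partial>lborel_vec n) has_real_derivative
      (\<integral>z. f z * (gaussian_density \<mu> L z * (score \<mu> L \<nu> V z * score \<mu> L \<nu>' W z + dscore \<mu> L \<nu> V \<nu>' W z))
          \<partial>lborel_vec n)) (at 0)"
    and "integrable (lborel_vec n) (\<lambda>z. f z * (gaussian_density \<mu> L z * score \<mu> L \<nu>' W z))"
    and "integrable (lborel_vec n)
      (\<lambda>z. f z * (gaussian_density \<mu> L z * (score \<mu> L \<nu> V z * score \<mu> L \<nu>' W z + dscore \<mu> L \<nu> V \<nu>' W z)))"
proof -
  note [simp] = spdD(2)[OF L] symD(1)[OF V] symD(1)[OF W] \<mu>
  obtain \<delta> where \<delta>: "0 < \<delta>" "\<delta> < 1" "integrable (lborel_vec n) (\<lambda>z. f z * gauss_weight \<mu> L \<delta> z)"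
    and fm: "f \<in> borel_measurable (lborel_vec n)"
    using f unfolding averageable_def by blast
  have h: "integrable (lborel_vec n) (\<lambda>z. C * \<bar>f z * gauss_weight \<mu> L \<delta> z\<bar>)" for C
    using \<delta>(3) by (intro integrable_mult_right integrable_abs)
  have bound: "\<bar>f z * p\<bar> \<le> C * \<bar>f z * gauss_weight \<mu> L \<delta> z\<bar>" if "\<bar>p\<bar> \<le> C * gauss_weight \<mu> L \<delta> z" for p C z
  proof -
    have "\<bar>f z\<bar> * \<bar>p\<bar> \<le> \<bar>f z\<bar> * (C * gauss_weight \<mu> L \<delta> z)" using that by (intro mult_left_mono) auto
    then show ?thesis by (simp add: abs_mult gauss_weight_def mult_ac)
  qed
  have D1: "((\<lambda>s. gaussian_density (\<mu> + s \<cdot>\<^sub>v a) (L + s \<cdot>\<^sub>m U) z) has_real_derivative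
      gaussian_density (\<mu> + s \<cdot>\<^sub>v a) (L + s \<cdot>\<^sub>m U) z * score (\<mu> + s \<cdot>\<^sub>v a) (L + s \<cdot>\<^sub>m U) a U z) (at s)"
    if "L + s \<cdot>\<^sub>m U \<in> spd n" "U \<in> sym_mats n" "a \<in> cv" "z \<in> cv" for s a U z
    using DERIV_gaussian_density[OF that(1,2) _ that(3,4), of "\<mu> + s \<cdot>\<^sub>v a"]
      DERIV_shift[of "\<lambda>s. gaussian_density (\<mu> + s \<cdot>\<^sub>v a) (L + s \<cdot>\<^sub>m U) z" _ 0 s] that symD(1)[OF that(2)]
    by (simp add: line_shift)
  have D2: "((\<lambda>s. score (\<mu> + s \<cdot>\<^sub>v \<nu>) (L + s \<cdot>\<^sub>m V) \<nu>' W z) has_real_derivative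
      dscore (\<mu> + s \<cdot>\<^sub>v \<nu>) (L + s \<cdot>\<^sub>m V) \<nu> V \<nu>' W z) (at s)" if "L + s \<cdot>\<^sub>m V \<in> spd n" "z \<in> cv" for s z
    using DERIV_score[OF that(1) V W _ \<mu>(2,3) that(2), of "\<mu> + s \<cdot>\<^sub>v \<nu>"]
      DERIV_shift[of "\<lambda>s. score (\<mu> + s \<cdot>\<^sub>v \<nu>) (L + s \<cdot>\<^sub>m V) \<nu>' W z" _ 0 s]
    by (simp add: line_shift)
  obtain \<rho>1 C1 where \<rho>1: "0 < \<rho>1" "0 < C1" "\<And>s. \<bar>s\<bar> < \<rho>1 \<Longrightarrow> L + s \<cdot>\<^sub>m W \<in> spd n"
    "\<And>s z. \<bar>s\<bar> < \<rho>1 \<Longrightarrow> z \<in> cv \<Longrightarrow> \<bar>gaussian_density (\<mu> + s \<cdot>\<^sub>v \<nu>') (L + s \<cdot>\<^sub>m W) z\<bar> \<le> C1 * gauss_weight \<mu> L \<delta> z"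
    "\<And>s z. \<bar>s\<bar> < \<rho>1 \<Longrightarrow> z \<in> cv \<Longrightarrow> \<bar>gaussian_density (\<mu> + s \<cdot>\<^sub>v \<nu>') (L + s \<cdot>\<^sub>m W) z
      * score (\<mu> + s \<cdot>\<^sub>v \<nu>') (L + s \<cdot>\<^sub>m W) \<nu>' W z\<bar> \<le> C1 * gauss_weight \<mu> L \<delta> z"
    using density_domination[OF L W W \<mu>(1,3,3) \<delta>(1,2)] by metis
  have int1: "integrable (lborel_vec n) (\<lambda>z. f z * gaussian_density (\<mu> + s \<cdot>\<^sub>v \<nu>') (L + s \<cdot>\<^sub>m W) z)" if s: "\<bar>s\<bar> < \<rho>1" for s
    by (rule Bochner_Integration.integrable_bound[OF h[of C1]])
      (use fm measurable_gaussian_density[OF \<rho>1(3)[OF s], of "\<mu> + s \<cdot>\<^sub>v \<nu>'"] \<rho>1(2) bound \<rho>1(4)[OF s] space_lborel_vec in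
        \<open>auto intro!: AE_I2\<close>)
  note R1 = has_derivative_integral_dominated[OF \<rho>1(1), of "lborel_vec n"
      "\<lambda>s z. f z * gaussian_density (\<mu> + s \<cdot>\<^sub>v \<nu>') (L + s \<cdot>\<^sub>m W) z"
      "\<lambda>s z. f z * (gaussian_density (\<mu> + s \<cdot>\<^sub>v \<nu>') (L + s \<cdot>\<^sub>m W) z * score (\<mu> + s \<cdot>\<^sub>v \<nu>') (L + s \<cdot>\<^sub>m W) \<nu>' W z)"
      "\<lambda>z. C1 * \<bar>f z * gauss_weight \<mu> L \<delta> z\<bar>", OF DERIV_cmult[OF D1[OF \<rho>1(3) W \<mu>(3) space_lborel_vec]]
      bound[OF \<rho>1(5)[OF _ space_lborel_vec]] h int1]
  show "((\<lambda>s. \<integral>z. f z * gaussian_density (\<mu> + s \<cdot>\<^sub>v \<nu>') (L + s \<cdot>\<^sub>m W) z \<partial>lborel_vec n) has_real_derivative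
      (\<integral>z. f z * (gaussian_density \<mu> L z * score \<mu> L \<nu>' W z) \<partial>lborel_vec n)) (at 0)"
    "integrable (lborel_vec n) (\<lambda>z. f z * (gaussian_density \<mu> L z * score \<mu> L \<nu>' W z))"
    using R1 by (simp_all add: mat_line_0 vec_line_0)
  obtain \<rho> C where \<rho>: "0 < \<rho>" "0 < C" "\<And>s. \<bar>s\<bar> < \<rho> \<Longrightarrow> L + s \<cdot>\<^sub>m V \<in> spd n"
    "\<And>s z. \<bar>s\<bar> < \<rho> \<Longrightarrow> z \<in> cv \<Longrightarrow> \<bar>gaussian_density (\<mu> + s \<cdot>\<^sub>v \<nu>) (L + s \<cdot>\<^sub>m V) z
      * score (\<mu> + s \<cdot>\<^sub>v \<nu>) (L + s \<cdot>\<^sub>m V) \<nu>' W z\<bar> \<le> C * gauss_weight \<mu> L \<delta> z"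
    "\<And>s z. \<bar>s\<bar> < \<rho> \<Longrightarrow> z \<in> cv \<Longrightarrow> \<bar>gaussian_density (\<mu> + s \<cdot>\<^sub>v \<nu>) (L + s \<cdot>\<^sub>m V) z
      * (score (\<mu> + s \<cdot>\<^sub>v \<nu>) (L + s \<cdot>\<^sub>m V) \<nu> V z * score (\<mu> + s \<cdot>\<^sub>v \<nu>) (L + s \<cdot>\<^sub>m V) \<nu>' W z
        + dscore (\<mu> + s \<cdot>\<^sub>v \<nu>) (L + s \<cdot>\<^sub>m V) \<nu> V \<nu>' W z)\<bar> \<le> C * gauss_weight \<mu> L \<delta> z"
    using density_domination[OF L V W \<mu> \<delta>(1,2)] by metis
  have int2: "integrable (lborel_vec n) (\<lambda>z. f z * (gaussian_density (\<mu> + s \<cdot>\<^sub>v \<nu>) (L + s \<cdot>\<^sub>m V) z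
      * score (\<mu> + s \<cdot>\<^sub>v \<nu>) (L + s \<cdot>\<^sub>m V) \<nu>' W z))" if s: "\<bar>s\<bar> < \<rho>" for s
    by (rule Bochner_Integration.integrable_bound[OF h[of C]])
      (use fm measurable_gaussian_density[OF \<rho>(3)[OF s], of "\<mu> + s \<cdot>\<^sub>v \<nu>"]
          measurable_score[OF \<rho>(3)[OF s], of "\<mu> + s \<cdot>\<^sub>v \<nu>" \<nu>' W] \<rho>(2) bound \<rho>(4)[OF s] space_lborel_vec in
        \<open>auto intro!: AE_I2\<close>)
  have D3: "((\<lambda>s. gaussian_density (\<mu> + s \<cdot>\<^sub>v \<nu>) (L + s \<cdot>\<^sub>m V) z * score (\<mu> + s \<cdot>\<^sub>v \<nu>) (L + s \<cdot>\<^sub>m V) \<nu>' W z) has_real_derivative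
      gaussian_density (\<mu> + s \<cdot>\<^sub>v \<nu>) (L + s \<cdot>\<^sub>m V) z
      * (score (\<mu> + s \<cdot>\<^sub>v \<nu>) (L + s \<cdot>\<^sub>m V) \<nu> V z * score (\<mu> + s \<cdot>\<^sub>v \<nu>) (L + s \<cdot>\<^sub>m V) \<nu>' W z
        + dscore (\<mu> + s \<cdot>\<^sub>v \<nu>) (L + s \<cdot>\<^sub>m V) \<nu> V \<nu>' W z)) (at s)" if "\<bar>s\<bar> < \<rho>" "z \<in> cv" for s z
    using DERIV_mult[OF D1[OF \<rho>(3)[OF that(1)] V \<mu>(2) that(2)] D2[OF \<rho>(3)[OF that(1)] that(2)]]
    by (simp add: algebra_simps)
  note R2 = has_derivative_integral_dominated[OF \<rho>(1), of "lborel_vec n"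
      "\<lambda>s z. f z * (gaussian_density (\<mu> + s \<cdot>\<^sub>v \<nu>) (L + s \<cdot>\<^sub>m V) z * score (\<mu> + s \<cdot>\<^sub>v \<nu>) (L + s \<cdot>\<^sub>m V) \<nu>' W z)"
      "\<lambda>s z. f z * (gaussian_density (\<mu> + s \<cdot>\<^sub>v \<nu>) (L + s \<cdot>\<^sub>m V) z
      * (score (\<mu> + s \<cdot>\<^sub>v \<nu>) (L + s \<cdot>\<^sub>m V) \<nu> V z * score (\<mu> + s \<cdot>\<^sub>v \<nu>) (L + s \<cdot>\<^sub>m V) \<nu>' W z
        + dscore (\<mu> + s \<cdot>\<^sub>v \<nu>) (L + s \<cdot>\<^sub>m V) \<nu> V \<nu>' W z))"
      "\<lambda>z. C * \<bar>f z * gauss_weight \<mu> L \<delta> z\<bar>", OF DERIV_cmult[OF D3[OF _ space_lborel_vec]]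
      bound[OF \<rho>(5)[OF _ space_lborel_vec]] h int2]
  show "((\<lambda>s. \<integral>z. f z * (gaussian_density (\<mu> + s \<cdot>\<^sub>v \<nu>) (L + s \<cdot>\<^sub>m V) z * score (\<mu> + s \<cdot>\<^sub>v \<nu>) (L + s \<cdot>\<^sub>m V) \<nu>' W z)
          \<partial>lborel_vec n) has_real_derivative
      (\<integral>z. f z * (gaussian_density \<mu> L z * (score \<mu> L \<nu> V z * score \<mu> L \<nu>' W z + dscore \<mu> L \<nu> V \<nu>' W z))
          \<partial>lborel_vec n)) (at 0)"
    "integrable (lborel_vec n)
      (\<lambda>z. f z * (gaussian_density \<mu> L z * (score \<mu> L \<nu> V z * score \<mu> L \<nu>' W z + dscore \<mu> L \<nu> V \<nu>' W z)))"
    using R2 by (simp_all add: mat_line_0 vec_line_0)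
qed

text \<open>\<open>deriv\<close> is total, so existence and value are extracted together from
  \<open>has_real_derivative\<close>. The second derivative uses the first-order formula at all
  nearby points.\<close>

lemma smoothed_derivatives:
  assumes L: "L \<in> spd n" and \<mu>: "\<mu> \<in> cv" and f: "averageable (l w) \<mu> L"
  shows "has_riem_hess n (smoothed n l w) (\<mu>, L)"
    and "\<And>\<nu>' W. \<nu>' \<in> cv \<Longrightarrow> W \<in> sym_mats n \<Longrightarrow> dir_deriv (smoothed n l w) (\<mu>, L) (\<nu>', W)
      = (\<integral>z. l w z * (gaussian_density \<mu> L z * score \<mu> L \<nu>' W z) \<partial>lborel_vec n)"
    and "\<And>\<nu> V \<nu>' W. \<nu> \<in> cv \<Longrightarrow> V \<in> sym_mats n \<Longrightarrow> \<nu>' \<in> cv \<Longrightarrow> W \<in> sym_mats n \<Longrightarrow>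
      dir_deriv (\<lambda>y. dir_deriv (smoothed n l w) y (\<nu>', W)) (\<mu>, L) (\<nu>, V)
      = (\<integral>z. l w z * (gaussian_density \<mu> L z * (score \<mu> L \<nu> V z * score \<mu> L \<nu>' W z + dscore \<mu> L \<nu> V \<nu>' W z)) \<partial>lborel_vec n)"
proof -
  let ?F = "smoothed n l w"
  have first: "((\<lambda>t. ?F (shift (m, M) t (\<nu>', W))) has_real_derivative
      (\<integral>z. l w z * (gaussian_density m M z * score m M \<nu>' W z) \<partial>lborel_vec n)) (at 0)"
    if "M \<in> spd n" "m \<in> cv" "averageable (l w) m M" "\<nu>' \<in> cv" "W \<in> sym_mats n" for m M \<nu>' W
    unfolding smoothed_def shift_def using DERIV_averages(1)[OF that(1,5,5,2,4,4,3)] by simp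
  have dd: "dir_deriv ?F (m, M) (\<nu>', W)
      = (\<integral>z. l w z * (gaussian_density m M z * score m M \<nu>' W z) \<partial>lborel_vec n)"
    if "M \<in> spd n" "m \<in> cv" "averageable (l w) m M" "\<nu>' \<in> cv" "W \<in> sym_mats n" for m M \<nu>' W
    unfolding dir_deriv_def by (rule DERIV_imp_deriv[OF first[OF that]])
  then show "\<And>\<nu>' W. \<nu>' \<in> cv \<Longrightarrow> W \<in> sym_mats n \<Longrightarrow> dir_deriv ?F (\<mu>, L) (\<nu>', W)
      = (\<integral>z. l w z * (gaussian_density \<mu> L z * score \<mu> L \<nu>' W z) \<partial>lborel_vec n)"
    using L \<mu> f by blast
  have second: "((\<lambda>s. dir_deriv ?F (shift (\<mu>, L) s (\<nu>, V)) (\<nu>', W)) has_real_derivative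
      (\<integral>z. l w z * (gaussian_density \<mu> L z * (score \<mu> L \<nu> V z * score \<mu> L \<nu>' W z + dscore \<mu> L \<nu> V \<nu>' W z)) \<partial>lborel_vec n)) (at 0)"
    if "\<nu> \<in> cv" "V \<in> sym_mats n" "\<nu>' \<in> cv" "W \<in> sym_mats n" for \<nu> V \<nu>' W
  proof -
    have "\<forall>\<^sub>F s in nhds 0. dir_deriv ?F (shift (\<mu>, L) s (\<nu>, V)) (\<nu>', W)
      = (\<integral>z. l w z * (gaussian_density (\<mu> + s \<cdot>\<^sub>v \<nu>) (L + s \<cdot>\<^sub>m V) z * score (\<mu> + s \<cdot>\<^sub>v \<nu>) (L + s \<cdot>\<^sub>m V) \<nu>' W z) \<partial>lborel_vec n)"
      using averageable_near[OF L that(2) \<mu> that(1) f]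
      by eventually_elim (use dd that \<mu> in \<open>simp add: shift_def\<close>)
    then show ?thesis
      using DERIV_averages(2)[OF L that(2,4) \<mu> that(1,3) f] by (subst DERIV_cong_ev[OF refl _ refl]) auto
  qed
  then show "\<And>\<nu> V \<nu>' W. \<nu> \<in> cv \<Longrightarrow> V \<in> sym_mats n \<Longrightarrow> \<nu>' \<in> cv \<Longrightarrow> W \<in> sym_mats n \<Longrightarrow>
      dir_deriv (\<lambda>y. dir_deriv ?F y (\<nu>', W)) (\<mu>, L) (\<nu>, V)
      = (\<integral>z. l w z * (gaussian_density \<mu> L z * (score \<mu> L \<nu> V z * score \<mu> L \<nu>' W z + dscore \<mu> L \<nu> V \<nu>' W z)) \<partial>lborel_vec n)"
    unfolding dir_deriv_def[of "\<lambda>y. dir_deriv ?F y _"] by (intro DERIV_imp_deriv) blast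
  show "has_riem_hess n ?F (\<mu>, L)"
    unfolding has_riem_hess_def
  proof (intro ballI conjI)
    fix X Y assume "X \<in> tangents n" "Y \<in> tangents n"
    then obtain \<nu> V \<nu>' W where X: "X = (\<nu>, V)" "\<nu> \<in> cv" "V \<in> sym_mats n" and Y: "Y = (\<nu>', W)" "\<nu>' \<in> cv" "W \<in> sym_mats n"
      by (auto simp: tangents_def)
    show "(\<lambda>s. dir_deriv ?F (shift (\<mu>, L) s X) Y) differentiable at 0"
      unfolding X Y using second[OF X(2,3) Y(2,3)] real_differentiable_def by blast
    show "\<forall>\<^sub>F s in nhds 0. (\<lambda>t. ?F (shift (shift (\<mu>, L) s X) t Y)) differentiable at 0"
      using averageable_near[OF L X(3) \<mu> X(2) f]
    proof eventually_elim
      case (elim s)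
      have "shift (\<mu>, L) s X = (\<mu> + s \<cdot>\<^sub>v \<nu>, L + s \<cdot>\<^sub>m V)" by (simp add: shift_def X)
      then show ?case
        unfolding Y using first[of "L + s \<cdot>\<^sub>m V" "\<mu> + s \<cdot>\<^sub>v \<nu>" \<nu>' W] elim X(2) Y \<mu> real_differentiable_def by auto
    qed
  qed
qed

end

section \<open>The Riemannian Hessian\<close>

context fixed_dim
begin

text \<open>Cyclic shifts and transposition generate all permutations of three symmetric factors
  under the trace.\<close>

lemma tr_triple_sym:
  assumes "A \<in> sym_mats n" "B \<in> sym_mats n" "C \<in> sym_mats n"
  shows "tr (A * (B * C)) = tr (C * (B * A))" "tr (A * (B * C)) = tr (B * (C * A))" "tr (A * (B * C)) = tr (C * (A * B))"
    "tr (A * (B * C)) = tr (B * (A * C))" "tr (A * (B * C)) = tr (A * (C * B))"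
proof -
  note [simp] = symD[OF assms(1)] symD[OF assms(2)] symD[OF assms(3)]
  have "tr (A * (B * C)) = tr (transpose_mat (A * (B * C)))" by (simp add: tr_simps)
  also have "\<dots> = tr (C * (B * A))" by (simp add: transpose_simps mat_simps)
  finally show 1: "tr (A * (B * C)) = tr (C * (B * A))" .
  have "tr (A * (B * C)) = tr (B * C * A)" by (rule tr_comm) simp_all
  then show 2: "tr (A * (B * C)) = tr (B * (C * A))" by (simp add: mat_simps)
  have "tr (C * (A * B)) = tr (A * B * C)" by (rule tr_comm) simp_all
  then show 3: "tr (A * (B * C)) = tr (C * (A * B))" by (simp add: mat_simps)
  have "tr (B * (A * C)) = tr (A * C * B)" by (rule tr_comm) simp_all
  moreover have "tr (C * (B * A)) = tr (B * A * C)" by (rule tr_comm) simp_all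
  ultimately show 4: "tr (A * (B * C)) = tr (B * (A * C))" unfolding 1 by (simp add: mat_simps)
  then show "tr (A * (B * C)) = tr (A * (C * B))" using \<open>tr (B * (A * C)) = tr (A * C * B)\<close> by (simp add: mat_simps)
qed

text \<open>The operator sending \<open>X\<close> to \<open>L * X + X * L\<close> is self-adjoint
  for the trace pairing.\<close>

lemma tr_lyap_pairing:
  assumes L: "L \<in> sym_mats n" and X: "X \<in> sym_mats n" and Y: "Y \<in> sym_mats n"
  shows "tr (X * (L * Y + Y * L)) = 2 * tr (X * (L * Y))" "tr (X * (L * Y + Y * L)) = tr ((L * X + X * L) * Y)"
  using tr_triple_sym[OF X L Y] tr_triple_sym[OF L X Y] symD[OF L] symD[OF X] symD[OF Y]
  by (simp_all add: mat_simps tr_simps)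

text \<open>Self-adjointness removes one of the two Lyapunov solutions, so that only one inverse
  operator has to be differentiated.\<close>

lemma bw_metric_eq:
  assumes L: "L \<in> spd n" and V: "V \<in> sym_mats n" and W: "W \<in> sym_mats n"
  shows "bw_metric L V W = tr (lyap L V * W) / 2" "bw_metric L V W = tr (lyap L W * V) / 2"
proof -
  note X = lyap_solves[OF L V] and Y = lyap_solves[OF L W] and Ls = spdD(1)[OF L]
  have eq: "bw_metric L V W = tr (lyap L V * (L * lyap L W))"
    unfolding bw_metric_def using symD(1)[OF X(1)] symD(1)[OF Y(1)] spdD(2)[OF L] by (simp add: mat_simps)
  show "bw_metric L V W = tr (lyap L V * W) / 2"
    using tr_lyap_pairing(1)[OF Ls X(1) Y(1)] Y(2) eq by simp
  show "bw_metric L V W = tr (lyap L W * V) / 2"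
    using tr_lyap_pairing(1)[OF Ls Y(1) X(1)] X(2) eq tr_triple_sym(1)[OF X(1) Ls Y(1)] by simp
qed

text \<open>Coercivity gives \<open>c * (fnorm X)\<^sup>2 \<le> tr (X * (L * X))\<close>, and the
  equation turns the right side into \<open>tr (X * V) / 2\<close>.\<close>

lemma fnorm_lyap_le:
  assumes L: "L \<in> spd n" and V: "V \<in> sym_mats n"
    and c: "0 < c" "\<And>v. v \<in> cv \<Longrightarrow> c * (v \<bullet> v) \<le> v \<bullet> (L *\<^sub>v v)"
  shows "fnorm (lyap L V) \<le> fnorm V / (2 * c)"
proof -
  define X where "X = lyap L V"
  note X = lyap_solves[OF L V, folded X_def] and Ls = spdD(1)[OF L]
  note [simp] = symD[OF X(1)] spdD(2)[OF L] symD(1)[OF V]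
  have "c * (fnorm X)\<^sup>2 = (\<Sum>j<n. c * ((X *\<^sub>v unit_vec n j) \<bullet> (X *\<^sub>v unit_vec n j)))"
    by (simp add: fnorm_sq_col vnorm_sq sum_distrib_left)
  also have "\<dots> \<le> (\<Sum>j<n. (X *\<^sub>v unit_vec n j) \<bullet> (L *\<^sub>v (X *\<^sub>v unit_vec n j)))"
    by (intro sum_mono c(2)) simp
  also have "\<dots> = tr (X * (L * X))" using tr_cong_sum[of X L] by (simp add: mat_simps)
  also have "\<dots> = tr (X * V) / 2" using tr_lyap_pairing(1)[OF Ls X(1) X(1)] X(2) by simp
  also have "\<dots> \<le> fnorm X * fnorm V / 2" using tr_mult_le[of X V] by simp
  finally have "fnorm X * (2 * c * fnorm X) \<le> fnorm X * fnorm V" by (simp add: power2_eq_square algebra_simps)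
  then show ?thesis unfolding X_def[symmetric] using c(1)
    by (cases "fnorm X = 0") (auto simp: field_simps less_le)
qed

text \<open>The solution \<open>X\<close> at the moved point solves the equation at \<open>L\<close>
  with right side \<open>V - s \<cdot>\<^sub>m (Z * X + X * Z)\<close>. Pairing with
  \<open>lyap L U\<close> gives an exact first-order identity for every \<open>U\<close>; used for
  \<open>W\<close> and then for \<open>T W\<close>, it leaves a remainder of order
  \<open>s\<^sup>2\<close>.\<close>

lemma DERIV_lyap:
  assumes L: "L \<in> spd n" and V: "V \<in> sym_mats n" and W: "W \<in> sym_mats n" and Z: "Z \<in> sym_mats n"
  shows "((\<lambda>t. tr (lyap (L + t \<cdot>\<^sub>m Z) V * W)) has_real_derivative
    - tr (lyap L V * (Z * lyap L W + lyap L W * Z))) (at 0)"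
proof -
  obtain \<rho> c where \<rho>: "0 < \<rho>" "0 < c" "\<And>s. \<bar>s\<bar> < \<rho> \<Longrightarrow> L + s \<cdot>\<^sub>m Z \<in> spd n"
    "\<And>s v. \<bar>s\<bar> < \<rho> \<Longrightarrow> v \<in> cv \<Longrightarrow> c * (v \<bullet> v) \<le> v \<bullet> ((L + s \<cdot>\<^sub>m Z) *\<^sub>v v)"
    using spd_perturbation[OF L Z] by blast
  have Ls: "L \<in> sym_mats n" by (rule spdD(1)[OF L])
  note [simp] = symD(1)[OF V] symD(1)[OF W] symD(1)[OF Z] spdD(2)[OF L]
  define T where "T U = Z * lyap L U + lyap L U * Z" for U
  have T: "T U \<in> sym_mats n" if "U \<in> sym_mats n" for U
    unfolding T_def using sym_closed(6)[OF lyap_solves(1)[OF L that] Z] .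
  have diff: "tr (lyap (L + s \<cdot>\<^sub>m Z) V * U) - tr (lyap L V * U) = - s * tr (lyap (L + s \<cdot>\<^sub>m Z) V * T U)"
    if s: "\<bar>s\<bar> < \<rho>" and U: "U \<in> sym_mats n" for s U
  proof -
    define X where "X = lyap (L + s \<cdot>\<^sub>m Z) V"
    define Y where "Y = lyap L U"
    note X = lyap_solves[OF \<rho>(3)[OF s] V, folded X_def] and Y = lyap_solves[OF L U, folded Y_def]
      and X0 = lyap_solves[OF L V]
    note [simp] = symD(1)[OF X(1)] symD(1)[OF Y(1)]
    have "tr (X * U) = tr ((L * X + X * L) * Y)" using tr_lyap_pairing(2)[OF Ls X(1) Y(1)] Y(2) by simp
    moreover have "L * X + X * L = V - s \<cdot>\<^sub>m (Z * X + X * Z)"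
    proof -
      have "V = (L * X + X * L) + s \<cdot>\<^sub>m (Z * X + X * Z)"
        unfolding X(2)[symmetric] by (rule eq_matI) (auto simp: mat_simps algebra_simps simp del: index_mult_mat(1))
      then show ?thesis by (simp only:) (rule eq_matI, auto simp del: index_mult_mat(1))
    qed
    ultimately have "tr (X * U) = tr (V * Y) - s * tr ((Z * X + X * Z) * Y)" by (simp add: mat_simps tr_simps)
    moreover have "tr ((Z * X + X * Z) * Y) = tr (X * T U)"
      unfolding T_def Y_def[symmetric] using tr_lyap_pairing(2)[OF Z X(1) Y(1)] by simp
    moreover have "tr (lyap L V * U) = tr (V * Y)"
      using tr_lyap_pairing(2)[OF Ls X0(1) Y(1)] X0(2) Y(2) by simp
    ultimately show ?thesis unfolding X_def[symmetric] by simp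
  qed
  define C where "C = fnorm V / (2 * c) * fnorm (T (T W))"
  have L0: "L + 0 \<cdot>\<^sub>m Z = L" by (simp add: mat_line_0)
  have "\<bar>tr (lyap (L + s \<cdot>\<^sub>m Z) V * W) - tr (lyap (L + 0 \<cdot>\<^sub>m Z) V * W) - s * - tr (lyap L V * T W)\<bar> \<le> C * s\<^sup>2"
    if s: "\<bar>s\<bar> < \<rho>" for s
  proof -
    let ?X = "lyap (L + s \<cdot>\<^sub>m Z) V"
    have X: "?X \<in> sym_mats n" by (rule lyap_solves(1)[OF \<rho>(3)[OF s] V])
    have "tr (?X * W) - tr (lyap L V * W) + s * tr (lyap L V * T W) = - s * (tr (?X * T W) - tr (lyap L V * T W))"
      using diff[OF s W] by (simp add: algebra_simps)
    also have "\<dots> = s\<^sup>2 * tr (?X * T (T W))" using diff[OF s T[OF W]] by (simp add: power2_eq_square)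
    finally have e: "tr (?X * W) - tr (lyap L V * W) + s * tr (lyap L V * T W) = s\<^sup>2 * tr (?X * T (T W))" .
    have "\<bar>tr (?X * T (T W))\<bar> \<le> fnorm ?X * fnorm (T (T W))"
      by (rule tr_mult_le) (use symD(1)[OF X] symD(1)[OF T[OF T[OF W]]] in auto)
    also have "\<dots> \<le> C" unfolding C_def using fnorm_lyap_le[OF \<rho>(3)[OF s] V \<rho>(2) \<rho>(4)[OF s]]
      by (intro mult_right_mono) simp_all
    finally have "\<bar>s\<^sup>2 * tr (?X * T (T W))\<bar> \<le> s\<^sup>2 * C" unfolding abs_mult by (simp add: mult_left_mono)
    then show ?thesis unfolding L0 using e by (simp add: mult.commute)
  qed
  then have "\<forall>\<^sub>F s in at 0. \<bar>tr (lyap (L + s \<cdot>\<^sub>m Z) V * W) - tr (lyap (L + 0 \<cdot>\<^sub>m Z) V * W) - s * - tr (lyap L V * T W)\<bar> \<le> C * s\<^sup>2"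
    unfolding eventually_at using \<rho>(1) by (auto simp: dist_real_def)
  then show ?thesis unfolding T_def by (rule DERIV_quadratic_remainder)
qed

section \<open>The Christoffel term\<close>

lemma dir_deriv_metric:
  assumes L: "L \<in> spd n" and V: "V \<in> sym_mats n" and W: "W \<in> sym_mats n" and Z: "Z \<in> sym_mats n"
  shows "dir_deriv (\<lambda>y. Defs.metric y (\<nu>, V) (\<nu>', W)) (\<mu>, L) (\<zeta>, Z)
    = - tr (lyap L V * (Z * lyap L W + lyap L W * Z)) / 2"
proof -
  obtain \<rho> where \<rho>: "0 < \<rho>" "\<And>s. \<bar>s\<bar> < \<rho> \<Longrightarrow> L + s \<cdot>\<^sub>m Z \<in> spd n"
    using spd_perturbation[OF L Z] by metis
  have "((\<lambda>t. \<nu> \<bullet> \<nu>' + tr (lyap (L + t \<cdot>\<^sub>m Z) V * W) / 2) has_real_derivative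
      0 + - tr (lyap L V * (Z * lyap L W + lyap L W * Z)) / 2) (at 0)"
    by (intro DERIV_add DERIV_const DERIV_cdivide DERIV_lyap L V W Z)
  moreover have "\<forall>\<^sub>F t in nhds 0. Defs.metric (shift (\<mu>, L) t (\<zeta>, Z)) (\<nu>, V) (\<nu>', W) = \<nu> \<bullet> \<nu>' + tr (lyap (L + t \<cdot>\<^sub>m Z) V * W) / 2"
    unfolding eventually_nhds_metric using \<rho>
    by (intro exI[of _ \<rho>]) (auto simp: dist_real_def Defs.metric_def shift_def bw_metric_eq(1)[OF _ V W])
  ultimately have "((\<lambda>t. Defs.metric (shift (\<mu>, L) t (\<zeta>, Z)) (\<nu>, V) (\<nu>', W)) has_real_derivative
      - tr (lyap L V * (Z * lyap L W + lyap L W * Z)) / 2) (at 0)"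
    by (subst DERIV_cong_ev[OF refl _ refl]) auto
  then show ?thesis unfolding dir_deriv_def by (rule DERIV_imp_deriv)
qed

text \<open>With \<open>V = S L + L S\<close> the Koszul formula reads
  \<open>2 g(G, Z) = - 2 tr (K S L S)\<close> where \<open>K\<close> solves \<open>L K + K L = Z\<close>.\<close>

lemma christoffel_eq:
  assumes L: "L \<in> spd n" and S: "S \<in> sym_mats n" and \<mu>: "\<nu> \<in> cv"
  shows "christoffel n (\<mu>, L) (\<nu>, S * L + L * S) (\<nu>, S * L + L * S) = (0\<^sub>v n, (-2) \<cdot>\<^sub>m (S * L * S))"
proof -
  define V where "V = S * L + L * S"
  define G where "G = (-2) \<cdot>\<^sub>m (S * L * S)"
  note [simp] = symD(1)[OF S] spdD(2)[OF L] \<mu>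
  have Ls: "L \<in> sym_mats n" by (rule spdD(1)[OF L])
  have V: "V \<in> sym_mats n" unfolding V_def using sym_closed(6)[OF Ls S] .
  have G: "G \<in> sym_mats n" unfolding G_def using sym_closed(3)[OF sym_closed(5)[OF Ls S]] .
  note [simp] = symD(1)[OF V] symD(1)[OF G]
  have VS: "lyap L V = S"
    by (rule lyap_eqI[OF L S]) (simp add: V_def comm_add_mat[of "L * S" n n "S * L"])
  let ?X = "(\<nu>, V)" and ?x = "(\<mu>, L)"
  have koszul: "dir_deriv (\<lambda>y. Defs.metric y ?X (\<zeta>, Z)) ?x ?X + dir_deriv (\<lambda>y. Defs.metric y ?X (\<zeta>, Z)) ?x ?X
      - dir_deriv (\<lambda>y. Defs.metric y ?X ?X) ?x (\<zeta>, Z) = tr (lyap L Z * G)" if Z: "Z \<in> sym_mats n" for \<zeta> Z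
  proof -
    define K where "K = lyap L Z"
    note K = lyap_solves[OF L Z, folded K_def]
    note [simp] = symD(1)[OF K(1)] symD(1)[OF Z]
    have SS: "S * S \<in> sym_mats n" using sym_closed(5)[OF sym_closed(7) S] by (simp add: mat_simps)
    \<comment> \<open>All traces are reduced to \<open>tr (K * (S * (S * L)))\<close> and
      \<open>tr (K * (S * (L * S)))\<close>; the former cancels in the Koszul formula.\<close>
    have 1: "tr (S * (V * K + K * V)) = 2 * tr (K * (S * (S * L))) + 2 * tr (K * (S * (L * S)))"
    proof -
      have "tr (S * (V * K + K * V)) = 2 * tr (S * (V * K))" by (rule tr_lyap_pairing(1)[OF V S K(1)])
      also have "tr (S * (V * K)) = tr (K * (S * V))" by (rule tr_triple_sym(3)[OF S V K(1)])
      also have "S * V = S * (S * L) + S * (L * S)" unfolding V_def by (simp add: mat_simps)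
      finally show ?thesis by (simp add: mat_simps tr_simps)
    qed
    have 2: "tr (S * (Z * S + S * Z)) = 4 * tr (K * (S * (S * L)))"
    proof -
      have "tr (S * (Z * S + S * Z)) = 2 * tr (S * (Z * S))" by (rule tr_lyap_pairing(1)[OF Z S S])
      also have "tr (S * (Z * S)) = tr (S * S * Z)" using tr_triple_sym(5)[OF S Z S] by (simp add: mat_simps)
      also have "\<dots> = 2 * tr (S * S * (L * K))" using tr_lyap_pairing(1)[OF Ls SS K(1)] K(2) by simp
      also have "tr (S * S * (L * K)) = tr (K * (S * S * L))" by (rule tr_triple_sym(3)[OF SS Ls K(1)])
      finally show ?thesis by (simp add: mat_simps)
    qed
    have "tr (K * G) = - 2 * tr (K * (S * (L * S)))" unfolding G_def by (simp add: mat_simps tr_simps)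
    then show ?thesis
      unfolding dir_deriv_metric[OF L V Z V] dir_deriv_metric[OF L V V Z] VS K_def[symmetric] 1 2 by simp
  qed
  have metric_G: "2 * Defs.metric ?x (g, G') (\<zeta>, Z) = 2 * (g \<bullet> \<zeta>) + tr (lyap L Z * G')"
    if "G' \<in> sym_mats n" "Z \<in> sym_mats n" for g G' \<zeta> Z
    unfolding Defs.metric_def using bw_metric_eq(2)[OF L that] by simp
  show ?thesis
    unfolding christoffel_def V_def[symmetric] G_def[symmetric]
  proof (rule the_equality)
    show "(0\<^sub>v n, G) \<in> tangents n \<and> (\<forall>Z\<in>tangents n. 2 * Defs.metric ?x (0\<^sub>v n, G) Z =
        dir_deriv (\<lambda>y. Defs.metric y ?X Z) ?x ?X + dir_deriv (\<lambda>y. Defs.metric y ?X Z) ?x ?X - dir_deriv (\<lambda>y. Defs.metric y ?X ?X) ?x Z)"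
      using G koszul metric_G by (auto simp: tangents_def)
    fix Y assume Y: "Y \<in> tangents n \<and> (\<forall>Z\<in>tangents n. 2 * Defs.metric ?x Y Z =
        dir_deriv (\<lambda>y. Defs.metric y ?X Z) ?x ?X + dir_deriv (\<lambda>y. Defs.metric y ?X Z) ?x ?X - dir_deriv (\<lambda>y. Defs.metric y ?X ?X) ?x Z)"
    then obtain g G' where Y': "Y = (g, G')" "g \<in> cv" "G' \<in> sym_mats n" by (auto simp: tangents_def)
    note [simp] = symD(1)[OF Y'(3)]
    have eq: "2 * (g \<bullet> \<zeta>) + tr (lyap L Z * G') = tr (lyap L Z * G)" if "\<zeta> \<in> cv" "Z \<in> sym_mats n" for \<zeta> Z
      using Y koszul[OF that(2), of \<zeta>] metric_G[OF Y'(3) that(2), of g \<zeta>] that unfolding Y' tangents_def by auto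
    \<comment> \<open>Testing with the zero matrix isolates the vector part of
      \<open>Y\<close>.\<close>
    have "lyap L (0\<^sub>m n n) = 0\<^sub>m n n" by (rule lyap_eqI[OF L sym_closed(8)]) simp
    then have "g \<bullet> g = 0"
      using eq[OF Y'(2) sym_closed(8)] by (simp add: tr_def)
    then have g0: "g = 0\<^sub>v n" using dot_self_eq_0[OF Y'(2)] by simp
    define D where "D = G' - G"
    have D: "D \<in> sym_mats n" unfolding D_def by (rule sym_closed(2)[OF Y'(3) G])
    note [simp] = symD[OF D]
    \<comment> \<open>The test direction is chosen so that its Lyapunov solution is \<open>D\<close>
      itself; the pairing then becomes the definite form \<open>tr (D * D)\<close>.\<close>
    have "lyap L (L * D + D * L) = D" by (rule lyap_eqI[OF L D]) simp
    then have "tr (D * G') = tr (D * G)"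
      using eq[of "0\<^sub>v n" "L * D + D * L"] sym_closed(6)[OF D Ls] Y'(2) by simp
    moreover have "tr (D * D) = tr (D * G') - tr (D * G)" by (subst (2) D_def) (simp add: mat_simps tr_simps)
    ultimately have "tr (D * D) = 0" by simp
    then have "fnorm D = 0" using fnorm_sq_tr[of D] by simp
    then have D0: "D $$ (i, j) = 0" if "i < n" "j < n" for i j
      using that unfolding fnorm_L2 by (auto simp: L2_set_eq_0_iff)
    have "G' = G"
    proof (rule eq_matI)
      fix i j assume "i < dim_row G" "j < dim_col G"
      then have ij: "i < n" "j < n" by simp_all
      then show "G' $$ (i, j) = G $$ (i, j)" using D0[OF ij] by (simp add: D_def)
    qed simp_all
    then show "Y = (0\<^sub>v n, G)" unfolding Y' using g0 by simp
  qed
qed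

text \<open>In the application \<open>a\<close> is the size of the whitened direction,
  \<open>x\<close> the length of the whitened point, \<open>k\<close> the square root of the
  dimension and \<open>m\<close> the value \<open>n + x\<^sup>2\<close>. The constant is
  \<open>16 = 4 + 11 + 1\<close>: squared score, second derivative with \<open>11 = 2 + 9\<close>,
  Christoffel term.\<close>

lemma score_bound_real:
  fixes a x m k :: real
  assumes "0 \<le> a" "0 \<le> x" "x \<le> m" "x\<^sup>2 \<le> m" "1 \<le> m" "x\<^sup>2 + k \<le> m" "0 \<le> k"
    and "\<bar>s\<bar> \<le> a * (x + x\<^sup>2 + k)" "\<bar>d\<bar> \<le> 2 * a\<^sup>2 + (a + 2 * a * x)\<^sup>2" "\<bar>g\<bar> \<le> a\<^sup>2 * (x\<^sup>2 + k)"
  shows "\<bar>s\<^sup>2 + d - g\<bar> \<le> 16 * a\<^sup>2 * m\<^sup>2"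
proof -
  have "\<bar>s\<bar> \<le> a * (2 * m)" using assms(8) by (rule order_trans) (use assms in \<open>auto intro!: mult_left_mono\<close>)
  then have "\<bar>s\<bar>\<^sup>2 \<le> (a * (2 * m))\<^sup>2" by (rule power_mono) simp
  then have 1: "s\<^sup>2 \<le> 4 * (a\<^sup>2 * m\<^sup>2)" by (simp add: power_mult_distrib)
  have mm: "m \<le> m\<^sup>2" "1 \<le> m\<^sup>2" using assms(5) by (auto simp: self_le_power one_le_power)
  have "a * (1 + 2 * x) \<le> a * (3 * m)" using assms by (intro mult_left_mono) auto
  then have "(a + 2 * a * x)\<^sup>2 \<le> (a * (3 * m))\<^sup>2" using assms by (intro power_mono) (auto simp: algebra_simps)
  then have "(a + 2 * a * x)\<^sup>2 \<le> 9 * (a\<^sup>2 * m\<^sup>2)" by (simp add: power_mult_distrib)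
  moreover have "a\<^sup>2 * 1 \<le> a\<^sup>2 * m\<^sup>2" using mm by (intro mult_left_mono) auto
  ultimately have 2: "\<bar>d\<bar> \<le> 11 * (a\<^sup>2 * m\<^sup>2)" using assms(9) by linarith
  have "a\<^sup>2 * (x\<^sup>2 + k) \<le> a\<^sup>2 * m\<^sup>2" using mm assms by (intro mult_left_mono) auto
  then have 3: "\<bar>g\<bar> \<le> a\<^sup>2 * m\<^sup>2" using assms(10) by linarith
  have "\<bar>s\<^sup>2 + d - g\<bar> \<le> s\<^sup>2 + \<bar>d\<bar> + \<bar>g\<bar>" using zero_le_power2[of s] by linarith
  then show ?thesis using 1 2 3 by linarith
qed

text \<open>Whitening by \<open>I = minv (msqrt L)\<close> turns \<open>V\<close> into B + B^T and
  \<open>G\<close> into -2 B B^T, where \<open>B = I * (S * R)\<close>. The squared Frobenius norm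
  of \<open>S * R\<close> is the metric quantity \<open>tr (S * L * S)\<close>, so
  \<open>a = sqrt (\<omega> * N)\<close> controls both matrices. A trace costs
  \<open>sqrt n\<close>, hence at most \<open>n\<close>, and everything fits under a multiple of
  \<open>(n + q)\<^sup>2\<close>.\<close>

lemma Hessian_integrand_bound:
  fixes q :: real
  assumes n: "0 < n" and L: "L \<in> spd n" and S: "S \<in> sym_mats n" and \<mu>: "\<mu> \<in> cv" "\<nu> \<in> cv" "z \<in> cv"
    and \<omega>: "0 \<le> \<omega>" "\<And>v. v \<in> cv \<Longrightarrow> v \<bullet> (minv L *\<^sub>v v) \<le> \<omega> * (vnorm v)\<^sup>2"
  defines "V \<equiv> S * L + L * S" and "G \<equiv> (-2) \<cdot>\<^sub>m (S * L * S)"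
    and "q \<equiv> (z - \<mu>) \<bullet> (minv L *\<^sub>v (z - \<mu>))"
  shows "\<bar>(score \<mu> L \<nu> V z)\<^sup>2 + dscore \<mu> L \<nu> V \<nu> V z - score \<mu> L (0\<^sub>v n) G z\<bar>
    \<le> 16 * \<omega> * ((vnorm \<nu>)\<^sup>2 + tr (S * L * S)) * (n + q)\<^sup>2"
proof -
  define R where "R = msqrt L"
  note R = spd_msqrt[OF L, folded R_def]
  define I where "I = minv R"
  note I = spd_minv[OF R(1), folded I_def]
  note [simp] = spdD(2)[OF L] symD[OF S] spdD(2,3)[OF R(1)] spdD(2,3)[OF I(1)] \<mu>
  note cancel = inverse_cancel[OF spdD(2)[OF R(1)] spdD(2)[OF I(1)] I(2)]
  have K: "minv L = I * I" using spd_square(2)[OF R(1)] R(2) by (simp add: I_def)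
  have Iw: "vnorm (I *\<^sub>v v) \<le> sqrt \<omega> * vnorm v" if "v \<in> cv" for v
  proof -
    have "(vnorm (I *\<^sub>v v))\<^sup>2 \<le> \<omega> * (vnorm v)\<^sup>2" using \<omega>(2)[OF that] root_quadratic[OF I(1) that] by (simp add: K)
    from real_le_rsqrt[OF this] show ?thesis by (simp add: real_sqrt_mult)
  qed
  define N where "N = (vnorm \<nu>)\<^sup>2 + tr (S * L * S)"
  have SR: "(fnorm (S * R))\<^sup>2 = tr (S * L * S)"
  proof -
    have "(fnorm (S * R))\<^sup>2 = tr (R * (S * (S * R)))" by (simp add: fnorm_sq_tr transpose_simps mat_simps)
    also have "\<dots> = tr (S * (S * R) * R)" by (rule tr_comm) simp_all
    also have "\<dots> = tr (S * (S * L))" using R(2) by (simp add: mat_simps)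
    also have "\<dots> = tr (S * L * S)" by (rule tr_comm[THEN trans]) (simp_all add: mat_simps)
    finally show ?thesis .
  qed
  have N: "0 \<le> N" "vnorm \<nu> \<le> sqrt N" "fnorm (S * R) \<le> sqrt N"
    unfolding N_def SR[symmetric] by (auto intro!: real_le_rsqrt)
  define a where "a = sqrt (\<omega> * N)"
  have a: "0 \<le> a" "a\<^sup>2 = \<omega> * N" "a = sqrt \<omega> * sqrt N" using \<omega>(1) N(1) by (auto simp: a_def real_sqrt_mult power_mult_distrib)
  define B where "B = I * (S * R)"
  have [simp]: "B \<in> cm" by (simp add: B_def)
  have B: "fnorm B \<le> a"
  proof -
    have "fnorm B \<le> sqrt \<omega> * fnorm (S * R)" unfolding B_def using Iw \<omega>(1) by (intro fnorm_mult_bound) auto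
    also have "\<dots> \<le> a" unfolding a(3) using N(3) \<omega>(1) by (intro mult_left_mono) auto
    finally show ?thesis .
  qed
  have BT: "transpose_mat B = R * (S * I)" unfolding B_def by (simp add: transpose_simps mat_simps)
  define V' where "V' = I * (V * I)"
  define G' where "G' = I * (G * I)"
  have [simp]: "V \<in> cm" "G \<in> cm" "V' \<in> cm" "G' \<in> cm" by (simp_all add: V_def G_def V'_def G'_def)
  have "V' = B + transpose_mat B"
    unfolding V'_def V_def BT unfolding B_def R(2)[symmetric] using I by (simp add: mat_simps cancel)
  then have V': "fnorm V' \<le> 2 * a" using fnorm_triangle[of B "transpose_mat B"] B by simp
  have "G' = (-2) \<cdot>\<^sub>m (B * transpose_mat B)"
    unfolding G'_def G_def BT unfolding B_def R(2)[symmetric] using I by (simp add: mat_simps)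
  then have "fnorm G' = 2 * fnorm (B * transpose_mat B)" by (simp add: fnorm_smult)
  also have "\<dots> \<le> 2 * (fnorm B * fnorm B)" using fnorm_mult_le[of B "transpose_mat B"] by simp
  also have "\<dots> \<le> 2 * (a * a)" using B a(1) by (intro mult_left_mono mult_mono) auto
  finally have G': "fnorm G' \<le> 2 * a\<^sup>2" by (simp add: power2_eq_square)
  define x where "x = I *\<^sub>v (z - \<mu>)"
  define u where "u = minv L *\<^sub>v (z - \<mu>)"
  have [simp]: "x \<in> cv" "u \<in> cv" by (simp_all add: x_def u_def K)
  have u: "u = I *\<^sub>v x" unfolding u_def K x_def by (simp add: mat_vec_simps)
  have q: "q = (vnorm x)\<^sup>2" unfolding q_def x_def K using root_quadratic[OF I(1)] by simp
  have adj: "y \<bullet> (I *\<^sub>v w) = (I *\<^sub>v y) \<bullet> w" if "y \<in> cv" "w \<in> cv" for y w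
    using dot_sym[OF spdD(1)[OF I(1)] that] .
  have quad: "\<bar>u \<bullet> (M *\<^sub>v u)\<bar> \<le> fnorm (I * (M * I)) * (vnorm x)\<^sup>2" if "M \<in> cm" for M
  proof -
    have "u \<bullet> (M *\<^sub>v u) = x \<bullet> (I * (M * I) *\<^sub>v x)" unfolding u using that adj[of x "M *\<^sub>v (I *\<^sub>v x)"] by (simp add: mat_vec_simps)
    then show ?thesis using sym_quadratic_le[of "I * (M * I)" x] that by (simp add: vnorm_sq)
  qed
  have trK: "\<bar>tr (minv L * M)\<bar> \<le> sqrt n * fnorm (I * (M * I))" if "M \<in> cm" for M
  proof -
    have "tr (minv L * M) = tr (I * (I * M))" unfolding K using that by (simp add: mat_simps)
    also have "\<dots> = tr (I * M * I)" using that by (intro tr_comm) simp_all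
    finally show ?thesis using tr_le[of "I * (M * I)"] that by (simp add: mat_simps)
  qed
  have \<nu>: "vnorm (I *\<^sub>v \<nu>) \<le> a"
    using Iw[OF \<mu>(2)] mult_left_mono[OF N(2), of "sqrt \<omega>"] \<omega>(1) unfolding a(3) by simp
  define m where "m = n + (vnorm x)\<^sup>2"
  have n1: "1 \<le> real n" using n by simp
  have sn: "sqrt n \<le> n" using self_le_power[OF n1, of 2] by (intro real_le_lsqrt) auto
  have s: "\<bar>score \<mu> L \<nu> V z\<bar> \<le> a * (vnorm x + (vnorm x)\<^sup>2 + sqrt n)"
  proof -
    have "\<bar>\<nu> \<bullet> u\<bar> \<le> a * vnorm x"
      unfolding u using adj[of \<nu> x] Cauchy_Schwarz[of "I *\<^sub>v \<nu>" x] mult_right_mono[OF \<nu>, of "vnorm x"] by simp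
    moreover have "\<bar>u \<bullet> (V *\<^sub>v u)\<bar> \<le> 2 * a * (vnorm x)\<^sup>2"
      using quad[of V] mult_right_mono[OF V', of "(vnorm x)\<^sup>2"] unfolding V'_def[symmetric] by simp
    moreover have "\<bar>tr (minv L * V)\<bar> \<le> sqrt n * (2 * a)"
      using trK[of V] mult_left_mono[OF V', of "sqrt n"] unfolding V'_def[symmetric] by simp
    ultimately have "\<bar>score \<mu> L \<nu> V z\<bar> \<le> a * vnorm x + (2 * a * (vnorm x)\<^sup>2) / 2 + (sqrt n * (2 * a)) / 2"
      unfolding score_def Let_def u_def[symmetric] by linarith
    then show ?thesis by (simp add: algebra_simps)
  qed
  have d: "\<bar>dscore \<mu> L \<nu> V \<nu> V z\<bar> \<le> 2 * a\<^sup>2 + (a + 2 * a * vnorm x)\<^sup>2"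
  proof -
    have "tr (minv L * V * minv L * V) = tr (I * (I * (V * (I * (I * V)))))" unfolding K by (simp add: mat_simps)
    also have "\<dots> = tr (I * (V * (I * (I * V))) * I)" by (rule tr_comm) simp_all
    also have "\<dots> = tr (V' * V')" unfolding V'_def by (simp add: mat_simps)
    finally have "\<bar>tr (minv L * V * minv L * V)\<bar> \<le> fnorm V' * fnorm V'" using tr_mult_le[of V' V'] by simp
    also have "\<dots> \<le> (2 * a) * (2 * a)" using V' a(1) by (intro mult_mono) auto
    finally have 1: "\<bar>tr (minv L * V * minv L * V)\<bar> \<le> 4 * a\<^sup>2" by (simp add: power2_eq_square)
    define w where "w = \<nu> + V *\<^sub>v u"
    have w: "w \<in> cv" by (simp add: w_def)
    have Iw': "I *\<^sub>v w = I *\<^sub>v \<nu> + V' *\<^sub>v x" unfolding w_def V'_def u by (simp add: mat_vec_simps)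
    have "vnorm (I *\<^sub>v w) \<le> vnorm (I *\<^sub>v \<nu>) + fnorm V' * vnorm x"
      unfolding Iw' using vnorm_triangle[of "I *\<^sub>v \<nu>" "V' *\<^sub>v x"] vnorm_mat_vec_le[of V' x] by simp
    also have "\<dots> \<le> a + 2 * a * vnorm x" using \<nu> V' by (intro add_mono mult_right_mono) auto
    finally have "(vnorm (I *\<^sub>v w))\<^sup>2 \<le> (a + 2 * a * vnorm x)\<^sup>2" by (rule power_mono) simp
    moreover have "w \<bullet> (minv L *\<^sub>v w) = (vnorm (I *\<^sub>v w))\<^sup>2" unfolding K by (rule root_quadratic[OF I(1) w])
    moreover have "V *\<^sub>v u + \<nu> = w" unfolding w_def by (simp add: comm_add_vec[of "V *\<^sub>v u" n \<nu>])
    ultimately have 2: "\<bar>(\<nu> + V *\<^sub>v u) \<bullet> (minv L *\<^sub>v (V *\<^sub>v u + \<nu>))\<bar> \<le> (a + 2 * a * vnorm x)\<^sup>2"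
      by (simp add: w_def[symmetric])
    show ?thesis unfolding dscore_def Let_def u_def[symmetric] using 1 2 by linarith
  qed
  have g: "\<bar>score \<mu> L (0\<^sub>v n) G z\<bar> \<le> a\<^sup>2 * ((vnorm x)\<^sup>2 + sqrt n)"
  proof -
    have "\<bar>u \<bullet> (G *\<^sub>v u)\<bar> \<le> 2 * a\<^sup>2 * (vnorm x)\<^sup>2"
      using quad[of G] mult_right_mono[OF G', of "(vnorm x)\<^sup>2"] unfolding G'_def[symmetric] by simp
    moreover have "\<bar>tr (minv L * G)\<bar> \<le> sqrt n * (2 * a\<^sup>2)"
      using trK[of G] mult_left_mono[OF G', of "sqrt n"] unfolding G'_def[symmetric] by simp
    ultimately have "\<bar>score \<mu> L (0\<^sub>v n) G z\<bar> \<le> (2 * a\<^sup>2 * (vnorm x)\<^sup>2) / 2 + (sqrt n * (2 * a\<^sup>2)) / 2"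
      unfolding score_def Let_def u_def[symmetric] by simp
    then show ?thesis by (simp add: algebra_simps)
  qed
  have m: "vnorm x \<le> m" "(vnorm x)\<^sup>2 \<le> m" "1 \<le> m" "(vnorm x)\<^sup>2 + sqrt n \<le> m"
    using n1 sn le_one_plus_square[of "vnorm x"] zero_le_power2[of "vnorm x"] unfolding m_def by linarith+
  have "\<bar>(score \<mu> L \<nu> V z)\<^sup>2 + dscore \<mu> L \<nu> V \<nu> V z - score \<mu> L (0\<^sub>v n) G z\<bar> \<le> 16 * a\<^sup>2 * m\<^sup>2"
    by (rule score_bound_real[OF a(1) vnorm_nonneg m _ s d g]) simp
  then show ?thesis unfolding a(2) N_def[symmetric] m_def q by (simp add: mult.assoc)
qed

end

text \<open>The factors come from the pointwise bound \<open>16\<close>, from absorbing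
  \<open>(n + q)\<^sup>2\<close> into \<open>exp (d * q / (2 * n))\<close>, and from Hoelder's
  inequality; none involves the dimension.\<close>

definition hess_const :: "real \<Rightarrow> real \<Rightarrow> real \<Rightarrow> real \<Rightarrow> real" where
  "hess_const \<kappa> \<theta> d \<gamma> = 16 * (8 / d\<^sup>2) * exp (d / 2) * exp (bound_exponent \<kappa> \<theta> d \<gamma>)"

context fixed_dim
begin

text \<open>The damped weight serves twice: integrability against it makes \<open>l w\<close>
  averageable, which validates the Hessian formula, and the integral against it bounds that formula.
  Since \<open>g i \<ge> \<gamma>\<^sup>2\<close>, the form of \<open>minv L\<close> is at most
  \<open>b / \<gamma>\<^sup>2\<close>, whence the prefactor.\<close>

lemma Hessian_bound:
  fixes l :: "real vec \<Rightarrow> real vec \<Rightarrow> real"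
  assumes n: "0 < n" and L': "L' \<in> spd n" and \<gamma>: "0 < \<gamma>" "\<gamma> < 1"
    and \<kappa>: "1 < \<kappa>" "0 < \<theta>" "0 < d" "d < 1" "(2 - \<gamma>)\<^sup>2 \<le> (1 - d) * \<kappa> - \<theta>"
    and \<mu>': "\<mu>' \<in> cv" and ball: "(\<mu>, L) \<in> ball_product n \<mu>' L' (radius \<gamma> L')"
    and f: "l w \<in> borel_measurable (lborel_vec n)" "\<And>z. z \<in> cv \<Longrightarrow> 0 \<le> l w z"
      "integrable (lborel_vec n) (\<lambda>z. l w z powr \<kappa> * gaussian_density \<mu>' L' z)"
  defines "J \<equiv> \<integral>z. l w z powr \<kappa> * gaussian_density \<mu>' L' z \<partial>lborel_vec n"
  shows "integrable (lborel_vec n) (\<lambda>z. l w z * gaussian_density \<mu> L z)"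
    "has_riem_hess n (smoothed n l w) (\<mu>, L)"
    "hess_sup n (smoothed n l w) (\<mu>, L)
      \<le> ereal (hess_const \<kappa> \<theta> d \<gamma> / \<gamma>\<^sup>2 * opnorm (minv L') * (real n)\<^sup>2 * J powr (1 / \<kappa>))"
proof -
  define b where "b = opnorm (minv L')"
  have b: "0 < b" unfolding b_def using spd_opnorm_pos[OF spd_minv(1)[OF L'] n] .
  have L: "L \<in> spd n" and \<mu>: "\<mu> \<in> cv" and dist: "vnorm (\<mu> - \<mu>') \<le> radius \<gamma> L'" "bw_dist L L' \<le> radius \<gamma> L'"
    using ball by (auto simp: ball_product_def)
  obtain P P' g where P: "P \<in> cm" "P' \<in> cm" "P * P' = 1\<^sub>m n"
    "L = P * mat_diag n g * transpose_mat P" "L' = P * transpose_mat P"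
    "\<And>i. i < n \<Longrightarrow> \<gamma>\<^sup>2 \<le> g i" "\<And>i. i < n \<Longrightarrow> g i \<le> (2 - \<gamma>)\<^sup>2" "(\<Sum>i<n. (g i - 1)\<^sup>2) \<le> 9"
    "\<And>h. h \<in> cv \<Longrightarrow> (vnorm (P' *\<^sub>v h))\<^sup>2 \<le> b * (vnorm h)\<^sup>2"
    using BW_ball_coordinates[OF n L L' \<gamma> dist(2)] unfolding b_def by blast
  have g0: "0 < g i" if "i < n" for i using P(6)[OF that] \<gamma> by (meson less_le_trans zero_less_power)
  have g1: "g i \<le> (1 - d) * \<kappa> - \<theta>" if "i < n" for i using P(7)[OF that] \<kappa>(5) by linarith
  have h: "vnorm (P' *\<^sub>v (\<mu> - \<mu>')) \<le> 1"
  proof -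
    have r: "radius \<gamma> L' = (1 - \<gamma>) / sqrt b"
      unfolding radius_def b_def[symmetric] using b by (simp add: powr_minus powr_half_sqrt field_simps)
    have "(vnorm (P' *\<^sub>v (\<mu> - \<mu>')))\<^sup>2 \<le> b * (vnorm (\<mu> - \<mu>'))\<^sup>2" using \<mu> \<mu>' by (intro P(9)) simp
    also have "\<dots> \<le> b * ((1 - \<gamma>) / sqrt b)\<^sup>2" using dist(1) b unfolding r by (intro mult_left_mono power_mono) auto
    also have "\<dots> = (1 - \<gamma>)\<^sup>2" using b by (simp add: power_divide)
    also have "\<dots> \<le> 1\<^sup>2" using \<gamma> by (intro power_mono) auto
    finally show ?thesis by (rule power2_le_imp_le) simp
  qed
  define q where "q z = (z - \<mu>) \<bullet> (minv L *\<^sub>v (z - \<mu>))" for z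
  define D where "D = sqrt (det ((2 * pi) \<cdot>\<^sub>m L))"
  have D: "0 < D" using spd_det_pos[OF L] spdD(2)[OF L] by (simp add: D_def)
  define wt where "wt z = exp (- (1 - d / n) * q z / 2) / D" for z
  note H = weighted_Hoelder_bound[OF n P(1,2,3,4,5) \<gamma> \<kappa>(1,2,3,4) P(6) g1 P(8) \<mu> \<mu>' h f, folded q_def D_def,
      folded wt_def J_def]
  have dn: "0 < d / n" "d / n < 1" using n \<kappa> by (auto simp: field_simps)
  have av: "averageable (l w) \<mu> L"
    unfolding averageable_def
  proof (intro conjI exI[of _ "d / n"] dn f(1))
    have "integrable (lborel_vec n) (\<lambda>z. D * (l w z * wt z))" using H(1) by (rule integrable_mult_right)
    then show "integrable (lborel_vec n) (\<lambda>z. l w z * gauss_weight \<mu> L (d / n) z)"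
      using D by (simp add: wt_def gauss_weight_def q_def)
  qed
  note der = smoothed_derivatives[OF L \<mu>, of l w, OF av]
  show "integrable (lborel_vec n) (\<lambda>z. l w z * gaussian_density \<mu> L z)" by (rule averageable_integrable[OF L \<mu> av])
  show "has_riem_hess n (smoothed n l w) (\<mu>, L)" by (rule der(1))
  define \<omega> where "\<omega> = b / \<gamma>\<^sup>2"
  have \<omega>0: "0 \<le> \<omega>" using b by (simp add: \<omega>_def)
  have \<omega>: "v \<bullet> (minv L *\<^sub>v v) \<le> \<omega> * (vnorm v)\<^sup>2" if v: "v \<in> cv" for v
  proof -
    have K: "minv L = transpose_mat P' * mat_diag n (\<lambda>i. 1 / g i) * P'"
      unfolding P(4) by (rule minv_coordinates(1)[OF P(1,2,3)]) (use g0 in force)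
    have y: "P' *\<^sub>v v \<in> cv" using P v by simp
    have "v \<bullet> (minv L *\<^sub>v v) = (P' *\<^sub>v v) \<bullet> (mat_diag n (\<lambda>i. 1 / g i) *\<^sub>v (P' *\<^sub>v v))"
      unfolding K using P(2) v dot_transpose[of "transpose_mat P'" v "mat_diag n (\<lambda>i. 1 / g i) *\<^sub>v (P' *\<^sub>v v)"]
      by (simp add: mat_vec_simps)
    also have "\<dots> = (\<Sum>i<n. 1 / g i * ((P' *\<^sub>v v) $ i)\<^sup>2)" by (rule mat_diag_quadratic[OF y])
    also have "\<dots> \<le> (\<Sum>i<n. 1 / \<gamma>\<^sup>2 * ((P' *\<^sub>v v) $ i)\<^sup>2)"
      using P(6) g0 \<gamma> by (intro sum_mono mult_right_mono divide_left_mono) auto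
    also have "\<dots> = 1 / \<gamma>\<^sup>2 * (vnorm (P' *\<^sub>v v))\<^sup>2"
      unfolding vnorm_sq scalar_prod_sum[OF y] by (simp add: sum_distrib_left power2_eq_square)
    also have "\<dots> \<le> 1 / \<gamma>\<^sup>2 * (b * (vnorm v)\<^sup>2)" using P(9)[OF v] by (intro mult_left_mono) auto
    finally show ?thesis by (simp add: \<omega>_def)
  qed
  define C where "C = 16 * (8 / d\<^sup>2) * exp (d / 2) * \<omega> * (real n)\<^sup>2"
  have C0: "0 \<le> C" unfolding C_def using \<omega>0 by simp
  have q0: "0 \<le> q z" if "z \<in> cv" for z
    unfolding q_def using spdD(5)[OF spd_minv(1)[OF L]] that \<mu> by simp
  \<comment> \<open>In terms of \<open>t = q z / n\<close> the polynomial is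
    \<open>n\<^sup>2 * (1 + t)\<^sup>2\<close> and the damping is \<open>exp (d * t / 2)\<close>;
    this scaling keeps \<open>8 / d\<^sup>2\<close> free of the dimension.\<close>
  have poly: "(n + q z)\<^sup>2 * gaussian_density \<mu> L z \<le> (8 / d\<^sup>2) * exp (d / 2) * (real n)\<^sup>2 * wt z" if z: "z \<in> cv" for z
  proof -
    define t where "t = q z / n"
    have t: "0 \<le> t" "q z = n * t" using q0[OF z] n by (auto simp: t_def)
    have "((d / 2) * (1 + t))\<^sup>2 \<le> 2 * exp ((d / 2) * (1 + t))" using t \<kappa> by (intro square_le_exp) auto
    then have "(2 / d)\<^sup>2 * ((d / 2) * (1 + t))\<^sup>2 \<le> (2 / d)\<^sup>2 * (2 * exp ((d / 2) * (1 + t)))"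
      by (rule mult_left_mono) simp
    moreover have "(2 / d)\<^sup>2 * ((d / 2) * (1 + t))\<^sup>2 = (1 + t)\<^sup>2"
      unfolding power_mult_distrib[symmetric] mult.assoc[symmetric] using \<kappa> by simp
    ultimately have "(1 + t)\<^sup>2 \<le> (8 / d\<^sup>2) * exp ((d / 2) * (1 + t))" by (simp add: power_divide)
    also have "\<dots> = (8 / d\<^sup>2) * exp (d / 2) * exp (d * t / 2)" by (simp add: exp_add[symmetric] algebra_simps)
    finally have "(real n)\<^sup>2 * (1 + t)\<^sup>2 \<le> (real n)\<^sup>2 * ((8 / d\<^sup>2) * exp (d / 2) * exp (d * t / 2))"
      by (rule mult_left_mono) simp
    then have "(n + q z)\<^sup>2 \<le> (real n)\<^sup>2 * ((8 / d\<^sup>2) * exp (d / 2) * exp (d * t / 2))"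
      unfolding power_mult_distrib[symmetric] t(2) by (simp add: algebra_simps)
    then have "(n + q z)\<^sup>2 * gaussian_density \<mu> L z \<le> (real n)\<^sup>2 * ((8 / d\<^sup>2) * exp (d / 2) * exp (d * t / 2)) * gaussian_density \<mu> L z"
      using D unfolding gaussian_density_def D_def[symmetric] by (intro mult_right_mono) auto
    also have "\<dots> = (8 / d\<^sup>2) * exp (d / 2) * (real n)\<^sup>2 * (exp (d * t / 2) * gaussian_density \<mu> L z)" by simp
    also have "exp (d * t / 2) * gaussian_density \<mu> L z = wt z"
      unfolding gaussian_density_def wt_def q_def[symmetric] D_def[symmetric] t_def
      by (simp add: exp_add[symmetric] algebra_simps diff_divide_distrib)
    finally show ?thesis .
  qed
  have riem: "\<bar>riem_hess n (smoothed n l w) (\<mu>, L) (\<nu>, S * L + L * S) (\<nu>, S * L + L * S)\<bar>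
      \<le> (C * (\<integral>z. l w z * wt z \<partial>lborel_vec n)) * ((vnorm \<nu>)\<^sup>2 + tr (S * L * S))"
    if \<nu>: "\<nu> \<in> cv" and S: "S \<in> sym_mats n" for \<nu> S
  proof -
    define V where "V = S * L + L * S"
    define G where "G = (-2) \<cdot>\<^sub>m (S * L * S)"
    define N where "N = (vnorm \<nu>)\<^sup>2 + tr (S * L * S)"
    have V: "V \<in> sym_mats n" unfolding V_def by (rule sym_closed(6)[OF spdD(1)[OF L] S])
    have G: "G \<in> sym_mats n" unfolding G_def by (rule sym_closed(3)[OF sym_closed(5)[OF spdD(1)[OF L] S]])
    have N: "0 \<le> N" unfolding N_def using psd_tr_nonneg[OF S spd_psd[OF L]] by simp
    let ?g = "gaussian_density \<mu> L"
    let ?h = "\<lambda>z. (score \<mu> L \<nu> V z)\<^sup>2 + dscore \<mu> L \<nu> V \<nu> V z - score \<mu> L (0\<^sub>v n) G z"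
    have i1: "integrable (lborel_vec n) (\<lambda>z. l w z * (?g z * (score \<mu> L \<nu> V z * score \<mu> L \<nu> V z + dscore \<mu> L \<nu> V \<nu> V z)))"
      by (rule DERIV_averages(4)[OF L V V \<mu> \<nu> \<nu> av])
    have i2: "integrable (lborel_vec n) (\<lambda>z. l w z * (?g z * score \<mu> L (0\<^sub>v n) G z))"
      by (rule DERIV_averages(3)[OF L G G \<mu> zero_carrier_vec zero_carrier_vec av])
    have split: "l w z * (?g z * ?h z) = l w z * (?g z * (score \<mu> L \<nu> V z * score \<mu> L \<nu> V z + dscore \<mu> L \<nu> V \<nu> V z))
        - l w z * (?g z * score \<mu> L (0\<^sub>v n) G z)" for z
      by (simp add: power2_eq_square algebra_simps)
    have "riem_hess n (smoothed n l w) (\<mu>, L) (\<nu>, V) (\<nu>, V)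
      = (\<integral>z. l w z * (?g z * (score \<mu> L \<nu> V z * score \<mu> L \<nu> V z + dscore \<mu> L \<nu> V \<nu> V z)) \<partial>lborel_vec n)
        - (\<integral>z. l w z * (?g z * score \<mu> L (0\<^sub>v n) G z) \<partial>lborel_vec n)"
      unfolding riem_hess_def der(3)[OF \<nu> V \<nu> V]
      unfolding V_def christoffel_eq[OF L S \<nu>] G_def[symmetric] der(2)[OF zero_carrier_vec G] ..
    also have "\<dots> = (\<integral>z. l w z * (?g z * ?h z) \<partial>lborel_vec n)"
      unfolding split by (rule Bochner_Integration.integral_diff[OF i1 i2, symmetric])
    finally have "\<bar>riem_hess n (smoothed n l w) (\<mu>, L) (\<nu>, V) (\<nu>, V)\<bar> \<le> (\<integral>z. \<bar>l w z * (?g z * ?h z)\<bar> \<partial>lborel_vec n)"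
      using integral_abs_bound[of "lborel_vec n" "\<lambda>z. l w z * (?g z * ?h z)"] by simp
    also have "\<dots> \<le> (\<integral>z. C * N * (l w z * wt z) \<partial>lborel_vec n)"
    proof (rule integral_mono)
      show "integrable (lborel_vec n) (\<lambda>z. \<bar>l w z * (?g z * ?h z)\<bar>)"
        unfolding split by (intro integrable_abs Bochner_Integration.integrable_diff i1 i2)
      show "integrable (lborel_vec n) (\<lambda>z. C * N * (l w z * wt z))" using H(1) by (rule integrable_mult_right)
      fix z assume "z \<in> space (lborel_vec n)"
      then have z: "z \<in> cv" by (rule space_lborel_vec)
      have g: "0 \<le> ?g z" using D unfolding gaussian_density_def D_def[symmetric] by simp
      have "\<bar>?h z\<bar> \<le> 16 * \<omega> * N * (n + q z)\<^sup>2"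
        using Hessian_integrand_bound[OF n L S \<mu> \<nu> z \<omega>0 \<omega>] unfolding V_def G_def N_def q_def .
      then have "l w z * (?g z * \<bar>?h z\<bar>) \<le> l w z * (?g z * (16 * \<omega> * N * (n + q z)\<^sup>2))"
        using f(2)[OF z] g by (intro mult_left_mono) auto
      also have "\<dots> = l w z * (16 * \<omega> * N * ((n + q z)\<^sup>2 * ?g z))" by simp
      also have "\<dots> \<le> l w z * (16 * \<omega> * N * ((8 / d\<^sup>2) * exp (d / 2) * (real n)\<^sup>2 * wt z))"
        using f(2)[OF z] \<omega>0 N by (intro mult_left_mono poly[OF z]) auto
      also have "\<dots> = C * N * (l w z * wt z)" by (simp add: C_def)
      finally show "\<bar>l w z * (?g z * ?h z)\<bar> \<le> C * N * (l w z * wt z)" using f(2)[OF z] g by (simp add: abs_mult)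
    qed
    also have "\<dots> = (C * (\<integral>z. l w z * wt z \<partial>lborel_vec n)) * N" by simp
    finally show ?thesis unfolding V_def N_def .
  qed
  define B where "B = hess_const \<kappa> \<theta> d \<gamma> / \<gamma>\<^sup>2 * opnorm (minv L') * (real n)\<^sup>2 * J powr (1 / \<kappa>)"
  have "C * (\<integral>z. l w z * wt z \<partial>lborel_vec n) \<le> C * (J powr (1 / \<kappa>) * exp (bound_exponent \<kappa> \<theta> d \<gamma>))"
    using H(2) C0 by (rule mult_left_mono)
  also have "\<dots> = B" unfolding B_def C_def hess_const_def \<omega>_def b_def by simp
  finally have CB: "C * (\<integral>z. l w z * wt z \<partial>lborel_vec n) \<le> B" .
  have B0: "0 \<le> B" unfolding B_def hess_const_def using b by (simp add: b_def[symmetric])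
  show "hess_sup n (smoothed n l w) (\<mu>, L) \<le> ereal B"
    unfolding hess_sup_def prod.case
  proof (rule SUP_least, elim CollectE case_prodE conjE)
    fix x :: "real vec \<times> real mat" and \<nu> S assume x: "x = (\<nu>, S)" and \<nu>: "\<nu> \<in> carrier_vec n" and S: "S \<in> sym_mats n"
    define N where "N = (vnorm \<nu>)\<^sup>2 + tr (S * L * S)"
    have N: "0 \<le> N" unfolding N_def using psd_tr_nonneg[OF S spd_psd[OF L]] by simp
    have "\<bar>riem_hess n (smoothed n l w) (\<mu>, L) (\<nu>, S * L + L * S) (\<nu>, S * L + L * S)\<bar> \<le> B * N"
      using riem[OF \<nu> S] mult_right_mono[OF CB N] unfolding N_def[symmetric] by linarith
    \<comment> \<open>Division by zero gives zero, so the estimate also holds for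
      \<open>N = 0\<close>.\<close>
    then have "\<bar>riem_hess n (smoothed n l w) (\<mu>, L) (\<nu>, S * L + L * S) (\<nu>, S * L + L * S)\<bar> / N \<le> B"
      using N B0 by (cases "N = 0") (auto simp: divide_le_eq)
    then show "(case x of (\<nu>, S) \<Rightarrow> ereal (\<bar>riem_hess n (smoothed n l w) (\<mu>, L) (\<nu>, S * L + L * S) (\<nu>, S * L + L * S)\<bar>
        / ((vnorm \<nu>)\<^sup>2 + tr (S * L * S)))) \<le> ereal B" unfolding N_def x by simp
  qed
qed

end

section \<open>The constants\<close>

text \<open>Both \<open>x + t\<close> and \<open>y\<close> lie between \<open>x\<close> and
  \<open>y + t\<close>, with complementary weights. Adding the two inequalities of logarithmic
  convexity gives the claim.\<close>

lemma Gamma_ratio_mono: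
  fixes x y t :: real
  assumes "0 < x" "x \<le> y" "0 \<le> t"
  shows "Gamma (x + t) / Gamma x \<le> Gamma (y + t) / Gamma y"
proof (cases "y + t = x")
  case True
  then have "y = x" using assms by linarith
  then show ?thesis by simp
next
  case False
  define h where "h = y + t - x"
  have h: "0 < h" using assms False by (simp add: h_def)
  define \<theta> where "\<theta> = t / h"
  have \<theta>: "0 \<le> \<theta>" "\<theta> \<le> 1" "\<theta> * h = t" using assms h by (auto simp: \<theta>_def h_def)
  have pos: "0 < Gamma x" "0 < Gamma y" "0 < Gamma (x + t)" "0 < Gamma (y + t)"
    using assms by (auto intro!: Gamma_real_pos)
  have "x + t = (1 - \<theta>) * x + \<theta> * (y + t)" using \<theta>(3) by (simp add: h_def algebra_simps)
  then have "ln (Gamma (x + t)) \<le> (1 - \<theta>) * ln (Gamma x) + \<theta> * ln (Gamma (y + t))"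
    using convex_onD[OF log_convex_Gamma_real, of \<theta> x "y + t"] assms \<theta> by simp
  moreover have "y = (1 - (1 - \<theta>)) * x + (1 - \<theta>) * (y + t)" using \<theta>(3) by (simp add: h_def algebra_simps)
  then have "ln (Gamma y) \<le> \<theta> * ln (Gamma x) + (1 - \<theta>) * ln (Gamma (y + t))"
    using convex_onD[OF log_convex_Gamma_real, of "1 - \<theta>" x "y + t"] assms \<theta> by simp
  ultimately have "ln (Gamma (x + t)) + ln (Gamma y) \<le> ln (Gamma x) + ln (Gamma (y + t))"
    by (simp add: algebra_simps)
  then have "ln (Gamma (x + t) / Gamma x) \<le> ln (Gamma (y + t) / Gamma y)" using pos by (simp add: ln_div)
  then show ?thesis using pos by simp
qed

text \<open>The value at \<open>n = 1\<close> of the Gamma factor in both scales; by monotonicity it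
  bounds that factor from below for all \<open>n \<ge> 1\<close>.\<close>

definition Gamma_const :: "real \<Rightarrow> real" where
  "Gamma_const q = (Gamma (1 / 2 + 2 * q) / Gamma (1 / 2)) powr (1 / q)"

lemma Gamma_const_pos:
  assumes "0 < q"
  shows "0 < Gamma_const q"
proof -
  have "0 < Gamma (1 / 2 + 2 * q) / Gamma (1 / 2)" using assms by (intro divide_pos_pos Gamma_real_pos) auto
  then show ?thesis unfolding Gamma_const_def by (metis less_irrefl powr_gt_zero)
qed

lemma Gamma_const_le:
  assumes "0 < q" "1 \<le> n"
  shows "Gamma_const q \<le> (Gamma ((real n + 4 * q) / 2) / Gamma (real n / 2)) powr (1 / q)"
proof -
  have "Gamma (1 / 2 + 2 * q) / Gamma (1 / 2) \<le> Gamma (real n / 2 + 2 * q) / Gamma (real n / 2)"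
    using assms by (intro Gamma_ratio_mono) auto
  moreover have "real n / 2 + 2 * q = (real n + 4 * q) / 2" by simp
  ultimately show ?thesis
    unfolding Gamma_const_def using assms Gamma_real_pos[of "1 / 2 + 2 * q"] Gamma_real_pos[of "1 / 2"]
    by (intro powr_mono2) auto
qed

context fixed_dim
begin

text \<open>The common source is \<open>f\<^sup>2 = tr (minv L)\<close>, while
  \<open>n \<le> \<sigma> * f\<close> is Cauchy--Schwarz for the trace of \<open>S * I\<close>.
  These relations convert \<open>n\<close> and \<open>opnorm (minv L)\<close>, in which the Hessian
  bound is phrased, into the Frobenius norms of the scales.\<close>

lemma inverse_root_norms:
  fixes f \<sigma> b :: real
  assumes n: "0 < n" and L: "L \<in> spd n"
  defines "f \<equiv> fnorm (minv (msqrt L))" and "\<sigma> \<equiv> fnorm (msqrt L)" and "b \<equiv> opnorm (minv L)"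
  shows "0 < b" "b \<le> f\<^sup>2" "f\<^sup>2 \<le> sqrt n * fnorm (minv L)" "f\<^sup>2 \<le> n * b" "real n \<le> \<sigma> * f" "fnorm L \<le> \<sigma>\<^sup>2"
proof -
  define S where "S = msqrt L"
  note S = spd_msqrt[OF L, folded S_def]
  define I where "I = minv S"
  note I = spd_minv[OF S(1), folded I_def]
  note [simp] = spdD(2)[OF S(1)] spdD(2,3)[OF I(1)] spdD(2)[OF L]
  have K: "minv L = I * I" using spd_square(2)[OF S(1)] S(2) by (simp add: I_def)
  have f: "f = fnorm I" "\<sigma> = fnorm S" unfolding f_def \<sigma>_def I_def S_def by simp_all
  have tr: "f\<^sup>2 = tr (minv L)" unfolding f K by (simp add: fnorm_sq_tr)
  show "0 < b" unfolding b_def by (rule spd_opnorm_pos[OF spd_minv(1)[OF L] n])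
  show "b \<le> f\<^sup>2"
    unfolding b_def
  proof (rule opnorm_le)
    fix x assume x: "x \<in> cv"
    have "vnorm (minv L *\<^sub>v x) \<le> f * vnorm (I *\<^sub>v x)"
      unfolding K f using x vnorm_mat_vec_le[of I "I *\<^sub>v x"] by (simp add: mat_vec_simps)
    also have "\<dots> \<le> f * (f * vnorm x)" unfolding f using x by (intro mult_left_mono vnorm_mat_vec_le) auto
    finally show "vnorm (minv L *\<^sub>v x) \<le> f\<^sup>2 * vnorm x" by (simp add: power2_eq_square)
  qed (use K in simp_all)
  show "f\<^sup>2 \<le> sqrt n * fnorm (minv L)" unfolding tr using tr_le[of "minv L"] K by simp
  show "f\<^sup>2 \<le> n * b"
  proof -
    have "tr (minv L) = (\<Sum>j<n. unit_vec n j \<bullet> (minv L *\<^sub>v unit_vec n j))" by (rule tr_as_sum) (simp add: K)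
    also have "\<dots> \<le> (\<Sum>j<n. b)"
    proof (rule sum_mono)
      fix j assume "j \<in> {..<n}"
      then have "vnorm (unit_vec n j) = 1" using unit_vec_facts(2) by simp
      then show "unit_vec n j \<bullet> (minv L *\<^sub>v unit_vec n j) \<le> b"
        using quadratic_le_opnorm[OF spd_minv(4)[OF L] unit_vec_carrier, of j] unfolding b_def by simp
    qed
    finally show ?thesis unfolding tr by simp
  qed
  have "real n = tr (S * I)" unfolding I(2) by (simp add: tr_sum)
  also have "\<dots> \<le> \<sigma> * f" unfolding f using tr_mult_le[of S I] by simp
  finally show "real n \<le> \<sigma> * f" .
  show "fnorm L \<le> \<sigma>\<^sup>2" unfolding f using fnorm_mult_le[of S S] S(2) by (simp add: power2_eq_square)
qed

end

text \<open>The case \<open>0 < 1 - r * f\<close>, with \<open>e\<close> for this difference. Powers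
  of \<open>f \<ge> 1\<close> may be added freely: \<open>b * n\<^sup>2 \<le> f ^ 8 * n ^ 4 \<le>
  \<sigma> ^ 4 * f ^ 12\<close>. Then \<open>f\<^sup>2 / \<gamma> \<le> X / e\<close> supplies six
  powers of \<open>1 / \<gamma>\<close>.\<close>

lemma scale_lower_bound_inside:
  fixes n b f \<sigma> X e \<gamma> :: real
  assumes "1 \<le> n" "0 < b" "b \<le> f\<^sup>2" "1 \<le> f" "n \<le> \<sigma> * f" "f\<^sup>2 \<le> X" "0 < e" "e \<le> \<gamma>"
  shows "b * n\<^sup>2 / \<gamma> ^ 6 \<le> \<sigma> ^ 4 * (X / e) ^ 6"
proof -
  define \<tau> where "\<tau> = f\<^sup>2"
  have \<tau>: "1 \<le> \<tau>" "b \<le> \<tau>" "\<tau> \<le> X" unfolding \<tau>_def using assms by (auto simp: one_le_power)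
  have "b * n\<^sup>2 \<le> \<tau> ^ 4 * n ^ 4"
    using \<tau> assms(1,2) self_le_power[of \<tau> 4] power_increasing[of 2 4 n] by (intro mult_mono) auto
  also have "\<dots> \<le> \<tau> ^ 4 * (\<sigma> * f) ^ 4" using assms(1,5) \<tau> by (intro mult_left_mono power_mono) auto
  also have "\<dots> = \<sigma> ^ 4 * \<tau> ^ 6" unfolding \<tau>_def by (simp add: power_mult_distrib power_mult[symmetric] power_add[symmetric])
  finally have "b * n\<^sup>2 / \<gamma> ^ 6 \<le> \<sigma> ^ 4 * \<tau> ^ 6 / \<gamma> ^ 6" using assms by (intro divide_right_mono) auto
  also have "\<dots> = \<sigma> ^ 4 * (\<tau> / \<gamma>) ^ 6" by (simp add: power_divide)
  also have "\<dots> \<le> \<sigma> ^ 4 * (X / e) ^ 6"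
    using \<tau> assms by (intro mult_left_mono power_mono frac_le) auto
  finally show ?thesis .
qed

text \<open>Here \<open>e\<close> may have either sign. From
  \<open>e\<^sup>2 \<le> f\<^sup>2 / b\<close> the factor \<open>(X / e) ^ 6\<close> is at least
  \<open>f ^ 6 * b ^ 3\<close>, and the powers of \<open>n\<close> and \<open>b\<close> are balanced
  by \<open>n * b \<ge> f\<^sup>2 \<ge> 1\<close>. No power of \<open>\<gamma>\<close> is
  gained.\<close>

lemma scale_lower_bound_outside:
  fixes n b f \<sigma> X e :: real
  assumes "1 \<le> n" "0 < b" "1 \<le> f" "n \<le> \<sigma> * f" "f\<^sup>2 \<le> X" "f\<^sup>2 \<le> n * b" "e \<noteq> 0" "e\<^sup>2 \<le> f\<^sup>2 / b"
  shows "b * n\<^sup>2 \<le> \<sigma> ^ 4 * (X / e) ^ 6"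
proof -
  define \<tau> where "\<tau> = f\<^sup>2"
  have \<tau>: "1 \<le> \<tau>" "\<tau> \<le> X" "\<tau> \<le> n * b" unfolding \<tau>_def using assms by (auto simp: one_le_power)
  have "1 * 1 \<le> (n * b)\<^sup>2 * \<tau>" using \<tau> by (intro mult_mono) (auto simp: one_le_power)
  then have "b * n\<^sup>2 * 1 \<le> b * n\<^sup>2 * ((n * b)\<^sup>2 * \<tau>)" using assms by (intro mult_left_mono) auto
  also have "\<dots> = n ^ 4 * (\<tau> * b ^ 3)" by (simp add: power_mult_distrib power2_eq_square power3_eq_cube power4_eq_xxxx)
  also have "\<dots> \<le> (\<sigma> * f) ^ 4 * (\<tau> * b ^ 3)" using assms(1,2,4) \<tau> by (intro mult_right_mono power_mono) auto
  also have "\<dots> = \<sigma> ^ 4 * (\<tau> ^ 3 * b ^ 3)"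
    unfolding \<tau>_def by (simp add: power_mult_distrib power_mult[symmetric] power_add[symmetric])
  also have "\<tau> ^ 3 * b ^ 3 = \<tau> ^ 6 / (\<tau> / b) ^ 3"
    using \<tau>(1) assms(2) by (simp add: power_divide field_simps power_add[symmetric])
  also have "\<sigma> ^ 4 * (\<tau> ^ 6 / (\<tau> / b) ^ 3) \<le> \<sigma> ^ 4 * (X ^ 6 / (e\<^sup>2) ^ 3)"
    using \<tau> assms unfolding \<tau>_def[symmetric] by (intro mult_left_mono frac_le power_mono) auto
  also have "\<dots> = \<sigma> ^ 4 * (X / e) ^ 6" by (simp add: power_divide power_mult[symmetric])
  finally show ?thesis by simp
qed

section \<open>Dependence of the Hessian bound on \<gamma>\<close>

lemma hess_const_pos: "0 < d \<Longrightarrow> 0 < hess_const \<kappa> \<theta> d \<gamma>"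
  unfolding hess_const_def by simp

text \<open>In the exponent \<open>\<gamma>\<close> enters only through
  \<open>27 / (2 * \<kappa>) * - ln \<gamma>\<close>, where \<open>27 = 9 * 3\<close>. For
  \<open>\<kappa> \<ge> 4\<close> its exponential is at most \<open>1 / \<gamma> ^ 4\<close>; with
  the prefactor \<open>1 / \<gamma>\<^sup>2\<close> this makes the sixth power that the scale
  offers.\<close>

lemma hess_const_gamma:
  assumes "0 < \<gamma>" "\<gamma> < 1" "4 \<le> \<kappa>" "0 < d"
  shows "hess_const \<kappa> \<theta> d \<gamma> / \<gamma>\<^sup>2 \<le> hess_const \<kappa> \<theta> d 1 / \<gamma> ^ 6"
proof -
  have "27 / (2 * \<kappa>) \<le> 4" using assms(3) by (simp add: field_simps)
  then have "27 / (2 * \<kappa>) * - ln \<gamma> \<le> 4 * - ln \<gamma>" using assms(1,2) by (intro mult_right_mono) auto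
  moreover have "bound_exponent \<kappa> \<theta> d \<gamma> = bound_exponent \<kappa> \<theta> d 1 + 27 / (2 * \<kappa>) * - ln \<gamma>"
    unfolding bound_exponent_def using assms(3) by (simp add: field_simps)
  ultimately have "bound_exponent \<kappa> \<theta> d \<gamma> \<le> bound_exponent \<kappa> \<theta> d 1 + 4 * - ln \<gamma>" by linarith
  then have "exp (bound_exponent \<kappa> \<theta> d \<gamma>) \<le> exp (bound_exponent \<kappa> \<theta> d 1 + 4 * - ln \<gamma>)" by simp
  also have "\<dots> = exp (bound_exponent \<kappa> \<theta> d 1) * (1 / \<gamma> ^ 4)"
  proof -
    have "exp (4 * - ln \<gamma>) = exp (- ln \<gamma>) ^ 4" using exp_of_nat_mult[of 4 "- ln \<gamma>"] by simp
    then show ?thesis unfolding exp_add using assms(1) by (simp add: exp_minus power_inverse divide_inverse)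
  qed
  finally have "hess_const \<kappa> \<theta> d \<gamma> \<le> hess_const \<kappa> \<theta> d 1 * (1 / \<gamma> ^ 4)"
    unfolding hess_const_def mult.assoc using assms(4) by (intro mult_left_mono) auto
  then have "hess_const \<kappa> \<theta> d \<gamma> / \<gamma>\<^sup>2 \<le> hess_const \<kappa> \<theta> d 1 * (1 / \<gamma> ^ 4) / \<gamma>\<^sup>2" by (rule divide_right_mono) simp
  also have "\<dots> = hess_const \<kappa> \<theta> d 1 / \<gamma> ^ 6" by (simp add: power_add[symmetric])
  finally show ?thesis .
qed

section \<open>Moments as weighted Lebesgue integrals, and the uniform estimate\<close>

lemma gaussian_integrals:
  assumes L: "L \<in> spd n" and \<mu>: "\<mu> \<in> carrier_vec n" and f: "f \<in> borel_measurable (lborel_vec n)"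
  shows "integrable (gaussian n \<mu> L) f \<longleftrightarrow> integrable (lborel_vec n) (\<lambda>z. f z * gaussian_density \<mu> L z)"
    "(\<integral>z. f z \<partial>gaussian n \<mu> L) = (\<integral>z. f z * gaussian_density \<mu> L z \<partial>lborel_vec n)"
proof -
  interpret fixed_dim n .
  have g: "gaussian_density \<mu> L \<in> borel_measurable (lborel_vec n)" by (rule measurable_gaussian_density[OF L \<mu>])
  have "0 \<le> gaussian_density \<mu> L z" for z
    unfolding gaussian_density_def using spd_det_pos[OF L] spdD(2)[OF L] by simp
  then have nn: "AE z in lborel_vec n. 0 \<le> gaussian_density \<mu> L z" by simp
  show "integrable (gaussian n \<mu> L) f \<longleftrightarrow> integrable (lborel_vec n) (\<lambda>z. f z * gaussian_density \<mu> L z)"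
    unfolding gaussian_def integrable_density[OF f g nn] by (simp add: mult.commute)
  show "(\<integral>z. f z \<partial>gaussian n \<mu> L) = (\<integral>z. f z * gaussian_density \<mu> L z \<partial>lborel_vec n)"
    unfolding gaussian_def integral_density[OF f g nn] by (simp add: mult.commute)
qed

text \<open>Measurability of \<open>l w\<close> is read off from its moment of order
  \<open>1\<close>: an integrable function is measurable, and
  \<open>\<bar>l w z\<bar> powr 1\<close> is \<open>l w z\<close> where \<open>l\<close> is
  nonnegative.\<close>

lemma assumption_A2_integrable:
  assumes L: "L \<in> spd n" and \<mu>: "\<mu> \<in> carrier_vec n" and A1: "assumption_A1 d n l" and A2: "assumption_A2 d n P \<mu> L l"
    and w: "w \<in> carrier_vec d" and \<kappa>: "1 \<le> \<kappa>" "\<kappa> \<le> P"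
  shows "l w \<in> borel_measurable (lborel_vec n)" "\<And>z. z \<in> carrier_vec n \<Longrightarrow> 0 \<le> l w z"
    "integrable (gaussian n \<mu> L) (\<lambda>z. \<bar>l w z\<bar> powr \<kappa>)"
    "integrable (lborel_vec n) (\<lambda>z. l w z powr \<kappa> * gaussian_density \<mu> L z)"
    "(\<integral>z. \<bar>l w z\<bar> powr \<kappa> \<partial>gaussian n \<mu> L) = (\<integral>z. l w z powr \<kappa> * gaussian_density \<mu> L z \<partial>lborel_vec n)"
proof -
  show nonneg: "\<And>z. z \<in> carrier_vec n \<Longrightarrow> 0 \<le> l w z" using A1 w by (auto simp: assumption_A1_def)
  have P: "1 \<le> P" using A2 by (simp add: assumption_A2_def)
  have int: "integrable (gaussian n \<mu> L) (\<lambda>z. \<bar>l w z\<bar> powr s)" if "1 \<le> s" "s \<le> P" for s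
    using A2 w that by (auto simp: assumption_A2_def)
  show 3: "integrable (gaussian n \<mu> L) (\<lambda>z. \<bar>l w z\<bar> powr \<kappa>)" by (rule int[OF \<kappa>])
  have "(\<lambda>z. \<bar>l w z\<bar> powr 1) \<in> borel_measurable (gaussian n \<mu> L)"
    by (rule borel_measurable_integrable[OF int[OF order_refl P]])
  then have "(\<lambda>z. \<bar>l w z\<bar> powr 1) \<in> borel_measurable (lborel_vec n)" by (simp add: gaussian_def)
  then show m: "l w \<in> borel_measurable (lborel_vec n)"
    by (rule measurable_cong[THEN iffD1, rotated]) (use nonneg space_lborel_vec in force)
  have m': "(\<lambda>z. \<bar>l w z\<bar> powr \<kappa>) \<in> borel_measurable (lborel_vec n)" using m by measurable
  have eq: "\<bar>l w z\<bar> powr \<kappa> * gaussian_density \<mu> L z = l w z powr \<kappa> * gaussian_density \<mu> L z"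
    if "z \<in> space (lborel_vec n)" for z
    using nonneg[OF space_lborel_vec[OF that]] by simp
  have "integrable (lborel_vec n) (\<lambda>z. \<bar>l w z\<bar> powr \<kappa> * gaussian_density \<mu> L z)
    \<longleftrightarrow> integrable (lborel_vec n) (\<lambda>z. l w z powr \<kappa> * gaussian_density \<mu> L z)"
    by (rule Bochner_Integration.integrable_cong[OF refl eq])
  then show "integrable (lborel_vec n) (\<lambda>z. l w z powr \<kappa> * gaussian_density \<mu> L z)"
    using 3 unfolding gaussian_integrals(1)[OF L \<mu> m'] by (rule iffD1)
  show "(\<integral>z. \<bar>l w z\<bar> powr \<kappa> \<partial>gaussian n \<mu> L) = (\<integral>z. l w z powr \<kappa> * gaussian_density \<mu> L z \<partial>lborel_vec n)"
    unfolding gaussian_integrals(2)[OF L \<mu> m'] by (rule Bochner_Integration.integral_cong[OF refl eq])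
qed

text \<open>The constants \<open>a\<close>, \<open>b\<close>, \<open>k\<close> precede
  \<open>n\<close>, \<open>\<gamma>\<close> and \<open>\<Lambda>'\<close>, so they depend on the
  exponents alone; \<open>C\<close> and \<open>C''\<close> precede the mean and the loss. At
  \<open>r * fnorm (minv (msqrt \<Lambda>')) = 1\<close> division by zero makes
  \<open>scale_C\<close> vanish, so this value is excluded from the comparison. Above it the
  denominator no longer bounds \<open>\<gamma>\<close> from below, and the upper constant is
  \<open>b' \<gamma>\<close>, as for \<open>q = 2\<close>.\<close>

theorem theorem5:
  fixes p q :: real
  assumes "1 \<le> p" "1 \<le> q" "1 / p + 1 / q = 1"
  shows "\<exists>(a :: real) > 0. \<exists>(b :: real) > 0. \<exists>(k :: real) > 0. \<exists>b' :: real \<Rightarrow> real.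
    \<forall>n \<ge> 1. \<forall>\<gamma> \<in> {0<..<1}. \<forall>\<Lambda>' \<in> spd n. let r = radius \<gamma> \<Lambda>' in
    \<exists>C > 0. \<exists>C'' > 0.
      (\<forall>\<mu>' \<in> carrier_vec n. \<forall>d \<ge> 1. \<forall>l P.
         assumption_A1 d n l \<and> assumption_A2 d n P \<mu>' \<Lambda>' l \<and> p * q \<le> P \<longrightarrow>
         (\<forall>w \<in> carrier_vec d.
            integrable (gaussian n \<mu>' \<Lambda>') (\<lambda>z. \<bar>l w z\<bar> powr (p * q)) \<and>
            (\<forall>(\<mu>, \<Lambda>) \<in> ball_product n \<mu>' \<Lambda>' r.
               integrable (gaussian n \<mu> \<Lambda>) (l w) \<and>
               has_riem_hess n (smoothed n l w) (\<mu>, \<Lambda>) \<and>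
               hess_sup n (smoothed n l w) (\<mu>, \<Lambda>) \<le>
                 ereal (C * (C'' * (\<integral>z. \<bar>l w z\<bar> powr (p * q) \<partial>gaussian n \<mu>' \<Lambda>') powr (1 / q))
                              powr (1 / p))))) \<and>
      (1 \<le> fnorm \<Lambda>' \<and> 1 \<le> fnorm (minv (msqrt \<Lambda>')) \<longrightarrow>
         C'' \<le> k * scale_C'' p n \<Lambda>' r \<and>
         (r * fnorm (minv (msqrt \<Lambda>')) \<noteq> 1 \<longrightarrow>
            a * scale_C q n \<Lambda>' r \<le> C \<and>
            C \<le> (if q = 2 \<or> 1 < r * fnorm (minv (msqrt \<Lambda>')) then b' \<gamma> else b) * scale_C q n \<Lambda>' r))"
proof -
  define \<kappa> where "\<kappa> = p * q"
  have pq: "0 < p" "0 < q" using assms by auto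
  have sum: "\<kappa> = p + q" using assms(3) pq unfolding \<kappa>_def by (simp add: field_simps)
  \<comment> \<open>Product and sum of \<open>p\<close> and \<open>q\<close> agree, so
    \<open>\<kappa> * (\<kappa> - 4)\<close> is a square; hence \<open>\<kappa> \<ge> 4\<close>,
    with equality only for \<open>p = q = 2\<close>.\<close>
  have sq: "\<kappa>\<^sup>2 - 4 * \<kappa> = (p - q)\<^sup>2"
  proof -
    have "\<kappa>\<^sup>2 = (p + q)\<^sup>2" using sum by simp
    then show ?thesis unfolding \<kappa>_def by (simp add: power2_eq_square algebra_simps)
  qed
  have \<kappa>0: "0 < \<kappa>" unfolding \<kappa>_def using pq by simp
  have "0 \<le> \<kappa> * (\<kappa> - 4)" using sq zero_le_power2[of "p - q"] by (simp add: power2_eq_square algebra_simps)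
  then have \<kappa>4: "4 \<le> \<kappa>" using \<kappa>0 by (simp add: zero_le_mult_iff)
  have \<kappa>4': "4 < \<kappa>" if "q \<noteq> 2"
  proof -
    have "\<kappa> \<noteq> 4"
    proof
      assume "\<kappa> = 4"
      then have "(p - q)\<^sup>2 = 0" using sq by simp
      then show False using \<open>\<kappa> = 4\<close> sum that by simp
    qed
    with \<kappa>4 show ?thesis by simp
  qed
  \<comment> \<open>The slack \<open>\<kappa> - 4\<close> is split into
    \<open>\<theta> = 3 * (\<kappa> - 4) / 4\<close> and
    \<open>d * \<kappa> = (\<kappa> - 4) / 4\<close>; then
    \<open>(1 - d) * \<kappa> - \<theta> = 4\<close>, which suffices for every
    \<open>\<gamma>\<close>.\<close>
  define cA where "cA = hess_const \<kappa> (3 * (\<kappa> - 4) / 4) ((\<kappa> - 4) / (4 * \<kappa>)) 1"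
  \<comment> \<open>Only the slack \<open>4 - (2 - \<gamma>)\<^sup>2 \<ge> 3 * \<gamma>\<close> is
    used here, split evenly between \<open>\<theta>\<close> and \<open>d * \<kappa>\<close>.\<close>
  define KB where "KB \<gamma> = hess_const \<kappa> (3 * \<gamma> / 2) (3 * \<gamma> / (2 * \<kappa>)) \<gamma> / \<gamma>\<^sup>2" for \<gamma>
  define c where "c = Gamma_const q"
  have c: "0 < c" unfolding c_def by (rule Gamma_const_pos[OF pq(2)])
  \<comment> \<open>For \<open>q = 2\<close> any positive number will do, since the upper estimate
    then uses \<open>b'\<close>.\<close>
  define b where "b = (if q = 2 then 1 else cA / c)"
  define b' where "b' \<gamma> = b + KB \<gamma> / c" for \<gamma>
  have b: "0 < b"
  proof (cases "q = 2")
    case False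
    then show ?thesis using \<kappa>4' \<kappa>0 c unfolding b_def cA_def by (auto intro!: divide_pos_pos hess_const_pos)
  qed (simp add: b_def)
  have KB: "0 < KB \<gamma>" if "0 < \<gamma>" for \<gamma>
    unfolding KB_def using that \<kappa>0 by (intro divide_pos_pos hess_const_pos) auto
  have kp: "0 < 1 / Gamma_const p" using Gamma_const_pos[OF pq(1)] by simp
  show ?thesis
  \<comment> \<open>The same \<open>b\<close> serves as lower and upper constant: \<open>C\<close>
    may be enlarged freely and is set equal to a multiple of the scale.\<close>
  proof (rule exI[of _ b], intro conjI b, rule exI[of _ b], intro conjI b, rule exI[of _ "1 / Gamma_const p"],
      intro conjI kp, rule exI[of _ b'], intro allI ballI impI, unfold Let_def)
    fix n :: nat and \<gamma> :: real and L' :: "real mat"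
    assume n: "1 \<le> n" and "\<gamma> \<in> {0<..<1}" and L': "L' \<in> spd n"
    then have \<gamma>: "0 < \<gamma>" "\<gamma> < 1" by auto
    interpret fixed_dim n .
    define r where "r = radius \<gamma> L'"
    define f where "f = fnorm (minv (msqrt L'))"
    define op where "op = opnorm (minv L')"
    define \<sigma> where "\<sigma> = fnorm (msqrt L')"
    have n0: "0 < n" using n by simp
    note norms = inverse_root_norms[OF n0 L', folded f_def op_def \<sigma>_def]
    have f0: "0 \<le> f" by (simp add: f_def)
    have r: "r = (1 - \<gamma>) / sqrt op"
      unfolding r_def radius_def op_def[symmetric] using norms(1) by (simp add: powr_minus powr_half_sqrt field_simps)
    \<comment> \<open>The Frobenius norm \<open>f\<close> is at least \<open>sqrt op\<close>, so
      \<open>r * f\<close> is at least \<open>1 - \<gamma>\<close>.\<close>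
    have rf: "1 - r * f \<le> \<gamma>" "0 \<le> r * f" "(1 - r * f)\<^sup>2 \<le> f\<^sup>2 / op"
    proof -
      have so: "0 < sqrt op" using norms(1) by simp
      have fo: "1 \<le> f / sqrt op" using norms(1,2) f0 so by (simp add: real_le_lsqrt)
      have eq: "r * f = (1 - \<gamma>) * (f / sqrt op)" unfolding r by simp
      show "1 - r * f \<le> \<gamma>" unfolding eq using fo \<gamma> mult_left_mono[OF fo, of "1 - \<gamma>"] by simp
      have "0 \<le> f / sqrt op" using fo by linarith
      then show "0 \<le> r * f" unfolding eq using \<gamma> by (intro mult_nonneg_nonneg) auto
      have "r * f \<le> 1 * (f / sqrt op)" unfolding eq using fo \<gamma> by (intro mult_right_mono) auto
      then have "\<bar>1 - r * f\<bar> \<le> f / sqrt op" using fo \<open>0 \<le> r * f\<close> by linarith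
      then have "\<bar>1 - r * f\<bar>\<^sup>2 \<le> (f / sqrt op)\<^sup>2" by (rule power_mono) simp
      then show "(1 - r * f)\<^sup>2 \<le> f\<^sup>2 / op" using norms(1) by (simp add: power_divide)
    qed
    define cond where "cond \<longleftrightarrow> 1 \<le> fnorm L' \<and> 1 \<le> f"
    define sc where "sc = scale_C q n L' r"
    define X where "X = sqrt n * fnorm (minv L')"
    have sc: "c * (\<sigma> ^ 4 * (X / (1 - r * f)) ^ 6) \<le> sc"
    proof -
      have "0 \<le> \<sigma> ^ 4 * (X / (1 - r * f)) ^ 6" by simp
      then have "c * (\<sigma> ^ 4 * (X / (1 - r * f)) ^ 6)
          \<le> (Gamma ((real n + 4 * q) / 2) / Gamma (real n / 2)) powr (1 / q) * (\<sigma> ^ 4 * (X / (1 - r * f)) ^ 6)"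
        unfolding c_def by (intro mult_right_mono Gamma_const_le[OF pq(2) n])
      then show ?thesis unfolding sc_def scale_C_def \<sigma>_def X_def f_def by (simp add: mult.assoc)
    qed
    have outside: "op * (real n)\<^sup>2 \<le> sc / c" if "cond" "r * f \<noteq> 1"
    proof -
      have "op * (real n)\<^sup>2 \<le> \<sigma> ^ 4 * (X / (1 - r * f)) ^ 6"
        using norms n rf that by (intro scale_lower_bound_outside[where f = f]) (auto simp: X_def cond_def)
      then show ?thesis using sc c by (simp add: pos_le_divide_eq mult.commute) (meson mult_left_mono order_trans less_imp_le)
    qed
    have inside: "op * (real n)\<^sup>2 / \<gamma> ^ 6 \<le> sc / c" if "cond" "r * f < 1"
    proof -
      have "op * (real n)\<^sup>2 / \<gamma> ^ 6 \<le> \<sigma> ^ 4 * (X / (1 - r * f)) ^ 6"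
        using norms n rf that by (intro scale_lower_bound_inside[where f = f]) (auto simp: X_def cond_def)
      then have "c * (op * (real n)\<^sup>2 / \<gamma> ^ 6) \<le> sc" using sc c by (meson mult_left_mono order_trans less_imp_le)
      then show ?thesis using c by (simp add: pos_le_divide_eq mult.commute)
    qed
    have opn: "0 < op * (real n)\<^sup>2" using norms(1) n by simp
    define coef where "coef = (if q = 2 \<or> 1 < r * f then b' \<gamma> else b)"
    have coef: "b \<le> coef" unfolding coef_def b'_def using KB[OF \<gamma>(1)] c by simp
    \<comment> \<open>Where the scale has to be matched, \<open>C\<close> is a multiple of it;
      otherwise, in particular when the scale is zero, \<open>C\<close> is the explicit Hessian
      constant.\<close>
    define C where "C = (if cond \<and> r * f \<noteq> 1 then coef * sc else KB \<gamma> * (op * (real n)\<^sup>2))"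
    have scpos: "0 < sc" if "cond" "r * f \<noteq> 1"
    proof -
      have "0 < sc / c" using outside[OF that] opn by linarith
      then show ?thesis using c by (simp add: zero_less_divide_iff)
    qed
    have C: "0 < C"
      unfolding C_def using scpos b coef KB[OF \<gamma>(1)] opn by (auto intro!: mult_pos_pos)
    \<comment> \<open>The pair \<open>\<theta>\<close>, \<open>d\<close> is free in the Hessian
      bound and follows the case distinction made for \<open>C\<close>.\<close>
    have "\<exists>\<theta> d. 0 < \<theta> \<and> 0 < d \<and> d < 1 \<and> (2 - \<gamma>)\<^sup>2 \<le> (1 - d) * \<kappa> - \<theta> \<and> hess_const \<kappa> \<theta> d \<gamma> / \<gamma>\<^sup>2 * (op * (real n)\<^sup>2) \<le> C"
    proof (cases "cond \<and> r * f \<noteq> 1 \<and> \<not> (q = 2 \<or> 1 < r * f)")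
      case True
      then have k: "4 < \<kappa>" and cr: "cond" "r * f < 1" "r * f \<noteq> 1" "q \<noteq> 2" using \<kappa>4' by auto
      let ?\<theta> = "3 * (\<kappa> - 4) / 4" and ?d = "(\<kappa> - 4) / (4 * \<kappa>)"
      have d: "0 < ?d" "?d < 1" using k by (auto simp: field_simps)
      have "(1 - ?d) * \<kappa> - ?\<theta> = 4" using k by (simp add: field_simps)
      moreover have "(2 - \<gamma>)\<^sup>2 \<le> 2\<^sup>2" using \<gamma> by (intro power_mono) auto
      moreover have "hess_const \<kappa> ?\<theta> ?d \<gamma> / \<gamma>\<^sup>2 * (op * (real n)\<^sup>2) \<le> C"
      proof -
        have "hess_const \<kappa> ?\<theta> ?d \<gamma> / \<gamma>\<^sup>2 * (op * (real n)\<^sup>2) \<le> cA / \<gamma> ^ 6 * (op * (real n)\<^sup>2)"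
          unfolding cA_def using opn by (intro mult_right_mono hess_const_gamma[OF \<gamma> \<kappa>4 d(1)]) simp
        also have "\<dots> = cA * (op * (real n)\<^sup>2 / \<gamma> ^ 6)" by simp
        also have "\<dots> \<le> cA * (sc / c)"
          using inside[OF cr(1,2)] hess_const_pos[OF d(1)] unfolding cA_def by (intro mult_left_mono) (auto simp: less_imp_le)
        also have "\<dots> = C" unfolding C_def coef_def b_def using True by simp
        finally show ?thesis .
      qed
      ultimately show ?thesis using d k by (intro exI[of _ ?\<theta>] exI[of _ ?d]) auto
    next
      case False
      let ?\<theta> = "3 * \<gamma> / 2" and ?d = "3 * \<gamma> / (2 * \<kappa>)"
      have d: "0 < ?d" "?d < 1" using \<kappa>4 \<gamma> by (auto simp: field_simps)
      have "(1 - ?d) * \<kappa> - ?\<theta> = \<kappa> - 3 * \<gamma>" using \<kappa>0 by (simp add: field_simps)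
      moreover have "(2 - \<gamma>)\<^sup>2 \<le> 4 - 3 * \<gamma>"
      proof -
        have "\<gamma> * \<gamma> \<le> 1 * \<gamma>" using \<gamma> by (intro mult_right_mono) auto
        then show ?thesis by (simp add: power2_eq_square algebra_simps)
      qed
      moreover have "hess_const \<kappa> ?\<theta> ?d \<gamma> / \<gamma>\<^sup>2 * (op * (real n)\<^sup>2) \<le> C"
        unfolding KB_def[symmetric]
      proof (cases "cond \<and> r * f \<noteq> 1")
        case True
        then have "KB \<gamma> * (op * (real n)\<^sup>2) \<le> KB \<gamma> * (sc / c)"
          using KB[OF \<gamma>(1)] by (intro mult_left_mono outside) auto
        \<comment> \<open>In this case \<open>coef\<close> is \<open>b' \<gamma>\<close>, which
          contains the summand \<open>KB \<gamma> / c\<close>.\<close>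
        also have "\<dots> \<le> coef * sc"
          using True False b scpos by (auto simp: coef_def b'_def distrib_right)
        finally show "KB \<gamma> * (op * (real n)\<^sup>2) \<le> C" using True by (simp add: C_def)
      next
        case False
        then show "KB \<gamma> * (op * (real n)\<^sup>2) \<le> C" unfolding C_def by (simp only: if_False order_refl)
      qed
      ultimately show ?thesis using d \<gamma> \<kappa>4 by (intro exI[of _ ?\<theta>] exI[of _ ?d]) auto
    qed
    then obtain \<theta> d where td: "0 < \<theta>" "0 < d" "d < 1" "(2 - \<gamma>)\<^sup>2 \<le> (1 - d) * \<kappa> - \<theta>"
      "hess_const \<kappa> \<theta> d \<gamma> / \<gamma>\<^sup>2 * (op * (real n)\<^sup>2) \<le> C" by blast
    have main: "integrable (gaussian n \<mu>' L') (\<lambda>z. \<bar>l w z\<bar> powr \<kappa>) \<and>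
        (\<forall>(\<mu>, L) \<in> ball_product n \<mu>' L' r.
           integrable (gaussian n \<mu> L) (l w) \<and> has_riem_hess n (smoothed n l w) (\<mu>, L) \<and>
           hess_sup n (smoothed n l w) (\<mu>, L) \<le>
             ereal (C * (1 * (\<integral>z. \<bar>l w z\<bar> powr \<kappa> \<partial>gaussian n \<mu>' L') powr (1 / q)) powr (1 / p)))"
      if \<mu>': "\<mu>' \<in> carrier_vec n" and A: "assumption_A1 D n l" "assumption_A2 D n P \<mu>' L' l" "\<kappa> \<le> P"
        and w: "w \<in> carrier_vec D" for \<mu>' D l P w
    proof -
      have k1: "1 \<le> \<kappa>" "1 < \<kappa>" using \<kappa>4 by auto
      note A2 = assumption_A2_integrable[OF L' \<mu>' A(1,2) w k1(1) A(3)]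
      let ?J = "\<integral>z. \<bar>l w z\<bar> powr \<kappa> \<partial>gaussian n \<mu>' L'"
      \<comment> \<open>With \<open>C'' = 1\<close> the nested powers collapse to the Hoelder
        exponent \<open>1 / \<kappa>\<close>.\<close>
      have J: "(1 * ?J powr (1 / q)) powr (1 / p) = ?J powr (1 / \<kappa>)"
        unfolding \<kappa>_def by (simp add: powr_powr mult.commute)
      have "integrable (gaussian n \<mu> L) (l w) \<and> has_riem_hess n (smoothed n l w) (\<mu>, L) \<and>
           hess_sup n (smoothed n l w) (\<mu>, L) \<le> ereal (C * ?J powr (1 / \<kappa>))"
        if ball: "(\<mu>, L) \<in> ball_product n \<mu>' L' r" for \<mu> L
      proof -
        note H = Hessian_bound[of L' \<gamma> \<kappa> \<theta> d \<mu>' \<mu> L l w, OF n0 L' \<gamma> k1(2) td(1-4) \<mu>' ball[unfolded r_def] A2(1,2,4)]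
        have L: "L \<in> spd n" "\<mu> \<in> carrier_vec n" using ball by (auto simp: ball_product_def)
        have "hess_sup n (smoothed n l w) (\<mu>, L)
            \<le> ereal (hess_const \<kappa> \<theta> d \<gamma> / \<gamma>\<^sup>2 * op * (real n)\<^sup>2 * ?J powr (1 / \<kappa>))"
          using H(3) unfolding A2(5)[symmetric] op_def .
        also have "\<dots> \<le> ereal (C * ?J powr (1 / \<kappa>))"
          using mult_right_mono[OF td(5), of "?J powr (1 / \<kappa>)"] by (simp add: mult.assoc)
        finally show ?thesis using H(1,2) gaussian_integrals(1)[OF L A2(1)] by blast
      qed
      then show ?thesis using A2(3) unfolding J by blast
    qed
    have cmp: "1 \<le> 1 / Gamma_const p * scale_C'' p n L' r \<and> (r * f \<noteq> 1 \<longrightarrow> b * sc \<le> C \<and> C \<le> coef * sc)" if cond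
    proof (intro conjI impI)
      \<comment> \<open>\<open>fnorm L' \<le> \<sigma>\<^sup>2\<close> passes the normalisation of
        \<open>L'\<close> to its root, so every factor of the scale other than the Gamma factor is
        at least \<open>1\<close>.\<close>
      have f1: "1 \<le> f" and s1: "1 \<le> \<sigma>\<^sup>2" using that norms(6) by (auto simp: cond_def)
      have \<sigma>4: "1 \<le> \<sigma> ^ 4" using one_le_power[OF s1, of 2] unfolding power_mult[symmetric] by simp
      define G where "G = (Gamma ((real n + 4 * p) / 2) / Gamma (real n / 2)) powr (1 / p)"
      have G: "Gamma_const p \<le> G" unfolding G_def by (rule Gamma_const_le[OF pq(1) n])
      have "1 * 1 * 1 * 1 * G \<le> real n * max 1 (r\<^sup>2) * f ^ 4 * \<sigma> ^ 4 * G"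
        using n f1 \<sigma>4 by (intro mult_right_mono mult_mono) (auto simp: G_def one_le_power)
      then have "Gamma_const p \<le> scale_C'' p n L' r"
        using G unfolding scale_C''_def f_def \<sigma>_def G_def by simp
      then show "1 \<le> 1 / Gamma_const p * scale_C'' p n L' r" using Gamma_const_pos[OF pq(1)] by simp
      assume "r * f \<noteq> 1"
      then have "C = coef * sc" "0 < sc" using that scpos by (auto simp: C_def)
      then show "b * sc \<le> C" "C \<le> coef * sc" using coef by simp_all
    qed
    show "\<exists>C > 0. \<exists>C'' > 0.
      (\<forall>\<mu>' \<in> carrier_vec n. \<forall>d \<ge> 1. \<forall>l P.
         assumption_A1 d n l \<and> assumption_A2 d n P \<mu>' L' l \<and> p * q \<le> P \<longrightarrow>
         (\<forall>w \<in> carrier_vec d.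
            integrable (gaussian n \<mu>' L') (\<lambda>z. \<bar>l w z\<bar> powr (p * q)) \<and>
            (\<forall>(\<mu>, \<Lambda>) \<in> ball_product n \<mu>' L' (radius \<gamma> L').
               integrable (gaussian n \<mu> \<Lambda>) (l w) \<and>
               has_riem_hess n (smoothed n l w) (\<mu>, \<Lambda>) \<and>
               hess_sup n (smoothed n l w) (\<mu>, \<Lambda>) \<le>
                 ereal (C * (C'' * (\<integral>z. \<bar>l w z\<bar> powr (p * q) \<partial>gaussian n \<mu>' L') powr (1 / q))
                              powr (1 / p))))) \<and>
      (1 \<le> fnorm L' \<and> 1 \<le> fnorm (minv (msqrt L')) \<longrightarrow>
         C'' \<le> 1 / Gamma_const p * scale_C'' p n L' (radius \<gamma> L') \<and>
         (radius \<gamma> L' * fnorm (minv (msqrt L')) \<noteq> 1 \<longrightarrow>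
            b * scale_C q n L' (radius \<gamma> L') \<le> C \<and>
            C \<le> (if q = 2 \<or> 1 < radius \<gamma> L' * fnorm (minv (msqrt L')) then b' \<gamma> else b) * scale_C q n L' (radius \<gamma> L')))"
      unfolding r_def[symmetric] f_def[symmetric] sc_def[symmetric] coef_def[symmetric] cond_def[symmetric] \<kappa>_def[symmetric]
    proof (rule exI[of _ C], rule conjI[OF C], rule exI[of _ 1], intro conjI)
      show "(0 :: real) < 1" by simp
    qed (use main cmp in blast)+
  qed
qed

end
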